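(* Let $N\in\mathbb Z_{\ge0}$ and $0\le k,j\le N$. In the algebra $\mathcal F_R(\mathrm{SL}(2))$, the matrix elements $t_{kj}^N$ are given by $$t_{kj}^N=\begin{cases}\gamma^{j-k}\delta^{N-k-j}P_k,& k\le j,\ k+j\le N,\\ \gamma^{j-k}P_{N-j}\,\alpha^{k+j-N},& k\le j,\ N\le k+j,\\ \delta^{N-k-j}P_j\,\beta^{k-j},& j\le k,\ k+j\le N,\\ P_{N-k}\,\alpha^{k+j-N}\beta^{k-j},& j\le k,\ N\le k+j,\end{cases}$$ where $P_n\in\mathcal F_R(\mathrm{SL}(2))_{00}$ (with $n=k,\,N-j,\,j,\,N-k$ in the four cases) can be written in terms of Askey--Wilson polynomials as $$P_n=q^{n(\lambda-\mu+1+n+|N-k-j|)+j(j-N)}\frac{(q^2;q^2)_{N-n}}{(q^2;q^2)_j(q^2;q^2)_{N-j}\,(q^{2(\lambda+2)},q^{2(-\mu+|N-k-j|)};q^2)_n}$$ $$\times\ p_n\!\left(\tfrac12\Xi;\,q^{\mu-\lambda+1+2|j-k|},\,q^{\lambda-\mu+1},\,q^{\lambda+\mu+3},\,q^{-\lambda-\mu-1+2|N-k-j|};\,q^2\right).$$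
   Context: Fix $0<q<1$ and put $q^x=e^{x\log q}$. $M$ is the field of meromorphic functions on $\mathbb C$. Put $$F(\lambda)=\frac{q^{2(\lambda+1)}-q^{-2}}{q^{2(\lambda+1)}-1},\quad G(\lambda)=\frac{(q^{2(\lambda+1)}-q^2)(q^{2(\lambda+1)}-q^{-2})}{(q^{2(\lambda+1)}-1)^2},$$ $$H(\lambda,\mu)=\frac{(q-q^{-1})(q^{2(\lambda+\mu+2)}-1)}{(q^{2(\lambda+1)}-1)(q^{2(\mu+1)}-1)},\quad I(\lambda,\mu)=\frac{(q-q^{-1})(q^{2(\mu+1)}-q^{2(\lambda+1)})}{(q^{2(\lambda+1)}-1)(q^{2(\mu+1)}-1)}.$$ $\mathcal F_R(\mathrm M(2))$ is the unital associative complex algebra generated by $\alpha,\beta,\gamma,\delta$ and two copies of $M$, whose elements are written $f(\lambda)$ and $f(\mu)$, with relations $f(\lambda)g(\mu)=g(\mu)f(\lambda)$; $f(\lambda)\alpha=\alpha f(\lambda+1)$, $f(\mu)\alpha=\alpha f(\mu+1)$, $f(\lambda)\beta=\beta f(\lambda+1)$, $f(\mu)\beta=\beta f(\mu-1)$, $f(\lambda)\gamma=\gamma f(\lambda-1)$, $f(\mu)\gamma=\gamma f(\mu+1)$, $f(\lambda)\delta=\delta f(\lambda-1)$, $f(\mu)\delta=\delta f(\mu-1)$; $\alpha\beta=qF(\mu-1)\beta\alpha$, $\alpha\gamma=qF(\lambda)\gamma\alpha$, $\beta\delta=qF(\lambda)\delta\beta$, $\gamma\delta=qF(\mu-1)\delta\gamma$;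 $\alpha\delta-\delta\alpha=H(\lambda,\mu)\gamma\beta$, $G(\mu)\alpha\delta-G(\lambda)\delta\alpha=H(\lambda,\mu)\beta\gamma$, $\beta\gamma-G(\mu)\gamma\beta=I(\lambda,\mu)\delta\alpha$, $\beta\gamma-G(\lambda)\gamma\beta=I(\lambda,\mu)\alpha\delta$. It is bigraded by $\alpha\in\mathcal F_{11}$, $\beta\in\mathcal F_{1,-1}$, $\gamma\in\mathcal F_{-1,1}$, $\delta\in\mathcal F_{-1,-1}$, $f(\lambda),f(\mu)\in\mathcal F_{00}$. $\mathcal F_R(\mathrm{SL}(2))$ is its quotient by the relation $c=1$, where $c=\alpha\delta-qF(\lambda)\gamma\beta$ is central. For $A=\mathcal F_R(\mathrm{SL}(2))$, $A\widetilde\otimes A=\bigoplus_{a,b,c}A_{ac}\otimes A_{cb}$ modulo $f(\mu)x\otimes y=x\otimes f(\lambda)y$, with factorwise multiplication; the coproduct $\Delta:A\to A\widetilde\otimes A$ is the algebra homomorphism with $\Delta(\alpha)=\alpha\otimes\alpha+\beta\otimes\gamma$, $\Delta(\beta)=\alpha\otimes\beta+\beta\otimes\delta$, $\Delta(\gamma)=\gamma\otimes\alpha+\delta\otimes\gamma$, $\Delta(\delta)=\gamma\otimes\beta+\delta\otimes\delta$, $\Delta(f(\lambda))=f(\lambda)\otimes1$, $\Delta(f(\mu))=1\otimes f(\mu)$. The matrix elements $t_{kj}^N\in A$ ($0\le k,j\le N$) are defined by $\Delta(\gamma^{N-k}\alpha^k)=\sum_{j=0}^Nt_{kj}^N\otimes\gamma^{N-j}\alpha^j$.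 The element $$\Xi=q^{\lambda-\mu+1}+q^{\mu-\lambda-1}-q^{-(\lambda+\mu+2)}(1-q^{2(\lambda+2)})(1-q^{2\mu})\gamma\beta$$ is central in $A$. The subalgebra $A_{00}$ is commutative and contains $\Xi$ and all $f(\lambda),f(\mu)$, so polynomials in $\Xi$ with coefficients depending on $\lambda,\mu$ make sense in $A_{00}$. Notation: $(a;q)_k=\prod_{i=0}^{k-1}(1-aq^i)$, $(a_1,\dots,a_r;q)_k=\prod_i(a_i;q)_k$, ${}_{4}\phi_3\!\left[\begin{smallmatrix}a_1,\dots,a_4\\ b_1,b_2,b_3\end{smallmatrix};q,z\right]=\sum_{k\ge0}\frac{(a_1,\dots,a_4;q)_k}{(q,b_1,b_2,b_3;q)_k}z^k$. The Askey--Wilson polynomial is $$p_n(\cos\theta;a,b,c,d;q)=\frac{(ab,ac,ad;q)_n}{a^n}\,{}_4\phi_3\!\left[\begin{matrix}q^{-n},\,abcdq^{n-1},\,ae^{i\theta},\,ae^{-i\theta}\\ ab,\,ac,\,ad\end{matrix};q,q\right],$$ a polynomial of degree $n$ in $\cos\theta$, symmetric in $a,b,c,d$. *)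

theory Defs
  imports
    "HOL-Complex_Analysis.Complex_Analysis"
    "HOL-Library.Poly_Mapping"
    "HOL-Algebra.Algebraic_Closure_Type"
    "HOL-Algebra.QuotRing"
begin

section \<open>The field of meromorphic functions on the complex plane\<close>

text \<open>
  Meromorphic functions in the library are total functions whose values at the poles (and at
  removable singularities) are arbitrary, so functions that agree outside a discrete set are
  identified.
\<close>

lemma eventually_cosparse_UNIV:
  "eventually P (cosparse (UNIV :: complex set)) \<longleftrightarrow> (\<forall>z. eventually P (at z))"
  by (simp add: eventually_cosparse_open_eq)

quotient_type mero = "complex \<Rightarrow> complex" / partial:
  "\<lambda>f g. f meromorphic_on UNIV \<and> g meromorphic_on UNIV \<and>
     eventually (\<lambda>z. f z = g z) (cosparse UNIV)"
proof (rule part_equivpI)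
  show "\<exists>f :: complex \<Rightarrow> complex. f meromorphic_on UNIV \<and> f meromorphic_on UNIV \<and>
     eventually (\<lambda>z. f z = f z) (cosparse UNIV)"
    by (rule exI[of _ "\<lambda>_. 0"]) auto
qed (auto simp: symp_def transp_def eq_commute elim: eventually_elim2)

instantiation mero :: field
begin

lift_definition zero_mero :: mero is "\<lambda>_. 0" by auto
lift_definition one_mero :: mero is "\<lambda>_. 1" by auto
lift_definition plus_mero :: "mero \<Rightarrow> mero \<Rightarrow> mero" is "\<lambda>f g z. f z + g z"
  by (auto intro!: meromorphic_intros elim: eventually_elim2)
lift_definition minus_mero :: "mero \<Rightarrow> mero \<Rightarrow> mero" is "\<lambda>f g z. f z - g z"
  by (auto intro!: meromorphic_intros elim: eventually_elim2)
lift_definition uminus_mero :: "mero \<Rightarrow> mero" is "\<lambda>f z. - f z"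
  by (auto intro!: meromorphic_intros elim: eventually_mono)
lift_definition times_mero :: "mero \<Rightarrow> mero \<Rightarrow> mero" is "\<lambda>f g z. f z * g z"
  by (auto intro!: meromorphic_intros elim: eventually_elim2)
lift_definition inverse_mero :: "mero \<Rightarrow> mero" is "\<lambda>f z. inverse (f z)"
  by (auto intro!: meromorphic_intros elim: eventually_mono)
lift_definition divide_mero :: "mero \<Rightarrow> mero \<Rightarrow> mero" is "\<lambda>f g z. f z / g z"
  by (auto intro!: meromorphic_intros elim: eventually_elim2)

instance
proof
  fix f :: mero
  assume "f \<noteq> 0"
  thus "inverse f * f = 1"
  proof (transfer, goal_cases)
    case (1 f)
    have "eventually (\<lambda>z. f z \<noteq> 0) (cosparse UNIV)"
      using meromorphic_imp_constant_or_avoid[of f UNIV 0] 1 by auto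
    hence "eventually (\<lambda>z. inverse (f z) * f z = 1) (cosparse UNIV)"
      by eventually_elim auto
    thus ?case using 1 by (auto intro!: meromorphic_intros)
  qed
next
  show "(0 :: mero) \<noteq> 1"
    by transfer (auto simp: eventually_cosparse_UNIV)
qed (transfer; force intro!: meromorphic_intros simp: algebra_simps divide_inverse)+

end

lift_definition mero_shift :: "complex \<Rightarrow> mero \<Rightarrow> mero" is "\<lambda>c f z. f (z + c)"
proof -
  fix c :: complex and f g :: "complex \<Rightarrow> complex"
  assume *: "f meromorphic_on UNIV \<and> g meromorphic_on UNIV \<and>
     eventually (\<lambda>z. f z = g z) (cosparse UNIV)"
  have mero: "(\<lambda>z. h (z + c)) meromorphic_on UNIV" if "h meromorphic_on UNIV" for h
    by (rule meromorphic_on_compose[OF that]) (auto intro!: analytic_intros)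
  have "eventually (\<lambda>w. f (w + c) = g (w + c)) (at z)" for z
    using * eventually_filtermap[of "\<lambda>w. f w = g w" "\<lambda>w. w + c" "at z"]
      filtermap_at_shift[of "- c" z]
    by (auto simp: eventually_cosparse_UNIV)
  thus "(\<lambda>z. f (z + c)) meromorphic_on UNIV \<and> (\<lambda>z. g (z + c)) meromorphic_on UNIV \<and>
     eventually (\<lambda>z. f (z + c) = g (z + c)) (cosparse UNIV)"
    using * mero by (auto simp: eventually_cosparse_UNIV)
qed

definition mero_const :: "complex \<Rightarrow> mero" where
  "mero_const c = abs_mero (\<lambda>_. c)"

text \<open>\<open>qpow q x\<close> is $q^x = e^{x \log q}$ for real \<open>q > 0\<close>.\<close>

definition qpow :: "real \<Rightarrow> complex \<Rightarrow> complex" where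
  "qpow q x = complex_of_real q powr x"

definition Fc :: "real \<Rightarrow> mero" where
  "Fc q = abs_mero (\<lambda>l. (qpow q (2 * (l + 1)) - qpow q (- 2)) / (qpow q (2 * (l + 1)) - 1))"

definition Gc :: "real \<Rightarrow> mero" where
  "Gc q = abs_mero (\<lambda>l. ((qpow q (2 * (l + 1)) - qpow q 2) * (qpow q (2 * (l + 1)) - qpow q (- 2)))
            / (qpow q (2 * (l + 1)) - 1) ^ 2)"


section \<open>The free algebra\<close>

text \<open>The generators $\alpha,\beta,\gamma,\delta$, $f(\lambda)$ and $f(\mu)$.\<close>

datatype gen = Al | Be | Ga | De | Lam mero | Mu mero

datatype gword = GWord (letters: "gen list")

instantiation gword :: monoid_add
begin

definition zero_gword :: gword where "0 = GWord []"
definition plus_gword :: "gword \<Rightarrow> gword \<Rightarrow> gword" where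
  "u + v = GWord (letters u @ letters v)"

instance
  by standard (simp_all add: zero_gword_def plus_gword_def)

end

text \<open>
  The free unital complex algebra is the monoid algebra of the free monoid of words. Likewise
  its tensor square is the monoid algebra of pairs of words.
\<close>

type_synonym free_alg = "gword \<Rightarrow>\<^sub>0 complex"
type_synonym free_alg2 = "(gword \<times> gword) \<Rightarrow>\<^sub>0 complex"

definition scal :: "complex \<Rightarrow> 'a::monoid_add \<Rightarrow>\<^sub>0 complex" where
  "scal c = Poly_Mapping.single 0 c"

definition gn :: "gen \<Rightarrow> free_alg" where
  "gn g = Poly_Mapping.single (GWord [g]) 1"

abbreviation lam :: "mero \<Rightarrow> free_alg" where "lam f \<equiv> gn (Lam f)"
abbreviation mu :: "mero \<Rightarrow> free_alg" where "mu f \<equiv> gn (Mu f)"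

fun gen_deg :: "gen \<Rightarrow> int \<times> int" where
  "gen_deg Al = (1, 1)"
| "gen_deg Be = (1, - 1)"
| "gen_deg Ga = (- 1, 1)"
| "gen_deg De = (- 1, - 1)"
| "gen_deg (Lam f) = (0, 0)"
| "gen_deg (Mu f) = (0, 0)"

definition ldeg :: "gword \<Rightarrow> int" where
  "ldeg w = (\<Sum>g\<leftarrow>letters w. fst (gen_deg g))"

definition rdeg :: "gword \<Rightarrow> int" where
  "rdeg w = (\<Sum>g\<leftarrow>letters w. snd (gen_deg g))"

definition free_comp :: "int \<Rightarrow> int \<Rightarrow> free_alg set" where
  "free_comp a b = {x. \<forall>w\<in>Poly_Mapping.keys x. ldeg w = a \<and> rdeg w = b}"

text \<open>$\bigoplus_a$ of the components of bidegree $(a,b)$.\<close>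

definition free_rcomp :: "int \<Rightarrow> free_alg set" where
  "free_rcomp b = {x. \<forall>w\<in>Poly_Mapping.keys x. rdeg w = b}"


section \<open>The algebra $\mathcal F_R(\mathrm{SL}(2))$\<close>

text \<open>
  $q^{2(\lambda+\mu+2)} = q^{2(\lambda+1)} q^{2(\mu+1)}$, so \<open>Hc\<close> and \<open>Ic\<close> are sums of products
  $f(\lambda) g(\mu)$.
\<close>

definition Q1 :: "real \<Rightarrow> mero" where
  "Q1 q = abs_mero (\<lambda>x. qpow q (2 * (x + 1)))"

definition Hc :: "real \<Rightarrow> free_alg" where
  "Hc q = scal (of_real (q - 1 / q)) * (lam (Q1 q) * mu (Q1 q) - 1)
           * lam (inverse (Q1 q - 1)) * mu (inverse (Q1 q - 1))"

definition Ic :: "real \<Rightarrow> free_alg" where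
  "Ic q = scal (of_real (q - 1 / q)) * (mu (Q1 q) - lam (Q1 q))
           * lam (inverse (Q1 q - 1)) * mu (inverse (Q1 q - 1))"

text \<open>A relation $x = y$ is listed as the element $x - y$.\<close>

inductive_set M2_rels :: "real \<Rightarrow> free_alg set" for q :: real where
  lam_add: "lam (f + g) - (lam f + lam g) \<in> M2_rels q"
| lam_mult: "lam (f * g) - lam f * lam g \<in> M2_rels q"
| lam_const: "lam (mero_const c) - scal c \<in> M2_rels q"
| mu_add: "mu (f + g) - (mu f + mu g) \<in> M2_rels q"
| mu_mult: "mu (f * g) - mu f * mu g \<in> M2_rels q"
| mu_const: "mu (mero_const c) - scal c \<in> M2_rels q"
| lam_mu: "lam f * mu g - mu g * lam f \<in> M2_rels q"
| lam_Al: "lam f * gn Al - gn Al * lam (mero_shift 1 f) \<in> M2_rels q"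
| mu_Al: "mu f * gn Al - gn Al * mu (mero_shift 1 f) \<in> M2_rels q"
| lam_Be: "lam f * gn Be - gn Be * lam (mero_shift 1 f) \<in> M2_rels q"
| mu_Be: "mu f * gn Be - gn Be * mu (mero_shift (- 1) f) \<in> M2_rels q"
| lam_Ga: "lam f * gn Ga - gn Ga * lam (mero_shift (- 1) f) \<in> M2_rels q"
| mu_Ga: "mu f * gn Ga - gn Ga * mu (mero_shift 1 f) \<in> M2_rels q"
| lam_De: "lam f * gn De - gn De * lam (mero_shift (- 1) f) \<in> M2_rels q"
| mu_De: "mu f * gn De - gn De * mu (mero_shift (- 1) f) \<in> M2_rels q"
| Al_Be: "gn Al * gn Be - scal (of_real q) * mu (mero_shift (- 1) (Fc q)) * gn Be * gn Al \<in> M2_rels q"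
| Al_Ga: "gn Al * gn Ga - scal (of_real q) * lam (Fc q) * gn Ga * gn Al \<in> M2_rels q"
| Be_De: "gn Be * gn De - scal (of_real q) * lam (Fc q) * gn De * gn Be \<in> M2_rels q"
| Ga_De: "gn Ga * gn De - scal (of_real q) * mu (mero_shift (- 1) (Fc q)) * gn De * gn Ga \<in> M2_rels q"
| Al_De1: "(gn Al * gn De - gn De * gn Al) - Hc q * gn Ga * gn Be \<in> M2_rels q"
| Al_De2: "(mu (Gc q) * gn Al * gn De - lam (Gc q) * gn De * gn Al) - Hc q * gn Be * gn Ga \<in> M2_rels q"
| Be_Ga1: "(gn Be * gn Ga - mu (Gc q) * gn Ga * gn Be) - Ic q * gn De * gn Al \<in> M2_rels q"
| Be_Ga2: "(gn Be * gn Ga - lam (Gc q) * gn Ga * gn Be) - Ic q * gn Al * gn De \<in> M2_rels q"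

definition qdet :: "real \<Rightarrow> free_alg" where
  "qdet q = gn Al * gn De - scal (of_real q) * lam (Fc q) * gn Ga * gn Be"

abbreviation free_ring :: "free_alg ring" where
  "free_ring \<equiv> ring_of_type_algebra"

definition SL2_ideal :: "real \<Rightarrow> free_alg set" where
  "SL2_ideal q = genideal free_ring (insert (qdet q - 1) (M2_rels q))"

definition SL2 :: "real \<Rightarrow> free_alg set ring" where
  "SL2 q = free_ring Quot SL2_ideal q"

definition cls :: "real \<Rightarrow> free_alg \<Rightarrow> free_alg set" where
  "cls q x = SL2_ideal q +>\<^bsub>free_ring\<^esub> x"

definition SL2_comp :: "real \<Rightarrow> int \<Rightarrow> int \<Rightarrow> free_alg set set" where
  "SL2_comp q a b = cls q ` free_comp a b"

definition SL2_rcomp :: "real \<Rightarrow> int \<Rightarrow> free_alg set set" where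
  "SL2_rcomp q b = cls q ` free_rcomp b"

lemma ring_ring_of_type_algebra: "ring (ring_of_type_algebra :: 'a::ring_1 ring)"
proof (unfold_locales, goal_cases)
  case 7
  show ?case
    by (auto simp: ring_of_type_algebra_def Units_def)
      (metis add.right_inverse add.left_inverse)
qed (auto simp: ring_of_type_algebra_def algebra_simps)

lemma ideal_SL2_ideal: "ideal (SL2_ideal q) free_ring"
  unfolding SL2_ideal_def
  by (rule ring.genideal_ideal[OF ring_ring_of_type_algebra]) (simp add: ring_of_type_algebra_def)

lemma ring_SL2: "ring (SL2 q)"
  unfolding SL2_def by (rule ideal.quotient_is_ring[OF ideal_SL2_ideal])


section \<open>The algebra $A \mathbin{\widetilde\otimes} A$ and the coproduct\<close>

definition tens :: "free_alg \<Rightarrow> free_alg \<Rightarrow> free_alg2" where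
  "tens x y = (\<Sum>u\<in>Poly_Mapping.keys x. \<Sum>v\<in>Poly_Mapping.keys y.
     Poly_Mapping.single (u, v) (Poly_Mapping.lookup x u * Poly_Mapping.lookup y v))"

text \<open>
  Write $T$ for the free algebra and $J$ for the ideal of relations, so that $A = T/J$. All
  relations are homogeneous, hence $A_{ac} \otimes A_{cb}$ is the quotient of
  $T_{ac} \otimes T_{cb}$ by $J_{ac} \otimes T_{cb} + T_{ac} \otimes J_{cb}$.
  Therefore $A \mathbin{\widetilde\otimes} A$ is the quotient of the algebra
  $\bigoplus_{a,b,c} T_{ac} \otimes T_{cb}$, spanned by the pairs of words \<open>(u, v)\<close> with
  \<open>rdeg u = ldeg v\<close>, by the ideal generated by \<open>tensor_rels\<close>.
\<close>

definition matched_ring :: "free_alg2 ring" where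
  "matched_ring = ring_of_type_algebra
     \<lparr>carrier := {p. \<forall>(u, v)\<in>Poly_Mapping.keys p. rdeg u = ldeg v}\<rparr>"

inductive_set tensor_rels :: "real \<Rightarrow> free_alg2 set" for q :: real where
  left: "r \<in> SL2_ideal q \<Longrightarrow> r \<in> free_comp a c \<Longrightarrow> y \<in> free_comp c b \<Longrightarrow> tens r y \<in> tensor_rels q"
| right: "x \<in> free_comp a c \<Longrightarrow> r \<in> SL2_ideal q \<Longrightarrow> r \<in> free_comp c b \<Longrightarrow> tens x r \<in> tensor_rels q"
| balance: "x \<in> free_comp a c \<Longrightarrow> y \<in> free_comp c b \<Longrightarrow>
    tens (mu f * x) y - tens x (lam f * y) \<in> tensor_rels q"

definition tensor_ideal :: "real \<Rightarrow> free_alg2 set" where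
  "tensor_ideal q = genideal matched_ring (tensor_rels q)"

definition SL2_tensor :: "real \<Rightarrow> free_alg2 set ring" where
  "SL2_tensor q = matched_ring Quot tensor_ideal q"

definition tensor_cls :: "real \<Rightarrow> free_alg2 \<Rightarrow> free_alg2 set" where
  "tensor_cls q p = tensor_ideal q +>\<^bsub>matched_ring\<^esub> p"

text \<open>
  The elementary tensor of two elements of $A$, and the coproduct, are given on
  representatives; all representatives give the same coset, so that the unions below are single
  cosets. The elementary tensor is meaningful only if the right degree of the first factor
  matches the left degree of the second one.
\<close>

definition tensor :: "real \<Rightarrow> free_alg set \<Rightarrow> free_alg set \<Rightarrow> free_alg2 set" where
  "tensor q U V = \<Union>{tensor_cls q (tens x y) | x y.
     x \<in> U \<and> y \<in> V \<and> tens x y \<in> carrier matched_ring}"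

fun gen_coprod :: "gen \<Rightarrow> free_alg2" where
  "gen_coprod Al = tens (gn Al) (gn Al) + tens (gn Be) (gn Ga)"
| "gen_coprod Be = tens (gn Al) (gn Be) + tens (gn Be) (gn De)"
| "gen_coprod Ga = tens (gn Ga) (gn Al) + tens (gn De) (gn Ga)"
| "gen_coprod De = tens (gn Ga) (gn Be) + tens (gn De) (gn De)"
| "gen_coprod (Lam f) = tens (lam f) 1"
| "gen_coprod (Mu f) = tens 1 (mu f)"

definition free_coprod :: "free_alg \<Rightarrow> free_alg2" where
  "free_coprod x = (\<Sum>w\<in>Poly_Mapping.keys x.
     scal (Poly_Mapping.lookup x w) * prod_list (map gen_coprod (letters w)))"

definition coprod :: "real \<Rightarrow> free_alg set \<Rightarrow> free_alg2 set" where
  "coprod q U = (\<Union>x\<in>U. tensor_cls q (free_coprod x))"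

lemma rdeg_plus: "rdeg (u + v) = rdeg u + rdeg v"
  and ldeg_plus: "ldeg (u + v) = ldeg u + ldeg v"
  by (simp_all add: rdeg_def ldeg_def plus_gword_def)

lemma ring_matched_ring: "ring matched_ring"
proof -
  interpret R: ring "ring_of_type_algebra :: free_alg2 ring"
    by (rule ring_ring_of_type_algebra)
  have minus: "\<ominus>\<^bsub>ring_of_type_algebra\<^esub> x = - x" for x :: free_alg2
    by (rule R.minus_equality) (auto simp: ring_of_type_algebra_def)
  let ?S = "{p :: free_alg2. \<forall>(u, v)\<in>Poly_Mapping.keys p. rdeg u = ldeg v}"
  have "subring ?S (ring_of_type_algebra :: free_alg2 ring)"
  proof (rule R.subringI)
    fix p r :: free_alg2
    assume *: "p \<in> ?S" "r \<in> ?S"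
    show "p \<otimes>\<^bsub>ring_of_type_algebra\<^esub> r \<in> ?S"
      using * keys_mult[of p r]
      by (fastforce simp: ring_of_type_algebra_def rdeg_plus ldeg_plus)
    show "p \<oplus>\<^bsub>ring_of_type_algebra\<^esub> r \<in> ?S"
      using * Poly_Mapping.keys_add[of p r] by (fastforce simp: ring_of_type_algebra_def)
    show "\<ominus>\<^bsub>ring_of_type_algebra\<^esub> p \<in> ?S"
      using * by (simp add: minus in_keys_iff)
  qed (auto simp: in_keys_iff ring_of_type_algebra_def lookup_one when_def zero_prod_def
          zero_gword_def rdeg_def ldeg_def)
  thus ?thesis
    unfolding matched_ring_def by (rule R.subring_is_ring)
qed


section \<open>Matrix elements\<close>

definition alA :: "real \<Rightarrow> free_alg set" where "alA q = cls q (gn Al)"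
definition beA :: "real \<Rightarrow> free_alg set" where "beA q = cls q (gn Be)"
definition gaA :: "real \<Rightarrow> free_alg set" where "gaA q = cls q (gn Ga)"
definition deA :: "real \<Rightarrow> free_alg set" where "deA q = cls q (gn De)"

text \<open>
  As $\gamma^{N-j}\alpha^j$ has left degree $2j-N$, the left tensor factor $t^N_{kj}$ has right
  degree $2j-N$.
\<close>

definition mat_elt :: "real \<Rightarrow> nat \<Rightarrow> nat \<Rightarrow> nat \<Rightarrow> free_alg set" where
  "mat_elt q N k = (THE t. t \<in> (\<Pi>\<^sub>E j\<in>{..N}. SL2_rcomp q (2 * int j - int N)) \<and>
     coprod q (gaA q [^]\<^bsub>SL2 q\<^esub> (N - k) \<otimes>\<^bsub>SL2 q\<^esub> alA q [^]\<^bsub>SL2 q\<^esub> k) =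
     (\<Oplus>\<^bsub>SL2_tensor q\<^esub>j\<in>{..N}.
        tensor q (t j) (gaA q [^]\<^bsub>SL2 q\<^esub> (N - j) \<otimes>\<^bsub>SL2 q\<^esub> alA q [^]\<^bsub>SL2 q\<^esub> j)))"


section \<open>Askey--Wilson polynomials\<close>

text \<open>
  The following is used with pairwise commuting arguments. The base \<open>p\<close> and the parameters
  are elements of the ring \<open>R\<close>.
\<close>

primrec qpoch :: "('a, 'b) ring_scheme \<Rightarrow> 'a \<Rightarrow> 'a \<Rightarrow> nat \<Rightarrow> 'a" where
  "qpoch R a p 0 = \<one>\<^bsub>R\<^esub>"
| "qpoch R a p (Suc k) = qpoch R a p k \<otimes>\<^bsub>R\<^esub> (\<one>\<^bsub>R\<^esub> \<ominus>\<^bsub>R\<^esub> a \<otimes>\<^bsub>R\<^esub> p [^]\<^bsub>R\<^esub> k)"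

text \<open>
  $(ae^{i\theta}, ae^{-i\theta}; p)_k = \prod_{i<k} (1 - 2 a x p^i + a^2 p^{2i})$ with
  $x = \cos\theta$; see \<open>qpoch2_cos\<close> below.
\<close>

primrec qpoch2 :: "('a, 'b) ring_scheme \<Rightarrow> 'a \<Rightarrow> 'a \<Rightarrow> 'a \<Rightarrow> nat \<Rightarrow> 'a" where
  "qpoch2 R a x p 0 = \<one>\<^bsub>R\<^esub>"
| "qpoch2 R a x p (Suc k) = qpoch2 R a x p k \<otimes>\<^bsub>R\<^esub>
     (let b = a \<otimes>\<^bsub>R\<^esub> p [^]\<^bsub>R\<^esub> k
      in \<one>\<^bsub>R\<^esub> \<ominus>\<^bsub>R\<^esub> (b \<otimes>\<^bsub>R\<^esub> x \<oplus>\<^bsub>R\<^esub> b \<otimes>\<^bsub>R\<^esub> x) \<oplus>\<^bsub>R\<^esub> b \<otimes>\<^bsub>R\<^esub> b)"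

text \<open>
  The terms with $k > n$ of the ${}_4\phi_3$ series vanish because of the factor
  $(p^{-n};p)_k$. The exponent in \<open>p [^] (int n - 1)\<close> is an integer, as \<open>n\<close> may be 0.
\<close>

definition askey_wilson ::
  "('a, 'b) ring_scheme \<Rightarrow> nat \<Rightarrow> 'a \<Rightarrow> 'a \<Rightarrow> 'a \<Rightarrow> 'a \<Rightarrow> 'a \<Rightarrow> 'a \<Rightarrow> 'a" where
  "askey_wilson R n x a b c d p =
     qpoch R (a \<otimes>\<^bsub>R\<^esub> b) p n \<otimes>\<^bsub>R\<^esub> qpoch R (a \<otimes>\<^bsub>R\<^esub> c) p n \<otimes>\<^bsub>R\<^esub> qpoch R (a \<otimes>\<^bsub>R\<^esub> d) p n
       \<otimes>\<^bsub>R\<^esub> inv\<^bsub>R\<^esub> (a [^]\<^bsub>R\<^esub> n) \<otimes>\<^bsub>R\<^esub>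
     (\<Oplus>\<^bsub>R\<^esub>k\<in>{..n}.
        qpoch R (inv\<^bsub>R\<^esub> (p [^]\<^bsub>R\<^esub> n)) p k
          \<otimes>\<^bsub>R\<^esub> qpoch R (a \<otimes>\<^bsub>R\<^esub> b \<otimes>\<^bsub>R\<^esub> c \<otimes>\<^bsub>R\<^esub> d \<otimes>\<^bsub>R\<^esub> p [^]\<^bsub>R\<^esub> (int n - 1)) p k
          \<otimes>\<^bsub>R\<^esub> qpoch2 R a x p k
          \<otimes>\<^bsub>R\<^esub> inv\<^bsub>R\<^esub> (qpoch R p p k \<otimes>\<^bsub>R\<^esub> qpoch R (a \<otimes>\<^bsub>R\<^esub> b) p k
                \<otimes>\<^bsub>R\<^esub> qpoch R (a \<otimes>\<^bsub>R\<^esub> c) p k \<otimes>\<^bsub>R\<^esub> qpoch R (a \<otimes>\<^bsub>R\<^esub> d) p k)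
          \<otimes>\<^bsub>R\<^esub> p [^]\<^bsub>R\<^esub> k)"

lemma qpoch2_cos:
  fixes a p \<theta> :: complex
  defines "R \<equiv> ring_of_type_algebra"
  shows "qpoch R (a * exp (\<i> * \<theta>)) p k * qpoch R (a * exp (- (\<i> * \<theta>))) p k
         = qpoch2 R a (cos \<theta>) p k"
proof -
  interpret R: ring R unfolding R_def by (rule ring_ring_of_type_algebra)
  have uminus: "\<ominus>\<^bsub>R\<^esub> x = - x" for x
    by (rule R.minus_equality) (auto simp: R_def ring_of_type_algebra_def)
  have ops: "x \<otimes>\<^bsub>R\<^esub> y = x * y" "x \<oplus>\<^bsub>R\<^esub> y = x + y" "x \<ominus>\<^bsub>R\<^esub> y = x - y" "\<one>\<^bsub>R\<^esub> = 1" for x y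
    by (auto simp: a_minus_def uminus) (auto simp: R_def ring_of_type_algebra_def)
  have factor: "(1 - a * exp (\<i> * \<theta>) * z) * (1 - a * exp (- (\<i> * \<theta>)) * z) =
        1 - (a * z * cos \<theta> + a * z * cos \<theta>) + a * z * (a * z)" for z
  proof -
    have "exp (\<i> * \<theta>) * exp (- (\<i> * \<theta>)) = 1"
      by (simp flip: exp_add)
    thus ?thesis
      unfolding cos_exp_eq by (simp add: field_simps) algebra
  qed
  show ?thesis
  proof (induction k)
    case (Suc k)
    have "qpoch R (a * exp (\<i> * \<theta>)) p (Suc k) * qpoch R (a * exp (- (\<i> * \<theta>))) p (Suc k) =
        (qpoch R (a * exp (\<i> * \<theta>)) p k * qpoch R (a * exp (- (\<i> * \<theta>))) p k) *
        ((1 - a * exp (\<i> * \<theta>) * p [^]\<^bsub>R\<^esub> k) * (1 - a * exp (- (\<i> * \<theta>)) * p [^]\<^bsub>R\<^esub> k))"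
      by (simp only: qpoch.simps ops mult_ac)
    thus ?case
      by (simp only: Suc factor qpoch2.simps ops Let_def)
  qed (simp add: ops)
qed


section \<open>The elements $P_n$\<close>

text \<open>\<open>qlm q a b c\<close> is the element $q^{a\lambda + b\mu + c}$ of $A$.\<close>

definition qlm :: "real \<Rightarrow> int \<Rightarrow> int \<Rightarrow> int \<Rightarrow> free_alg set" where
  "qlm q a b c = cls q (lam (abs_mero (\<lambda>l. qpow q (of_int a * l))) *
                        mu (abs_mero (\<lambda>m. qpow q (of_int b * m + of_int c))))"

definition Xi :: "real \<Rightarrow> free_alg set" where
  "Xi q = qlm q 1 (- 1) 1 \<oplus>\<^bsub>SL2 q\<^esub> qlm q (- 1) 1 (- 1) \<ominus>\<^bsub>SL2 q\<^esub>
     qlm q (- 1) (- 1) (- 2) \<otimes>\<^bsub>SL2 q\<^esub> (\<one>\<^bsub>SL2 q\<^esub> \<ominus>\<^bsub>SL2 q\<^esub> qlm q 2 0 4)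
       \<otimes>\<^bsub>SL2 q\<^esub> (\<one>\<^bsub>SL2 q\<^esub> \<ominus>\<^bsub>SL2 q\<^esub> qlm q 0 2 0) \<otimes>\<^bsub>SL2 q\<^esub> gaA q \<otimes>\<^bsub>SL2 q\<^esub> beA q"

definition Pn :: "real \<Rightarrow> nat \<Rightarrow> nat \<Rightarrow> nat \<Rightarrow> nat \<Rightarrow> free_alg set" where
  "Pn q N k j n =
    (let A = SL2 q;
         m = \<bar>int N - int k - int j\<bar>;
         d = \<bar>int j - int k\<bar>;
         p = qlm q 0 0 2
     in qlm q (int n) (- int n) (int n * (1 + int n + m) + int j * (int j - int N))
        \<otimes>\<^bsub>A\<^esub> qpoch A p p (N - n)
        \<otimes>\<^bsub>A\<^esub> inv\<^bsub>A\<^esub> (qpoch A p p j \<otimes>\<^bsub>A\<^esub> qpoch A p p (N - j)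
              \<otimes>\<^bsub>A\<^esub> qpoch A (qlm q 2 0 4) p n \<otimes>\<^bsub>A\<^esub> qpoch A (qlm q 0 (- 2) (2 * m)) p n)
        \<otimes>\<^bsub>A\<^esub> askey_wilson A n (cls q (scal (1 / 2)) \<otimes>\<^bsub>A\<^esub> Xi q)
              (qlm q (- 1) 1 (1 + 2 * d)) (qlm q 1 (- 1) 1) (qlm q 1 1 3)
              (qlm q (- 1) (- 1) (- 1 + 2 * m)) p)"

end

theory Submission
  imports Defs
begin

text \<open>
  The elements $\gamma^{N-j}\alpha^j$ are independent as right tensor factors, as one sees by
  letting the right factor act on a representation of $A$ by difference operators. Hence the matrix
  elements are determined by $\Delta(\gamma^{N-k}\alpha^k)$, and splitting off a factor
  $\gamma$ on the left or a factor $\alpha$ on the right gives two recurrences in $N$. Since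
  $\delta\alpha$ and $\gamma\beta$ are, up to invertible factors, $(1-ce^{i\theta})(1-ce^{-i\theta})$
  and $(1-be^{i\theta})(1-be^{-i\theta})$ with $2\cos\theta = \Xi$, the recurrences for the closed
  form reduce to two contiguous relations for Askey--Wilson polynomials, and for $n = 0$ to a
  $q$-Pascal rule.
\<close>

section \<open>Exponentials and shifts of meromorphic functions\<close>

text \<open>The functions F, G, H, I obscure the relations. With u = q F and v = q + 1/q - u one has
  G = u v, q F shifted by -1 is 1/v, H = u(lambda) - v(mu) and I = u(lambda) + v(mu) - (q + 1/q).
  The relations become v(mu) alpha beta = beta alpha, alpha delta = 1 + u(lambda) gamma beta and the
  like, with coefficients polynomial in u(lambda) and v(mu). This form serves the representation,
  the coproduct and the centrality of Xi. Across the tensor sign, v(mu) on the left is q + 1/q -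
  u(lambda) on the right.

  Since rows are unique, a row satisfies both recurrences at once. Each entry of the closed form is
  therefore checked against only one of them, chosen so that, with n the index of P_n, d = |j - k|
  and m = |N - k - j|, the triples (n, d, m) involved stay in one of the four regions.

  Functions of lambda alone or of mu alone can be inverted, but there is no field containing both.
  The Askey-Wilson identities are therefore proved over a commutative ring, dividing by units
  only.\<close>

lemma qpow_eq_exp: "qpow q x = (if q = 0 then 0 else exp (x * Ln (of_real q)))"
  by (simp add: qpow_def powr_def)

lemma qpow_add: "qpow q (x + y) = qpow q x * qpow q y"
  by (simp add: qpow_eq_exp exp_add algebra_simps)

lemma qpow_of_int: "0 < q \<Longrightarrow> qpow q (of_int n) = of_real (q powi n)"
  by (simp add: qpow_def powr_of_int power_int_def complex_powr_of_int power_inverse)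

lemma qpow_meromorphic:
  assumes "g analytic_on UNIV"
  shows "(\<lambda>z. qpow q (g z)) meromorphic_on UNIV"
  unfolding qpow_eq_exp
  by (cases "q = 0") (auto intro!: analytic_on_imp_meromorphic_on analytic_intros assms)

lemma meromorphic_qpow_affine: "(\<lambda>z. qpow q (of_int a * z + of_int c)) meromorphic_on UNIV"
  by (intro qpow_meromorphic analytic_intros)

definition mexp :: "real \<Rightarrow> int \<Rightarrow> int \<Rightarrow> mero" where
  "mexp q a c = abs_mero (\<lambda>z. qpow q (of_int a * z + of_int c))"

lemma
  assumes "f meromorphic_on UNIV" "g meromorphic_on UNIV"
  shows abs_mero_add: "abs_mero f + abs_mero g = abs_mero (\<lambda>z. f z + g z)"
    and abs_mero_diff: "abs_mero f - abs_mero g = abs_mero (\<lambda>z. f z - g z)"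
    and abs_mero_mult: "abs_mero f * abs_mero g = abs_mero (\<lambda>z. f z * g z)"
    and abs_mero_divide: "abs_mero f / abs_mero g = abs_mero (\<lambda>z. f z / g z)"
  by (rule plus_mero.abs_eq minus_mero.abs_eq times_mero.abs_eq divide_mero.abs_eq; simp add: assms)+

lemma mero_shift_abs: "f meromorphic_on UNIV \<Longrightarrow> mero_shift c (abs_mero f) = abs_mero (\<lambda>z. f (z + c))"
  by (rule mero_shift.abs_eq) simp

lemma mero_const_add: "mero_const (c + d) = mero_const c + mero_const d"
  and mero_const_mult: "mero_const (c * d) = mero_const c * mero_const d"
  and mero_const_0: "mero_const 0 = 0"
  and mero_const_1: "mero_const 1 = 1"
  unfolding mero_const_def
  by (simp_all add: abs_mero_add abs_mero_mult zero_mero_def one_mero_def meromorphic_on_const)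

lemma mero_const_inject: "mero_const c = mero_const d \<longleftrightarrow> c = d"
proof
  assume "mero_const c = mero_const d"
  hence "eventually (\<lambda>_::complex. c = d) (cosparse UNIV)"
    unfolding mero_const_def
    using Quotient_rel[OF Quotient_mero, of "\<lambda>_. c" "\<lambda>_. d"] by (simp add: meromorphic_on_const)
  thus "c = d" by (auto simp: eventually_cosparse_UNIV)
qed simp

lemma mero_const_diff: "mero_const (c - d) = mero_const c - mero_const d"
  by (metis add_diff_cancel mero_const_add diff_add_cancel)

lemma mexp_add: "mexp q a c * mexp q a' c' = mexp q (a + a') (c + c')"
  unfolding mexp_def
  by (subst abs_mero_mult) (rule meromorphic_qpow_affine | simp add: qpow_add [symmetric] algebra_simps)+

lemma mexp_const: "0 < q \<Longrightarrow> mexp q 0 c = mero_const (of_real (q powi c))"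
  by (simp add: mexp_def mero_const_def qpow_of_int)

lemma mexp_0: "0 < q \<Longrightarrow> mexp q 0 0 = 1"
  by (simp add: mexp_const mero_const_1)

lemma mexp_nonzero [simp]: "0 < q \<Longrightarrow> mexp q a c \<noteq> 0"
  using mexp_add[of q a c "-a" "-c"] mexp_0[of q] by auto

lemma mexp_power: "0 < q \<Longrightarrow> mexp q a c ^ n = mexp q (int n * a) (int n * c)"
  by (induction n) (auto simp: mexp_0 mexp_add algebra_simps)

lemma shift_meromorphic: "f meromorphic_on UNIV \<Longrightarrow> (\<lambda>z. f (z + c)) meromorphic_on UNIV" for f :: "complex \<Rightarrow> complex"
  by (rule meromorphic_on_compose) (auto intro!: analytic_intros)

lemma mero_shift_add: "mero_shift k (f + g) = mero_shift k f + mero_shift k g"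
  and mero_shift_mult: "mero_shift k (f * g) = mero_shift k f * mero_shift k g"
  and mero_shift_uminus: "mero_shift k (- f) = - mero_shift k f"
  and mero_shift_diff: "mero_shift k (f - g) = mero_shift k f - mero_shift k g"
  and mero_shift_inverse: "mero_shift k (inverse f) = inverse (mero_shift k f)"
  and mero_shift_divide: "mero_shift k (f / g) = mero_shift k f / mero_shift k g"
  by (transfer; auto intro!: shift_meromorphic meromorphic_intros)+

lemma mero_shift_0 [simp]: "mero_shift k 0 = 0"
  and mero_shift_1 [simp]: "mero_shift k 1 = 1"
  by (transfer; auto)+

lemma mero_shift_const [simp]: "mero_shift k (mero_const c) = mero_const c"
  unfolding mero_const_def by (simp add: mero_shift_abs meromorphic_on_const)

lemma mero_shift_shift: "mero_shift k (mero_shift l f) = mero_shift (k + l) f"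
  by transfer (use shift_meromorphic[OF shift_meromorphic] in \<open>auto simp: add.assoc\<close>)

lemma mero_shift_id [simp]: "mero_shift 0 f = f"
  by transfer auto

lemma mero_shift_mexp: "mero_shift (of_int k) (mexp q a c) = mexp q a (c + a * k)"
  unfolding mexp_def
  by (subst mero_shift_abs) (rule meromorphic_qpow_affine | simp add: algebra_simps)+

lemmas mero_shift_hom = mero_shift_add mero_shift_mult mero_shift_uminus mero_shift_diff
  mero_shift_inverse mero_shift_divide

lemma powi_eq_1_iff:
  assumes "0 < (q::real)" "q < 1" shows "q powi n = 1 \<longleftrightarrow> n = 0"
proof
  assume *: "q powi n = 1"
  have "ln (q powi n) = of_int n * ln q"
    using assms by (simp add: powr_real_of_int' [symmetric] ln_powr)
  thus "n = 0" using * assms by auto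
qed auto

text \<open>Translation by 1 multiplies the function by the constant q^a, so a function equal to 1
  has q^a = 1 and a = 0; the constant case is a statement on integer powers of the real number q <
  1. The denominators 1 - q^{az+c} met below are nonzero by this criterion.\<close>

lemma mexp_eq_1_iff:
  assumes "0 < q" "q < 1" shows "mexp q a c = 1 \<longleftrightarrow> a = 0 \<and> c = 0"
proof
  have const: "c = 0" if "mexp q 0 c = 1" for c
    using that assms powi_eq_1_iff[of q c]
    by (simp add: mexp_const mero_const_inject flip: mero_const_1 of_real_power_int)
  assume *: "mexp q a c = 1"
  hence "mero_shift (of_int 1) (mexp q a c) = 1" by simp
  hence "mexp q a (c + a) = 1" by (subst (asm) mero_shift_mexp) simp
  moreover have "mexp q a (c + a) = mexp q a c * mexp q 0 a" by (simp add: mexp_add)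
  ultimately have "a = 0" using const[of a] * by auto
  thus "a = 0 \<and> c = 0" using * const by auto
qed (use assms in \<open>simp add: mexp_0\<close>)

lemma abs_mero_qpow: "abs_mero (\<lambda>z. qpow q (of_int a * z + of_int c)) = mexp q a c"
  by (simp add: mexp_def)

lemma Q1_eq: "Q1 q = mexp q 2 2"
  by (simp add: Q1_def mexp_def algebra_simps)

lemma Fc_eq: assumes "0 < q" shows "Fc q = (mexp q 2 2 - mexp q 0 (- 2)) / (mexp q 2 2 - 1)"
proof -
  have "mexp q 2 2 = abs_mero (\<lambda>l. qpow q (2 * (l + 1)))"
    "mexp q 0 (- 2) = abs_mero (\<lambda>l. qpow q (- 2))"
    by (simp_all add: mexp_def algebra_simps)
  moreover have "(\<lambda>l. qpow q (2 * (l + 1))) meromorphic_on UNIV"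
    by (intro qpow_meromorphic analytic_intros)
  ultimately show ?thesis
    by (simp add: Fc_def one_mero_def abs_mero_diff abs_mero_divide meromorphic_on_diff meromorphic_on_const)
qed

lemma Gc_eq: assumes "0 < q"
  shows "Gc q = ((mexp q 2 2 - mexp q 0 2) * (mexp q 2 2 - mexp q 0 (- 2))) / (mexp q 2 2 - 1) ^ 2"
proof -
  have "mexp q 2 2 = abs_mero (\<lambda>l. qpow q (2 * (l + 1)))"
    "mexp q 0 (- 2) = abs_mero (\<lambda>l. qpow q (- 2))" "mexp q 0 2 = abs_mero (\<lambda>l. qpow q 2)"
    by (simp_all add: mexp_def algebra_simps)
  moreover have "(\<lambda>l. qpow q (2 * (l + 1))) meromorphic_on UNIV"
    by (intro qpow_meromorphic analytic_intros)
  ultimately show ?thesis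
    by (simp add: Gc_def one_mero_def abs_mero_diff abs_mero_divide abs_mero_mult
        meromorphic_on_diff meromorphic_on_mult meromorphic_on_const power2_eq_square)
qed

section \<open>Ideals and cosets\<close>

lemma free_ring_simps [simp]:
  "carrier free_ring = UNIV" "x \<otimes>\<^bsub>free_ring\<^esub> y = x * y" "x \<oplus>\<^bsub>free_ring\<^esub> y = x + y"
  "\<zero>\<^bsub>free_ring\<^esub> = 0" "\<one>\<^bsub>free_ring\<^esub> = 1"
  by (simp_all add: ring_of_type_algebra_def)

lemma free_ring_a_inv [simp]: "\<ominus>\<^bsub>free_ring\<^esub> x = - x"
proof -
  interpret ring free_ring by (rule ring_ring_of_type_algebra)
  show ?thesis by (rule minus_equality) auto
qed

lemma
  shows SL2_ideal_0: "0 \<in> SL2_ideal q"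
    and SL2_ideal_add: "x \<in> SL2_ideal q \<Longrightarrow> y \<in> SL2_ideal q \<Longrightarrow> x + y \<in> SL2_ideal q"
    and SL2_ideal_uminus: "x \<in> SL2_ideal q \<Longrightarrow> - x \<in> SL2_ideal q"
    and SL2_ideal_mult_left: "x \<in> SL2_ideal q \<Longrightarrow> r * x \<in> SL2_ideal q"
    and SL2_ideal_mult_right: "x \<in> SL2_ideal q \<Longrightarrow> x * r \<in> SL2_ideal q"
proof -
  interpret ideal "SL2_ideal q" free_ring by (rule ideal_SL2_ideal)
  show "0 \<in> SL2_ideal q" using additive_subgroup.zero_closed[OF additive_subgroup_axioms] by simp
  show "x \<in> SL2_ideal q \<Longrightarrow> y \<in> SL2_ideal q \<Longrightarrow> x + y \<in> SL2_ideal q" using additive_subgroup.a_closed[OF additive_subgroup_axioms] by simp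
  show "x \<in> SL2_ideal q \<Longrightarrow> - x \<in> SL2_ideal q" using I_l_closed[of x "- 1"] by simp
  show "x \<in> SL2_ideal q \<Longrightarrow> r * x \<in> SL2_ideal q" using I_l_closed by simp
  show "x \<in> SL2_ideal q \<Longrightarrow> x * r \<in> SL2_ideal q" using I_r_closed by simp
qed

lemma SL2_ideal_diff: "x \<in> SL2_ideal q \<Longrightarrow> y \<in> SL2_ideal q \<Longrightarrow> x - y \<in> SL2_ideal q"
  using SL2_ideal_add[of x q "- y"] SL2_ideal_uminus[of y q] by simp

lemma SL2_ideal_sum: "(\<And>i. i \<in> A \<Longrightarrow> f i \<in> SL2_ideal q) \<Longrightarrow> sum f A \<in> SL2_ideal q"
  by (induction A rule: infinite_finite_induct) (auto intro: SL2_ideal_0 SL2_ideal_add)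

lemma SL2_ideal_gens: "insert (qdet q - 1) (M2_rels q) \<subseteq> SL2_ideal q"
  unfolding SL2_ideal_def
  by (rule ring.genideal_self[OF ring_ring_of_type_algebra]) simp

text \<open>Serves as an induction principle: with I the set of elements having some property, a
  claim on the ideal is reduced to its generators. The representation, the grading and the coproduct
  are all handled in this way.\<close>

lemma SL2_ideal_minimal:
  assumes "0 \<in> I" "\<And>x y. x \<in> I \<Longrightarrow> y \<in> I \<Longrightarrow> x - y \<in> I"
    "\<And>x r. x \<in> I \<Longrightarrow> r * x \<in> I" "\<And>x r. x \<in> I \<Longrightarrow> x * r \<in> I"
    "\<And>r. r \<in> M2_rels q \<Longrightarrow> r \<in> I" "qdet q - 1 \<in> I"
  shows "SL2_ideal q \<subseteq> I"
  unfolding SL2_ideal_def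
proof (rule ring.genideal_minimal[OF ring_ring_of_type_algebra])
  have um: "- x \<in> I" if "x \<in> I" for x
    using assms(2)[OF assms(1) that] by simp
  have ad: "x + y \<in> I" if "x \<in> I" "y \<in> I" for x y
    using assms(2)[OF that(1) um[OF that(2)]] by simp
  show "ideal I free_ring"
  proof (rule idealI[OF ring_ring_of_type_algebra])
    interpret R: ring free_ring by (rule ring_ring_of_type_algebra)
    show "subgroup I (add_monoid free_ring)"
      by (rule R.add.subgroupI) (use assms ad um in auto)
  qed (use assms in auto)
qed (use assms in auto)

lemma mem_cls: "z \<in> cls q x \<longleftrightarrow> z - x \<in> SL2_ideal q"
  by (auto simp: cls_def a_r_coset_def' intro!: bexI[of _ "z - x"])

lemma cls_eq_iff: "cls q x = cls q y \<longleftrightarrow> x - y \<in> SL2_ideal q"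
proof
  assume "cls q x = cls q y"
  hence "x \<in> cls q y" by (metis mem_cls diff_self SL2_ideal_0)
  thus "x - y \<in> SL2_ideal q" by (simp add: mem_cls)
next
  assume *: "x - y \<in> SL2_ideal q"
  show "cls q x = cls q y"
  proof (rule Set.set_eqI)
    fix z show "z \<in> cls q x \<longleftrightarrow> z \<in> cls q y"
      using SL2_ideal_add[OF _ *, of "z - x"] SL2_ideal_diff[OF _ *, of "z - y"] by (auto simp: mem_cls)
  qed
qed

lemma carrier_SL2: "carrier (SL2 q) = range (cls q)"
  by (auto simp: SL2_def FactRing_def A_RCOSETS_def' cls_def)

lemma cls_hom:
  "cls q x \<otimes>\<^bsub>SL2 q\<^esub> cls q y = cls q (x * y)" "cls q x \<oplus>\<^bsub>SL2 q\<^esub> cls q y = cls q (x + y)"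
  "\<one>\<^bsub>SL2 q\<^esub> = cls q 1"
  using ideal.rcos_ring_hom[OF ideal_SL2_ideal[of q]]
  by (auto simp: ring_hom_def cls_def SL2_def)

lemma cls_0: "\<zero>\<^bsub>SL2 q\<^esub> = cls q 0"
  by (auto simp: SL2_def FactRing_def mem_cls)

lemma cls_closed [simp]: "cls q x \<in> carrier (SL2 q)"
  by (simp add: carrier_SL2)

section \<open>Matched tensors in the tensor square of the free algebra\<close>

lemma matched_ring_simps [simp]:
  "x \<otimes>\<^bsub>matched_ring\<^esub> y = x * y" "x \<oplus>\<^bsub>matched_ring\<^esub> y = x + y"
  "\<zero>\<^bsub>matched_ring\<^esub> = 0" "\<one>\<^bsub>matched_ring\<^esub> = 1"
  by (simp_all add: ring_of_type_algebra_def matched_ring_def)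

definition matched :: "free_alg2 set" where
  "matched = {p. \<forall>(u, v)\<in>Poly_Mapping.keys p. rdeg u = ldeg v}"

lemma carrier_matched_ring: "carrier matched_ring = matched"
  by (simp add: matched_ring_def matched_def)

lemma
  shows matched_0: "0 \<in> matched" and matched_1: "1 \<in> matched"
    and matched_add: "x \<in> matched \<Longrightarrow> y \<in> matched \<Longrightarrow> x + y \<in> matched"
    and matched_mult: "x \<in> matched \<Longrightarrow> y \<in> matched \<Longrightarrow> x * y \<in> matched"
    and matched_uminus: "x \<in> matched \<Longrightarrow> - x \<in> matched"
    and matched_ring_a_inv [simp]: "x \<in> matched \<Longrightarrow> \<ominus>\<^bsub>matched_ring\<^esub> x = - x"
proof -
  interpret ring matched_ring by (rule ring_matched_ring)
  show "0 \<in> matched" "1 \<in> matched"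
    using zero_closed one_closed by (simp_all add: carrier_matched_ring)
  show add: "x + y \<in> matched" if "x \<in> matched" "y \<in> matched" for x y
    using add.m_closed[of x y] that by (simp add: carrier_matched_ring)
  show "x * y \<in> matched" if "x \<in> matched" "y \<in> matched" for x y
    using m_closed[of x y] that by (simp add: carrier_matched_ring)
  show um: "- x \<in> matched" if "x \<in> matched" for x
    using that by (simp add: matched_def)
  show "\<ominus>\<^bsub>matched_ring\<^esub> x = - x" if "x \<in> matched" for x
    using that um by (intro minus_equality) (auto simp: carrier_matched_ring)
qed

lemma matched_diff: "x \<in> matched \<Longrightarrow> y \<in> matched \<Longrightarrow> x - y \<in> matched"
  using matched_add[of x "- y"] matched_uminus[of y] by simp

lemma matched_sum: "(\<And>i. i \<in> A \<Longrightarrow> f i \<in> matched) \<Longrightarrow> sum f A \<in> matched"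
  by (induction A rule: infinite_finite_induct) (auto intro: matched_0 matched_add)

text \<open>Additive extension of a map given on monomials. Since \<open>h\<close> receives the word
  together with its coefficient, additivity in the coefficient is all that is required, and the
  target may be any abelian group without a scalar action.\<close>

definition lext :: "('w \<Rightarrow> complex \<Rightarrow> 'v) \<Rightarrow> ('w \<Rightarrow>\<^sub>0 complex) \<Rightarrow> 'v::ab_group_add" where
  "lext h x = (\<Sum>w\<in>Poly_Mapping.keys x. h w (Poly_Mapping.lookup x w))"

context
  fixes h :: "'w \<Rightarrow> complex \<Rightarrow> 'v::ab_group_add"
  assumes h_add: "\<And>w c d. h w (c + d) = h w c + h w d"
begin

lemma lext_superset:
  assumes "finite S" "Poly_Mapping.keys x \<subseteq> S"
  shows "lext h x = (\<Sum>w\<in>S. h w (Poly_Mapping.lookup x w))"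
proof -
  have "h w 0 = 0" for w using h_add[of w 0 0] by simp
  thus ?thesis
    unfolding lext_def using assms by (intro sum.mono_neutral_left) (auto simp: in_keys_iff)
qed

lemma lext_add: "lext h (x + y) = lext h x + lext h y"
proof -
  let ?S = "Poly_Mapping.keys x \<union> Poly_Mapping.keys y"
  have "Poly_Mapping.keys (x + y) \<subseteq> ?S" by (rule Poly_Mapping.keys_add)
  thus ?thesis
    by (simp add: lext_superset[of ?S] lookup_add h_add sum.distrib)
qed

lemma lext_single: "lext h (Poly_Mapping.single w c) = h w c"
  by (subst lext_superset[of "{w}"]) auto

lemma lext_0: "lext h 0 = 0"
  by (simp add: lext_def)

lemma lext_uminus: "lext h (- x) = - lext h x"
  using lext_add[of x "- x"] by (simp add: lext_0 minus_unique)

lemma lext_diff: "lext h (x - y) = lext h x - lext h y"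
  using lext_add[of x "- y"] by (simp add: lext_uminus)

lemma lext_sum: "lext h (sum f A) = (\<Sum>i\<in>A. lext h (f i))"
  by (induction A rule: infinite_finite_induct) (auto simp: lext_0 lext_add)

end

lemma poly_mapping_add_induct [case_names single add]:
  assumes "\<And>w c. P (Poly_Mapping.single w c)" "\<And>x y. P x \<Longrightarrow> P y \<Longrightarrow> P (x + y)"
  shows "P (x :: 'w \<Rightarrow>\<^sub>0 complex)"
proof (induction x rule: Poly_Mapping.update_induct)
  case const
  show ?case using assms(1)[of undefined 0] by simp
next
  case (update f a b)
  have "Poly_Mapping.update a b f = Poly_Mapping.single a b + f"
    using update by (intro poly_mapping_eqI)
      (auto simp: lookup_update lookup_add lookup_single in_keys_iff when_def)
  thus ?case using assms update by simp
qed

text \<open>u(x) = q F(x), and v is its complement to q + 1/q. Both have product form: u = q^{-1} (1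
  - q^{2x+4})/(1 - q^{2x+2}) and v = q (1 - q^{2x})/(1 - q^{2x+2}). In the relations u is taken at
  lambda and v at mu.\<close>

definition uf :: "real \<Rightarrow> mero" where "uf q = mero_const (of_real q) * Fc q"
definition vf :: "real \<Rightarrow> mero" where "vf q = mero_const (of_real (q + 1 / q)) - uf q"

context
  fixes q :: real assumes q: "0 < q" "q < 1"
begin

lemma Q1_nz: "Q1 q - 1 \<noteq> 0"
  using mexp_eq_1_iff[OF q, of 2 2] by (simp add: Q1_eq)

lemma mexp_1_nz: "a \<noteq> 0 \<or> c \<noteq> 0 \<Longrightarrow> 1 - mexp q a c \<noteq> 0" "a \<noteq> 0 \<or> c \<noteq> 0 \<Longrightarrow> mexp q a c - 1 \<noteq> 0"
  using mexp_eq_1_iff[OF q, of a c] by auto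

lemma uf_eq: "uf q = mexp q 0 (- 1) * (1 - mexp q 2 4) / (1 - mexp q 2 2)"
proof -
  have "mexp q 0 1 = mero_const (of_real q)" using q by (simp add: mexp_const)
  moreover have "mexp q 0 1 * (mexp q 2 2 - mexp q 0 (-2)) = mexp q 0 (-1) * (mexp q 2 4 - 1)"
    by (simp add: algebra_simps mexp_add)
  ultimately have "uf q = mexp q 0 (-1) * (mexp q 2 4 - 1) / (mexp q 2 2 - 1)"
    by (simp add: uf_def Fc_eq[OF q(1)] times_divide_eq_right)
  also have "\<dots> = mexp q 0 (- 1) * (1 - mexp q 2 4) / (1 - mexp q 2 2)"
    by (metis minus_diff_eq minus_divide_divide mult_minus_right)
  finally show ?thesis .
qed

lemma mero_const_q: "mero_const (of_real q) = mexp q 0 1" "mero_const (of_real (1/q)) = mexp q 0 (-1)"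
  "mero_const (of_real (inverse q)) = mexp q 0 (-1)"
  using q by (simp_all add: mexp_const power_int_minus inverse_eq_divide)

text \<open>Partial fractions: the polar part carries the same factor q - 1/q as H and I, which
  allows these to be split into a function of lambda and a function of mu.\<close>

lemma uf_eq': "uf q = mexp q 0 1 + (mexp q 0 1 - mexp q 0 (-1)) * inverse (Q1 q - 1)"
proof -
  have "mexp q 0 (-1) * (1 - mexp q 2 4) = mexp q 0 1 * (1 - mexp q 2 2) - (mexp q 0 1 - mexp q 0 (-1))"
    by (simp add: algebra_simps mexp_add)
  thus ?thesis
    using Q1_nz mexp_1_nz[of 2 2] unfolding uf_eq Q1_eq by (simp add: divide_simps) (simp add: algebra_simps)
qed

lemma vf_eq': "vf q = mexp q 0 (-1) - (mexp q 0 1 - mexp q 0 (-1)) * inverse (Q1 q - 1)"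
  unfolding vf_def uf_eq' by (simp add: mero_const_add mero_const_q[simplified])

lemma vf_eq: "vf q = mexp q 0 1 * (1 - mexp q 2 0) / (1 - mexp q 2 2)"
proof -
  have "mexp q 0 1 * (1 - mexp q 2 0) = mexp q 0 (-1) * (1 - mexp q 2 2) + (mexp q 0 1 - mexp q 0 (-1))"
    by (simp add: algebra_simps mexp_add)
  thus ?thesis
    using Q1_nz mexp_1_nz[of 2 2] unfolding vf_eq' Q1_eq by (simp add: divide_simps) (simp add: algebra_simps)
qed

lemma vf_nz: "vf q \<noteq> 0"
  unfolding vf_eq using q by (simp add: mexp_1_nz[simplified])

lemma uf_plus_vf: "uf q + vf q = mexp q 0 1 + mexp q 0 (-1)"
  by (simp add: uf_eq' vf_eq')

text \<open>Shifting the product form of u by -1 gives q^{-1} (1 - q^{2x+2})/(1 - q^{2x}), the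
  reciprocal of v. Hence alpha beta = q F(mu - 1) beta alpha becomes v(mu) alpha beta = beta
  alpha.\<close>

lemma shift_Fc: "mero_const (of_real q) * mero_shift (- 1) (Fc q) = inverse (vf q)"
proof -
  have "mero_const (of_real q) * mero_shift (- 1) (Fc q) = mero_shift (of_int (- 1)) (uf q)"
    by (simp add: uf_def mero_shift_mult)
  also have "\<dots> = mexp q 0 (- 1) * (1 - mexp q 2 2) / (1 - mexp q 2 0)"
    unfolding uf_eq mero_shift_hom mero_shift_mexp by simp
  also have "mexp q 0 (-1) = inverse (mexp q 0 1)"
    using mexp_add[of q 0 1 0 "-1"] q by (simp add: mexp_0 field_simps)
  finally show ?thesis by (simp add: vf_eq field_simps)
qed

lemma Gc_eq_uv: "Gc q = uf q * vf q"
proof -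
  have 1: "mexp q 0 (-1) * (1 - mexp q 2 4) * (mexp q 0 1 * (1 - mexp q 2 0))
      = (mexp q 2 2 - mexp q 0 2) * (mexp q 2 2 - mexp q 0 (- 2))"
    by (simp add: algebra_simps mexp_add mexp_0 q)
  have 2: "(1 - mexp q 2 2) * (1 - mexp q 2 2) = (mexp q 2 2 - 1)\<^sup>2"
    by (simp add: algebra_simps power2_eq_square)
  show ?thesis
    unfolding uf_eq vf_eq Gc_eq[OF q(1)] times_divide_times_eq 1 2 ..
qed

end

section \<open>A representation by difference operators\<close>

text \<open>$\beta$ acts as a plain shift and \<open>zc q m\<close> is the eigenvalue of $\gamma\beta$ at \<open>m\<close>; the relations
  then force the coefficients of $\alpha$ and $\delta$.\<close>

definition zc :: "real \<Rightarrow> int \<Rightarrow> mero" where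
  "zc q m = (mexp q 0 (1 - 2 * m) + mexp q 0 (2 * m - 1)) * mexp q 2 (2 * m + 2)
     / ((1 - mexp q 2 4) * (1 - mexp q 2 (4 * m)))"

definition alc :: "real \<Rightarrow> int \<Rightarrow> mero" where
  "alc q m = mexp q 1 (2 * m) / (mexp q 2 (4 * m) - 1)"

definition dec :: "real \<Rightarrow> int \<Rightarrow> mero" where
  "dec q m = - ((1 + mexp q 4 (4 * m + 6)) * mexp q (- 1) (- 2 * m - 1) / (1 - mexp q 2 4))"

text \<open>The integer \<open>m\<close> stands for (mu - lambda)/2: alpha and delta preserve mu -
  lambda, while beta and gamma change it by 2 in opposite directions. So f(mu) multiplies the
  component at \<open>m\<close> by f(lambda + 2m).\<close>

fun act :: "real \<Rightarrow> gen \<Rightarrow> (int \<Rightarrow> mero) \<Rightarrow> int \<Rightarrow> mero" where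
  "act q (Lam f) v m = f * v m"
| "act q (Mu f) v m = mero_shift (2 * of_int m) f * v m"
| "act q Al v m = alc q m * mero_shift (- 1) (v m)"
| "act q Be v m = mero_shift (- 1) (v (m + 1))"
| "act q Ga v m = zc q m * mero_shift 1 (v (m - 1))"
| "act q De v m = dec q m * mero_shift 1 (v m)"

definition actw :: "real \<Rightarrow> gword \<Rightarrow> (int \<Rightarrow> mero) \<Rightarrow> int \<Rightarrow> mero" where
  "actw q w v = foldr (act q) (letters w) v"

definition Act :: "real \<Rightarrow> free_alg \<Rightarrow> (int \<Rightarrow> mero) \<Rightarrow> int \<Rightarrow> mero" where
  "Act q x v m = lext (\<lambda>w c. mero_const c * actw q w v m) x"

lemma Act_add: "Act q (x + y) v m = Act q x v m + Act q y v m"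
  and Act_diff: "Act q (x - y) v m = Act q x v m - Act q y v m"
  and Act_0: "Act q 0 v m = 0"
  and Act_single: "Act q (Poly_Mapping.single w c) v m = mero_const c * actw q w v m"
  unfolding Act_def
  by ((subst lext_add lext_diff lext_0 lext_single)?; simp add: lext_def mero_const_add algebra_simps)+

lemma act_add: "act q g (\<lambda>m. v m + v' m) m = act q g v m + act q g v' m"
  by (cases g) (simp_all add: mero_shift_hom algebra_simps)

lemma act_cmult: "act q g (\<lambda>m. mero_const c * v m) m = mero_const c * act q g v m"
  by (cases g) (simp_all add: mero_shift_hom algebra_simps)

lemma actw_add: "actw q w (\<lambda>m. v m + v' m) m = actw q w v m + actw q w v' m"
proof -
  have "foldr (act q) ws (\<lambda>m. v m + v' m) = (\<lambda>m. foldr (act q) ws v m + foldr (act q) ws v' m)" for ws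
    by (induction ws) (simp_all add: act_add)
  thus ?thesis by (simp add: actw_def)
qed

lemma actw_cmult: "actw q w (\<lambda>m. mero_const c * v m) m = mero_const c * actw q w v m"
proof -
  have "foldr (act q) ws (\<lambda>m. mero_const c * v m) = (\<lambda>m. mero_const c * foldr (act q) ws v m)" for ws
    by (induction ws) (simp_all add: act_cmult)
  thus ?thesis by (simp add: actw_def)
qed

lemma actw_plus: "actw q (w + w') v = actw q w (actw q w' v)"
  by (simp add: actw_def plus_gword_def)

lemma Act_mult: "Act q (x * y) v m = Act q x (Act q y v) m"
proof (induction x rule: poly_mapping_add_induct)
  case (single w c)
  show ?case
  proof (induction y rule: poly_mapping_add_induct)
    case (single w' d)
    have "Act q (Poly_Mapping.single w' d) v = (\<lambda>m. mero_const d * actw q w' v m)"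
      by (simp add: Act_single fun_eq_iff)
    thus ?case
      by (simp add: mult_single Act_single actw_plus actw_cmult mero_const_mult)
  next
    case (add y z)
    have "Act q (y + z) v = (\<lambda>m. Act q y v m + Act q z v m)"
      by (simp add: Act_add fun_eq_iff)
    thus ?case using add
      by (simp add: distrib_left Act_add) (simp add: Act_single actw_add algebra_simps)
  qed
qed (simp add: distrib_right Act_add)

lemma Act_gn: "Act q (gn g) v m = act q g v m"
  by (simp add: gn_def Act_single mero_const_1 actw_def)

lemma Act_scal: "Act q (scal c) v m = mero_const c * v m"
  by (simp add: scal_def Act_single actw_def zero_gword_def)

lemma Act_1: "Act q 1 v m = v m"
  using Act_scal[of q 1] by (simp add: scal_def mero_const_1)

lemma Act_mult_fun: "Act q (x * y) v = Act q x (Act q y v)"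
  by (simp add: Act_mult fun_eq_iff)

lemma Act_gn_fun: "Act q (gn g) v = act q g v"
  by (simp add: Act_gn fun_eq_iff)

lemma Act_scal_fun: "Act q (scal c) v = (\<lambda>m. mero_const c * v m)"
  by (simp add: Act_scal fun_eq_iff)

lemma Act_diff_fun: "Act q (x - y) v = (\<lambda>m. Act q x v m - Act q y v m)"
  by (simp add: Act_diff fun_eq_iff)

lemma Act_1_fun: "Act q 1 v = v"
  by (simp add: Act_1 fun_eq_iff)

lemmas Act_simps = Act_add Act_diff Act_0 Act_mult_fun Act_gn_fun Act_scal_fun Act_1_fun
  Act_diff_fun

lemma mero_shift_mexp_simps:
  "mero_shift 1 (mexp q a c) = mexp q a (c + a)" "mero_shift (- 1) (mexp q a c) = mexp q a (c - a)"
  "mero_shift (2 * of_int m) (mexp q a c) = mexp q a (c + 2 * m * a)"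
  using mero_shift_mexp[of 1 q a c] mero_shift_mexp[of "-1" q a c] mero_shift_mexp[of "2 * m" q a c]
  by (simp_all add: algebra_simps)

text \<open>u and v as functions of mu, which is lambda + 2m at level \<open>m\<close>.\<close>

definition um :: "real \<Rightarrow> int \<Rightarrow> mero" where "um q m = mero_shift (2 * of_int m) (uf q)"
definition vm :: "real \<Rightarrow> int \<Rightarrow> mero" where "vm q m = mero_shift (2 * of_int m) (vf q)"

context
  fixes q :: real and m :: int assumes q: "0 < q" "q < 1"
begin

lemma vm_nz: "vm q m \<noteq> 0"
  using vf_nz[OF q] mero_shift_shift[of "- (2 * of_int m)" "2 * of_int m" "vf q"]
  by (auto simp: vm_def)

lemma vm_eq: "vm q m = mexp q 0 1 * (1 - mexp q 2 (4 * m)) / (1 - mexp q 2 (4 * m + 2))"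
  unfolding vm_def vf_eq[OF q] mero_shift_hom mero_shift_mexp_simps by (simp add: algebra_simps)

lemma um_eq: "um q m = mexp q 0 1 + mexp q 0 (-1) - vm q m"
proof -
  have "um q m + vm q m = mero_shift (2 * of_int m) (mexp q 0 1 + mexp q 0 (-1))"
    unfolding um_def vm_def uf_plus_vf[OF q, symmetric] mero_shift_hom ..
  also have "\<dots> = mexp q 0 1 + mexp q 0 (-1)"
    unfolding mero_shift_hom mero_shift_mexp_simps by simp
  finally show ?thesis by (simp add: algebra_simps)
qed

text \<open>Symbols for the exponentials at level \<open>m\<close>. With mu = lambda + 2m,
  \<open>rx\<close> is q^{2(lambda+1)}, \<open>rt\<close> is q, \<open>rs\<close> is q^{mu-lambda},
  \<open>rw\<close> is q^{2 mu}, and \<open>rra\<close>, \<open>rrb\<close> are q^mu and its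
  inverse. The representation identities become identities of rational functions in them, subject to
  \<open>wts\<close> and \<open>rr'\<close>.\<close>

definition "rx = mexp q 2 2"
definition "rt = mexp q 0 1"
definition "rs = mexp q 0 (2 * m)"
definition "rw = mexp q 2 (4 * m)"
definition "rra = mexp q 1 (2 * m)"
definition "rrb = mexp q (- 1) (- 2 * m)"

lemma wts: "rw * rt^2 = rx * rs^2"
  using q by (simp add: rx_def rs_def rw_def rt_def mexp_add mexp_power algebra_simps)

lemma rr': "rra * rrb = 1"
  using q by (simp add: rra_def rrb_def mexp_add mexp_0)

lemma nz: "rx \<noteq> 0" "rt \<noteq> 0" "rs \<noteq> 0" "rra \<noteq> 0" "rrb \<noteq> 0"
  using q by (simp_all add: rx_def rt_def rs_def rra_def rrb_def)

lemma ratoms: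
  "mexp q 2 2 = rx" "mexp q 2 4 = rx * rt^2" "mexp q 2 6 = rx * rt^4" "mexp q 2 (4 * m) = rw" "mexp q 2 (4 * m + 2) = rw * rt^2"
  "mexp q 2 0 = rx / rt^2" "mexp q 2 (4 * m - 2) = rw / rt^2" "mexp q 2 (2 * m + 4) = rx * rs * rt^2"
  "mexp q 0 1 = rt" "mexp q 0 (- 1) = 1 / rt" "mexp q 0 (1 - 2 * m) = rt / rs" "mexp q 0 (2 * m - 1) = rs / rt"
  "mexp q 0 (- 1 - 2 * m) = 1 / (rt * rs)" "mexp q 0 (2 * m + 1) = rs * rt" "mexp q 2 (2 * m + 2) = rx * rs"
  "mexp q 2 (2 * m) = rx * rs / rt^2" "mexp q 4 (4 * m + 6) = rx * rw * rt^4" "mexp q 4 (4 * m + 2) = rx * rw"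
  "mexp q (- 1) (- 2 * m - 1) = rrb / rt" "mexp q (- 1) (- 2 * m - 2) = rrb / rt^2" "mexp q (- 1) (- 2 * m) = rrb"
  "mexp q 1 (2 * m) = rra" "mexp q 1 (2 * m + 1) = rra * rt" "mexp q 1 (2 * m - 1) = rra / rt"
proof -
  have t2: "rt^2 = mexp q 0 2" "rt^4 = mexp q 0 4" using q by (simp_all add: rt_def mexp_power)
  note d = rx_def rs_def rw_def rt_def rra_def rrb_def
  show "mexp q 2 2 = rx" "mexp q 2 4 = rx * rt^2" "mexp q 2 6 = rx * rt^4" "mexp q 2 (4 * m) = rw" "mexp q 2 (4 * m + 2) = rw * rt^2"
    "mexp q 2 (2 * m + 4) = rx * rs * rt^2" "mexp q 0 1 = rt" "mexp q 0 (2 * m + 1) = rs * rt" "mexp q 2 (2 * m + 2) = rx * rs"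
    "mexp q 4 (4 * m + 6) = rx * rw * rt^4" "mexp q 4 (4 * m + 2) = rx * rw" "mexp q (- 1) (- 2 * m) = rrb"
    "mexp q 1 (2 * m) = rra" "mexp q 1 (2 * m + 1) = rra * rt"
    by (unfold t2, unfold d mexp_add, (rule refl | (rule arg_cong2[where f = "mexp q"]; simp))+)
  have [simp]: "mexp q a c \<noteq> 0" for a c using q by simp
  have "mexp q 2 0 * rt^2 = rx" "mexp q 2 (4 * m - 2) * rt^2 = rw" "mexp q 0 (- 1) * rt = 1" "mexp q 0 (1 - 2 * m) * rs = rt"
    "mexp q 0 (2 * m - 1) * rt = rs" "mexp q 0 (- 1 - 2 * m) * (rt * rs) = 1" "mexp q 2 (2 * m) * rt^2 = rx * rs"
    "mexp q (- 1) (- 2 * m - 1) * rt = rrb" "mexp q (- 1) (- 2 * m - 2) * rt^2 = rrb" "mexp q 1 (2 * m - 1) * rt = rra"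
    unfolding t2 using q by (simp_all add: d mexp_add mexp_0 add.commute[of 2 "2 * m"])
  thus "mexp q 2 0 = rx / rt^2" "mexp q 2 (4 * m - 2) = rw / rt^2" "mexp q 0 (- 1) = 1 / rt" "mexp q 0 (1 - 2 * m) = rt / rs" "mexp q 0 (2 * m - 1) = rs / rt"
    "mexp q 0 (- 1 - 2 * m) = 1 / (rt * rs)" "mexp q 2 (2 * m) = rx * rs / rt^2"
    "mexp q (- 1) (- 2 * m - 1) = rrb / rt" "mexp q (- 1) (- 2 * m - 2) = rrb / rt^2" "mexp q 1 (2 * m - 1) = rra / rt"
    using nz by (simp_all add: eq_divide_eq)
qed

lemma rnz: "1 - rx \<noteq> 0" "1 - rx * rt^2 \<noteq> 0" "1 - rx * rt^4 \<noteq> 0" "1 - rw \<noteq> 0" "1 - rw * rt^2 \<noteq> 0" "1 - rw / rt^2 \<noteq> 0"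
  using mexp_1_nz(1)[OF q, of 2 2] mexp_1_nz(1)[OF q, of 2 4] mexp_1_nz(1)[OF q, of 2 6]
    mexp_1_nz(1)[OF q, of 2 "4 * m"] mexp_1_nz(1)[OF q, of 2 "4 * m + 2"] mexp_1_nz(1)[OF q, of 2 "4 * m - 2"]
  unfolding ratoms by simp_all

lemma uf_at: "uf q = (1 / rt) * (1 - rx * rt^2) / (1 - rx)"
  unfolding uf_eq[OF q] ratoms ..

lemma vm_at: "vm q m = rt * (1 - rw) / (1 - rw * rt^2)"
  unfolding vm_eq ratoms ..

lemma zc_num: "(rt / rs + rs / rt) * (rx * rs) = rt * (rx + rw)"
proof -
  have "(rt / rs + rs / rt) * (rx * rs) = rt * rx + (rx * rs^2) / rt"
    using nz by (simp add: algebra_simps power2_eq_square)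
  also have "\<dots> = rt * (rx + rw)"
    unfolding wts[symmetric] using nz by (simp add: algebra_simps power2_eq_square)
  finally show ?thesis .
qed

lemma zc_num': "(1 / (rt * rs) + rs * rt) * (rx * rs) = rx / rt + rw * rt ^ 3"
proof -
  have "(1 / (rt * rs) + rs * rt) * (rx * rs) = rx / rt + (rx * rs^2) * rt"
    using nz by (simp add: field_simps power2_eq_square)
  also have "\<dots> = rx / rt + rw * rt ^ 3"
    unfolding wts[symmetric] using nz by (simp add: field_simps power2_eq_square power3_eq_cube)
  finally show ?thesis .
qed

lemma zc_at: "zc q m = rt * (rx + rw) / ((1 - rx * rt^2) * (1 - rw))"
  unfolding zc_def ratoms zc_num ..

lemma alc_at: "alc q m = - (rra / (1 - rw))"
  unfolding alc_def ratoms by (metis minus_diff_eq minus_divide_right)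

lemma dec_at: "dec q m = - ((1 + rx * rw * rt^4) * (rrb / rt) / (1 - rx * rt^2))"
  unfolding dec_def ratoms ..

lemma shifted_at:
  "mero_shift (- 1) (dec q m) = - ((1 + rx * rw) * rrb / (1 - rx))"
  "mero_shift 1 (alc q m) = - (rra * rt / (1 - rw * rt^2))"
  "mero_shift (- 1) (zc q (m + 1)) = (rx / rt + rw * rt ^ 3) / ((1 - rx) * (1 - rw * rt^2))"
  "mero_shift (- 1) (alc q (m + 1)) = - (rra * rt / (1 - rw * rt^2))"
  "mero_shift (- 1) (zc q m) = (rx + rw) / rt / ((1 - rx) * (1 - rw / rt^2))"
  "mero_shift 1 (alc q (m - 1)) = - ((rra / rt) / (1 - rw / rt^2))"
  "mero_shift (- 1) (dec q (m + 1)) = - ((1 + rx * rw * rt^4) * (rrb / rt^2) / (1 - rx))"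
  "mero_shift 1 (dec q (m - 1)) = - ((1 + rx * rw * rt^4) * rrb / (1 - rx * rt^4))"
  "mero_shift 1 (zc q m) = rt ^ 3 * (rx + rw) / ((1 - rx * rt^4) * (1 - rw * rt^2))"
proof -
  note d = dec_def alc_def zc_def mero_shift_hom mero_shift_mexp_simps
  have neg: "a / (b - c) = - (a / (c - b))" for a b c :: mero
    by (metis minus_diff_eq minus_divide_right)
  have "mero_shift (- 1) (dec q m) = - ((1 + mexp q 4 (4 * m + 2)) * mexp q (- 1) (- 2 * m) / (1 - mexp q 2 2))"
    unfolding d by (simp add: algebra_simps)
  thus "mero_shift (- 1) (dec q m) = - ((1 + rx * rw) * rrb / (1 - rx))" unfolding ratoms .
  have "mero_shift 1 (alc q m) = mexp q 1 (2 * m + 1) / (mexp q 2 (4 * m + 2) - 1)"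
    unfolding d by (simp add: algebra_simps)
  thus "mero_shift 1 (alc q m) = - (rra * rt / (1 - rw * rt^2))" unfolding ratoms neg[of _ _ 1] .
  have "mero_shift (- 1) (zc q (m + 1)) = (mexp q 0 (- 1 - 2 * m) + mexp q 0 (2 * m + 1)) * mexp q 2 (2 * m + 2)
     / ((1 - mexp q 2 2) * (1 - mexp q 2 (4 * m + 2)))"
    unfolding d by (simp add: algebra_simps)
  thus "mero_shift (- 1) (zc q (m + 1)) = (rx / rt + rw * rt ^ 3) / ((1 - rx) * (1 - rw * rt^2))"
    unfolding ratoms zc_num' .
  have "mero_shift (- 1) (alc q (m + 1)) = mexp q 1 (2 * m + 1) / (mexp q 2 (4 * m + 2) - 1)"
    unfolding d by (simp add: algebra_simps)
  thus "mero_shift (- 1) (alc q (m + 1)) = - (rra * rt / (1 - rw * rt^2))" unfolding ratoms neg[of _ _ 1] .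
  have "mero_shift (- 1) (zc q m) = (mexp q 0 (1 - 2 * m) + mexp q 0 (2 * m - 1)) * mexp q 2 (2 * m)
     / ((1 - mexp q 2 2) * (1 - mexp q 2 (4 * m - 2)))"
    unfolding d by (simp add: algebra_simps)
  moreover have "(rt / rs + rs / rt) * (rx * rs / rt^2) = (rx + rw) / rt"
    unfolding times_divide_eq_right zc_num using nz by (simp add: power2_eq_square)
  ultimately show "mero_shift (- 1) (zc q m) = (rx + rw) / rt / ((1 - rx) * (1 - rw / rt^2))"
    unfolding ratoms by (simp only:)
  have "mero_shift 1 (alc q (m - 1)) = mexp q 1 (2 * m - 1) / (mexp q 2 (4 * m - 2) - 1)"
    unfolding d by (simp add: algebra_simps)
  thus "mero_shift 1 (alc q (m - 1)) = - ((rra / rt) / (1 - rw / rt^2))" unfolding ratoms neg[of _ _ 1] .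
  have "mero_shift (- 1) (dec q (m + 1)) = - ((1 + mexp q 4 (4 * m + 6)) * mexp q (- 1) (- 2 * m - 2) / (1 - mexp q 2 2))"
  proof -
    have i: "- 2 * (m + 1) - 1 - - 1 = - 2 * m - 2" "4 * (m + 1) + 6 - 4 = 4 * m + 6" "4 - 2 = (2 :: int)"
      by simp_all
    show ?thesis unfolding d i by simp
  qed
  thus "mero_shift (- 1) (dec q (m + 1)) = - ((1 + rx * rw * rt^4) * (rrb / rt^2) / (1 - rx))" unfolding ratoms .
  have "mero_shift 1 (dec q (m - 1)) = - ((1 + mexp q 4 (4 * m + 6)) * mexp q (- 1) (- 2 * m) / (1 - mexp q 2 6))"
    unfolding d by (simp add: algebra_simps)
  thus "mero_shift 1 (dec q (m - 1)) = - ((1 + rx * rw * rt^4) * rrb / (1 - rx * rt^4))" unfolding ratoms .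
  have "mero_shift 1 (zc q m) = (mexp q 0 (1 - 2 * m) + mexp q 0 (2 * m - 1)) * mexp q 2 (2 * m + 4)
     / ((1 - mexp q 2 6) * (1 - mexp q 2 (4 * m + 2)))"
    unfolding d by (simp add: algebra_simps)
  moreover have "(rt / rs + rs / rt) * (rx * rs * rt^2) = rt^3 * (rx + rw)"
  proof -
    have "(rt / rs + rs / rt) * (rx * rs * rt^2) = (rt / rs + rs / rt) * (rx * rs) * rt^2" by (simp only: mult.assoc)
    also have "\<dots> = rt^3 * (rx + rw)" unfolding zc_num by (simp add: power2_eq_square power3_eq_cube)
    finally show ?thesis .
  qed
  ultimately show "mero_shift 1 (zc q m) = rt ^ 3 * (rx + rw) / ((1 - rx * rt^4) * (1 - rw * rt^2))"
    unfolding ratoms by (simp only:)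
qed

text \<open>Both sides equal (1 + x w)/((1 - x)(1 - w)) with x = \<open>rx\<close> and w =
  \<open>rw\<close>. The split 1 + x w = (1 - x)(1 - w) + (x + w) separates the 1 from the
  eigenvalue of gamma beta.\<close>

lemma rep_AD: "alc q m * mero_shift (- 1) (dec q m) = 1 + uf q * zc q m"
proof -
  have "alc q m * mero_shift (- 1) (dec q m) = (rra * rrb) * (1 + rx * rw) / ((1 - rw) * (1 - rx))"
    unfolding shifted_at unfolding alc_at by simp
  also have "1 + rx * rw = (1 - rw) * (1 - rx) + (rx + rw)" by (simp add: algebra_simps)
  also have "rra * rrb * ((1 - rw) * (1 - rx) + (rx + rw)) / ((1 - rw) * (1 - rx)) = 1 + (rx + rw) / ((1 - rx) * (1 - rw))"
    using rnz unfolding rr' by (simp add: add_divide_distrib mult.commute)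
  also have "\<dots> = 1 + uf q * zc q m"
    unfolding uf_at zc_at using rnz nz by simp
  finally show ?thesis .
qed

lemma rep_DA: "dec q m * mero_shift 1 (alc q m) = 1 + vm q m * zc q m"
proof -
  have "dec q m * mero_shift 1 (alc q m) = (rra * rrb) * (1 + rx * rw * rt^4) / ((1 - rx * rt^2) * (1 - rw * rt^2))"
    unfolding shifted_at unfolding dec_at using nz by simp
  also have "1 + rx * rw * rt^4 = (1 - rx * rt^2) * (1 - rw * rt^2) + rt^2 * (rx + rw)"
    by (simp add: algebra_simps power_numeral_reduce)
  also have "rra * rrb * ((1 - rx * rt^2) * (1 - rw * rt^2) + rt^2 * (rx + rw)) / ((1 - rx * rt^2) * (1 - rw * rt^2))
      = 1 + rt^2 * (rx + rw) / ((1 - rx * rt^2) * (1 - rw * rt^2))"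
    using rnz unfolding rr' by (simp add: add_divide_distrib)
  also have "\<dots> = 1 + vm q m * zc q m"
    unfolding vm_at zc_at using rnz by (simp add: power2_eq_square mult_ac)
  finally show ?thesis .
qed

text \<open>beta gamma at level \<open>m\<close> is the shifted eigenvalue of gamma beta at level
  \<open>m + 1\<close>, and the relations prescribe it in terms of the eigenvalue at
  \<open>m\<close>. The identity is thus a first order recursion in \<open>m\<close>, solved by the
  explicit formula for \<open>zc\<close>.\<close>

lemma rep_BG: "mero_shift (- 1) (zc q (m + 1)) = uf q + vm q m - (rt + 1 / rt) + uf q * vm q m * zc q m"
proof -
  have "uf q * vm q m * zc q m = rt * (rx + rw) / ((1 - rx) * (1 - rw * rt^2))"
    unfolding vm_at zc_at uf_at using rnz nz by simp
  moreover have "(rx / rt + rw * rt ^ 3) / ((1 - rx) * (1 - rw * rt^2)) =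
     (1 / rt) * (1 - rx * rt^2) / (1 - rx) + rt * (1 - rw) / (1 - rw * rt^2) - (rt + 1 / rt) + rt * (rx + rw) / ((1 - rx) * (1 - rw * rt^2))"
  proof -
    have frac: "A / (Xa * W) = a / Xa + b / W - c + e / (Xa * W)"
      if "A = a * W + b * Xa - c * (Xa * W) + e" "Xa \<noteq> 0" "W \<noteq> 0" for A Xa W a b c e :: mero
      using that by (simp add: add_divide_distrib diff_divide_distrib)
    define ti where "ti = 1 / rt"
    have ti: "rt * ti = 1" using nz by (simp add: ti_def)
    have ti': "ti * (rt * y) = y" for y by (metis ti mult.assoc mult.commute mult_1)
    have "rx * ti + rw * rt ^ 3 = ti * (1 - rx * rt^2) * (1 - rw * rt^2) + rt * (1 - rw) * (1 - rx)
        - (rt + ti) * ((1 - rx) * (1 - rw * rt^2)) + rt * (rx + rw)"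
      by (simp add: algebra_simps power_numeral_reduce ti')
    thus ?thesis
      by (intro frac) (use rnz in \<open>simp_all add: ti_def\<close>)
  qed
  ultimately show ?thesis unfolding shifted_at unfolding vm_at uf_at by simp
qed

lemma rep_BA: "mero_shift (- 1) (alc q (m + 1)) = vm q m * alc q m"
  unfolding shifted_at unfolding vm_at alc_at using rnz by simp

lemma rep_AG: "alc q m * mero_shift (- 1) (zc q m) = uf q * (zc q m * mero_shift 1 (alc q (m - 1)))"
  unfolding shifted_at unfolding uf_at alc_at zc_at using rnz nz by (simp add: power2_eq_square mult_ac)

lemma rep_BD: "mero_shift (- 1) (dec q (m + 1)) = uf q * dec q m"
  unfolding shifted_at unfolding uf_at dec_at using rnz nz by (simp add: power2_eq_square power3_eq_cube)

lemma rep_GD: "vm q m * (zc q m * mero_shift 1 (dec q (m - 1))) = dec q m * mero_shift 1 (zc q m)"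
  unfolding shifted_at unfolding vm_at dec_at zc_at using rnz nz by (simp add: power2_eq_square power3_eq_cube mult_ac)

end

lemma shift_uf_m: assumes "0 < q" "q < 1"
  shows "mero_shift (2 * of_int m) (mero_shift (- 1) (Fc q)) * mero_const (of_real q) * vm q m = 1"
proof -
  have "mero_shift (2 * of_int m) (mero_const (of_real q) * mero_shift (- 1) (Fc q)) * vm q m = 1"
    unfolding shift_Fc[OF assms] vm_def using vm_nz[OF assms, of m] by (simp add: mero_shift_hom vm_def)
  thus ?thesis by (simp add: mero_shift_hom mult_ac)
qed

text \<open>With X and Y one less than q^{2(lambda+1)} and q^{2(mu+1)}, the numerator is (X + 1)(Y +
  1) - 1, and division by X Y gives 1 + 1/X + 1/Y. Times q - 1/q this is the difference of the
  partial fraction forms of u and v.\<close>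

lemma Act_Hc:
  assumes q: "0 < q" "q < 1"
  shows "Act q (Hc q) v m = (uf q - vm q m) * v m"
proof -
  let ?k = "mexp q 0 1 - mexp q 0 (-1)"
  define Xa Y where "Xa = Q1 q - 1" and "Y = mero_shift (2 * of_int m) (Q1 q) - 1"
  have Xa: "Xa \<noteq> 0" using Q1_nz[OF q] by (simp add: Xa_def)
  have "Y = mexp q 2 (4 * m + 2) - 1"
    unfolding Y_def Q1_eq mero_shift_mexp_simps by (simp add: algebra_simps)
  hence Y: "Y \<noteq> 0" using mexp_1_nz(2)[OF q, of 2 "4 * m + 2"] by simp
  have u: "uf q = mexp q 0 1 + ?k * inverse Xa" unfolding uf_eq'[OF q] Xa_def ..
  have v: "vm q m = mexp q 0 (-1) - ?k * inverse Y"
    unfolding vm_def vf_eq'[OF q] Y_def mero_shift_hom mero_shift_mexp_simps by simp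
  have k: "mero_const (of_real (q - 1 / q)) = ?k"
    using mero_const_q[OF q] by (simp only: mero_const_diff of_real_diff)
  hence k': "mero_const (of_real q - 1 / of_real q) = ?k" by simp
  have *: "?k * ((Xa + 1) * (Y + 1) - 1) * inverse Xa * inverse Y = uf q - vm q m"
  proof -
    have "((Xa + 1) * (Y + 1) - 1) * inverse Xa * inverse Y = 1 + inverse Xa + inverse Y"
      using Xa Y by (simp add: field_simps)
    hence "?k * ((Xa + 1) * (Y + 1) - 1) * inverse Xa * inverse Y = ?k * (1 + inverse Xa + inverse Y)"
      by (simp only: mult.assoc)
    thus ?thesis unfolding u v by (simp add: algebra_simps)
  qed
  have "Act q (Hc q) v m = ?k * ((Xa + 1) * (Y + 1) - 1) * inverse Xa * inverse Y * v m"
    by (simp add: Hc_def Act_simps k' mero_shift_hom) (simp add: Xa_def Y_def algebra_simps)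
  thus ?thesis using * by simp
qed

lemma Act_Ic:
  assumes q: "0 < q" "q < 1"
  shows "Act q (Ic q) v m = (uf q + vm q m - (mexp q 0 1 + mexp q 0 (- 1))) * v m"
proof -
  let ?k = "mexp q 0 1 - mexp q 0 (-1)"
  define Xa Y where "Xa = Q1 q - 1" and "Y = mero_shift (2 * of_int m) (Q1 q) - 1"
  have Xa: "Xa \<noteq> 0" using Q1_nz[OF q] by (simp add: Xa_def)
  have "Y = mexp q 2 (4 * m + 2) - 1"
    unfolding Y_def Q1_eq mero_shift_mexp_simps by (simp add: algebra_simps)
  hence Y: "Y \<noteq> 0" using mexp_1_nz(2)[OF q, of 2 "4 * m + 2"] by simp
  have u: "uf q = mexp q 0 1 + ?k * inverse Xa" unfolding uf_eq'[OF q] Xa_def ..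
  have v: "vm q m = mexp q 0 (-1) - ?k * inverse Y"
    unfolding vm_def vf_eq'[OF q] Y_def mero_shift_hom mero_shift_mexp_simps by simp
  have k: "mero_const (of_real (q - 1 / q)) = ?k"
    using mero_const_q[OF q] by (simp only: mero_const_diff of_real_diff)
  hence k': "mero_const (of_real q - 1 / of_real q) = ?k" by simp
  have *: "?k * (Y - Xa) * inverse Xa * inverse Y = uf q + vm q m - (mexp q 0 1 + mexp q 0 (- 1))"
  proof -
    have "(Y - Xa) * inverse Xa * inverse Y = inverse Xa - inverse Y"
      using Xa Y by (simp add: field_simps)
    hence "?k * (Y - Xa) * inverse Xa * inverse Y = ?k * (inverse Xa - inverse Y)"
      by (simp only: mult.assoc)
    thus ?thesis unfolding u v by (simp add: algebra_simps)
  qed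
  have "Act q (Ic q) v m = ?k * (Y - Xa) * inverse Xa * inverse Y * v m"
    by (simp add: Ic_def Act_simps k' mero_shift_hom) (simp add: Xa_def Y_def algebra_simps)
  thus ?thesis using * by simp
qed

lemma shift_Gc_m: assumes q: "0 < q" "q < 1"
  shows "mero_shift (2 * of_int m) (Gc q) = (mexp q 0 1 + mexp q 0 (-1) - vm q m) * vm q m"
proof -
  have "mero_shift (2 * of_int m) (Gc q) = um q m * vm q m"
    unfolding Gc_eq_uv[OF q] mero_shift_hom um_def vm_def ..
  thus ?thesis unfolding um_eq[OF q] .
qed

lemma Gc_u: assumes q: "0 < q" "q < 1"
  shows "Gc q = uf q * (mexp q 0 1 + mexp q 0 (-1) - uf q)"
  using uf_plus_vf[OF q] unfolding Gc_eq_uv[OF q] by (metis add_diff_cancel_left')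

lemma Act_rels:
  assumes q: "0 < q" "q < 1" and r: "r \<in> insert (qdet q - 1) (M2_rels q)"
  shows "Act q r v m = 0"
proof -
  let ?c = "mero_const (complex_of_real q)"
  let ?g = "mero_shift (2 * of_int m) (mero_shift (- 1) (Fc q))"
  have t: "rt q + 1 / rt q = mexp q 0 1 + mexp q 0 (-1)" by (simp only: ratoms(9,10)[OF q])
  have AD: "Act q (gn Al * gn De) v m = (1 + uf q * zc q m) * v m" for v
    unfolding rep_AD[OF q, symmetric] by (simp add: Act_simps mero_shift_hom mero_shift_shift)
  have DA: "Act q (gn De * gn Al) v m = (1 + vm q m * zc q m) * v m" for v
    unfolding rep_DA[OF q, symmetric] by (simp add: Act_simps mero_shift_hom mero_shift_shift)
  have GB: "Act q (gn Ga * gn Be) v m = zc q m * v m" for v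
    by (simp add: Act_simps mero_shift_hom mero_shift_shift)
  have BG: "Act q (gn Be * gn Ga) v m = (uf q + vm q m - (mexp q 0 1 + mexp q 0 (-1)) + uf q * vm q m * zc q m) * v m" for v
    unfolding rep_BG[OF q, unfolded t, symmetric] by (simp add: Act_simps mero_shift_hom mero_shift_shift)
  have lamA: "Act q (lam f * x) v m = f * Act q x v m"
    and muA: "Act q (mu f * x) v m = mero_shift (2 * of_int m) f * Act q x v m"
    and scA: "Act q (scal c * x) v m = mero_const c * Act q x v m"
    and HcA: "Act q (Hc q * x) v m = (uf q - vm q m) * Act q x v m"
    and IcA: "Act q (Ic q * x) v m = (uf q + vm q m - (mexp q 0 1 + mexp q 0 (- 1))) * Act q x v m" for f x c
    by (simp_all only: Act_mult Act_gn act.simps Act_scal Act_Hc[OF q] Act_Ic[OF q])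
  note A = lamA muA scA HcA IcA AD DA GB BG
  have uF: "?c * (Fc q * y) = uf q * y" for y by (simp add: uf_def)
  \<comment> \<open>The coefficient q F(mu - 1) in two of the relations is the inverse of v(mu), so
    it is removed by exhibiting a factor \<open>vm q m\<close>.\<close>
  have cancel: "?c * (?g * y) = y'" if "y = vm q m * y'" for y y'
    using shift_uf_m[OF q, of m] that by (simp add: mult_ac)
  from r show ?thesis
  proof (elim insertE)
    assume "r = qdet q - 1"
    thus ?thesis by (simp only: qdet_def Act_diff Act_1 mult.assoc A uF) (simp add: algebra_simps)
  next
    assume "r \<in> M2_rels q"
    thus ?thesis
    proof cases
      case Al_Be
      have "Act q (gn Al * gn Be) v m = alc q m * mero_shift (- 2) (v (m + 1))"
        by (simp add: Act_simps mero_shift_shift)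
      moreover have "Act q (gn Be * gn Al) v m = vm q m * (alc q m * mero_shift (- 2) (v (m + 1)))"
        by (simp add: Act_simps mero_shift_hom mero_shift_shift rep_BA[OF q])
      ultimately show ?thesis unfolding Al_Be mult.assoc Act_diff A using cancel by simp
    next
      case Al_Ga
      have "Act q (gn Al * gn Ga) v m = uf q * (zc q m * mero_shift 1 (alc q (m - 1))) * v (m - 1)"
        by (simp add: Act_simps mero_shift_hom mero_shift_shift rep_AG[OF q, symmetric])
      moreover have "Act q (gn Ga * gn Al) v m = (zc q m * mero_shift 1 (alc q (m - 1))) * v (m - 1)"
        by (simp add: Act_simps mero_shift_hom mero_shift_shift)
      ultimately show ?thesis unfolding Al_Ga mult.assoc Act_diff A uF by simp
    next
      case Be_De
      have "Act q (gn Be * gn De) v m = uf q * dec q m * v (m + 1)"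
        by (simp add: Act_simps mero_shift_hom mero_shift_shift rep_BD[OF q])
      moreover have "Act q (gn De * gn Be) v m = dec q m * v (m + 1)"
        by (simp add: Act_simps mero_shift_hom mero_shift_shift)
      ultimately show ?thesis unfolding Be_De mult.assoc Act_diff A uF by simp
    next
      case Ga_De
      have "Act q (gn Ga * gn De) v m = zc q m * mero_shift 1 (dec q (m - 1)) * mero_shift 2 (v (m - 1))"
        by (simp add: Act_simps mero_shift_hom mero_shift_shift)
      moreover have "Act q (gn De * gn Ga) v m = vm q m * (zc q m * mero_shift 1 (dec q (m - 1)) * mero_shift 2 (v (m - 1)))"
        by (simp add: Act_simps mero_shift_hom mero_shift_shift rep_GD[OF q, symmetric])
      ultimately show ?thesis unfolding Ga_De mult.assoc Act_diff A using cancel by (simp add: mult.assoc)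
    next
      case Al_De1
      show ?thesis unfolding Al_De1 mult.assoc Act_diff A by (simp add: algebra_simps)
    next
      case Al_De2
      show ?thesis unfolding Al_De2 mult.assoc Act_diff A shift_Gc_m[OF q] unfolding Gc_u[OF q] by (simp add: algebra_simps)
    next
      case Be_Ga1
      show ?thesis unfolding Be_Ga1 mult.assoc Act_diff A shift_Gc_m[OF q] unfolding Gc_u[OF q] by (simp add: algebra_simps)
    next
      case Be_Ga2
      show ?thesis unfolding Be_Ga2 mult.assoc Act_diff A shift_Gc_m[OF q] unfolding Gc_u[OF q] by (simp add: algebra_simps)
    qed (simp_all add: Act_simps mero_shift_hom mero_shift_shift, simp_all add: algebra_simps)
  qed
qed

lemma Act_SL2_ideal:
  assumes q: "0 < q" "q < 1" and x: "x \<in> SL2_ideal q"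
  shows "Act q x v m = 0"
proof -
  have [simp]: "act q g (\<lambda>m. 0) = (\<lambda>m. 0)" for g by (cases g) auto
  have [simp]: "actw q w (\<lambda>m. 0) m = 0" for w m
  proof -
    have "foldr (act q) ws (\<lambda>m. 0) = (\<lambda>m. 0)" for ws by (induction ws) auto
    thus ?thesis by (simp add: actw_def)
  qed
  have [simp]: "Act q x (\<lambda>m. 0) m = 0" for x m by (simp add: Act_def lext_def)
  have "SL2_ideal q \<subseteq> {x. \<forall>v m. Act q x v m = 0}"
  proof (rule SL2_ideal_minimal, goal_cases)
    case (3 x r)
    have "Act q x v = (\<lambda>m. 0)" for v using 3 by (simp add: fun_eq_iff)
    thus ?case by (simp add: Act_mult)
  next
    case 6
    show ?case by (simp only: mem_Collect_eq Act_rels[OF q insertI1]) simp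
  qed (auto simp: Act_diff Act_0 Act_mult Act_rels[OF q])
  thus ?thesis using x by blast
qed

text \<open>The critical factor is the constant q^{1-2m} + q^{2m-1}, a sum of two positive reals. So
  gamma acts at every level with a nonzero coefficient.\<close>

lemma zc_nz: assumes q: "0 < q" "q < 1" shows "zc q m \<noteq> 0"
proof -
  have "q powi (1 - 2 * m) + q powi (2 * m - 1) > 0"
    using q by (intro add_pos_pos) auto
  hence "mero_const (of_real (q powi (1 - 2 * m) + q powi (2 * m - 1))) \<noteq> mero_const 0"
    by (simp only: mero_const_inject of_real_eq_0_iff)
  hence "mexp q 0 (1 - 2 * m) + mexp q 0 (2 * m - 1) \<noteq> 0"
    using q by (simp add: mexp_const mero_const_add mero_const_0)
  thus ?thesis
    unfolding zc_def using q mexp_1_nz[OF q, of 2 4] mexp_1_nz[OF q, of 2 "4 * m"] by simp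
qed

lemma alc_nz: assumes q: "0 < q" "q < 1" shows "alc q m \<noteq> 0"
  unfolding alc_def using q mexp_1_nz[OF q, of 2 "4 * m"] by simp

lemma mero_shift_eq_0_iff [simp]: "mero_shift c f = 0 \<longleftrightarrow> f = 0"
  using mero_shift_shift[of "- c" c f] by auto

lemma Act_Al_power:
  assumes q: "0 < q" "q < 1"
  shows "\<exists>c. c \<noteq> 0 \<and> (\<forall>v. Act q (gn Al ^ b) v m = c * mero_shift (- of_nat b) (v m))"
proof (induction b)
  case 0
  show ?case by (intro exI[of _ 1]) (simp add: Act_1)
next
  case (Suc b)
  then obtain c where c: "c \<noteq> 0" "\<And>v. Act q (gn Al ^ b) v m = c * mero_shift (- of_nat b) (v m)" by blast
  show ?case
    using c alc_nz[OF q, of m]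
    by (intro exI[of _ "alc q m * mero_shift (- 1) c"]) (simp add: Act_mult Act_gn mero_shift_hom mero_shift_shift)
qed

lemma Act_Ga_power:
  assumes q: "0 < q" "q < 1"
  shows "\<exists>c. c \<noteq> 0 \<and> (\<forall>v. Act q (gn Ga ^ a) v m = c * mero_shift (of_nat a) (v (m - int a)))"
proof (induction a arbitrary: m)
  case 0
  show ?case by (intro exI[of _ 1]) (simp add: Act_1)
next
  case (Suc a)
  obtain c where c: "c \<noteq> 0" "\<And>v. Act q (gn Ga ^ a) v (m - 1) = c * mero_shift (of_nat a) (v (m - 1 - int a))"
    using Suc[of "m - 1"] by blast
  show ?case
    using c zc_nz[OF q, of m]
    by (intro exI[of _ "zc q m * mero_shift 1 c"]) (simp add: Act_mult Act_gn mero_shift_hom mero_shift_shift algebra_simps)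
qed

text \<open>gamma^a reads the component \<open>a\<close> levels below and alpha^b stays on its
  level, so level 0 of the result sees only the component at \<open>- a\<close>. For fixed a + b the
  products are therefore separated by functions supported on a single level.\<close>

lemma Act_Ga_Al:
  assumes q: "0 < q" "q < 1"
  obtains c where "c \<noteq> 0" "\<And>v. Act q (gn Ga ^ a * gn Al ^ b) v 0 = c * mero_shift (of_nat a - of_nat b) (v (- int a))"
proof -
  obtain c where c: "c \<noteq> 0" "\<And>v. Act q (gn Ga ^ a) v 0 = c * mero_shift (of_nat a) (v (- int a))"
    using Act_Ga_power[OF q, of a 0] by auto
  obtain d where d: "d \<noteq> 0" "\<And>v. Act q (gn Al ^ b) v (- int a) = d * mero_shift (- of_nat b) (v (- int a))"
    using Act_Al_power[OF q, of b "- int a"] by auto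
  show ?thesis
    by (rule that[of "c * mero_shift (of_nat a) d"])
      (use c d in \<open>simp_all add: Act_mult mero_shift_hom mero_shift_shift\<close>)
qed

section \<open>Elementary tensors\<close>

lemma poly_mapping_sum_single:
  "x = (\<Sum>w\<in>Poly_Mapping.keys x. Poly_Mapping.single w (Poly_Mapping.lookup x w))" for x :: "'w \<Rightarrow>\<^sub>0 complex"
proof (rule poly_mapping_eqI)
  fix k
  have "(\<Sum>w\<in>Poly_Mapping.keys x. Poly_Mapping.lookup (Poly_Mapping.single w (Poly_Mapping.lookup x w)) k)
     = (\<Sum>w\<in>Poly_Mapping.keys x. if w = k then Poly_Mapping.lookup x k else 0)"
    by (intro sum.cong) (auto simp: lookup_single when_def)
  also have "\<dots> = Poly_Mapping.lookup x k" by (auto simp: in_keys_iff)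
  finally show "Poly_Mapping.lookup x k = Poly_Mapping.lookup (\<Sum>w\<in>Poly_Mapping.keys x. Poly_Mapping.single w (Poly_Mapping.lookup x w)) k"
    by (simp add: lookup_sum)
qed

lemma tens_lext: "tens x y = lext (\<lambda>u c. lext (\<lambda>v d. Poly_Mapping.single (u, v) (c * d)) y) x"
  by (simp add: tens_def lext_def)

lemma tens_add_right: "tens x (y + y') = tens x y + tens x y'"
proof -
  have "lext (\<lambda>v d. Poly_Mapping.single (u, v) (c * d)) (y + y') =
      lext (\<lambda>v d. Poly_Mapping.single (u, v) (c * d)) y + lext (\<lambda>v d. Poly_Mapping.single (u, v) (c * d)) y'" for u :: gword and c
    by (rule lext_add) (simp add: single_add algebra_simps)
  thus ?thesis by (simp add: tens_lext) (simp add: lext_def sum.distrib)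
qed

lemma tens_add_left: "tens (x + x') y = tens x y + tens x' y"
  unfolding tens_lext
  by (rule lext_add) (simp add: lext_def single_add algebra_simps sum.distrib)

lemma tens_0 [simp]: "tens 0 y = 0" "tens x 0 = 0"
  by (simp_all add: tens_def)

lemma tens_uminus: "tens (- x) y = - tens x y" "tens x (- y) = - tens x y"
  using tens_add_left[of x "- x" y] tens_add_right[of x y "- y"]
  by (simp_all only: add.right_inverse tens_0 eq_neg_iff_add_eq_0 add.commute)

lemma tens_diff_left: "tens (x - x') y = tens x y - tens x' y"
  using tens_add_left[of x "- x'" y] by (simp add: tens_uminus)

lemma tens_diff_right: "tens x (y - y') = tens x y - tens x y'"
  using tens_add_right[of x y "- y'"] by (simp add: tens_uminus)

lemma tens_sum_left: "tens (sum f A) y = (\<Sum>i\<in>A. tens (f i) y)"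
  by (induction A rule: infinite_finite_induct) (auto simp: tens_add_left)

lemma tens_sum_right: "tens x (sum f A) = (\<Sum>i\<in>A. tens x (f i))"
  by (induction A rule: infinite_finite_induct) (auto simp: tens_add_right)

lemma tens_single: "tens (Poly_Mapping.single u c) (Poly_Mapping.single v d) = Poly_Mapping.single (u, v) (c * d)"
  by (auto simp: tens_def)

lemma tens_mult: "tens x y * tens x' y' = tens (x * x') (y * y')"
proof (induction x rule: poly_mapping_add_induct)
  case (single u c)
  show ?case
  proof (induction y rule: poly_mapping_add_induct)
    case (single v d)
    show ?case
    proof (induction x' rule: poly_mapping_add_induct)
      case (single u' c')
      show ?case
      proof (induction y' rule: poly_mapping_add_induct)
        case (single v' d')
        show ?case by (simp add: tens_single mult_single mult_ac)
      qed (simp add: tens_add_right distrib_left)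
    qed (simp add: tens_add_left distrib_left)
  qed (simp add: tens_add_right distrib_right)
qed (simp add: tens_add_left distrib_right)

lemma tens_1: "tens 1 1 = 1"
  using tens_single[of 0 1 0 1] by (simp add: zero_prod_def [symmetric])

lemma lookup_tens: "Poly_Mapping.lookup (tens x y) (u, v) = Poly_Mapping.lookup x u * Poly_Mapping.lookup y v"
proof (induction x rule: poly_mapping_add_induct)
  case (single u c)
  show ?case
    by (induction y rule: poly_mapping_add_induct)
      (auto simp: tens_single lookup_single when_def tens_add_right lookup_add algebra_simps)
qed (simp add: tens_add_left lookup_add algebra_simps)

lemma keys_tens: "Poly_Mapping.keys (tens x y) = Poly_Mapping.keys x \<times> Poly_Mapping.keys y"
  by (auto simp: in_keys_iff lookup_tens)

section \<open>Homogeneous components and homogeneity of the ideal of relations\<close>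

definition free_lcomp :: "int \<Rightarrow> free_alg set" where
  "free_lcomp a = {x. \<forall>w\<in>Poly_Mapping.keys x. ldeg w = a}"

lemma tens_matched: "x \<in> free_rcomp c \<Longrightarrow> y \<in> free_lcomp c \<Longrightarrow> tens x y \<in> matched"
  by (auto simp: matched_def keys_tens free_rcomp_def free_lcomp_def)

lemma free_comp_subset: "x \<in> free_comp a b \<Longrightarrow> x \<in> free_rcomp b" "x \<in> free_comp a b \<Longrightarrow> x \<in> free_lcomp a"
  by (auto simp: free_comp_def free_rcomp_def free_lcomp_def)

definition flt :: "('w \<Rightarrow> bool) \<Rightarrow> ('w \<Rightarrow>\<^sub>0 complex) \<Rightarrow> 'w \<Rightarrow>\<^sub>0 complex" where
  "flt P = lext (\<lambda>w c. if P w then Poly_Mapping.single w c else 0)"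

lemma flt_add: "flt P (x + y) = flt P x + flt P y"
  and flt_diff: "flt P (x - y) = flt P x - flt P y"
  and flt_single: "flt P (Poly_Mapping.single w c) = (if P w then Poly_Mapping.single w c else 0)"
  unfolding flt_def by ((subst lext_add lext_diff lext_single; simp add: single_add)+)

lemma lookup_flt: "Poly_Mapping.lookup (flt P x) w = (if P w then Poly_Mapping.lookup x w else 0)"
  by (induction x rule: poly_mapping_add_induct) (auto simp: flt_add flt_single lookup_add lookup_single when_def)

lemma flt_all: "(\<And>w. w \<in> Poly_Mapping.keys x \<Longrightarrow> P w) \<Longrightarrow> flt P x = x"
  by (rule poly_mapping_eqI) (auto simp: lookup_flt in_keys_iff)

lemma flt_none: "(\<And>w. w \<in> Poly_Mapping.keys x \<Longrightarrow> \<not> P w) \<Longrightarrow> flt P x = 0"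
  by (rule poly_mapping_eqI) (auto simp: lookup_flt in_keys_iff)

lemma keys_flt: "Poly_Mapping.keys (flt P x) = {w \<in> Poly_Mapping.keys x. P w}"
  by (auto simp: in_keys_iff lookup_flt split: if_splits)

definition hp :: "int \<Rightarrow> int \<Rightarrow> free_alg \<Rightarrow> free_alg" where
  "hp a b = flt (\<lambda>w. ldeg w = a \<and> rdeg w = b)"

lemma hp_in: "hp a b x \<in> free_comp a b"
  by (auto simp: hp_def free_comp_def keys_flt)

lemma hp_add: "hp a b (x + y) = hp a b x + hp a b y"
  by (simp add: hp_def flt_add)

lemma hp_mult_left: "hp a b (Poly_Mapping.single w c * x) = Poly_Mapping.single w c * hp (a - ldeg w) (b - rdeg w) x"
  by (induction x rule: poly_mapping_add_induct)
    (auto simp: hp_def mult_single flt_single ldeg_plus rdeg_plus distrib_left flt_add)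

lemma hp_mult_right: "hp a b (x * Poly_Mapping.single w c) = hp (a - ldeg w) (b - rdeg w) x * Poly_Mapping.single w c"
  by (induction x rule: poly_mapping_add_induct)
    (auto simp: hp_def mult_single flt_single ldeg_plus rdeg_plus distrib_right flt_add)

lemma free_comp_gn: "gn g \<in> free_comp (fst (gen_deg g)) (snd (gen_deg g))"
  by (auto simp: free_comp_def gn_def ldeg_def rdeg_def)

lemma free_comp_scal: "scal c \<in> free_comp 0 0"
  by (auto simp: free_comp_def scal_def ldeg_def rdeg_def zero_gword_def)

lemma free_comp_1: "1 \<in> free_comp 0 0"
  using free_comp_scal[of 1] by (simp add: scal_def)

lemma free_comp_0: "0 \<in> free_comp a b"
  by (auto simp: free_comp_def)

lemma free_comp_add: "x \<in> free_comp a b \<Longrightarrow> y \<in> free_comp a b \<Longrightarrow> x + y \<in> free_comp a b"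
  unfolding free_comp_def using Poly_Mapping.keys_add[of x y] by blast

lemma free_comp_diff: "x \<in> free_comp a b \<Longrightarrow> y \<in> free_comp a b \<Longrightarrow> x - y \<in> free_comp a b"
  unfolding free_comp_def using Poly_Mapping.keys_diff[of x y] by blast

lemma free_comp_mult:
  "x \<in> free_comp a b \<Longrightarrow> y \<in> free_comp a' b' \<Longrightarrow> a'' = a + a' \<Longrightarrow> b'' = b + b' \<Longrightarrow> x * y \<in> free_comp a'' b''"
  unfolding free_comp_def using keys_mult[of x y] by (force simp: ldeg_plus rdeg_plus)

lemma free_comp_mult_0: "x \<in> free_comp 0 0 \<Longrightarrow> y \<in> free_comp a b \<Longrightarrow> x * y \<in> free_comp a b"
  by (rule free_comp_mult) auto

lemma free_comp_gnI: "fst (gen_deg g) = a \<Longrightarrow> snd (gen_deg g) = b \<Longrightarrow> gn g \<in> free_comp a b"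
  using free_comp_gn[of g] by simp

lemma free_comp_gn_gn: "fst (gen_deg g) + fst (gen_deg g') = a \<Longrightarrow> snd (gen_deg g) + snd (gen_deg g') = b
    \<Longrightarrow> gn g * gn g' \<in> free_comp a b"
  by (rule free_comp_mult[OF free_comp_gn free_comp_gn]) auto

lemmas free_comp_intros = free_comp_diff free_comp_add free_comp_gn_gn free_comp_mult_0 free_comp_gnI
  free_comp_scal free_comp_1

lemma Hc_00: "Hc q \<in> free_comp 0 0"
  unfolding Hc_def mult.assoc by (intro free_comp_intros; simp)

lemma Ic_00: "Ic q \<in> free_comp 0 0"
  unfolding Ic_def mult.assoc by (intro free_comp_intros; simp)

lemma free_comp_gens:
  "gn Al \<in> free_comp 1 1" "gn Be \<in> free_comp 1 (- 1)" "gn Ga \<in> free_comp (- 1) 1" "gn De \<in> free_comp (- 1) (- 1)"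
  "lam f \<in> free_comp 0 0" "mu f \<in> free_comp 0 0"
  using free_comp_gn[of Al] free_comp_gn[of Be] free_comp_gn[of Ga] free_comp_gn[of De] free_comp_gn[of "Lam f"]
    free_comp_gn[of "Mu f"] by simp_all

lemma rels_homogeneous:
  assumes "r \<in> insert (qdet q - 1) (M2_rels q)"
  shows "\<exists>a b. r \<in> free_comp a b"
proof -
  note I = Hc_00 Ic_00 free_comp_intros
  \<comment> \<open>The bidegrees that occur are (0,0), those of the four generators, and those of
    the products in the four q-commutation relations; listing them makes the existential claim a
    finite check.\<close>
  have "r \<in> free_comp 0 0 \<or> r \<in> free_comp 1 1 \<or> r \<in> free_comp 1 (- 1) \<or> r \<in> free_comp (- 1) 1
      \<or> r \<in> free_comp (- 1) (- 1) \<or> r \<in> free_comp 2 0 \<or> r \<in> free_comp 0 2 \<or> r \<in> free_comp 0 (- 2) \<or> r \<in> free_comp (- 2) 0"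
    using assms
  proof (elim insertE)
    assume r: "r = qdet q - 1"
    have "r \<in> free_comp 0 0" unfolding r qdet_def mult.assoc by (intro I; simp)
    thus ?thesis by blast
  next
    assume "r \<in> M2_rels q"
    thus ?thesis
    proof cases
      case lam_Al
      have "r \<in> free_comp 1 1" unfolding lam_Al mult.assoc by (intro I; simp)
      thus ?thesis by blast
    next
      case mu_Al
      have "r \<in> free_comp 1 1" unfolding mu_Al mult.assoc by (intro I; simp)
      thus ?thesis by blast
    next
      case lam_Be
      have "r \<in> free_comp 1 (- 1)" unfolding lam_Be mult.assoc by (intro I; simp)
      thus ?thesis by blast
    next
      case mu_Be
      have "r \<in> free_comp 1 (- 1)" unfolding mu_Be mult.assoc by (intro I; simp)
      thus ?thesis by blast
    next
      case lam_Ga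
      have "r \<in> free_comp (- 1) 1" unfolding lam_Ga mult.assoc by (intro I; simp)
      thus ?thesis by blast
    next
      case mu_Ga
      have "r \<in> free_comp (- 1) 1" unfolding mu_Ga mult.assoc by (intro I; simp)
      thus ?thesis by blast
    next
      case lam_De
      have "r \<in> free_comp (- 1) (- 1)" unfolding lam_De mult.assoc by (intro I; simp)
      thus ?thesis by blast
    next
      case mu_De
      have "r \<in> free_comp (- 1) (- 1)" unfolding mu_De mult.assoc by (intro I; simp)
      thus ?thesis by blast
    next
      case Al_Be
      have "r \<in> free_comp 2 0" unfolding Al_Be mult.assoc by (intro I; simp)
      thus ?thesis by blast
    next
      case Al_Ga
      have "r \<in> free_comp 0 2" unfolding Al_Ga mult.assoc by (intro I; simp)
      thus ?thesis by blast
    next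
      case Be_De
      have "r \<in> free_comp 0 (- 2)" unfolding Be_De mult.assoc by (intro I; simp)
      thus ?thesis by blast
    next
      case Ga_De
      have "r \<in> free_comp (- 2) 0" unfolding Ga_De mult.assoc by (intro I; simp)
      thus ?thesis by blast
    qed (intro disjI1, simp only: mult.assoc, intro I; simp)+
  qed
  thus ?thesis by blast
qed

lemma hp_homogeneous: "x \<in> free_comp a' b' \<Longrightarrow> hp a b x = (if a = a' \<and> b = b' then x else 0)"
  unfolding hp_def free_comp_def by (auto intro!: flt_all flt_none)

text \<open>A homogeneous generator multiplied by monomials stays homogeneous, so the ideal contains
  the components of each of its elements. This makes A graded and allows components of arbitrary
  representatives to be taken.\<close>

lemma hp_SL2_ideal:
  assumes "x \<in> SL2_ideal q" shows "hp a b x \<in> SL2_ideal q"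
proof -
  have "SL2_ideal q \<subseteq> {x. \<forall>a b. hp a b x \<in> SL2_ideal q}"
  proof (rule SL2_ideal_minimal, goal_cases)
    case 1 thus ?case using hp_homogeneous[OF free_comp_0[of 0 0]] by (auto simp: SL2_ideal_0)
  next
    case (2 x y) thus ?case by (auto simp: hp_def flt_diff SL2_ideal_diff)
  next
    case (3 x r)
    show ?case
      by (induction r rule: poly_mapping_add_induct)
        (use 3 in \<open>auto simp: hp_mult_left distrib_right hp_add intro!: SL2_ideal_mult_left SL2_ideal_add\<close>)
  next
    case (4 x r)
    show ?case
      by (induction r rule: poly_mapping_add_induct)
        (use 4 in \<open>auto simp: hp_mult_right distrib_left hp_add intro!: SL2_ideal_mult_right SL2_ideal_add\<close>)
  next
    case (5 r)
    then obtain a b where "r \<in> free_comp a b" using rels_homogeneous by blast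
    thus ?case using 5 SL2_ideal_gens by (auto simp: hp_homogeneous SL2_ideal_0)
  next
    case 6
    obtain a b where "qdet q - 1 \<in> free_comp a b" using rels_homogeneous by blast
    thus ?case using SL2_ideal_gens by (auto simp: hp_homogeneous SL2_ideal_0)
  qed
  thus ?thesis using assms by blast
qed

lemma flt_rdeg_sum: "flt (\<lambda>w. rdeg w = c) x = (\<Sum>a\<in>ldeg ` Poly_Mapping.keys x. hp a c x)"
proof (rule poly_mapping_eqI)
  fix w
  have "(\<Sum>a\<in>ldeg ` Poly_Mapping.keys x. if ldeg w = a \<and> rdeg w = c then Poly_Mapping.lookup x w else 0)
     = (\<Sum>a\<in>ldeg ` Poly_Mapping.keys x. if a = ldeg w then (if rdeg w = c then Poly_Mapping.lookup x w else 0) else 0)"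
    by (intro sum.cong) auto
  also have "\<dots> = (if rdeg w = c then Poly_Mapping.lookup x w else 0)"
    by (auto simp: in_keys_iff)
  finally show "Poly_Mapping.lookup (flt (\<lambda>w. rdeg w = c) x) w = Poly_Mapping.lookup (\<Sum>a\<in>ldeg ` Poly_Mapping.keys x. hp a c x) w"
    by (simp add: lookup_sum hp_def lookup_flt)
qed

lemma flt_ldeg_sum: "flt (\<lambda>w. ldeg w = c) x = (\<Sum>b\<in>rdeg ` Poly_Mapping.keys x. hp c b x)"
proof (rule poly_mapping_eqI)
  fix w
  have "(\<Sum>a\<in>rdeg ` Poly_Mapping.keys x. if ldeg w = c \<and> rdeg w = a then Poly_Mapping.lookup x w else 0)
     = (\<Sum>a\<in>rdeg ` Poly_Mapping.keys x. if a = rdeg w then (if ldeg w = c then Poly_Mapping.lookup x w else 0) else 0)"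
    by (intro sum.cong) auto
  also have "\<dots> = (if ldeg w = c then Poly_Mapping.lookup x w else 0)"
    by (auto simp: in_keys_iff)
  finally show "Poly_Mapping.lookup (flt (\<lambda>w. ldeg w = c) x) w = Poly_Mapping.lookup (\<Sum>b\<in>rdeg ` Poly_Mapping.keys x. hp c b x) w"
    by (simp add: lookup_sum hp_def lookup_flt)
qed

lemma rcomp_sum: "x \<in> free_rcomp c \<Longrightarrow> x = (\<Sum>a\<in>ldeg ` Poly_Mapping.keys x. hp a c x)"
  using flt_all[of x "\<lambda>w. rdeg w = c"] by (simp add: free_rcomp_def flt_rdeg_sum)

lemma lcomp_sum: "x \<in> free_lcomp c \<Longrightarrow> x = (\<Sum>b\<in>rdeg ` Poly_Mapping.keys x. hp c b x)"
  using flt_all[of x "\<lambda>w. ldeg w = c"] by (simp add: free_lcomp_def flt_ldeg_sum)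

section \<open>The ideal defining the tensor square of A\<close>

lemma tensor_rels_matched: "tensor_rels q \<subseteq> matched"
proof
  fix p assume "p \<in> tensor_rels q"
  thus "p \<in> matched"
  proof cases
    case (balance x a c y b f)
    have "mu f * x \<in> free_comp a c" "lam f * y \<in> free_comp c b"
      by (rule free_comp_mult[OF free_comp_gens(6)] free_comp_mult[OF free_comp_gens(5)]; use balance in simp)+
    thus ?thesis unfolding balance using balance
      by (intro matched_diff tens_matched) (auto dest: free_comp_subset)
  qed (auto intro: tens_matched free_comp_subset)
qed

lemma ideal_tensor_ideal: "ideal (tensor_ideal q) matched_ring"
  unfolding tensor_ideal_def
  by (rule ring.genideal_ideal[OF ring_matched_ring]) (simp add: carrier_matched_ring tensor_rels_matched)

lemma
  shows tensor_ideal_0: "0 \<in> tensor_ideal q"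
    and tensor_ideal_add: "x \<in> tensor_ideal q \<Longrightarrow> y \<in> tensor_ideal q \<Longrightarrow> x + y \<in> tensor_ideal q"
    and tensor_ideal_uminus: "x \<in> tensor_ideal q \<Longrightarrow> - x \<in> tensor_ideal q"
    and tensor_ideal_mult_left: "x \<in> tensor_ideal q \<Longrightarrow> r \<in> matched \<Longrightarrow> r * x \<in> tensor_ideal q"
    and tensor_ideal_mult_right: "x \<in> tensor_ideal q \<Longrightarrow> r \<in> matched \<Longrightarrow> x * r \<in> tensor_ideal q"
proof -
  interpret ideal "tensor_ideal q" matched_ring by (rule ideal_tensor_ideal)
  show "0 \<in> tensor_ideal q" using additive_subgroup.zero_closed[OF additive_subgroup_axioms] by simp
  show "x \<in> tensor_ideal q \<Longrightarrow> y \<in> tensor_ideal q \<Longrightarrow> x + y \<in> tensor_ideal q"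
    using additive_subgroup.a_closed[OF additive_subgroup_axioms] by simp
  show l: "x \<in> tensor_ideal q \<Longrightarrow> r \<in> matched \<Longrightarrow> r * x \<in> tensor_ideal q" for r
    using I_l_closed[of x r] by (simp add: carrier_matched_ring)
  show "x \<in> tensor_ideal q \<Longrightarrow> r \<in> matched \<Longrightarrow> x * r \<in> tensor_ideal q"
    using I_r_closed[of x r] by (simp add: carrier_matched_ring)
  show "x \<in> tensor_ideal q \<Longrightarrow> - x \<in> tensor_ideal q" using l[of "- 1"] matched_uminus[OF matched_1] by simp
qed

lemma tensor_ideal_diff: "x \<in> tensor_ideal q \<Longrightarrow> y \<in> tensor_ideal q \<Longrightarrow> x - y \<in> tensor_ideal q"
  using tensor_ideal_add[of x q "- y"] tensor_ideal_uminus[of y q] by simp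

lemma tensor_ideal_sum: "(\<And>i. i \<in> A \<Longrightarrow> f i \<in> tensor_ideal q) \<Longrightarrow> sum f A \<in> tensor_ideal q"
  by (induction A rule: infinite_finite_induct) (auto intro: tensor_ideal_0 tensor_ideal_add)

lemma tensor_ideal_gens: "tensor_rels q \<subseteq> tensor_ideal q"
  unfolding tensor_ideal_def
  by (rule ring.genideal_self[OF ring_matched_ring]) (simp add: carrier_matched_ring tensor_rels_matched)

lemma tensor_ideal_minimal:
  assumes "0 \<in> I" "\<And>x y. x \<in> I \<Longrightarrow> y \<in> I \<Longrightarrow> x - y \<in> I" "I \<subseteq> matched"
    "\<And>x r. x \<in> I \<Longrightarrow> r \<in> matched \<Longrightarrow> r * x \<in> I" "\<And>x r. x \<in> I \<Longrightarrow> r \<in> matched \<Longrightarrow> x * r \<in> I"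
    "tensor_rels q \<subseteq> I"
  shows "tensor_ideal q \<subseteq> I"
  unfolding tensor_ideal_def
proof (rule ring.genideal_minimal[OF ring_matched_ring])
  have um: "- x \<in> I" if "x \<in> I" for x
    using assms(2)[OF assms(1) that] by simp
  have ad: "x + y \<in> I" if "x \<in> I" "y \<in> I" for x y
    using assms(2)[OF that(1) um[OF that(2)]] by simp
  show "ideal I matched_ring"
  proof (rule idealI[OF ring_matched_ring])
    interpret R: ring matched_ring by (rule ring_matched_ring)
    show "subgroup I (add_monoid matched_ring)"
    proof (rule R.add.subgroupI)
      fix a assume "a \<in> I"
      thus "\<ominus>\<^bsub>matched_ring\<^esub> a \<in> I" using um[of a] assms(3) by auto
    qed (use assms ad in \<open>auto simp: carrier_matched_ring\<close>)
  qed (use assms in \<open>auto simp: carrier_matched_ring\<close>)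
qed (use assms in auto)

lemma mem_tensor_cls: "z \<in> tensor_cls q x \<longleftrightarrow> z - x \<in> tensor_ideal q"
  by (auto simp: tensor_cls_def a_r_coset_def' intro!: bexI[of _ "z - x"])

lemma tensor_cls_eq_iff: "tensor_cls q x = tensor_cls q y \<longleftrightarrow> x - y \<in> tensor_ideal q"
proof
  assume "tensor_cls q x = tensor_cls q y"
  hence "x \<in> tensor_cls q y" by (metis mem_tensor_cls diff_self tensor_ideal_0)
  thus "x - y \<in> tensor_ideal q" by (simp add: mem_tensor_cls)
next
  assume *: "x - y \<in> tensor_ideal q"
  show "tensor_cls q x = tensor_cls q y"
  proof (rule Set.set_eqI)
    fix z show "z \<in> tensor_cls q x \<longleftrightarrow> z \<in> tensor_cls q y"
      using tensor_ideal_add[OF _ *, of "z - x"] tensor_ideal_diff[OF _ *, of "z - y"] by (auto simp: mem_tensor_cls)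
  qed
qed

lemma carrier_SL2_tensor: "carrier (SL2_tensor q) = tensor_cls q ` matched"
  by (auto simp: SL2_tensor_def FactRing_def A_RCOSETS_def' tensor_cls_def carrier_matched_ring)

lemma ring_SL2_tensor: "ring (SL2_tensor q)"
  unfolding SL2_tensor_def by (rule ideal.quotient_is_ring[OF ideal_tensor_ideal])

lemma tensor_cls_hom:
  "x \<in> matched \<Longrightarrow> y \<in> matched \<Longrightarrow> tensor_cls q x \<otimes>\<^bsub>SL2_tensor q\<^esub> tensor_cls q y = tensor_cls q (x * y)"
  "x \<in> matched \<Longrightarrow> y \<in> matched \<Longrightarrow> tensor_cls q x \<oplus>\<^bsub>SL2_tensor q\<^esub> tensor_cls q y = tensor_cls q (x + y)"
  "\<one>\<^bsub>SL2_tensor q\<^esub> = tensor_cls q 1"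
  using ideal.rcos_ring_hom[OF ideal_tensor_ideal[of q]]
  by (auto simp: ring_hom_def tensor_cls_def SL2_tensor_def carrier_matched_ring)

lemma tensor_cls_0: "\<zero>\<^bsub>SL2_tensor q\<^esub> = tensor_cls q 0"
  by (auto simp: SL2_tensor_def FactRing_def mem_tensor_cls)

text \<open>The generators of the tensor ideal are bihomogeneous in each factor, but only the inner
  degree \<open>c\<close> matters: splitting both factors along their outer degrees leaves a finite
  sum of generators.\<close>

lemma tens_left_ideal:
  assumes "r \<in> SL2_ideal q" "r \<in> free_rcomp c" "y \<in> free_lcomp c"
  shows "tens r y \<in> tensor_ideal q"
proof -
  have "tens (hp a c r) (hp c b y) \<in> tensor_ideal q" for a b
    using tensor_ideal_gens hp_in hp_SL2_ideal[OF assms(1)] by (blast intro: tensor_rels.left)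
  hence "tens (\<Sum>a\<in>ldeg ` Poly_Mapping.keys r. hp a c r) (\<Sum>b\<in>rdeg ` Poly_Mapping.keys y. hp c b y) \<in> tensor_ideal q"
    unfolding tens_sum_left tens_sum_right by (intro tensor_ideal_sum) auto
  thus ?thesis using rcomp_sum[OF assms(2)] lcomp_sum[OF assms(3)] by simp
qed

lemma tens_right_ideal:
  assumes "r \<in> SL2_ideal q" "r \<in> free_lcomp c" "x \<in> free_rcomp c"
  shows "tens x r \<in> tensor_ideal q"
proof -
  have "tens (hp a c x) (hp c b r) \<in> tensor_ideal q" for a b
    using tensor_ideal_gens hp_in hp_SL2_ideal[OF assms(1)] by (blast intro: tensor_rels.right)
  hence "tens (\<Sum>a\<in>ldeg ` Poly_Mapping.keys x. hp a c x) (\<Sum>b\<in>rdeg ` Poly_Mapping.keys r. hp c b r) \<in> tensor_ideal q"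
    unfolding tens_sum_left tens_sum_right by (intro tensor_ideal_sum) auto
  thus ?thesis using rcomp_sum[OF assms(3)] lcomp_sum[OF assms(2)] by simp
qed

lemma tens_balance:
  assumes "x \<in> free_rcomp c" "y \<in> free_lcomp c"
  shows "tens (mu f * x) y - tens x (lam f * y) \<in> tensor_ideal q"
proof -
  have *: "tens (mu f * hp a c x) (hp c b y) - tens (hp a c x) (lam f * hp c b y) \<in> tensor_ideal q" for a b
    using tensor_ideal_gens hp_in by (blast intro: tensor_rels.balance)
  have "tens (mu f * (\<Sum>a\<in>ldeg ` Poly_Mapping.keys x. hp a c x)) (\<Sum>b\<in>rdeg ` Poly_Mapping.keys y. hp c b y)
     - tens (\<Sum>a\<in>ldeg ` Poly_Mapping.keys x. hp a c x) (lam f * (\<Sum>b\<in>rdeg ` Poly_Mapping.keys y. hp c b y)) \<in> tensor_ideal q"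
    unfolding sum_distrib_left tens_sum_left tens_sum_right sum_subtractf[symmetric] by (intro tensor_ideal_sum *)
  thus ?thesis using rcomp_sum[OF assms(1)] lcomp_sum[OF assms(2)] by simp
qed

lemma flt_rdeg_ideal: "x \<in> SL2_ideal q \<Longrightarrow> flt (\<lambda>w. rdeg w = c) x \<in> SL2_ideal q"
  unfolding flt_rdeg_sum by (intro SL2_ideal_sum hp_SL2_ideal)

lemma flt_ldeg_ideal: "x \<in> SL2_ideal q \<Longrightarrow> flt (\<lambda>w. ldeg w = c) x \<in> SL2_ideal q"
  unfolding flt_ldeg_sum by (intro SL2_ideal_sum hp_SL2_ideal)

text \<open>Admissible representatives can be replaced by their components of inner degree
  \<open>c\<close> at the price of elements of the ideal; hence the union in the definition of
  \<open>tensor\<close> is a single coset.\<close>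

lemma tensor_eq:
  assumes x: "x \<in> free_rcomp c" and y: "y \<in> free_lcomp c"
  shows "tensor q (cls q x) (cls q y) = tensor_cls q (tens x y)"
proof -
  have "tensor_cls q (tens x' y') = tensor_cls q (tens x y)"
    if x': "x' \<in> cls q x" and y': "y' \<in> cls q y" and m: "tens x' y' \<in> matched" for x' y'
  proof -
    define xc where "xc = flt (\<lambda>w. rdeg w = c) x'"
    define yc where "yc = flt (\<lambda>w. ldeg w = c) y'"
    have fx: "flt (\<lambda>w. rdeg w = d) x = (if d = c then x else 0)" for d
      using x by (auto intro!: flt_all flt_none simp: free_rcomp_def)
    have fy: "flt (\<lambda>w. ldeg w = d) y = (if d = c then y else 0)" for d
      using y by (auto intro!: flt_all flt_none simp: free_lcomp_def)
    have Jx: "flt (\<lambda>w. rdeg w = d) x' - flt (\<lambda>w. rdeg w = d) x \<in> SL2_ideal q" for d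
      using flt_rdeg_ideal x' by (simp add: mem_cls flip: flt_diff)
    have Jy: "flt (\<lambda>w. ldeg w = d) y' - flt (\<lambda>w. ldeg w = d) y \<in> SL2_ideal q" for d
      using flt_ldeg_ideal y' by (simp add: mem_cls flip: flt_diff)
    have xc: "xc \<in> free_rcomp c" "xc - x \<in> SL2_ideal q"
      using Jx[of c] by (auto simp: xc_def free_rcomp_def keys_flt fx)
    have yc: "yc \<in> free_lcomp c" "yc - y \<in> SL2_ideal q"
      using Jy[of c] by (auto simp: yc_def free_lcomp_def keys_flt fy)
    have xcx: "xc - x \<in> free_rcomp c"
      using xc(1) x Poly_Mapping.keys_diff[of xc x] by (fastforce simp: free_rcomp_def)
    have ycy: "yc - y \<in> free_lcomp c"
      using yc(1) y Poly_Mapping.keys_diff[of yc y] by (fastforce simp: free_lcomp_def)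
    have "tens xc yc - tens x y = tens (xc - x) yc + tens x (yc - y)"
      by (simp add: tens_diff_left tens_diff_right)
    also have "\<dots> \<in> tensor_ideal q"
      by (intro tensor_ideal_add tens_left_ideal[OF xc(2) xcx yc(1)] tens_right_ideal[OF yc(2) ycy x])
    finally have 1: "tens xc yc - tens x y \<in> tensor_ideal q" .
    have 2: "tens x' y' - tens xc yc \<in> tensor_ideal q"
    proof (cases "x' = 0 \<or> y' = 0")
      case True
      hence "xc = 0 \<or> yc = 0" by (auto simp: xc_def yc_def intro!: flt_none)
      thus ?thesis using True by (auto simp: tensor_ideal_0)
    next
      case False
      then obtain u v where u: "u \<in> Poly_Mapping.keys x'" and v: "v \<in> Poly_Mapping.keys y'" by (auto simp flip: keys_eq_empty)
      \<comment> \<open>When both factors are nonzero, matching forces one common right degree on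
        the left factor, equal to the left degree of the whole right factor.\<close>
      have d: "rdeg u' = rdeg u \<and> ldeg v' = rdeg u" if "u' \<in> Poly_Mapping.keys x'" "v' \<in> Poly_Mapping.keys y'" for u' v'
      proof -
        have m': "rdeg a = ldeg b" if "a \<in> Poly_Mapping.keys x'" "b \<in> Poly_Mapping.keys y'" for a b
          using m that by (auto simp: matched_def keys_tens)
        show ?thesis using m'[OF that(1) v] m'[OF u v] m'[OF u that(2)] by simp
      qed
      have x'd: "flt (\<lambda>w. rdeg w = rdeg u) x' = x'" using d v by (intro flt_all) blast
      show ?thesis
      proof (cases "rdeg u = c")
        case True
        have "xc = x'" using x'd True by (simp add: xc_def)
        moreover have "yc = y'" unfolding yc_def using d u True by (intro flt_all) blast
        ultimately show ?thesis by (simp add: tensor_ideal_0)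
      next
        \<comment> \<open>If the common degree is not \<open>c\<close>, then \<open>x'\<close>
          coincides with its part of that degree, which modulo the ideal agrees with the
          corresponding part of \<open>x\<close>, and that part is 0.\<close>
        case F: False
        have "xc = 0" unfolding xc_def using d[OF _ v] F by (intro flt_none) auto
        moreover have "x' \<in> SL2_ideal q" using Jx[of "rdeg u"] F by (simp add: fx x'd)
        moreover have "x' \<in> free_rcomp (rdeg u)" "y' \<in> free_lcomp (rdeg u)"
          using d u v unfolding free_rcomp_def free_lcomp_def by blast+
        ultimately show ?thesis using tens_left_ideal by auto
      qed
    qed
    show ?thesis using tensor_ideal_add[OF 1 2] by (simp add: tensor_cls_eq_iff)
  qed
  moreover have "x \<in> cls q x" "y \<in> cls q y" by (simp_all add: mem_cls SL2_ideal_0)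
  ultimately show ?thesis
    unfolding tensor_def carrier_matched_ring using tens_matched[OF x y] by blast
qed

section \<open>Independence of the right tensor factors\<close>

lemma scal_commute: "scal c * x = x * scal c" for x :: "'a::monoid_add \<Rightarrow>\<^sub>0 complex"
proof (induction x rule: poly_mapping_add_induct)
  case (single w d)
  show ?case by (simp add: scal_def mult_single mult.commute)
qed (simp add: distrib_left distrib_right)

lemma scal_swap: "(scal d * x) * (scal c * y) = scal c * scal d * (x * y)" for x :: "'a::monoid_add \<Rightarrow>\<^sub>0 complex"
proof -
  have "(scal d * x) * (scal c * y) = ((scal d * x) * scal c) * y" by (simp only: mult.assoc)
  also have "(scal d * x) * scal c = scal c * (scal d * x)" by (rule scal_commute[symmetric])
  finally show ?thesis by (simp only: mult.assoc)
qed

lemma scal_mult: "scal c * scal d = scal (c * d)"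
  and scal_add: "scal (c + d) = scal c + scal d"
  and scal_1: "scal 1 = 1" and scal_0: "scal 0 = 0"
  by (simp_all add: scal_def mult_single single_add)

lemma single_scal: "Poly_Mapping.single u c = scal c * Poly_Mapping.single u 1" for u :: "'a::monoid_add"
  by (simp add: scal_def mult_single)

lemma cls_mult_cong: "cls q x = cls q x' \<Longrightarrow> cls q y = cls q y' \<Longrightarrow> cls q (x * y) = cls q (x' * y')"
  and cls_add_cong: "cls q x = cls q x' \<Longrightarrow> cls q y = cls q y' \<Longrightarrow> cls q (x + y) = cls q (x' + y')"
  by (simp_all flip: cls_hom)

lemma cls_rel: "x - y \<in> M2_rels q \<Longrightarrow> cls q x = cls q y"
  using SL2_ideal_gens by (auto simp: cls_eq_iff)

lemmas cls_M2 = M2_rels.intros[THEN cls_rel]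

lemma cls_mu_0: "cls q (mu 0) = cls q 0"
  using cls_M2(6)[of q 0] by (simp add: mero_const_0 scal_0)

lemma cls_mu_gn: "cls q (mu f * gn g) = cls q (gn g * mu (mero_shift (of_int (snd (gen_deg g))) f))"
proof (cases g)
  case (Lam h) thus ?thesis using cls_M2(7)[of q h f] by simp
next
  case (Mu h) thus ?thesis using cls_M2(5)[of q f h] cls_M2(5)[of q h f] by (simp add: mult.commute)
qed (use cls_M2(9,11,13,15)[of q f] in simp_all)

lemma cls_lam_gn: "cls q (lam f * gn g) = cls q (gn g * lam (mero_shift (of_int (fst (gen_deg g))) f))"
proof (cases g)
  case (Mu h) thus ?thesis using cls_M2(7)[of q f h] by simp
next
  case (Lam h) thus ?thesis using cls_M2(2)[of q f h] cls_M2(2)[of q h f] by (simp add: mult.commute)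
qed (use cls_M2(8,10,12,14)[of q f] in simp_all)

lemma single_Cons: "Poly_Mapping.single (GWord (g # gs)) 1 = gn g * Poly_Mapping.single (GWord gs) 1"
  by (simp add: gn_def mult_single plus_gword_def)

lemma cls_mu_single:
  "cls q (mu f * Poly_Mapping.single u 1) = cls q (Poly_Mapping.single u 1 * mu (mero_shift (of_int (rdeg u)) f))"
proof (cases u)
  case (GWord gs)
  have "cls q (mu f * Poly_Mapping.single (GWord gs) 1) =
    cls q (Poly_Mapping.single (GWord gs) 1 * mu (mero_shift (of_int (rdeg (GWord gs))) f))"
  proof (induction gs arbitrary: f)
    case Nil
    have "Poly_Mapping.single (GWord []) 1 = (1 :: free_alg)" by (simp flip: zero_gword_def)
    thus ?case by (simp add: rdeg_def)
  next
    case (Cons g gs)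
    let ?s = "Poly_Mapping.single (GWord gs) (1 :: complex)"
    have "cls q (mu f * (gn g * ?s)) = cls q (gn g * (mu (mero_shift (of_int (snd (gen_deg g))) f) * ?s))"
      using cls_mult_cong[OF cls_mu_gn[of q f g] refl[of "cls q ?s"]] by (simp add: mult.assoc)
    also have "\<dots> = cls q (gn g * (?s * mu (mero_shift (of_int (rdeg (GWord gs))) (mero_shift (of_int (snd (gen_deg g))) f))))"
      by (intro cls_mult_cong refl Cons.IH)
    finally show ?case
      by (simp add: single_Cons mero_shift_shift mult.assoc rdeg_def add.commute)
  qed
  thus ?thesis by (simp add: GWord)
qed

text \<open>The right factor acts on \<open>v\<close>, and the resulting function of $\lambda$ is moved across the tensor
  sign, where it becomes a function of $\mu$.\<close>

definition Phi :: "real \<Rightarrow> (int \<Rightarrow> mero) \<Rightarrow> int \<Rightarrow> free_alg2 \<Rightarrow> free_alg" where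
  "Phi q v m = lext (\<lambda>(u, w) c. scal c * (mu (actw q w v m) * Poly_Mapping.single u 1))"

lemma Phi_additive:
  "(case k of (u, w) \<Rightarrow> \<lambda>c. scal c * (mu (actw q w v m) * Poly_Mapping.single u 1)) (c + d) =
   (case k of (u, w) \<Rightarrow> \<lambda>c. scal c * (mu (actw q w v m) * Poly_Mapping.single u 1)) c +
   (case k of (u, w) \<Rightarrow> \<lambda>c. scal c * (mu (actw q w v m) * Poly_Mapping.single u 1)) d"
  by (cases k) (simp add: scal_add distrib_right)

lemmas Phi_add = lext_add[of "\<lambda>(u, w) c. scal c * (mu (actw q w v m) * Poly_Mapping.single u 1)", OF Phi_additive,
    folded Phi_def] for q v m
lemmas Phi_diff = lext_diff[of "\<lambda>(u, w) c. scal c * (mu (actw q w v m) * Poly_Mapping.single u 1)", OF Phi_additive,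
    folded Phi_def] for q v m
lemmas Phi_sum = lext_sum[of "\<lambda>(u, w) c. scal c * (mu (actw q w v m) * Poly_Mapping.single u 1)", OF Phi_additive,
    folded Phi_def] for q v m

lemma Phi_0: "Phi q v m 0 = 0"
  by (simp add: Phi_def lext_def)

lemma Phi_single: "Phi q v m (Poly_Mapping.single (u, w) c) = scal c * (mu (actw q w v m) * Poly_Mapping.single u 1)"
  unfolding Phi_def
  using lext_single[of "\<lambda>(u, w) c. scal c * (mu (actw q w v m) * Poly_Mapping.single u 1)", OF Phi_additive, of "(u, w)" c]
  by simp

lemma cls_mu_scal: "cls q (mu (mero_const c * f)) = cls q (scal c * mu f)"
  using cls_mult_cong[OF cls_M2(6)[of q c] refl[of "cls q (mu f)"]] cls_M2(5)[of q "mero_const c" f] by simp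

lemma Phi_tens: "cls q (Phi q v m (tens x y)) = cls q (mu (Act q y v m) * x)"
proof (induction y rule: poly_mapping_add_induct)
  case (single w d)
  show ?case
  proof (induction x rule: poly_mapping_add_induct)
    case (single u c)
    let ?a = "actw q w v m" and ?u = "Poly_Mapping.single u (1 :: complex)"
    have "cls q (mu (mero_const d * ?a) * Poly_Mapping.single u c) = cls q ((scal d * mu ?a) * (scal c * ?u))"
      by (intro cls_mult_cong cls_mu_scal) (simp add: single_scal[of u c])
    also have "(scal d * mu ?a) * (scal c * ?u) = scal c * scal d * (mu ?a * ?u)"
      by (rule scal_swap)
    finally show ?case by (simp add: tens_single Phi_single Act_single scal_mult)
  next
    case (add x y)
    show ?case unfolding tens_add_left Phi_add distrib_left by (rule cls_add_cong[OF add])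
  qed
next
  case (add y z)
  have "cls q (mu (Act q (y + z) v m) * x) = cls q ((mu (Act q y v m) + mu (Act q z v m)) * x)"
    unfolding Act_add by (intro cls_mult_cong cls_M2 refl)
  moreover have "cls q (Phi q v m (tens x (y + z))) = cls q (mu (Act q y v m) * x + mu (Act q z v m) * x)"
    unfolding tens_add_right Phi_add by (rule cls_add_cong[OF add])
  ultimately show ?case by (simp add: distrib_right)
qed

lemma act_weight:
  "\<exists>c s. \<forall>f. act q g f m = c * mero_shift (- of_int (fst (gen_deg g))) (f (m + s))"
proof (cases g)
  case (Lam h) thus ?thesis by (intro exI[of _ h] exI[of _ 0]) auto
next
  case (Mu h) thus ?thesis by (intro exI[of _ "mero_shift (2 * of_int m) h"] exI[of _ 0]) auto
next
  case Al thus ?thesis by (intro exI[of _ "alc q m"] exI[of _ 0]) auto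
next
  case Be thus ?thesis by (intro exI[of _ 1] exI[of _ 1]) auto
next
  case Ga thus ?thesis by (intro exI[of _ "zc q m"] exI[of _ "- 1"]) auto
next
  case De thus ?thesis by (intro exI[of _ "dec q m"] exI[of _ 0]) auto
qed

lemma actw_weight:
  "\<exists>c s. \<forall>f. actw q w f m = c * mero_shift (- of_int (ldeg w)) (f (m + s))"
proof -
  have "\<exists>c s. \<forall>f. foldr (act q) gs f m = c * mero_shift (- of_int (ldeg (GWord gs))) (f (m + s))" for gs
  proof (induction gs arbitrary: m)
    case Nil
    show ?case by (intro exI[of _ 1] exI[of _ 0]) (simp add: ldeg_def)
  next
    case (Cons g gs)
    obtain c s where 1: "\<And>f. act q g f m = c * mero_shift (- of_int (fst (gen_deg g))) (f (m + s))"
      using act_weight[of q g m] by blast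
    obtain c' s' where 2: "\<And>f. foldr (act q) gs f (m + s) = c' * mero_shift (- of_int (ldeg (GWord gs))) (f (m + s + s'))"
      using Cons[of "m + s"] by blast
    have "foldr (act q) (g # gs) f m = (c * mero_shift (- of_int (fst (gen_deg g))) c') *
        mero_shift (- of_int (ldeg (GWord (g # gs)))) (f (m + (s + s')))" for f
      by (simp add: 1 2 mero_shift_hom mero_shift_shift ldeg_def algebra_simps)
    thus ?case by blast
  qed
  thus ?thesis by (cases w) (auto simp: actw_def)
qed

text \<open>Letting \<open>w'\<close> act shifts the function by \<open>- ldeg w'\<close>; moving
  it, now as a function of mu, to the right of \<open>u'\<close> shifts it by
  \<open>rdeg u'\<close>. For matched words the shifts cancel, and what remains is a left
  multiplication in A together with a change of level from \<open>m\<close> to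
  \<open>m + s\<close>.\<close>

lemma Phi_mult_left:
  assumes "rdeg u' = ldeg w'"
  shows "\<exists>c s. \<forall>v p. cls q (Phi q v m (Poly_Mapping.single (u', w') e * p)) =
    cls q (scal e * (mu c * Poly_Mapping.single u' 1) * Phi q v (m + s) p)"
proof -
  obtain c s where cs: "\<And>f. actw q w' f m = c * mero_shift (- of_int (ldeg w')) (f (m + s))"
    using actw_weight[of q w' m] by blast
  let ?u' = "Poly_Mapping.single u' (1 :: complex)"
  have "cls q (Phi q v m (Poly_Mapping.single (u', w') e * p)) =
    cls q (scal e * (mu c * ?u') * Phi q v (m + s) p)" for v p
  proof (induction p rule: poly_mapping_add_induct)
    case (single k d)
    obtain u w where k: "k = (u, w)" by (cases k)
    let ?a = "actw q w v (m + s)" and ?u = "Poly_Mapping.single u (1 :: complex)"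
    have uu: "Poly_Mapping.single (u' + u) 1 = ?u' * ?u" by (simp add: mult_single)
    have "cls q (Phi q v m (Poly_Mapping.single (u', w') e * Poly_Mapping.single k d)) =
      cls q (scal (e * d) * (mu (c * mero_shift (- of_int (ldeg w')) ?a) * (?u' * ?u)))"
      unfolding k mult_single plus_prod_def fst_conv snd_conv Phi_single actw_plus cs uu ..
    also have "\<dots> = cls q (scal (e * d) * (mu c * (mu (mero_shift (- of_int (ldeg w')) ?a) * ?u') * ?u))"
    proof -
      have "cls q (mu (c * mero_shift (- of_int (ldeg w')) ?a) * (?u' * ?u)) =
         cls q (mu c * mu (mero_shift (- of_int (ldeg w')) ?a) * (?u' * ?u))"
        by (intro cls_mult_cong refl cls_M2)
      hence "cls q (mu (c * mero_shift (- of_int (ldeg w')) ?a) * (?u' * ?u)) =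
         cls q (mu c * (mu (mero_shift (- of_int (ldeg w')) ?a) * ?u') * ?u)" by (simp only: mult.assoc)
      thus ?thesis by (rule cls_mult_cong[OF refl])
    qed
    also have "\<dots> = cls q (scal (e * d) * (mu c * (?u' * mu (mero_shift (of_int (rdeg u')) (mero_shift (- of_int (ldeg w')) ?a))) * ?u))"
      by (intro cls_mult_cong refl cls_mu_single)
    also have "mero_shift (of_int (rdeg u')) (mero_shift (- of_int (ldeg w')) ?a) = ?a"
      using assms by (simp add: mero_shift_shift)
    also have "scal (e * d) * (mu c * (?u' * mu ?a) * ?u) = scal e * (mu c * ?u') * (scal d * (mu ?a * ?u))"
    proof -
      have "scal e * (mu c * ?u') * (scal d * (mu ?a * ?u)) = scal e * ((mu c * ?u') * scal d) * (mu ?a * ?u)"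
        by (simp only: mult.assoc)
      also have "(mu c * ?u') * scal d = scal d * (mu c * ?u')" by (rule scal_commute[symmetric])
      also have "scal e * (scal d * (mu c * ?u')) * (mu ?a * ?u) = scal (e * d) * (mu c * (?u' * mu ?a) * ?u)"
        by (simp only: scal_mult[symmetric] mult.assoc)
      finally show ?thesis ..
    qed
    finally show ?case by (simp add: k Phi_single)
  next
    case (add x y)
    show ?case unfolding distrib_left Phi_add by (rule cls_add_cong[OF add])
  qed
  thus ?thesis by blast
qed

lemma Phi_mult_right:
  "Phi q v m (p * Poly_Mapping.single (u', w') e) = Phi q (actw q w' v) m p * (scal e * Poly_Mapping.single u' 1)"
proof (induction p rule: poly_mapping_add_induct)
  case (single k d)
  obtain u w where k: "k = (u, w)" by (cases k)
  have uu: "Poly_Mapping.single (u + u') 1 = Poly_Mapping.single u (1 :: complex) * Poly_Mapping.single u' 1" by (simp add: mult_single)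
  have uu': "Poly_Mapping.single (u + u') (1 * 1) = Poly_Mapping.single u (1 :: complex) * Poly_Mapping.single u' 1" by (simp only: mult_single)
  let ?a = "mu (actw q w (actw q w' v) m) * Poly_Mapping.single u 1" and ?u' = "Poly_Mapping.single u' (1 :: complex)"
  have "scal d * ?a * (scal e * ?u') = scal (d * e) * (?a * ?u')"
    unfolding scal_swap by (simp add: scal_mult mult.commute)
  thus ?case
    unfolding k mult_single plus_prod_def fst_conv snd_conv Phi_single actw_plus uu by (simp only: mult.assoc uu')
qed (simp add: distrib_right Phi_add)

lemma Phi_tensor_ideal:
  assumes q: "0 < q" "q < 1" and p: "p \<in> tensor_ideal q"
  shows "Phi q v m p \<in> SL2_ideal q"
proof -
  have mem: "x \<in> SL2_ideal q \<longleftrightarrow> cls q x = cls q 0" for x by (simp add: cls_eq_iff)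
  have sum_single: "r = (\<Sum>k\<in>Poly_Mapping.keys r. Poly_Mapping.single (fst k, snd k) (Poly_Mapping.lookup r k))" for r :: free_alg2
    using poly_mapping_sum_single[of r] by simp
  \<comment> \<open>All \<open>v\<close> and \<open>m\<close> have to be treated together: left
    multiplication changes the level \<open>m\<close>, and right multiplication replaces
    \<open>v\<close> by its image under the right word.\<close>
  have "tensor_ideal q \<subseteq> {p \<in> matched. \<forall>v m. Phi q v m p \<in> SL2_ideal q}"
  proof (rule tensor_ideal_minimal, goal_cases)
    case 1 thus ?case by (simp add: matched_0 Phi_0 SL2_ideal_0)
  next
    case (2 x y) thus ?case by (simp add: matched_diff Phi_diff SL2_ideal_diff)
  next
    case (4 x r)
    have "Phi q v m (r * x) \<in> SL2_ideal q" for v m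
    proof -
      have *: "Phi q v m (Poly_Mapping.single (fst k, snd k) e * x) \<in> SL2_ideal q" if "k \<in> Poly_Mapping.keys r" for k e
      proof -
        have "rdeg (fst k) = ldeg (snd k)" using 4 that by (auto simp: matched_def split: prod.splits)
        then obtain c s where "cls q (Phi q v m (Poly_Mapping.single (fst k, snd k) e * x)) =
            cls q (scal e * (mu c * Poly_Mapping.single (fst k) 1) * Phi q v (m + s) x)"
          using Phi_mult_left[of "fst k" "snd k" q m e] by blast
        moreover have "scal e * (mu c * Poly_Mapping.single (fst k) 1) * Phi q v (m + s) x \<in> SL2_ideal q"
          using 4 by (intro SL2_ideal_mult_left) auto
        ultimately show ?thesis by (simp add: mem)
      qed
      show ?thesis by (subst sum_single[of r]) (simp only: sum_distrib_right Phi_sum, intro SL2_ideal_sum *)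
    qed
    thus ?case using 4 matched_mult by auto
  next
    case (5 x r)
    have "Phi q v m (x * r) \<in> SL2_ideal q" for v m
    proof -
      have *: "Phi q v m (x * Poly_Mapping.single (fst k, snd k) e) \<in> SL2_ideal q" for k e
        unfolding Phi_mult_right using 5 by (intro SL2_ideal_mult_right) auto
      show ?thesis by (subst sum_single[of r]) (simp only: sum_distrib_left Phi_sum, intro SL2_ideal_sum *)
    qed
    thus ?case using 5 matched_mult by auto
  next
    case 6
    have "Phi q v m p \<in> SL2_ideal q" if "p \<in> tensor_rels q" for v m p
      using that
    proof cases
      case (left r a c y b)
      show ?thesis unfolding left mem Phi_tens using SL2_ideal_mult_left[OF left(2)] by (simp add: mem)
    next
      case (right x a c r b)
      have "cls q (mu 0 * x) = cls q (0 * x)" by (intro cls_mult_cong cls_mu_0 refl)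
      thus ?thesis unfolding right mem Phi_tens Act_SL2_ideal[OF q right(3)] by simp
    next
      case (balance x a c y b f)
      have "cls q (Phi q v m (tens x (lam f * y))) = cls q (mu (Act q y v m * f) * x)"
        unfolding Phi_tens by (simp add: Act_mult Act_gn mult.commute)
      also have "\<dots> = cls q (mu (Act q y v m) * mu f * x)"
        by (intro cls_mult_cong refl cls_M2)
      also have "\<dots> = cls q (Phi q v m (tens (mu f * x) y))"
        unfolding Phi_tens by (simp add: mult.assoc)
      finally show ?thesis unfolding balance Phi_diff cls_eq_iff[symmetric] by (rule sym)
    qed
    thus ?case using tensor_rels_matched by blast
  qed auto
  thus ?thesis using p by blast
qed

lemma tens_Ga_Al_unique:
  assumes q: "0 < q" "q < 1" and *: "(\<Sum>j\<le>N. tens (x j) (gn Ga ^ (N - j) * gn Al ^ j)) \<in> tensor_ideal q" and i: "i \<le> N"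
  shows "x i \<in> SL2_ideal q"
proof -
  \<comment> \<open>The indicator of the one level that gamma^(N-i) reads from level 0; it
    annihilates every other summand.\<close>
  define v :: "int \<Rightarrow> mero" where "v m = (if m = - int (N - i) then 1 else 0)" for m
  define a where "a j = Act q (gn Ga ^ (N - j) * gn Al ^ j) v 0" for j
  have a0: "a j = 0" if "j \<noteq> i" "j \<le> N" for j
  proof -
    obtain c where "Act q (gn Ga ^ (N - j) * gn Al ^ j) v 0 = c * mero_shift (of_nat (N - j) - of_nat j) (v (- int (N - j)))"
      using Act_Ga_Al[OF q, of "N - j" j] by metis
    thus ?thesis using that i by (simp add: a_def v_def)
  qed
  have ai: "a i \<noteq> 0"
  proof -
    obtain c where "c \<noteq> 0" "Act q (gn Ga ^ (N - i) * gn Al ^ i) v 0 = c * mero_shift (of_nat (N - i) - of_nat i) (v (- int (N - i)))"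
      using Act_Ga_Al[OF q, of "N - i" i] by metis
    thus ?thesis by (simp add: a_def v_def)
  qed
  have mu0: "mu 0 * y \<in> SL2_ideal q" for y
    using cls_mult_cong[OF cls_mu_0[of q] refl[of "cls q y"]] by (simp add: cls_eq_iff)
  have "Phi q v 0 (tens (x i) (gn Ga ^ (N - i) * gn Al ^ i)) =
      Phi q v 0 (\<Sum>j\<le>N. tens (x j) (gn Ga ^ (N - j) * gn Al ^ j)) - (\<Sum>j\<in>{..N} - {i}. Phi q v 0 (tens (x j) (gn Ga ^ (N - j) * gn Al ^ j)))"
    unfolding Phi_sum using i by (subst sum.remove[of "{..N}" i]) auto
  also have "\<dots> \<in> SL2_ideal q"
  proof (intro SL2_ideal_diff SL2_ideal_sum Phi_tensor_ideal[OF q *])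
    fix j assume "j \<in> {..N} - {i}"
    hence "a j = 0" using a0 by simp
    hence "cls q (Phi q v 0 (tens (x j) (gn Ga ^ (N - j) * gn Al ^ j))) = cls q (mu 0 * x j)"
      unfolding Phi_tens a_def by simp
    thus "Phi q v 0 (tens (x j) (gn Ga ^ (N - j) * gn Al ^ j)) \<in> SL2_ideal q"
      using mu0[of "x j"] by (metis cls_eq_iff diff_0_right)
  qed
  finally have "mu (a i) * x i \<in> SL2_ideal q"
    using Phi_tens[of q v 0 "x i" "gn Ga ^ (N - i) * gn Al ^ i"] by (metis a_def cls_eq_iff diff_0_right)
  \<comment> \<open>\<open>a i\<close> is a nonzero element of the field M, so it can be divided out
    as a function of mu.\<close>
  hence "mu (inverse (a i)) * (mu (a i) * x i) \<in> SL2_ideal q" by (rule SL2_ideal_mult_left)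
  moreover have "cls q (mu (inverse (a i)) * mu (a i)) = cls q 1"
    using cls_M2(5)[of q "inverse (a i)" "a i"] cls_M2(6)[of q 1] ai by (simp add: mero_const_1 scal_1)
  hence "cls q (mu (inverse (a i)) * mu (a i) * x i) = cls q (1 * x i)"
    by (intro cls_mult_cong refl)
  ultimately show ?thesis
    by (simp add: mult.assoc) (metis cls_eq_iff diff_0_right)
qed

section \<open>The coproduct on the free algebra\<close>

lemma free_coprod_lext: "free_coprod x = lext (\<lambda>w c. scal c * prod_list (map gen_coprod (letters w))) x"
  by (simp add: free_coprod_def lext_def)

lemma free_coprod_add: "free_coprod (x + y) = free_coprod x + free_coprod y"
  and free_coprod_diff: "free_coprod (x - y) = free_coprod x - free_coprod y"
  and free_coprod_single: "free_coprod (Poly_Mapping.single w c) = scal c * prod_list (map gen_coprod (letters w))"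
  and free_coprod_0: "free_coprod 0 = 0"
  unfolding free_coprod_lext
  by ((subst lext_add lext_diff lext_single)?; simp add: lext_def scal_add distrib_right)+

lemma free_coprod_mult: "free_coprod (x * y) = free_coprod x * free_coprod y"
proof (induction x rule: poly_mapping_add_induct)
  case (single w c)
  show ?case
  proof (induction y rule: poly_mapping_add_induct)
    case (single w' d)
    show ?case
    proof -
      let ?p = "\<lambda>w. prod_list (map gen_coprod (letters w))"
      have "scal c * ?p w * (scal d * ?p w') = scal (c * d) * (?p w * ?p w')"
        unfolding scal_swap by (simp add: scal_mult mult.commute)
      thus ?thesis
        by (simp add: mult_single free_coprod_single plus_gword_def)
    qed
  qed (simp add: distrib_left free_coprod_add)
qed (simp add: distrib_right free_coprod_add)

lemma free_coprod_gn: "free_coprod (gn g) = gen_coprod g"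
  by (simp add: gn_def free_coprod_single scal_1)

lemma free_coprod_scal: "free_coprod (scal c) = scal c"
  using free_coprod_single[of 0 c] by (simp add: scal_def zero_gword_def)

lemma free_coprod_1: "free_coprod 1 = 1"
  using free_coprod_scal[of 1] by (simp add: scal_1)

lemma scal_matched: "scal c \<in> matched"
  by (simp add: matched_def scal_def zero_prod_def zero_gword_def rdeg_def ldeg_def)

lemma gen_coprod_matched: "gen_coprod g \<in> matched"
proof -
  have "tens (gn a) (gn b) \<in> matched" if "snd (gen_deg a) = fst (gen_deg b)" for a b
    by (rule tens_matched[of _ "snd (gen_deg a)"]) (use free_comp_gn[of a] free_comp_gn[of b] that in \<open>auto dest: free_comp_subset\<close>)
  moreover have "tens (gn (Lam f)) 1 \<in> matched" "tens 1 (gn (Mu f)) \<in> matched" for f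
    by (rule tens_matched[of _ 0]; use free_comp_gens(5,6)[of f] free_comp_1 in \<open>auto dest: free_comp_subset\<close>)+
  ultimately show ?thesis by (cases g) (auto intro!: matched_add)
qed

lemma free_coprod_matched: "free_coprod x \<in> matched"
proof (induction x rule: poly_mapping_add_induct)
  case (single w c)
  have "prod_list (map gen_coprod gs) \<in> matched" for gs
    by (induction gs) (auto intro: matched_1 matched_mult gen_coprod_matched)
  thus ?case by (simp add: free_coprod_single matched_mult scal_matched)
qed (simp add: free_coprod_add matched_add)

section \<open>The coproduct\<close>

abbreviation good :: "real \<Rightarrow> bool" where "good q \<equiv> 0 < q \<and> q < 1"

lemma cls_uminus_cong: "cls q x = cls q x' \<Longrightarrow> cls q (- x) = cls q (- x')"
  using cls_mult_cong[of q "- 1" "- 1" x x'] by simp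

lemma cls_diff_cong: "cls q x = cls q x' \<Longrightarrow> cls q y = cls q y' \<Longrightarrow> cls q (x - y) = cls q (x' - y')"
  using cls_add_cong[of q x x' "- y" "- y'"] cls_uminus_cong[of q y y'] by simp

text \<open>Families indexed by all \<open>0 < q < 1\<close> turn the carrier-based ring \<open>SL2 q\<close> into an instance of
  the class \<open>ring_1\<close>.\<close>

quotient_type sl2 = "real \<Rightarrow> free_alg" / "\<lambda>x y. \<forall>q. good q \<longrightarrow> cls q (x q) = cls q (y q)"
  by (auto intro!: equivpI simp: reflp_def symp_def transp_def)

instantiation sl2 :: ring_1
begin

lift_definition zero_sl2 :: sl2 is "\<lambda>_. 0" .
lift_definition one_sl2 :: sl2 is "\<lambda>_. 1" .
lift_definition plus_sl2 :: "sl2 \<Rightarrow> sl2 \<Rightarrow> sl2" is "\<lambda>x y q. x q + y q"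
  by (rule cls_add_cong; blast)
lift_definition minus_sl2 :: "sl2 \<Rightarrow> sl2 \<Rightarrow> sl2" is "\<lambda>x y q. x q - y q"
  by (rule cls_diff_cong; blast)
lift_definition uminus_sl2 :: "sl2 \<Rightarrow> sl2" is "\<lambda>x q. - x q"
  by (rule cls_uminus_cong; blast)
lift_definition times_sl2 :: "sl2 \<Rightarrow> sl2 \<Rightarrow> sl2" is "\<lambda>x y q. x q * y q"
  by (rule cls_mult_cong; blast)

instance
proof
  show "(0 :: sl2) \<noteq> 1"
  proof transfer
    \<comment> \<open>One nontrivial fibre suffices. In it 1 acts as the identity of the
      representation, while elements of the ideal act as 0.\<close>
    have "1 \<notin> SL2_ideal (1 / 2)"
      using Act_SL2_ideal[of "1 / 2" 1 "\<lambda>_. 1" 0] by (auto simp: Act_1)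
    hence "cls (1 / 2) 0 \<noteq> cls (1 / 2) 1"
      by (metis cls_eq_iff diff_0_right)
    thus "\<not> (\<forall>q. good q \<longrightarrow> cls q 0 = cls q 1)" by (auto intro!: exI[of _ "1 / 2"])
  qed
qed (transfer; simp add: algebra_simps)+

end

text \<open>Passage back to the ring at one \<open>q\<close>. Outside 0 < q < 1 the representatives
  of a family are arbitrary, so a dummy value keeps the map well defined.\<close>

lift_definition ev :: "real \<Rightarrow> sl2 \<Rightarrow> free_alg set" is "\<lambda>q x. if good q then cls q (x q) else {}"
  by auto

lemma sl2_eqI: "(\<And>q. good q \<Longrightarrow> ev q x = ev q y) \<Longrightarrow> x = y"
  by transfer (auto split: if_splits)

lemma ev_hom:
  assumes "good q"
  shows "ev q (x + y) = ev q x \<oplus>\<^bsub>SL2 q\<^esub> ev q y" "ev q (x * y) = ev q x \<otimes>\<^bsub>SL2 q\<^esub> ev q y"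
    "ev q 1 = \<one>\<^bsub>SL2 q\<^esub>" "ev q 0 = \<zero>\<^bsub>SL2 q\<^esub>" "ev q x \<in> carrier (SL2 q)"
  using assms by (transfer; simp add: cls_hom cls_0)+

lift_definition lm :: "(real \<Rightarrow> mero) \<Rightarrow> sl2" is "\<lambda>f q. lam (f q)" .
lift_definition mm :: "(real \<Rightarrow> mero) \<Rightarrow> sl2" is "\<lambda>f q. mu (f q)" .
lift_definition sc :: "(real \<Rightarrow> complex) \<Rightarrow> sl2" is "\<lambda>c q. scal (c q)" .
lift_definition gs :: "gen \<Rightarrow> sl2" is "\<lambda>g q. gn g" .

abbreviation "al \<equiv> gs Al"
abbreviation "be \<equiv> gs Be"
abbreviation "ga \<equiv> gs Ga"
abbreviation "de \<equiv> gs De"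

definition kappa :: "real \<Rightarrow> complex" where "kappa q = of_real (q + 1 / q)"

text \<open>Common interface for functions of lambda and functions of mu. It is instantiated in A,
  in the tensor square, and in the commutative subalgebra generated by functions and gamma beta, so
  that the computations with G, H, I are made once. Agreement of functions is asked for 0 < q < 1
  only, to fit the quotient of families.\<close>

locale mero_hom =
  fixes l :: "(real \<Rightarrow> mero) \<Rightarrow> 'a::ring_1" and s :: "(real \<Rightarrow> complex) \<Rightarrow> 'a"
  assumes add: "l (\<lambda>q. f q + g q) = l f + l g"
    and mult: "l (\<lambda>q. f q * g q) = l f * l g"
    and const: "l (\<lambda>q. mero_const (c q)) = s c"
    and s1: "s (\<lambda>_. 1) = 1"
    and cong: "(\<And>q. good q \<Longrightarrow> f q = g q) \<Longrightarrow> l f = l g"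
begin

lemma one: "l (\<lambda>_. 1) = 1"
  using const[of "\<lambda>_. 1"] by (simp add: mero_const_1 s1)

lemma zero: "l (\<lambda>_. 0) = 0"
  using add[of "\<lambda>_. 0" "\<lambda>_. 0"] by simp

lemma uminus: "l (\<lambda>q. - f q) = - l f"
  using add[of f "\<lambda>q. - f q"] by (simp add: zero minus_unique)

lemma diff: "l (\<lambda>q. f q - g q) = l f - l g"
  using add[of f "\<lambda>q. - g q"] by (simp add: uminus)

lemma commute: "l f * l g = l g * l f"
  by (simp flip: mult add: mult.commute)

lemma inverse: "(\<And>q. good q \<Longrightarrow> f q \<noteq> 0) \<Longrightarrow> l f * l (\<lambda>q. inverse (f q)) = 1"
  "(\<And>q. good q \<Longrightarrow> f q \<noteq> 0) \<Longrightarrow> l (\<lambda>q. inverse (f q)) * l f = 1"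
  unfolding mult[symmetric] one[symmetric] by (rule cong; simp)+

lemma vf: "l vf = s kappa - l uf"
  using const[of kappa] diff[of "\<lambda>q. mero_const (kappa q)" uf]
  by (simp add: vf_def[abs_def] kappa_def)

lemma Gc: "l Gc = l uf * l vf"
  unfolding mult[symmetric] by (rule cong) (simp add: Gc_eq_uv)

lemma uf': "l uf = s (\<lambda>q. of_real q) + s (\<lambda>q. of_real (q - 1 / q)) * l (\<lambda>q. inverse (Q1 q - 1))"
  unfolding const[symmetric] mult[symmetric] add[symmetric]
proof (rule cong)
  fix q :: real assume q: "good q"
  show "uf q = mero_const (of_real q) + mero_const (of_real (q - 1 / q)) * inverse (Q1 q - 1)"
    unfolding of_real_diff mero_const_diff mero_const_q[OF conjunct1[OF q] conjunct2[OF q]] using q by (intro uf_eq') auto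
qed

lemma Q1: "l Q1 * l (\<lambda>q. inverse (Q1 q - 1)) = 1 + l (\<lambda>q. inverse (Q1 q - 1))"
  unfolding one[symmetric] add[symmetric] mult[symmetric]
proof (rule cong)
  fix q :: real assume q: "good q"
  have "Q1 q - 1 \<noteq> 0" using q by (intro Q1_nz) auto
  thus "Q1 q * inverse (Q1 q - 1) = 1 + inverse (Q1 q - 1)" by (simp add: field_simps)
qed

end

locale mero_hom2 = L: mero_hom l s + M: mero_hom m s
  for l m :: "(real \<Rightarrow> mero) \<Rightarrow> 'a::ring_1" and s +
  assumes comm: "l f * m g = m g * l f"
begin

abbreviation "kap \<equiv> s kappa"
abbreviation "Hx \<equiv> s (\<lambda>q. of_real (q - 1 / q)) * (l Q1 * m Q1 - 1) * l (\<lambda>q. inverse (Q1 q - 1)) * m (\<lambda>q. inverse (Q1 q - 1))"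
abbreviation "Ix \<equiv> s (\<lambda>q. of_real (q - 1 / q)) * (m Q1 - l Q1) * l (\<lambda>q. inverse (Q1 q - 1)) * m (\<lambda>q. inverse (Q1 q - 1))"

lemma s_comm: "s c * l f = l f * s c" "s c * m f = m f * s c"
  unfolding L.const[symmetric] by (rule L.commute) (simp add: L.const flip: M.const, rule M.commute)

lemma kap_split: "kap = s (\<lambda>q. of_real q) + (s (\<lambda>q. of_real q) - s (\<lambda>q. of_real (q - 1 / q)))"
  unfolding L.const[symmetric] L.diff[symmetric] L.add[symmetric]
  by (rule L.cong) (simp add: kappa_def flip: mero_const_add mero_const_diff)

text \<open>The partial fractions of H once more, with \<open>Q1\<close> expressing (X + 1)/X = 1 +
  1/X for X = q^{2(x+1)} - 1, so that only inverses of functions of one variable occur.\<close>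

lemma Hx_eq: "Hx = l uf - m vf"
proof -
  let ?k = "s (\<lambda>q. of_real (q - 1 / q))" and ?x = "l (\<lambda>q. inverse (Q1 q - 1))" and ?y = "m (\<lambda>q. inverse (Q1 q - 1))"
  have "(l Q1 * m Q1 - 1) * ?x * ?y = (l Q1 * ?x) * (m Q1 * ?y) - ?x * ?y"
    using comm[of "\<lambda>q. inverse (Q1 q - 1)" Q1] by (simp add: left_diff_distrib mult.assoc) (simp flip: mult.assoc)
  also have "\<dots> = 1 + ?x + ?y" unfolding L.Q1 M.Q1 by (simp add: algebra_simps)
  finally have "Hx = ?k * (1 + ?x + ?y)" by (simp only: mult.assoc)
  also have "\<dots> = l uf - m vf"
    unfolding M.vf L.uf' M.uf' kap_split by (simp add: algebra_simps)
  finally show ?thesis .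
qed

lemma Ix_eq: "Ix = l uf + m vf - kap"
proof -
  let ?k = "s (\<lambda>q. of_real (q - 1 / q))" and ?x = "l (\<lambda>q. inverse (Q1 q - 1))" and ?y = "m (\<lambda>q. inverse (Q1 q - 1))"
  have "(m Q1 - l Q1) * ?x * ?y = ?x * (m Q1 * ?y) - (l Q1 * ?x) * ?y"
    using comm[of "\<lambda>q. inverse (Q1 q - 1)" Q1] by (simp add: left_diff_distrib mult.assoc) (simp flip: mult.assoc)
  also have "\<dots> = ?x - ?y" unfolding L.Q1 M.Q1 by (simp add: algebra_simps)
  finally have "Ix = ?k * (?x - ?y)" by (simp only: mult.assoc)
  also have "\<dots> = l uf + m vf - kap"
    unfolding M.vf L.uf' M.uf' kap_split by (simp add: algebra_simps)
  finally show ?thesis .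
qed

end

interpretation A: mero_hom2 lm mm sc
proof unfold_locales
  show "lm (\<lambda>q. f q + g q) = lm f + lm g" "mm (\<lambda>q. f q + g q) = mm f + mm g"
    "lm (\<lambda>q. f q * g q) = lm f * lm g" "mm (\<lambda>q. f q * g q) = mm f * mm g"
    "lm f * mm g = mm g * lm f" "sc (\<lambda>_. 1) = 1"
    "lm (\<lambda>q. mero_const (c q)) = sc c" "mm (\<lambda>q. mero_const (c q)) = sc c" for f g c
    by (transfer; simp add: cls_M2 scal_1)+
qed (transfer; simp)+

section \<open>The defining relations of A in terms of u and v\<close>

lemma sc_commute: "sc c * x = x * sc c"
  by transfer (simp add: scal_commute)

lemma shift_gs:
  "lm f * gs g = gs g * lm (\<lambda>q. mero_shift (of_int (fst (gen_deg g))) (f q))"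
  "mm f * gs g = gs g * mm (\<lambda>q. mero_shift (of_int (snd (gen_deg g))) (f q))"
  by (transfer; simp add: cls_lam_gn cls_mu_gn)+

abbreviation "UL \<equiv> lm uf"
abbreviation "VM \<equiv> mm vf"
abbreviation "KA \<equiv> sc kappa"

lemma mm_inverse_vf: "sc (\<lambda>q. of_real q) * mm (\<lambda>q. mero_shift (- 1) (Fc q)) = mm (\<lambda>q. inverse (vf q))"
  unfolding A.M.const[symmetric] A.M.mult[symmetric] by (rule A.M.cong) (simp add: shift_Fc)

lemma lm_uf: "sc (\<lambda>q. of_real q) * lm Fc = UL"
  unfolding A.L.const[symmetric] A.L.mult[symmetric] by (rule A.L.cong) (simp add: uf_def)

lemma VM_inv: "VM * mm (\<lambda>q. inverse (vf q)) = 1"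
  by (rule A.M.inverse) (simp add: vf_nz)

lemma sl2_qcomm:
  "VM * al * be = be * al" "al * ga = UL * ga * al" "be * de = UL * de * be" "VM * ga * de = de * ga"
proof -
  have "al * be = sc (\<lambda>q. of_real q) * mm (\<lambda>q. mero_shift (- 1) (Fc q)) * be * al"
    "ga * de = sc (\<lambda>q. of_real q) * mm (\<lambda>q. mero_shift (- 1) (Fc q)) * de * ga"
    by (transfer; simp add: cls_M2)+
  hence "VM * (al * be) = VM * mm (\<lambda>q. inverse (vf q)) * (be * al)" "VM * (ga * de) = VM * mm (\<lambda>q. inverse (vf q)) * (de * ga)"
    unfolding mm_inverse_vf by (simp_all only: mult.assoc)
  thus "VM * al * be = be * al" "VM * ga * de = de * ga"
    unfolding VM_inv by (simp_all add: mult.assoc)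
  have "al * ga = sc (\<lambda>q. of_real q) * lm Fc * ga * al" "be * de = sc (\<lambda>q. of_real q) * lm Fc * de * be"
    by (transfer; simp add: cls_M2)+
  thus "al * ga = UL * ga * al" "be * de = UL * de * be" unfolding lm_uf .
qed

lemma Hc_sl2: "abs_sl2 Hc = UL - VM"
  unfolding A.Hx_eq[symmetric] by transfer (simp add: Hc_def)

lemma Ic_sl2: "abs_sl2 Ic = UL + VM - KA"
  unfolding A.Ix_eq[symmetric] by transfer (simp add: Ic_def)

lemma sl2_AD: "al * de = 1 + UL * (ga * be)"
proof -
  have "al * de - sc (\<lambda>q. of_real q) * lm Fc * ga * be = 1"
  proof (transfer, intro allI impI)
    fix q
    have "qdet q - 1 \<in> SL2_ideal q" using SL2_ideal_gens by blast
    thus "cls q (gn Al * gn De - scal (complex_of_real q) * lam (Fc q) * gn Ga * gn Be) = cls q 1"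
      by (simp add: cls_eq_iff qdet_def)
  qed
  thus ?thesis unfolding lm_uf by (simp add: algebra_simps)
qed

lemma sl2_DA: "de * al = 1 + VM * (ga * be)"
proof -
  have "al * de - de * al = abs_sl2 Hc * ga * be"
    by transfer (simp add: cls_M2)
  thus ?thesis unfolding Hc_sl2 sl2_AD by (simp add: algebra_simps)
qed

text \<open>Substituting delta alpha = 1 + v gamma beta and G(mu) = (kappa - v) v into the relation
  whose coefficient is I = u + v - kappa, the coefficient of gamma beta becomes (kappa - v) v + (u +
  v - kappa) v = u v, where u is taken at lambda and v at mu.\<close>

lemma sl2_BG: "be * ga = UL + VM - KA + UL * VM * (ga * be)"
proof -
  have "be * ga - mm Gc * ga * be = abs_sl2 Ic * de * al"
    by transfer (simp add: cls_M2)
  hence "be * ga = mm Gc * (ga * be) + abs_sl2 Ic * (de * al)"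
    by (simp add: algebra_simps)
  also have "mm Gc = (KA - VM) * VM"
    unfolding A.M.Gc A.M.vf by (simp add: algebra_simps sc_commute[of _ "mm uf"])
  finally show ?thesis unfolding Ic_sl2 sl2_DA by (simp add: algebra_simps)
qed

text \<open>Discarding the unmatched pairs makes the elementary tensor total and bilinear.\<close>

definition tmatch :: "free_alg \<Rightarrow> free_alg \<Rightarrow> free_alg2" where
  "tmatch x y = flt (\<lambda>(u, v). rdeg u = ldeg v) (tens x y)"

lemma tmatch_matched: "tmatch x y \<in> matched"
  by (auto simp: tmatch_def matched_def keys_flt)

lemma tmatch_add_left: "tmatch (x + x') y = tmatch x y + tmatch x' y"
  and tmatch_add_right: "tmatch x (y + y') = tmatch x y + tmatch x y'"
  and tmatch_diff_left: "tmatch (x - x') y = tmatch x y - tmatch x' y"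
  and tmatch_diff_right: "tmatch x (y - y') = tmatch x y - tmatch x y'"
  by (simp_all add: tmatch_def tens_add_left tens_add_right tens_diff_left tens_diff_right flt_add flt_diff)

lemma tmatch_sum:
  assumes "finite S" "rdeg ` Poly_Mapping.keys x \<subseteq> S"
  shows "tmatch x y = (\<Sum>c\<in>S. tens (flt (\<lambda>w. rdeg w = c) x) (flt (\<lambda>w. ldeg w = c) y))"
proof (rule poly_mapping_eqI)
  fix k :: "gword \<times> gword"
  obtain u v where k: "k = (u, v)" by (cases k)
  have "(\<Sum>c\<in>S. Poly_Mapping.lookup (tens (flt (\<lambda>w. rdeg w = c) x) (flt (\<lambda>w. ldeg w = c) y)) (u, v)) =
     (\<Sum>c\<in>S. if c = rdeg u then (if rdeg u = ldeg v then Poly_Mapping.lookup x u * Poly_Mapping.lookup y v else 0) else 0)"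
    by (intro sum.cong) (auto simp: lookup_tens lookup_flt)
  also have "\<dots> = (if rdeg u = ldeg v then Poly_Mapping.lookup x u * Poly_Mapping.lookup y v else 0)"
  proof -
    have "rdeg u \<in> S \<or> Poly_Mapping.lookup x u = 0" using assms by (auto simp: in_keys_iff)
    thus ?thesis using assms(1) by auto
  qed
  finally show "Poly_Mapping.lookup (tmatch x y) k = Poly_Mapping.lookup (\<Sum>c\<in>S. tens (flt (\<lambda>w. rdeg w = c) x) (flt (\<lambda>w. ldeg w = c) y)) k"
    by (simp add: lookup_sum k tmatch_def lookup_flt lookup_tens)
qed

lemma flt_rcomp: "flt (\<lambda>w. rdeg w = c) x \<in> free_rcomp c" and flt_lcomp: "flt (\<lambda>w. ldeg w = c) x \<in> free_lcomp c"
  by (auto simp: free_rcomp_def free_lcomp_def keys_flt)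

lemma tmatch_ideal_left: "x \<in> SL2_ideal q \<Longrightarrow> tmatch x y \<in> tensor_ideal q"
  by (subst tmatch_sum[OF finite_imageI subset_refl])
    (auto intro!: tensor_ideal_sum tens_left_ideal[where c = c for c] flt_rdeg_ideal flt_rcomp flt_lcomp)

lemma tmatch_ideal_right: "y \<in> SL2_ideal q \<Longrightarrow> tmatch x y \<in> tensor_ideal q"
  by (subst tmatch_sum[OF finite_imageI subset_refl])
    (auto intro!: tensor_ideal_sum tens_right_ideal[where c = c for c] flt_ldeg_ideal flt_rcomp flt_lcomp)

lemma flt_rdeg_mu: "flt (\<lambda>w. rdeg w = c) (mu f * x) = mu f * flt (\<lambda>w. rdeg w = c) x"
  by (induction x rule: poly_mapping_add_induct)
    (auto simp: gn_def mult_single flt_single flt_add distrib_left rdeg_plus, auto simp: rdeg_def)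

lemma flt_ldeg_lam: "flt (\<lambda>w. ldeg w = c) (lam f * x) = lam f * flt (\<lambda>w. ldeg w = c) x"
  by (induction x rule: poly_mapping_add_induct)
    (auto simp: gn_def mult_single flt_single flt_add distrib_left ldeg_plus, auto simp: ldeg_def)

lemma tmatch_balance: "tmatch (mu f * x) y - tmatch x (lam f * y) \<in> tensor_ideal q"
proof -
  define S where "S = rdeg ` Poly_Mapping.keys x \<union> rdeg ` Poly_Mapping.keys (mu f * x)"
  have S: "finite S" "rdeg ` Poly_Mapping.keys x \<subseteq> S" "rdeg ` Poly_Mapping.keys (mu f * x) \<subseteq> S"
    by (auto simp: S_def)
  show ?thesis
    unfolding tmatch_sum[OF S(1,2)] tmatch_sum[OF S(1,3)] flt_rdeg_mu flt_ldeg_lam sum_subtractf[symmetric]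
    by (intro tensor_ideal_sum tens_balance[OF flt_rcomp flt_lcomp])
qed

lemma tmatch_tens: "x \<in> free_rcomp c \<Longrightarrow> y \<in> free_lcomp c \<Longrightarrow> tmatch x y = tens x y"
  unfolding tmatch_def by (rule flt_all) (auto simp: keys_tens free_rcomp_def free_lcomp_def)

lemma flt_0: "flt P 0 = 0"
  by (simp add: flt_def lext_def)

lemma flt_mult_matched_left:
  assumes "p \<in> matched"
  shows "flt (\<lambda>(u, v). rdeg u = ldeg v) (p * r) = p * flt (\<lambda>(u, v). rdeg u = ldeg v) r"
proof -
  let ?P = "\<lambda>(u, v). rdeg u = ldeg v"
  have 1: "flt ?P (Poly_Mapping.single k c * r) = Poly_Mapping.single k c * flt ?P r" if "k \<in> Poly_Mapping.keys p" for k c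
  proof -
    obtain u v where k: "k = (u, v)" by (cases k)
    have "rdeg u = ldeg v" using assms that k by (auto simp: matched_def)
    thus ?thesis
      by (induction r rule: poly_mapping_add_induct)
        (auto simp: k mult_single flt_single flt_add distrib_left rdeg_plus ldeg_plus)
  qed
  have fs: "flt ?P (sum f S) = (\<Sum>i\<in>S. flt ?P (f i))" for f and S :: "(gword \<times> gword) set"
    by (induction S rule: infinite_finite_induct) (auto simp: flt_add flt_0)
  show ?thesis
    by (subst (1 2) poly_mapping_sum_single[of p]) (simp add: sum_distrib_right fs 1)
qed

text \<open>Multiplication by a matched tensor keeps matched pairs matched and unmatched pairs
  unmatched, so it commutes with the projection inside \<open>tmatch\<close>. Homogeneity of one
  factor is therefore enough.\<close>

lemma tmatch_mult:
  assumes "x \<in> free_rcomp c" "y \<in> free_lcomp c"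
  shows "tmatch x y * tmatch x' y' = tmatch (x * x') (y * y')"
  unfolding tmatch_tens[OF assms] unfolding tmatch_def tens_mult[symmetric]
  by (rule flt_mult_matched_left[symmetric, OF tens_matched[OF assms]])

\<comment> \<open>Families over all \<open>q\<close> again, with a partial quotient because only
  matched elements represent tensors.\<close>
quotient_type tsl2 = "real \<Rightarrow> free_alg2" / partial:
  "\<lambda>x y. (\<forall>q. x q \<in> matched) \<and> (\<forall>q. y q \<in> matched) \<and> (\<forall>q. good q \<longrightarrow> tensor_cls q (x q) = tensor_cls q (y q))"
proof (rule part_equivpI)
  show "\<exists>x. (\<forall>q. x q \<in> matched) \<and> (\<forall>q. x q \<in> matched) \<and> (\<forall>q. good q \<longrightarrow> tensor_cls q (x q) = tensor_cls q (x q))"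
    by (rule exI[of _ "\<lambda>_. 0"]) (simp add: matched_0)
qed (auto simp: symp_def transp_def)

lemma tensor_cls_congs:
  assumes "tensor_cls q x = tensor_cls q x'" "tensor_cls q y = tensor_cls q y'"
    "x \<in> matched" "x' \<in> matched" "y \<in> matched" "y' \<in> matched"
  shows "tensor_cls q (x + y) = tensor_cls q (x' + y')" "tensor_cls q (x * y) = tensor_cls q (x' * y')"
    "tensor_cls q (- x) = tensor_cls q (- x')" "tensor_cls q (x - y) = tensor_cls q (x' - y')"
proof -
  show a: "tensor_cls q (x + y) = tensor_cls q (x' + y')" "tensor_cls q (x * y) = tensor_cls q (x' * y')"
    using assms by (simp_all flip: tensor_cls_hom)
  have u: "- (y - y') \<in> tensor_ideal q" "- (x - x') \<in> tensor_ideal q"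
    using assms by (intro tensor_ideal_uminus; simp add: tensor_cls_eq_iff)+
  thus "tensor_cls q (- x) = tensor_cls q (- x')" by (simp add: tensor_cls_eq_iff)
  have "(x - x') + - (y - y') \<in> tensor_ideal q" using assms u by (intro tensor_ideal_add) (simp_all add: tensor_cls_eq_iff)
  thus "tensor_cls q (x - y) = tensor_cls q (x' - y')" by (simp add: tensor_cls_eq_iff algebra_simps)
qed

instantiation tsl2 :: ring_1
begin

lift_definition zero_tsl2 :: tsl2 is "\<lambda>_. 0" by (simp add: matched_0)
lift_definition one_tsl2 :: tsl2 is "\<lambda>_. 1" by (simp add: matched_1)
lift_definition plus_tsl2 :: "tsl2 \<Rightarrow> tsl2 \<Rightarrow> tsl2" is "\<lambda>x y q. x q + y q"
  by (intro conjI allI impI tensor_cls_congs matched_add) auto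
lift_definition minus_tsl2 :: "tsl2 \<Rightarrow> tsl2 \<Rightarrow> tsl2" is "\<lambda>x y q. x q - y q"
  by (intro conjI allI impI tensor_cls_congs matched_diff) auto
lift_definition uminus_tsl2 :: "tsl2 \<Rightarrow> tsl2" is "\<lambda>x q. - x q"
  by (intro conjI allI impI tensor_cls_congs matched_uminus) auto
lift_definition times_tsl2 :: "tsl2 \<Rightarrow> tsl2 \<Rightarrow> tsl2" is "\<lambda>x y q. x q * y q"
  by (intro conjI allI impI tensor_cls_congs matched_mult) auto

instance
proof
  show "(0 :: tsl2) \<noteq> 1"
  proof transfer
    let ?q = "1 / 2 :: real"
    have "1 \<notin> tensor_ideal ?q"
    proof
      assume "1 \<in> tensor_ideal ?q"
      \<comment> \<open>\<open>Phi\<close> sends the unit tensor to 1 modulo relations, so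
        nontriviality is inherited from A.\<close>
      hence "Phi ?q (\<lambda>_. 1) 0 (tens 1 1) \<in> SL2_ideal ?q"
        unfolding tens_1 by (intro Phi_tensor_ideal) auto
      hence "cls ?q (Phi ?q (\<lambda>_. 1) 0 (tens 1 1)) = cls ?q 0" unfolding cls_eq_iff by simp
      hence "cls ?q (mu 1 * 1) = cls ?q 0"
        using Phi_tens[of ?q "\<lambda>_. 1" 0 1 1] unfolding Act_1 by simp
      moreover have "cls ?q (mu 1) = cls ?q 1" using cls_M2(6)[of ?q 1] by (simp add: mero_const_1 scal_1)
      ultimately have "1 \<in> SL2_ideal ?q" by (metis cls_eq_iff diff_0_right mult_1_right)
      thus False using Act_SL2_ideal[of ?q 1 "\<lambda>_. 1" 0] by (auto simp: Act_1)
    qed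
    hence "tensor_cls ?q 0 \<noteq> tensor_cls ?q 1"
      by (metis tensor_cls_eq_iff diff_0_right)
    thus "\<not> ((\<forall>q. 0 \<in> matched) \<and> (\<forall>q. 1 \<in> matched) \<and> (\<forall>q. good q \<longrightarrow> tensor_cls q 0 = tensor_cls q 1))"
      by (auto intro!: exI[of _ ?q])
  qed
qed (transfer; simp add: algebra_simps matched_mult matched_add matched_uminus matched_0 matched_1 matched_diff)+

end

lift_definition tev :: "real \<Rightarrow> tsl2 \<Rightarrow> free_alg2 set" is "\<lambda>q x. if good q then tensor_cls q (x q) else {}"
  by auto

lemma tev_hom:
  assumes "good q"
  shows "tev q (x + y) = tev q x \<oplus>\<^bsub>SL2_tensor q\<^esub> tev q y" "tev q (x * y) = tev q x \<otimes>\<^bsub>SL2_tensor q\<^esub> tev q y"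
    "tev q 1 = \<one>\<^bsub>SL2_tensor q\<^esub>" "tev q 0 = \<zero>\<^bsub>SL2_tensor q\<^esub>" "tev q x \<in> carrier (SL2_tensor q)"
  using assms by (transfer; simp add: tensor_cls_hom tensor_cls_0 carrier_SL2_tensor)+

lift_definition tn :: "sl2 \<Rightarrow> sl2 \<Rightarrow> tsl2" is "\<lambda>x y q. tmatch (x q) (y q)"
proof (intro conjI allI impI, goal_cases)
  case (3 x x' y y' q)
  have "tmatch (x q - x' q) (y q) + tmatch (x' q) (y q - y' q) \<in> tensor_ideal q"
    using 3 by (intro tensor_ideal_add tmatch_ideal_left tmatch_ideal_right) (auto simp: cls_eq_iff)
  thus ?case by (simp add: tmatch_diff_left tmatch_diff_right tensor_cls_eq_iff)
qed (simp_all add: tmatch_matched)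

lemma tn_add_left: "tn (x + x') y = tn x y + tn x' y"
  and tn_add_right: "tn x (y + y') = tn x y + tn x y'"
  and tn_diff_left: "tn (x - x') y = tn x y - tn x' y"
  and tn_diff_right: "tn x (y - y') = tn x y - tn x y'"
  by (transfer; simp add: tmatch_add_left tmatch_add_right tmatch_diff_left tmatch_diff_right tmatch_matched matched_add matched_diff)+

lemma tn_0: "tn 0 y = 0" "tn x 0 = 0"
  using tn_add_left[of 0 0 y] tn_add_right[of x 0 0] by simp_all

lemma tn_balance: "tn (mm f * x) y = tn x (lm f * y)"
  by transfer (simp add: tmatch_matched tensor_cls_eq_iff tmatch_balance)

definition HR :: "int \<Rightarrow> sl2 set" where "HR c = {abs_sl2 r | r. \<forall>q. r q \<in> free_rcomp c}"
definition HL :: "int \<Rightarrow> sl2 set" where "HL c = {abs_sl2 r | r. \<forall>q. r q \<in> free_lcomp c}"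
definition Hm :: "int \<Rightarrow> int \<Rightarrow> sl2 set" where "Hm a b = {abs_sl2 r | r. \<forall>q. r q \<in> free_comp a b}"

lemma Hm_HR: "x \<in> Hm a b \<Longrightarrow> x \<in> HR b" and Hm_HL: "x \<in> Hm a b \<Longrightarrow> x \<in> HL a"
  by (auto simp: HR_def HL_def Hm_def dest: free_comp_subset)

lemma tn_mult:
  assumes "x \<in> HR c" "y \<in> HL c"
  shows "tn x y * tn x' y' = tn (x * x') (y * y')"
proof -
  obtain r s where r: "x = abs_sl2 r" "\<And>q. r q \<in> free_rcomp c" and s: "y = abs_sl2 s" "\<And>q. s q \<in> free_lcomp c"
    using assms by (auto simp: HR_def HL_def)
  define r' s' where "r' = rep_sl2 x'" and "s' = rep_sl2 y'"
  have x': "x' = abs_sl2 r'" and y': "y' = abs_sl2 s'"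
    unfolding r'_def s'_def by (rule Quotient_abs_rep[OF Quotient_sl2, symmetric])+
  have m: "(\<lambda>q. tmatch (r q) (s q) * tmatch (r' q) (s' q)) = (\<lambda>q. tmatch (r q * r' q) (s q * s' q))"
    by (rule ext) (rule tmatch_mult[OF r(2) s(2)])
  show ?thesis unfolding r(1) s(1) x' y' tn.abs_eq times_sl2.abs_eq m[symmetric]
    by (rule times_tsl2.abs_eq) (simp_all add: tmatch_matched)
qed

lemma tev_tn:
  assumes "x \<in> HR c" "y \<in> HL c" "good q"
  shows "tev q (tn x y) = tensor q (ev q x) (ev q y)"
proof -
  obtain r s where r: "x = abs_sl2 r" "\<And>q. r q \<in> free_rcomp c" and s: "y = abs_sl2 s" "\<And>q. s q \<in> free_lcomp c"
    using assms by (auto simp: HR_def HL_def)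
  have "tev q (tn x y) = tensor_cls q (tens (r q) (s q))"
    unfolding r(1) s(1) tn.abs_eq using assms(3) by (subst tev.abs_eq) (simp_all add: tmatch_tens[OF r(2) s(2)] tens_matched[OF r(2) s(2)])
  moreover have "ev q x = cls q (r q)" "ev q y = cls q (s q)"
    unfolding r(1) s(1) using assms(3) by (simp_all add: ev.abs_eq)
  ultimately show ?thesis by (simp add: tensor_eq[OF r(2) s(2)])
qed

lemma HR_sc: "sc c \<in> Hm 0 0" "lm f \<in> Hm 0 0" "mm f \<in> Hm 0 0" "1 \<in> Hm 0 0" "gs g \<in> Hm (fst (gen_deg g)) (snd (gen_deg g))"
  unfolding Hm_def sc_def lm_def mm_def one_sl2_def gs_def
  using free_comp_scal free_comp_gens(5,6) free_comp_1 free_comp_gn by auto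

lemma Hm_mult: "x \<in> Hm a b \<Longrightarrow> y \<in> Hm a' b' \<Longrightarrow> a'' = a + a' \<Longrightarrow> b'' = b + b' \<Longrightarrow> x * y \<in> Hm a'' b''"
proof -
  assume "x \<in> Hm a b" "y \<in> Hm a' b'" and ab: "a'' = a + a'" "b'' = b + b'"
  then obtain r s where "x = abs_sl2 r" "y = abs_sl2 s" and rs: "\<And>q. r q \<in> free_comp a b" "\<And>q. s q \<in> free_comp a' b'"
    by (auto simp: Hm_def)
  hence "x * y = abs_sl2 (\<lambda>q. r q * s q)" by (simp add: times_sl2.abs_eq)
  thus ?thesis using free_comp_mult[OF rs ab] by (auto simp: Hm_def)
qed

lemma Hm_add: "x \<in> Hm a b \<Longrightarrow> y \<in> Hm a b \<Longrightarrow> x + y \<in> Hm a b"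
proof -
  assume "x \<in> Hm a b" "y \<in> Hm a b"
  then obtain r s where "x = abs_sl2 r" "y = abs_sl2 s" and rs: "\<And>q. r q \<in> free_comp a b" "\<And>q. s q \<in> free_comp a b"
    by (auto simp: Hm_def)
  hence "x + y = abs_sl2 (\<lambda>q. r q + s q)" by (simp add: plus_sl2.abs_eq)
  thus ?thesis using free_comp_add[OF rs] by (auto simp: Hm_def)
qed

definition lt :: "(real \<Rightarrow> mero) \<Rightarrow> tsl2" where "lt f = tn (lm f) 1"
definition rt2 :: "(real \<Rightarrow> mero) \<Rightarrow> tsl2" where "rt2 f = tn 1 (mm f)"
definition st :: "(real \<Rightarrow> complex) \<Rightarrow> tsl2" where "st c = tn (sc c) 1"

lemma tn_11: "tn 1 1 = 1"
  by transfer (simp add: tmatch_tens[of _ 0] free_comp_subset[OF free_comp_1] tens_1 matched_1)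

lemma lt_tn: "lt f * tn x y = tn (lm f * x) y" and rt2_tn: "rt2 f * tn x y = tn x (mm f * y)"
  unfolding lt_def rt2_def
  by (simp_all add: tn_mult[OF Hm_HR[OF HR_sc(2)] Hm_HL[OF HR_sc(4)]]
    tn_mult[OF Hm_HR[OF HR_sc(4)] Hm_HL[OF HR_sc(3)]])

lemma tn_sc: "tn (sc c * x) y = tn x (sc c * y)"
  using tn_balance[of "\<lambda>q. mero_const (c q)"] by (simp add: A.L.const A.M.const)

interpretation T: mero_hom2 lt rt2 st
proof unfold_locales
  show "rt2 (\<lambda>q. mero_const (c q)) = st c" for c
    using tn_sc[of c 1 1] by (simp add: rt2_def st_def A.M.const)
  show "lt (\<lambda>q. f q + g q) = lt f + lt g" "rt2 (\<lambda>q. f q + g q) = rt2 f + rt2 g" for f g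
    by (simp_all add: lt_def rt2_def A.L.add A.M.add tn_add_left tn_add_right)
  show "lt (\<lambda>q. f q * g q) = lt f * lt g" for f g
    unfolding lt_def[of g] lt_tn by (simp add: lt_def A.L.mult)
  show "rt2 (\<lambda>q. f q * g q) = rt2 f * rt2 g" for f g
    unfolding rt2_def[of g] rt2_tn by (simp add: rt2_def A.M.mult)
  show "lt (\<lambda>q. mero_const (c q)) = st c" for c
    by (simp add: lt_def st_def A.L.const)
  show "st (\<lambda>_. 1) = 1"
    by (simp add: st_def A.L.s1 tn_11)
  show "lt f = lt g" if "\<And>q. good q \<Longrightarrow> f q = g q" for f g
  proof -
    have "lm f = lm g" by (rule A.L.cong) (rule that)
    thus ?thesis by (simp add: lt_def)
  qed
  show "rt2 f = rt2 g" if "\<And>q. good q \<Longrightarrow> f q = g q" for f g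
  proof -
    have "mm f = mm g" by (rule A.M.cong) (rule that)
    thus ?thesis by (simp add: rt2_def)
  qed
  show "lt f * rt2 g = rt2 g * lt f" for f g
    unfolding rt2_def[of g] lt_tn unfolding lt_def[of f] rt2_def[of g, symmetric] rt2_tn by simp
qed

definition cop :: "(real \<Rightarrow> free_alg) \<Rightarrow> tsl2" where "cop x = abs_tsl2 (\<lambda>q. free_coprod (x q))"

lemma cop_add: "cop (\<lambda>q. x q + y q) = cop x + cop y" and cop_diff: "cop (\<lambda>q. x q - y q) = cop x - cop y"
  and cop_mult: "cop (\<lambda>q. x q * y q) = cop x * cop y"
  unfolding cop_def
  by (subst plus_tsl2.abs_eq minus_tsl2.abs_eq times_tsl2.abs_eq;
      simp add: free_coprod_matched free_coprod_add free_coprod_diff free_coprod_mult)+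

lemma cop_1: "cop (\<lambda>_. 1) = 1"
  by (simp add: cop_def one_tsl2_def free_coprod_1)

lemma cop_scal: "cop (\<lambda>q. scal (c q)) = st c"
proof -
  have "tens (scal (c q)) 1 = scal (c q)" for q
    using tens_single[of 0 "c q" 0 1] by (simp add: scal_def zero_prod_def)
  thus ?thesis
    unfolding cop_def st_def sc_def one_sl2_def tn.abs_eq map_fun_def
    by (simp add: tn.abs_eq free_coprod_scal tmatch_tens[of _ 0] free_comp_subset[OF free_comp_1] free_comp_subset[OF free_comp_scal])
qed

lemma cop_lam: "cop (\<lambda>q. lam (f q)) = lt f" and cop_mu: "cop (\<lambda>q. mu (f q)) = rt2 f"
  unfolding cop_def lt_def lm_def rt2_def mm_def one_sl2_def tn.abs_eq map_fun_def
  by (simp_all add: tn.abs_eq free_coprod_gn tmatch_tens[of _ 0] free_comp_subset[OF free_comp_1] free_comp_subset[OF free_comp_gens(5)]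
     free_comp_subset[OF free_comp_gens(6)])

lemma tn_gs: "snd (gen_deg g) = fst (gen_deg g') \<Longrightarrow> tn (gs g) (gs g') = abs_tsl2 (\<lambda>_. tens (gn g) (gn g'))"
proof -
  assume "snd (gen_deg g) = fst (gen_deg g')"
  hence "tmatch (gn g) (gn g') = tens (gn g) (gn g')"
    using free_comp_subset(1)[OF free_comp_gn[of g]] free_comp_subset(2)[OF free_comp_gn[of g']] by (intro tmatch_tens) auto
  thus ?thesis unfolding gs_def map_fun_def by (simp add: tn.abs_eq)
qed

lemma abs_tsl2_add: "(\<And>q. x q \<in> matched) \<Longrightarrow> (\<And>q. y q \<in> matched) \<Longrightarrow> abs_tsl2 (\<lambda>q. x q + y q) = abs_tsl2 x + abs_tsl2 y"
  by (subst plus_tsl2.abs_eq) auto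

lemma tens_gn_matched: "snd (gen_deg g) = fst (gen_deg g') \<Longrightarrow> tens (gn g) (gn g') \<in> matched"
  by (rule tens_matched[of _ "snd (gen_deg g)"]) (use free_comp_gn[of g] free_comp_gn[of g'] in \<open>auto dest: free_comp_subset\<close>)

section \<open>The coproducts of the generators and the relations between them\<close>

definition "Dal = tn al al + tn be ga"
definition "Dbe = tn al be + tn be de"
definition "Dga = tn ga al + tn de ga"
definition "Dde = tn ga be + tn de de"
lemmas D_defs = Dal_def Dbe_def Dga_def Dde_def

lemma cop_gn: "cop (\<lambda>_. gn Al) = Dal" "cop (\<lambda>_. gn Be) = Dbe" "cop (\<lambda>_. gn Ga) = Dga" "cop (\<lambda>_. gn De) = Dde"
  unfolding cop_def D_defs free_coprod_gn gen_coprod.simps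
  by (subst abs_tsl2_add; simp add: tn_gs tens_gn_matched)+

lemma tn_gs_mult: "snd (gen_deg g) = fst (gen_deg g') \<Longrightarrow> tn (gs g) (gs g') * tn x y = tn (gs g * x) (gs g' * y)"
  by (rule tn_mult[OF Hm_HR[OF HR_sc(5)]]) (metis Hm_HL HR_sc(5))

lemma tn_gs_mults:
  "tn al al * tn x y = tn (al * x) (al * y)" "tn al be * tn x y = tn (al * x) (be * y)"
  "tn be ga * tn x y = tn (be * x) (ga * y)" "tn be de * tn x y = tn (be * x) (de * y)"
  "tn ga al * tn x y = tn (ga * x) (al * y)" "tn ga be * tn x y = tn (ga * x) (be * y)"
  "tn de ga * tn x y = tn (de * x) (ga * y)" "tn de de * tn x y = tn (de * x) (de * y)"
  by (rule tn_gs_mult; simp)+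

lemma D_prods:
  "Dal * Dbe = tn (al * al) (al * be) + tn (al * be) (al * de) + tn (be * al) (ga * be) + tn (be * be) (ga * de)"
  "Dbe * Dal = tn (al * al) (be * al) + tn (al * be) (be * ga) + tn (be * al) (de * al) + tn (be * be) (de * ga)"
  "Dal * Dga = tn (al * ga) (al * al) + tn (al * de) (al * ga) + tn (be * ga) (ga * al) + tn (be * de) (ga * ga)"
  "Dga * Dal = tn (ga * al) (al * al) + tn (ga * be) (al * ga) + tn (de * al) (ga * al) + tn (de * be) (ga * ga)"
  "Dbe * Dde = tn (al * ga) (be * be) + tn (al * de) (be * de) + tn (be * ga) (de * be) + tn (be * de) (de * de)"
  "Dde * Dbe = tn (ga * al) (be * be) + tn (ga * be) (be * de) + tn (de * al) (de * be) + tn (de * be) (de * de)"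
  "Dga * Dde = tn (ga * ga) (al * be) + tn (ga * de) (al * de) + tn (de * ga) (ga * be) + tn (de * de) (ga * de)"
  "Dde * Dga = tn (ga * ga) (be * al) + tn (ga * de) (be * ga) + tn (de * ga) (de * al) + tn (de * de) (de * ga)"
  "Dal * Dde = tn (al * ga) (al * be) + tn (al * de) (al * de) + tn (be * ga) (ga * be) + tn (be * de) (ga * de)"
  "Dde * Dal = tn (ga * al) (be * al) + tn (ga * be) (be * ga) + tn (de * al) (de * al) + tn (de * be) (de * ga)"
  "Dga * Dbe = tn (ga * al) (al * be) + tn (ga * be) (al * de) + tn (de * al) (ga * be) + tn (de * be) (ga * de)"
  "Dbe * Dga = tn (al * ga) (be * al) + tn (al * de) (be * ga) + tn (be * ga) (de * al) + tn (be * de) (de * ga)"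
  unfolding D_defs by (simp_all only: distrib_left distrib_right tn_gs_mults add_ac)

lemma VLM: "lm vf = KA - UL" "mm uf = KA - VM"
  unfolding A.L.vf A.M.vf by simp_all

lemma UV_comm: "VM * UL = UL * VM" "UL * KA = KA * UL" "VM * KA = KA * VM"
  by (simp_all add: A.comm sc_commute)

lemma UV_comm': "VM * (UL * x) = UL * (VM * x)" "UL * (KA * x) = KA * (UL * x)" "VM * (KA * x) = KA * (VM * x)"
  by (simp_all only: UV_comm flip: mult.assoc)

lemmas qcomm' = sl2_qcomm[unfolded mult.assoc]

text \<open>Arises from v(mu) Delta(alpha) Delta(beta) = Delta(beta) Delta(alpha). Of the four
  tensors on each side two match by q-commutation. The middle ones acquire the common left factor
  alpha beta, once v(mu) on the left is carried to the right as kappa - u(lambda); this identity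
  between right factors is what remains. The pair gamma, delta leads to the same identity.\<close>

lemma mid_identity_1: "VM * (al * de) + (KA - UL) * (VM * (ga * be)) = be * ga + (KA - UL) * (de * al)"
  unfolding sl2_AD sl2_DA sl2_BG by (simp add: algebra_simps UV_comm UV_comm')

text \<open>The mirror image, for the two relations with u(lambda): here the right factors are made
  equal, and u(lambda) on the right is carried to the left as kappa - v(mu).\<close>

lemma mid_identity_2: "(KA - VM) * (al * de) + be * ga = UL * ((KA - VM) * (ga * be) + de * al)"
  unfolding sl2_AD sl2_DA sl2_BG by (simp add: algebra_simps UV_comm UV_comm')

lemma tn_V: "tn (VM * x) y = tn x ((KA - UL) * y)"
  unfolding tn_balance VLM ..

lemma tn_U: "tn x (UL * y) = tn ((KA - VM) * x) y"
  unfolding tn_balance[symmetric] VLM ..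

abbreviation "UT \<equiv> lt uf"
abbreviation "VT \<equiv> rt2 vf"

lemma D_qcomm:
  "VT * (Dal * Dbe) = Dbe * Dal" "VT * (Dga * Dde) = Dde * Dga"
  "Dal * Dga = UT * (Dga * Dal)" "Dbe * Dde = UT * (Dde * Dbe)"
proof -
  have *: "tn x (VM * (al * de)) + tn (VM * x) (VM * (ga * be)) = tn x (be * ga) + tn (VM * x) (de * al)" for x
    unfolding tn_V tn_add_right[symmetric] mid_identity_1 ..
  show "VT * (Dal * Dbe) = Dbe * Dal"
    unfolding D_prods distrib_left rt2_tn using *[of "al * be"] by (simp add: qcomm' algebra_simps)
  show "VT * (Dga * Dde) = Dde * Dga"
    unfolding D_prods distrib_left rt2_tn using *[of "ga * de"] by (simp add: qcomm' algebra_simps)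
  have *: "tn (al * de) (UL * y) + tn (be * ga) y = tn (UL * (ga * be)) (UL * y) + tn (UL * (de * al)) y" for y
  proof -
    have "tn (al * de) (UL * y) + tn (be * ga) y = tn (UL * ((KA - VM) * (ga * be) + de * al)) y"
      unfolding tn_U tn_add_left[symmetric] mid_identity_2 ..
    also have "\<dots> = tn (UL * ((KA - VM) * (ga * be))) y + tn (UL * (de * al)) y"
      unfolding distrib_left tn_add_left ..
    also have "UL * ((KA - VM) * (ga * be)) = (KA - VM) * (UL * (ga * be))"
      by (simp add: algebra_simps UV_comm UV_comm')
    finally show ?thesis by (simp only: tn_U)
  qed
  show "Dal * Dga = UT * (Dga * Dal)"
    unfolding D_prods distrib_left lt_tn using *[of "ga * al"] by (simp add: qcomm' algebra_simps)
  show "Dbe * Dde = UT * (Dde * Dbe)"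
    unfolding D_prods distrib_left lt_tn using *[of "de * be"] by (simp add: qcomm' algebra_simps)
qed

lemma tn_K: "tn (KA * x) y = tn x (KA * y)" by (rule tn_sc)

text \<open>Collecting by right factors leaves alpha delta - u gamma beta = 1 in front of alpha
  delta, and beta gamma - u delta alpha = v(mu) - kappa in front of gamma beta. The latter crosses
  to the right as - u(lambda), so that the right factor is alpha delta - u gamma beta = 1 as
  well.\<close>

lemma D_AD: "Dal * Dde = 1 + UT * (Dga * Dbe)"
proof -
  have "Dal * Dde - UT * (Dga * Dbe) = tn (al * de - UL * (ga * be)) (al * de) + tn (be * ga - UL * (de * al)) (ga * be)"
    unfolding D_prods distrib_left lt_tn by (simp add: qcomm' tn_diff_left)
  also have "al * de - UL * (ga * be) = 1" unfolding sl2_AD by simp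
  also have "be * ga - UL * (de * al) = - ((KA - VM) * 1)"
    unfolding sl2_BG sl2_DA by (simp add: algebra_simps)
  also have "tn 1 (al * de) + tn (- ((KA - VM) * 1)) (ga * be) = tn 1 (al * de) - tn 1 (UL * (ga * be))"
    using tn_diff_left[of 0 "(KA - VM) * 1" "ga * be"] tn_diff_left[of 0 0 "ga * be"] by (simp add: tn_U)
  also have "\<dots> = 1" unfolding tn_diff_right[symmetric] sl2_AD by (simp add: tn_11)
  finally show ?thesis by (simp add: algebra_simps)
qed

lemma D_DA: "Dde * Dal = 1 + VT * (Dga * Dbe)"
proof -
  have "Dde * Dal - VT * (Dga * Dbe) = tn (ga * be) (be * ga - VM * (al * de)) + tn (de * al) (de * al - VM * (ga * be))"
    unfolding D_prods distrib_left rt2_tn by (simp add: qcomm' tn_diff_right)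
  also have "de * al - VM * (ga * be) = 1" unfolding sl2_DA by simp
  also have "be * ga - VM * (al * de) = - ((KA - UL) * 1)"
    unfolding sl2_BG sl2_AD by (simp add: algebra_simps UV_comm')
  also have "tn (ga * be) (- ((KA - UL) * 1)) + tn (de * al) 1 = tn (de * al) 1 - tn (VM * (ga * be)) 1"
    using tn_diff_right[of "ga * be" 0 "(KA - UL) * 1"] tn_diff_right[of "ga * be" 0 0] by (simp add: tn_V)
  also have "\<dots> = 1" unfolding tn_diff_left[symmetric] sl2_DA by (simp add: tn_11)
  finally show ?thesis by (simp add: algebra_simps)
qed

text \<open>Two copies of u + v - kappa are left, one in each tensor factor. As u(lambda) on the
  right equals kappa - v(mu) on the left, the inner functions cancel in their sum; the outer u and v
  remain, minus one kappa.\<close>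

lemma D_BG: "Dbe * Dga = UT + VT - st kappa + UT * (VT * (Dga * Dbe))"
proof -
  let ?z = "ga * be"
  have "Dbe * Dga - UT * (VT * (Dga * Dbe)) = tn (al * de) (be * ga) - tn (UL * ?z) (VM * (al * de))
     + (tn (be * ga) (de * al) - tn (UL * (de * al)) (VM * ?z))"
    unfolding D_prods distrib_left rt2_tn lt_tn by (simp add: qcomm')
  also have "tn (al * de) (be * ga) - tn (UL * ?z) (VM * (al * de)) = tn 1 (be * ga) + tn (UL * ?z) (be * ga - VM * (al * de))"
    unfolding sl2_AD[of ] by (simp add: tn_add_left tn_diff_right)
  also have "be * ga - VM * (al * de) = 0 - (KA - UL) * 1"
    unfolding sl2_BG sl2_AD by (simp add: algebra_simps UV_comm')
  also have "tn (be * ga) (de * al) - tn (UL * (de * al)) (VM * ?z) = tn (be * ga) 1 + tn (be * ga - UL * (de * al)) (VM * ?z)"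
    unfolding sl2_DA by (simp add: tn_add_right tn_diff_left)
  also have "be * ga - UL * (de * al) = 0 - (KA - VM) * 1"
    unfolding sl2_BG sl2_DA by (simp add: algebra_simps)
  also have "tn (UL * ?z) (0 - (KA - UL) * 1) = - tn (VM * (UL * ?z)) 1"
    unfolding tn_diff_right tn_V[symmetric] by (simp add: tn_0)
  also have "tn (0 - (KA - VM) * 1) (VM * ?z) = - tn 1 (UL * (VM * ?z))"
    unfolding tn_diff_left tn_U[symmetric] by (simp add: tn_0)
  also have "tn 1 (be * ga) + - tn (VM * (UL * ?z)) 1 + (tn (be * ga) 1 + - tn 1 (UL * (VM * ?z)))
     = tn 1 (be * ga - UL * (VM * ?z)) + tn (be * ga - UL * (VM * ?z)) 1"
    by (simp add: tn_diff_left tn_diff_right UV_comm')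
  also have "be * ga - UL * (VM * ?z) = UL + VM - KA" unfolding sl2_BG by (simp add: mult.assoc)
  also have "tn 1 (UL + VM - KA) + tn (UL + VM - KA) 1 = UT + VT - st kappa"
  proof -
    have "tn 1 UL = tn KA 1 - tn VM 1" using tn_U[of 1 1] by (simp add: tn_diff_left)
    moreover have "tn 1 KA = tn KA 1" using tn_K[of 1 1] by simp
    ultimately show ?thesis by (simp add: tn_add_right tn_add_left tn_diff_left tn_diff_right lt_def rt2_def st_def)
  qed
  finally show ?thesis by (simp add: algebra_simps)
qed

lemma T_comm: "UT * VT = VT * UT" "st c * UT = UT * st c" "st c * VT = VT * st c"
  by (simp_all add: T.comm T.s_comm)

lemma T_comm': "VT * (UT * x) = UT * (VT * x)" "UT * (st c * x) = st c * (UT * x)" "VT * (st c * x) = st c * (VT * x)"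
  by (simp_all only: T_comm flip: mult.assoc)

lemma cop_Hc: "cop Hc = UT - VT" and cop_Ic: "cop Ic = UT + VT - st kappa"
  unfolding T.Hx_eq[symmetric] T.Ix_eq[symmetric]
  unfolding Hc_def[abs_def] Ic_def[abs_def] cop_mult cop_diff cop_scal cop_lam cop_mu cop_1 by simp_all

lemma T_shift:
  assumes "snd (gen_deg g) = fst (gen_deg g')"
  shows "lt f * tn (gs g) (gs g') = tn (gs g) (gs g') * lt (\<lambda>q. mero_shift (of_int (fst (gen_deg g))) (f q))"
    and "rt2 f * tn (gs g) (gs g') = tn (gs g) (gs g') * rt2 (\<lambda>q. mero_shift (of_int (snd (gen_deg g'))) (f q))"
  unfolding lt_tn rt2_tn unfolding lt_def rt2_def tn_gs_mult[OF assms] by (simp_all add: shift_gs)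

lemma D_shift:
  "lt f * Dal = Dal * lt (\<lambda>q. mero_shift 1 (f q))" "rt2 f * Dal = Dal * rt2 (\<lambda>q. mero_shift 1 (f q))"
  "lt f * Dbe = Dbe * lt (\<lambda>q. mero_shift 1 (f q))" "rt2 f * Dbe = Dbe * rt2 (\<lambda>q. mero_shift (- 1) (f q))"
  "lt f * Dga = Dga * lt (\<lambda>q. mero_shift (- 1) (f q))" "rt2 f * Dga = Dga * rt2 (\<lambda>q. mero_shift 1 (f q))"
  "lt f * Dde = Dde * lt (\<lambda>q. mero_shift (- 1) (f q))" "rt2 f * Dde = Dde * rt2 (\<lambda>q. mero_shift (- 1) (f q))"
  unfolding D_defs distrib_left distrib_right by (simp_all add: T_shift)

lemma cop_ideal: "cop x = 0 \<Longrightarrow> good q \<Longrightarrow> free_coprod (x q) \<in> tensor_ideal q"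
proof -
  assume *: "cop x = 0" "good q"
  have "tev q (cop x) = tensor_cls q (free_coprod (x q))"
    unfolding cop_def using * by (subst tev.abs_eq) (simp_all add: free_coprod_matched)
  moreover have "tev q (cop x) = tensor_cls q 0" using * by (simp add: tev_hom tensor_cls_0)
  ultimately have "tensor_cls q (free_coprod (x q)) = tensor_cls q 0" by simp
  thus ?thesis unfolding tensor_cls_eq_iff by simp
qed

lemma st_inverse_vf: "st (\<lambda>q. of_real q) * rt2 (\<lambda>q. mero_shift (- 1) (Fc q)) = rt2 (\<lambda>q. inverse (vf q))"
  unfolding T.M.const[symmetric] T.M.mult[symmetric] by (rule T.M.cong) (simp add: shift_Fc)

lemma st_uf: "st (\<lambda>q. of_real q) * lt Fc = UT"
  unfolding T.L.const[symmetric] T.L.mult[symmetric] by (rule T.L.cong) (simp add: uf_def)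

lemma VT_inv: "rt2 (\<lambda>q. inverse (vf q)) * (VT * x) = x"
proof -
  have "rt2 (\<lambda>q. inverse (vf q)) * VT = 1" by (rule T.M.inverse) (simp add: vf_nz)
  thus ?thesis by (simp flip: mult.assoc)
qed

lemma free_coprod_rels:
  assumes q: "good q" and r: "r \<in> insert (qdet q - 1) (M2_rels q)"
  shows "free_coprod r \<in> tensor_ideal q"
proof -
  note C = cop_add cop_diff cop_mult cop_scal cop_lam cop_mu cop_1 cop_gn cop_Hc cop_Ic
  \<comment> \<open>A relation at the given \<open>q\<close> is extended to a family over all
    \<open>q\<close>, so that it can be checked in \<open>tsl2\<close>.\<close>
  have I: "free_coprod r \<in> tensor_ideal q" if "cop y = 0" "y q = r" for y
    using cop_ideal[OF that(1) q] that(2) by simp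
  have GT: "lt Gc = UT * (st kappa - UT)" "rt2 Gc = (st kappa - VT) * VT"
    unfolding T.L.Gc T.L.vf T.M.Gc T.M.vf by (simp_all add: algebra_simps T.s_comm[of _ uf])
  from r show ?thesis
  proof (elim insertE)
    assume r: "r = qdet q - 1"
    have "cop (\<lambda>q. qdet q - 1) = 0"
      unfolding qdet_def C st_uf D_AD by (simp add: mult.assoc)
    thus ?thesis by (rule I) (simp add: r)
  next
    assume "r \<in> M2_rels q"
    thus ?thesis
    proof cases
      case (lam_add f g)
      have "cop (\<lambda>q. lam (f + g) - (lam f + lam g)) = 0" unfolding C T.L.add by simp
      thus ?thesis by (rule I) (simp add: lam_add)
    next
      case (lam_mult f g)
      have "cop (\<lambda>q. lam (f * g) - lam f * lam g) = 0" unfolding C T.L.mult by simp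
      thus ?thesis by (rule I) (simp add: lam_mult)
    next
      case (lam_const c)
      have "cop (\<lambda>q. lam (mero_const c) - scal c) = 0" unfolding C T.L.const by simp
      thus ?thesis by (rule I) (simp add: lam_const)
    next
      case (mu_add f g)
      have "cop (\<lambda>q. mu (f + g) - (mu f + mu g)) = 0" unfolding C T.M.add by simp
      thus ?thesis by (rule I) (simp add: mu_add)
    next
      case (mu_mult f g)
      have "cop (\<lambda>q. mu (f * g) - mu f * mu g) = 0" unfolding C T.M.mult by simp
      thus ?thesis by (rule I) (simp add: mu_mult)
    next
      case (mu_const c)
      have "cop (\<lambda>q. mu (mero_const c) - scal c) = 0" unfolding C T.M.const by simp
      thus ?thesis by (rule I) (simp add: mu_const)
    next
      case (lam_mu f g)
      have "cop (\<lambda>q. lam f * mu g - mu g * lam f) = 0" unfolding C by (simp add: T.comm)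
      thus ?thesis by (rule I) (simp add: lam_mu)
    next
      case (lam_Al f)
      have "cop (\<lambda>q. lam f * gn Al - gn Al * lam (mero_shift 1 f)) = 0" unfolding C by (simp add: D_shift)
      thus ?thesis by (rule I) (simp add: lam_Al)
    next
      case (mu_Al f)
      have "cop (\<lambda>q. mu f * gn Al - gn Al * mu (mero_shift 1 f)) = 0" unfolding C by (simp add: D_shift)
      thus ?thesis by (rule I) (simp add: mu_Al)
    next
      case (lam_Be f)
      have "cop (\<lambda>q. lam f * gn Be - gn Be * lam (mero_shift 1 f)) = 0" unfolding C by (simp add: D_shift)
      thus ?thesis by (rule I) (simp add: lam_Be)
    next
      case (mu_Be f)
      have "cop (\<lambda>q. mu f * gn Be - gn Be * mu (mero_shift (- 1) f)) = 0" unfolding C by (simp add: D_shift)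
      thus ?thesis by (rule I) (simp add: mu_Be)
    next
      case (lam_Ga f)
      have "cop (\<lambda>q. lam f * gn Ga - gn Ga * lam (mero_shift (- 1) f)) = 0" unfolding C by (simp add: D_shift)
      thus ?thesis by (rule I) (simp add: lam_Ga)
    next
      case (mu_Ga f)
      have "cop (\<lambda>q. mu f * gn Ga - gn Ga * mu (mero_shift 1 f)) = 0" unfolding C by (simp add: D_shift)
      thus ?thesis by (rule I) (simp add: mu_Ga)
    next
      case (lam_De f)
      have "cop (\<lambda>q. lam f * gn De - gn De * lam (mero_shift (- 1) f)) = 0" unfolding C by (simp add: D_shift)
      thus ?thesis by (rule I) (simp add: lam_De)
    next
      case (mu_De f)
      have "cop (\<lambda>q. mu f * gn De - gn De * mu (mero_shift (- 1) f)) = 0" unfolding C by (simp add: D_shift)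
      thus ?thesis by (rule I) (simp add: mu_De)
    next
      case Al_Be
      have "cop (\<lambda>q. gn Al * gn Be - scal (of_real q) * mu (mero_shift (- 1) (Fc q)) * gn Be * gn Al) = 0"
        unfolding C st_inverse_vf unfolding mult.assoc D_qcomm(1)[symmetric] VT_inv by simp
      thus ?thesis by (rule I) (simp add: Al_Be)
    next
      case Al_Ga
      have "cop (\<lambda>q. gn Al * gn Ga - scal (of_real q) * lam (Fc q) * gn Ga * gn Al) = 0"
        unfolding C st_uf unfolding mult.assoc D_qcomm(3) by simp
      thus ?thesis by (rule I) (simp add: Al_Ga)
    next
      case Be_De
      have "cop (\<lambda>q. gn Be * gn De - scal (of_real q) * lam (Fc q) * gn De * gn Be) = 0"
        unfolding C st_uf unfolding mult.assoc D_qcomm(4) by simp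
      thus ?thesis by (rule I) (simp add: Be_De)
    next
      case Ga_De
      have "cop (\<lambda>q. gn Ga * gn De - scal (of_real q) * mu (mero_shift (- 1) (Fc q)) * gn De * gn Ga) = 0"
        unfolding C st_inverse_vf unfolding mult.assoc D_qcomm(2)[symmetric] VT_inv by simp
      thus ?thesis by (rule I) (simp add: Ga_De)
    next
      case Al_De1
      have "cop (\<lambda>q. (gn Al * gn De - gn De * gn Al) - Hc q * gn Ga * gn Be) = 0"
        unfolding C mult.assoc D_AD D_DA by (simp add: algebra_simps)
      thus ?thesis by (rule I) (simp add: Al_De1)
    next
      case Al_De2
      have "cop (\<lambda>q. (mu (Gc q) * gn Al * gn De - lam (Gc q) * gn De * gn Al) - Hc q * gn Be * gn Ga) = 0"
        unfolding C mult.assoc D_AD D_DA D_BG GT by (simp add: algebra_simps T_comm T_comm')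
      thus ?thesis by (rule I) (simp add: Al_De2)
    next
      case Be_Ga1
      have "cop (\<lambda>q. (gn Be * gn Ga - mu (Gc q) * gn Ga * gn Be) - Ic q * gn De * gn Al) = 0"
        unfolding C mult.assoc D_AD D_DA D_BG GT by (simp add: algebra_simps T_comm T_comm')
      thus ?thesis by (rule I) (simp add: Be_Ga1)
    next
      case Be_Ga2
      have "cop (\<lambda>q. (gn Be * gn Ga - lam (Gc q) * gn Ga * gn Be) - Ic q * gn Al * gn De) = 0"
        unfolding C mult.assoc D_AD D_DA D_BG GT by (simp add: algebra_simps T_comm T_comm')
      thus ?thesis by (rule I) (simp add: Be_Ga2)
    qed
  qed
qed

lemma free_coprod_ideal:
  assumes q: "good q" and x: "x \<in> SL2_ideal q" shows "free_coprod x \<in> tensor_ideal q"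
proof -
  have "SL2_ideal q \<subseteq> {x. free_coprod x \<in> tensor_ideal q}"
  proof (rule SL2_ideal_minimal, goal_cases)
    case 6 show ?case using free_coprod_rels[OF q insertI1] by simp
  qed (use free_coprod_rels[OF q] free_coprod_matched in
      \<open>auto simp: free_coprod_0 free_coprod_diff free_coprod_mult tensor_ideal_0 tensor_ideal_diff tensor_ideal_mult_left tensor_ideal_mult_right\<close>)
  thus ?thesis using x by blast
qed

lift_definition Delta :: "sl2 \<Rightarrow> tsl2" is "\<lambda>x q. free_coprod (x q)"
  using free_coprod_ideal
  by (auto simp: free_coprod_matched tensor_cls_eq_iff cls_eq_iff simp flip: free_coprod_diff)

lemma Delta_cop: "Delta (abs_sl2 x) = cop x"
  unfolding cop_def by (rule Delta.abs_eq)

lemma Delta_mult: "Delta (x * y) = Delta x * Delta y" and Delta_1: "Delta 1 = 1"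
  by (transfer; simp add: free_coprod_mult free_coprod_1 free_coprod_matched matched_mult matched_1)+

lemma Delta_gs: "Delta al = Dal" "Delta be = Dbe" "Delta ga = Dga" "Delta de = Dde"
  unfolding gs_def map_fun_def by (simp_all add: Delta_cop cop_gn)

lemma tev_Delta: "good q \<Longrightarrow> tev q (Delta x) = coprod q (ev q x)"
proof -
  assume q: "good q"
  define r where "r = rep_sl2 x"
  have x: "x = abs_sl2 r" unfolding r_def by (rule Quotient_abs_rep[OF Quotient_sl2, symmetric])
  have "tensor_cls q (free_coprod y) = tensor_cls q (free_coprod (r q))" if "y \<in> cls q (r q)" for y
    using free_coprod_ideal[OF q, of "y - r q"] that by (simp add: mem_cls tensor_cls_eq_iff free_coprod_diff)
  moreover have "r q \<in> cls q (r q)" by (simp add: mem_cls SL2_ideal_0)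
  ultimately have "coprod q (cls q (r q)) = tensor_cls q (free_coprod (r q))"
    unfolding coprod_def by blast
  moreover have "ev q x = cls q (r q)" using q by (simp add: x ev.abs_eq)
  moreover have "tev q (Delta x) = tensor_cls q (free_coprod (r q))"
    unfolding x Delta_cop cop_def using q by (subst tev.abs_eq) (simp_all add: free_coprod_matched)
  ultimately show ?thesis by simp
qed

section \<open>Uniqueness of expansions in gamma^(N-j) alpha^j\<close>

lemma abs_tsl2_sum:
  assumes "finite A" "\<And>j q. j \<in> A \<Longrightarrow> T j q \<in> matched"
  shows "(\<Sum>j\<in>A. abs_tsl2 (T j)) = abs_tsl2 (\<lambda>q. \<Sum>j\<in>A. T j q)"
  using assms
proof (induction A rule: finite_induct)
  case (insert a A)
  have "(\<Sum>j\<in>A. T j q) \<in> matched" for q using insert by (intro matched_sum) auto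
  thus ?case using insert by (simp add: plus_tsl2.abs_eq)
qed (simp add: zero_tsl2_def)

lemma gs_power_abs: "gs g ^ n = abs_sl2 (\<lambda>_. gn g ^ n)"
proof (induction n)
  case 0 show ?case by (simp add: one_sl2_def)
next
  case (Suc n) thus ?case by (simp add: gs_def times_sl2.abs_eq)
qed

lemma ga_al_abs: "ga ^ m * al ^ n = abs_sl2 (\<lambda>_. gn Ga ^ m * gn Al ^ n)"
  by (simp add: gs_power_abs times_sl2.abs_eq)

lemma free_comp_power: "x \<in> free_comp a b \<Longrightarrow> x ^ n \<in> free_comp (int n * a) (int n * b)"
  by (induction n) (auto intro!: free_comp_1 free_comp_mult simp: algebra_simps)

lemma ga_al_free: "j \<le> N \<Longrightarrow> gn Ga ^ (N - j) * gn Al ^ j \<in> free_lcomp (2 * int j - int N)"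
  by (rule free_comp_subset(2)[of _ _ "int N"],
      rule free_comp_mult[OF free_comp_power[OF free_comp_gens(3)] free_comp_power[OF free_comp_gens(1)]]) auto

lemma HR_diff:
  assumes "x \<in> HR c" "y \<in> HR c" shows "x - y \<in> HR c"
proof -
  obtain r s where "x = abs_sl2 r" "y = abs_sl2 s" and rs: "\<And>q. r q \<in> free_rcomp c" "\<And>q. s q \<in> free_rcomp c"
    using assms by (auto simp: HR_def)
  moreover have "r q - s q \<in> free_rcomp c" for q
    using rs[of q] Poly_Mapping.keys_diff[of "r q" "s q"] unfolding free_rcomp_def by blast
  ultimately show ?thesis by (auto simp: HR_def minus_sl2.abs_eq)
qed

lemma tn_unique_at:
  assumes x: "\<And>j. j \<le> N \<Longrightarrow> x j \<in> HR (2 * int j - int N)"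
    and q: "good q" and eq: "tev q (\<Sum>j\<le>N. tn (x j) (ga ^ (N - j) * al ^ j)) = tev q 0"
    and i: "i \<le> N"
  shows "ev q (x i) = ev q 0"
proof -
  have "\<forall>j\<in>{..N}. \<exists>r. x j = abs_sl2 r \<and> (\<forall>q. r q \<in> free_rcomp (2 * int j - int N))"
    using x by (auto simp: HR_def)
  then obtain r where r: "\<And>j. j \<le> N \<Longrightarrow> x j = abs_sl2 (r j)" "\<And>j q. j \<le> N \<Longrightarrow> r j q \<in> free_rcomp (2 * int j - int N)"
    unfolding bchoice_iff by auto
  let ?m = "\<lambda>j. gn Ga ^ (N - j) * gn Al ^ j"
  have "tn (x j) (ga ^ (N - j) * al ^ j) = abs_tsl2 (\<lambda>q. tens (r j q) (?m j))" if "j \<le> N" for j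
    unfolding r(1)[OF that] ga_al_abs tn.abs_eq by (simp add: tmatch_tens[OF r(2)[OF that] ga_al_free[OF that]])
  hence "(\<Sum>j\<le>N. tn (x j) (ga ^ (N - j) * al ^ j)) = (\<Sum>j\<le>N. abs_tsl2 (\<lambda>q. tens (r j q) (?m j)))"
    by (intro sum.cong) auto
  also have "\<dots> = abs_tsl2 (\<lambda>q. \<Sum>j\<le>N. tens (r j q) (?m j))"
    by (rule abs_tsl2_sum) (auto intro: tens_matched[OF r(2) ga_al_free])
  finally have 0: "tev q (abs_tsl2 (\<lambda>q. \<Sum>j\<le>N. tens (r j q) (?m j))) = tev q 0" using eq by simp
  have "(\<Sum>j\<le>N. tens (r j q) (?m j)) \<in> matched" for q
    by (intro matched_sum tens_matched[OF r(2) ga_al_free]) auto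
  hence "tev q (abs_tsl2 (\<lambda>q. \<Sum>j\<le>N. tens (r j q) (?m j))) = tensor_cls q (\<Sum>j\<le>N. tens (r j q) (?m j))"
    using q by (subst tev.abs_eq) auto
  hence "tensor_cls q (\<Sum>j\<le>N. tens (r j q) (?m j)) = tensor_cls q 0"
    unfolding 0 using q by (simp add: tev_hom tensor_cls_0)
  hence "(\<Sum>j\<le>N. tens (r j q) (?m j)) \<in> tensor_ideal q" by (simp add: tensor_cls_eq_iff)
  hence "r i q \<in> SL2_ideal q" using tens_Ga_Al_unique[of q "\<lambda>j. r j q" N i] q i by auto
  hence "cls q (r i q) = cls q 0" by (simp add: cls_eq_iff)
  thus ?thesis using q by (simp add: r(1)[OF i] ev.abs_eq zero_sl2_def)
qed

lemma tev_diff_eq: "good q \<Longrightarrow> tev q A = tev q B \<Longrightarrow> tev q (A - B) = tev q 0"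
  using tev_hom(1)[of q A "- B"] tev_hom(1)[of q B "- B"] by simp

lemma ev_diff_eq: "good q \<Longrightarrow> ev q (x - y) = ev q 0 \<Longrightarrow> ev q x = ev q y"
  using ev_hom(1)[of q "x - y" y] ev_hom(1)[of q 0 y] by simp

text \<open>The version at a single \<open>q\<close> serves the definite description in
  \<open>mat_elt\<close>; the version for families below serves the recurrences.\<close>

lemma tn_unique_ev:
  assumes x: "\<And>j. j \<le> N \<Longrightarrow> x j \<in> HR (2 * int j - int N)" and y: "\<And>j. j \<le> N \<Longrightarrow> y j \<in> HR (2 * int j - int N)"
    and q: "good q" and i: "i \<le> N"
    and eq: "tev q (\<Sum>j\<le>N. tn (x j) (ga ^ (N - j) * al ^ j)) = tev q (\<Sum>j\<le>N. tn (y j) (ga ^ (N - j) * al ^ j))"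
  shows "ev q (x i) = ev q (y i)"
proof (rule ev_diff_eq[OF q])
  have "tev q (\<Sum>j\<le>N. tn (x j - y j) (ga ^ (N - j) * al ^ j)) = tev q 0"
    unfolding tn_diff_left sum_subtractf by (rule tev_diff_eq[OF q eq])
  from tn_unique_at[OF HR_diff[OF x y] q this i] show "ev q (x i - y i) = ev q 0" .
qed

lemma tn_unique:
  assumes x: "\<And>j. j \<le> N \<Longrightarrow> x j \<in> HR (2 * int j - int N)" and y: "\<And>j. j \<le> N \<Longrightarrow> y j \<in> HR (2 * int j - int N)"
    and eq: "(\<Sum>j\<le>N. tn (x j) (ga ^ (N - j) * al ^ j)) = (\<Sum>j\<le>N. tn (y j) (ga ^ (N - j) * al ^ j))"
    and i: "i \<le> N"
  shows "x i = y i"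
  using tn_unique_ev[OF x y _ i] eq by (intro sl2_eqI) simp

section \<open>Contiguous relations for Askey--Wilson polynomials\<close>

text \<open>Inverse of a unit in a commutative ring that need not be a field; meaningful for
  \<open>x dvd 1\<close> only.\<close>

definition iv :: "'a::comm_ring_1 \<Rightarrow> 'a" where "iv x = (THE y. x * y = 1)"

lemma iv_unique: "x * y = 1 \<Longrightarrow> iv x = y"
  unfolding iv_def by (rule the_equality) (auto, metis mult.assoc mult.commute mult_1)

lemma iv: "x dvd 1 \<Longrightarrow> x * iv x = 1"
  by (metis dvd_def iv_unique)

lemma iv_mult: "x dvd 1 \<Longrightarrow> y dvd 1 \<Longrightarrow> iv (x * y) = iv x * iv y"
  by (rule iv_unique) (metis iv mult.assoc mult.commute mult_1)

definition qp :: "'a::comm_ring_1 \<Rightarrow> 'a \<Rightarrow> nat \<Rightarrow> 'a" where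
  "qp a p n = (\<Prod>i<n. 1 - a * p ^ i)"

text \<open>For $z = 2\cos\theta$ this is $(1 - ae^{i\theta})(1 - ae^{-i\theta})$.\<close>

definition qq :: "'a::comm_ring_1 \<Rightarrow> 'a \<Rightarrow> 'a" where
  "qq a z = 1 - a * z + a * a"

definition qp2 :: "'a::comm_ring_1 \<Rightarrow> 'a \<Rightarrow> 'a \<Rightarrow> nat \<Rightarrow> 'a" where
  "qp2 a z p n = (\<Prod>i<n. qq (a * p ^ i) z)"

lemma qp_0 [simp]: "qp a p 0 = 1" and qp_Suc: "qp a p (Suc n) = qp a p n * (1 - a * p ^ n)"
  by (simp_all add: qp_def)

lemma qp2_0 [simp]: "qp2 a z p 0 = 1" and qp2_Suc: "qp2 a z p (Suc n) = qp2 a z p n * qq (a * p ^ n) z"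
  by (simp_all add: qp2_def)

lemma qp_add: "qp a p (m + n) = qp a p m * qp (a * p ^ m) p n"
  by (induction n) (simp_all add: qp_Suc power_add mult_ac)

lemma qp_Suc': "qp a p (Suc n) = (1 - a) * qp (a * p) p n"
  using qp_add[of a p 1 n] by (simp add: qp_Suc)

lemma qp_unit: "(\<And>i. i < n \<Longrightarrow> (1 - a * p ^ i) dvd 1) \<Longrightarrow> qp a p n dvd 1"
proof (induction n)
  case (Suc n)
  hence "qp a p n dvd 1" "(1 - a * p ^ n) dvd 1" by auto
  thus ?case unfolding qp_Suc using mult_dvd_mono[of "qp a p n" 1 "1 - a * p ^ n" 1] by simp
qed simp

text \<open>\<open>AWs n a b c d p (2 * cos \<theta>)\<close> is $a^n p_n(\cos\theta;a,b,c,d;p)$; the denominators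
  $(ab,ac,ad;p)_i$ are cancelled so that no inverses of them are needed.\<close>

definition AWc :: "nat \<Rightarrow> 'a::comm_ring_1 \<Rightarrow> 'a \<Rightarrow> 'a \<Rightarrow> 'a \<Rightarrow> 'a \<Rightarrow> nat \<Rightarrow> 'a" where
  "AWc n a b c d p i = qp (iv (p ^ n)) p i * qp (a * b * c * d * p ^ (n - 1)) p i * iv (qp p p i) * p ^ i
     * (qp (a * b * p ^ i) p (n - i) * qp (a * c * p ^ i) p (n - i) * qp (a * d * p ^ i) p (n - i))"

definition AWs :: "nat \<Rightarrow> 'a::comm_ring_1 \<Rightarrow> 'a \<Rightarrow> 'a \<Rightarrow> 'a \<Rightarrow> 'a \<Rightarrow> 'a \<Rightarrow> 'a" where
  "AWs n a b c d p z = (\<Sum>i\<le>n. AWc n a b c d p i * qp2 a z p i)"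

text \<open>With the other denominators cancelled, the terminating series divides only by powers of
  the base and by (p;p)_i; the assumptions make these units. Inside the locale \<open>ip n\<close>
  is p^(-n).\<close>

locale aw_base =
  fixes p :: "'a::comm_ring_1"
  assumes p_unit: "p dvd 1" and qp_p_unit: "(1 - p ^ Suc i) dvd 1"
begin

definition "ip n = iv (p ^ n)"

lemma ip: "p ^ n * ip n = 1" unfolding ip_def
  by (rule iv) (metis dvd_power_same p_unit power_one)

lemma ip_Suc: "ip (Suc n) * p = ip n"
  by (metis ip mult.assoc mult.commute mult_1 power_Suc)

lemma ip_0: "ip 0 = 1" using ip[of 0] by simp

lemma qp_pp_unit: "qp p p i dvd 1"
  by (rule qp_unit) (use qp_p_unit in simp)

lemma qp_ip_Suc: "qp (ip (Suc n)) p (Suc j) = (1 - ip (Suc n)) * qp (ip n) p j"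
  by (simp add: qp_Suc' ip_Suc)

lemma iv_qp_Suc: "iv (qp p p j) = iv (qp p p (Suc j)) * (1 - p ^ Suc j)"
proof (rule iv_unique)
  have "qp p p j * (iv (qp p p (Suc j)) * (1 - p ^ Suc j)) = qp p p (Suc j) * iv (qp p p (Suc j))"
    by (simp add: qp_Suc mult_ac)
  thus "qp p p j * (iv (qp p p (Suc j)) * (1 - p ^ Suc j)) = 1"
    using iv[OF qp_pp_unit[of "Suc j"]] by simp
qed

lemma AWc_ip: "AWc n a b c d p i = qp (ip n) p i * qp (a * b * c * d * p ^ (n - 1)) p i * iv (qp p p i) * p ^ i
     * (qp (a * b * p ^ i) p (n - i) * qp (a * c * p ^ i) p (n - i) * qp (a * d * p ^ i) p (n - i))"
  by (simp add: AWc_def ip_def)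

lemma AWc_beyond: "AWc n a b c d p (Suc n) = 0"
proof -
  have "qp (ip n) p (Suc n) = 0" unfolding qp_Suc using ip[of n] by (simp add: mult.commute)
  thus ?thesis by (simp add: AWc_ip)
qed

text \<open>As a function of z, \<open>qq b z\<close> is affine, hence a multiple of
  \<open>qq (a * p ^ i) z\<close>, the factor that extends the basis element, plus a constant. The
  multiple is the ratio of the coefficients of z. The constant is the value (1 - b w)(1 - b/w) at z
  = w + 1/w with w = a p^i, where the extending factor vanishes.\<close>

lemma qq_qp2:
  assumes a: "a * ai = 1"
  shows "qq b z * qp2 a z p i = b * ai * ip i * qp2 a z p (Suc i) + (1 - a * b * p ^ i) * (1 - b * ai * ip i) * qp2 a z p i"
proof -
  have x: "(a * p ^ i) * (ai * ip i) = 1" using a ip[of i] by (metis (no_types, lifting) mult.assoc mult.commute mult_1)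
  define A1 where "A1 = a * p ^ i"
  define B1 where "B1 = ai * ip i"
  have AB: "A1 * B1 = 1" using x by (simp add: A1_def B1_def)
  have AB': "A1 * (B1 * y) = y" for y using AB by (simp flip: mult.assoc)
  have "qq b z = b * B1 * qq A1 z + (1 - A1 * b) * (1 - b * B1)"
  proof -
    have "b * B1 * qq A1 z + (1 - A1 * b) * (1 - b * B1) =
      b * B1 - b * (A1 * B1) * z + b * A1 * (A1 * B1) + 1 - A1 * b - b * B1 + b * b * (A1 * B1)"
      by (simp add: qq_def algebra_simps)
    thus ?thesis unfolding AB by (simp add: qq_def algebra_simps)
  qed
  hence "qq b z * qp2 a z p i = (b * B1 * qq A1 z + (1 - A1 * b) * (1 - b * B1)) * qp2 a z p i" by simp
  thus ?thesis unfolding qp2_Suc A1_def B1_def by (simp add: algebra_simps)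
qed

text \<open>Multiplication of \<open>AWs\<close> by a quadratic factor, expanded in the same basis.\<close>

definition "AWm n a ai b' c' d' h i =
  (case i of 0 \<Rightarrow> 0 | Suc j \<Rightarrow> AWc n a b' c' d' p j * (h * ai * ip j))
     + AWc n a b' c' d' p i * ((1 - a * h * p ^ i) * (1 - h * ai * ip i))"

lemma qq_AWs:
  assumes a: "a * ai = 1"
  shows "qq h z * AWs n a b' c' d' p z = (\<Sum>i\<le>Suc n. AWm n a ai b' c' d' h i * qp2 a z p i)"
proof -
  let ?K = "AWc n a b' c' d' p" and ?P = "qp2 a z p"
  have "qq h z * AWs n a b' c' d' p z = (\<Sum>i\<le>n. ?K i * (qq h z * ?P i))"
    unfolding AWs_def sum_distrib_left by (simp add: mult_ac)
  also have "\<dots> = (\<Sum>i\<le>n. ?K i * (h * ai * ip i) * ?P (Suc i)) + (\<Sum>i\<le>n. ?K i * ((1 - a * h * p ^ i) * (1 - h * ai * ip i)) * ?P i)"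
    unfolding qq_qp2[OF a] sum.distrib[symmetric] by (intro sum.cong) (simp_all add: algebra_simps)
  also have "(\<Sum>i\<le>n. ?K i * ((1 - a * h * p ^ i) * (1 - h * ai * ip i)) * ?P i) =
     (\<Sum>i\<le>Suc n. ?K i * ((1 - a * h * p ^ i) * (1 - h * ai * ip i)) * ?P i)"
    by (simp add: AWc_beyond)
  also have "(\<Sum>i\<le>n. ?K i * (h * ai * ip i) * ?P (Suc i)) =
    (\<Sum>i\<le>Suc n. (case i of 0 \<Rightarrow> 0 | Suc j \<Rightarrow> ?K j * (h * ai * ip j)) * ?P i)"
    unfolding sum.atMost_Suc_shift by simp
  finally show ?thesis by (simp only: AWm_def sum.distrib[symmetric] distrib_right)
qed

text \<open>What remains of the first contiguous relation at an interior index j + 1 after removal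
  of a common factor. Here x = p^j, y = p^n, w = p^(j-n), \<beta> and \<gamma> are b and c divided
  by a x, and \<open>p'\<close> is the base.\<close>

lemma poly_E5_mid:
  fixes a \<beta> \<gamma> d w y x p' :: 'a
  assumes "x = w * y" "b = \<beta> * (a * x)" "c = \<gamma> * (a * x)"
  shows "(\<beta> - \<gamma>) * (p' * x - w) * (1 - a * b * c * d * x * y) * (1 - a * d * y) =
    (1 - b * d * y) * ((1 - p' * x) * (1 - a * b * x) * (1 - a * d * x) * \<gamma> + (1 - w) * (1 - a * b * c * d * x * y) * (p' - \<gamma>))
  - (1 - c * d * y) * ((1 - p' * x) * (1 - a * c * x) * (1 - a * d * x) * \<beta> + (1 - w) * (1 - a * b * c * d * x * y) * (p' - \<beta>))"
  unfolding assms by (simp add: algebra_simps)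

text \<open>The same for the second contiguous relation, in the same notation, with \<open>D\<close>
  the parameter that is multiplied by the base.\<close>

lemma poly_E3_mid:
  fixes a \<beta> D w y x p' :: 'a
  assumes "x = w * y" "b = \<beta> * (a * x)" "e = a * b * c * D"
  shows "(1 - b * D * p' * y) * (1 - e * y) * (1 - a * D * p' * x) - (1 - b * D) * (1 - e * p' * x * y) * (1 - a * D * p' * y) =
    y * (a * D * ((1 - p' * x) * (1 - a * c * x) * (1 - a * D * p' * x) * \<beta> + (1 - w) * (1 - e * p' * x * y) * (p' - \<beta>)))"
  unfolding assms by (simp add: algebra_simps)

lemma AWc_swap: "AWc n a b c d p i = AWc n a c b d p i" "AWc n a b c d p i = AWc n a b d c p i"
  unfolding AWc_def by (simp_all only: mult_ac)

lemma ip_add: "ip (m + n) * p ^ m = ip n"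
proof -
  have "ip (m + n) * p ^ m = ip (m + n) * p ^ m * (p ^ n * ip n)" by (simp add: ip)
  also have "\<dots> = (p ^ (m + n) * ip (m + n)) * ip n" by (simp only: power_add mult_ac)
  also have "\<dots> = ip n" by (simp add: ip)
  finally show ?thesis .
qed

text \<open>This and the next two lemmas extract one and the same factor from the coefficients of
  the polynomials in the first relation; comparing coefficients then becomes a polynomial identity
  in powers of p and the parameters.\<close>

lemma AWc_top_step:
  assumes n: "n = Suc (j + r)"
  shows "AWc (Suc n) a b c d p (Suc j) =
    (qp (ip n) p j * qp (a * b * c * d * p ^ n) p j * iv (qp p p (Suc j)) * p ^ j
      * (qp (a * b * p ^ Suc j) p r * qp (a * c * p ^ Suc j) p r * qp (a * d * p ^ Suc j) p r))
    * ((1 - ip (Suc n)) * p * (1 - a * b * c * d * p ^ n * p ^ j) * ((1 - a * b * p ^ n) * (1 - a * c * p ^ n) * (1 - a * d * p ^ n)))"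
proof -
  have y: "h * p ^ Suc j * p ^ r = h * p ^ n" for h unfolding n by (simp add: power_add mult_ac)
  have d: "Suc n - 1 = n" "Suc n - Suc j = Suc r" using n by auto
  show ?thesis
    unfolding AWc_ip d qp_ip_Suc qp_Suc[of "a * b * c * d * p ^ n" p j] qp_Suc[of _ p r] y
    by (simp only: mult_ac power_Suc)
qed

lemma AWc_low_step:
  assumes n: "n = Suc (j + r)"
  shows "AWc n a b (c * p) d p j =
    (qp (ip n) p j * qp (a * b * c * d * p ^ n) p j * iv (qp p p (Suc j)) * p ^ j
      * (qp (a * b * p ^ Suc j) p r * qp (a * c * p ^ Suc j) p r * qp (a * d * p ^ Suc j) p r))
    * ((1 - p ^ Suc j) * (1 - a * b * p ^ j) * (1 - a * c * p ^ n) * (1 - a * d * p ^ j))"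
proof -
  have e: "a * b * (c * p) * d * p ^ (n - 1) = a * b * c * d * p ^ n"
    unfolding n by (simp add: mult_ac)
  have y: "h * p ^ Suc j * p ^ r = h * p ^ n" for h unfolding n by (simp add: power_add mult_ac)
  have s: "h * p ^ j * p = h * p ^ Suc j" "a * (c * p) * p ^ j = a * c * p ^ Suc j" for h by (simp_all add: mult_ac)
  have d: "n - j = Suc r" using n by auto
  show ?thesis
    unfolding AWc_ip d e iv_qp_Suc[of j] s(2) qp_Suc[of "a * c * p ^ Suc j" p r] qp_Suc'[of "a * b * p ^ j" p r] qp_Suc'[of "a * d * p ^ j" p r] s(1) y
    by (simp only: mult_ac)
qed

text \<open>The product of the factors 1 - a c p^i runs over a range shifted by one. Multiplying by
  the missing first factor exchanges it for the last one, and this multiplier is exactly what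
  \<open>AWm\<close> supplies.\<close>

lemma AWc_mid_step:
  assumes n: "n = Suc (j + r)"
  shows "AWc n a b (c * p) d p (Suc j) * (1 - a * c * p ^ Suc j) =
    (qp (ip n) p j * qp (a * b * c * d * p ^ n) p j * iv (qp p p (Suc j)) * p ^ j
      * (qp (a * b * p ^ Suc j) p r * qp (a * c * p ^ Suc j) p r * qp (a * d * p ^ Suc j) p r))
    * ((1 - ip (Suc r)) * p * (1 - a * b * c * d * p ^ n * p ^ j) * (1 - a * c * p ^ n))"
proof -
  have e: "a * b * (c * p) * d * p ^ (n - 1) = a * b * c * d * p ^ n"
    unfolding n by (simp add: mult_ac)
  have y: "a * c * p ^ Suc j * p ^ r = a * c * p ^ n" unfolding n by (simp add: power_add mult_ac)
  have s: "a * (c * p) * p ^ Suc j = a * c * p ^ Suc j * p" by (simp_all add: mult_ac)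
  have d: "n - Suc j = r" using n by auto
  have w: "ip n * p ^ j = ip (Suc r)" using ip_add[of j "Suc r"] n by simp
  have q: "qp (a * c * p ^ Suc j * p) p r * (1 - a * c * p ^ Suc j) = qp (a * c * p ^ Suc j) p r * (1 - a * c * p ^ n)"
    using qp_Suc'[of "a * c * p ^ Suc j" p r] qp_Suc[of "a * c * p ^ Suc j" p r] unfolding y by (simp add: mult.commute)
  have "AWc n a b (c * p) d p (Suc j) * (1 - a * c * p ^ Suc j) =
    (qp (ip n) p j * (1 - ip (Suc r))) * (qp (a * b * c * d * p ^ n) p j * (1 - a * b * c * d * p ^ n * p ^ j)) * iv (qp p p (Suc j)) * (p * p ^ j)
      * (qp (a * b * p ^ Suc j) p r * (qp (a * c * p ^ Suc j * p) p r * (1 - a * c * p ^ Suc j)) * qp (a * d * p ^ Suc j) p r)"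
    unfolding AWc_ip d e s qp_Suc[of "ip n" p j] qp_Suc[of "a * b * c * d * p ^ n" p j] w
    by (simp only: mult_ac power_Suc)
  thus ?thesis unfolding q by (simp only: mult_ac)
qed

lemma AWm_mid:
  assumes n: "n = Suc (j + r)"
  shows "AWm n a ai b (c * p) d c (Suc j) =
    (qp (ip n) p j * qp (a * b * c * d * p ^ n) p j * iv (qp p p (Suc j)) * p ^ j
      * (qp (a * b * p ^ Suc j) p r * qp (a * c * p ^ Suc j) p r * qp (a * d * p ^ Suc j) p r))
    * (1 - a * c * p ^ n) * ((1 - p * p ^ j) * (1 - a * b * p ^ j) * (1 - a * d * p ^ j) * (c * ai * ip j)
        + (1 - ip (Suc r)) * (1 - a * b * c * d * p ^ j * p ^ n) * (p - c * ai * ip j))"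
    (is "_ = ?T * ?C * _")
proof -
  have "AWm n a ai b (c * p) d c (Suc j) = AWc n a b (c * p) d p j * (c * ai * ip j)
    + AWc n a b (c * p) d p (Suc j) * (1 - a * c * p ^ Suc j) * (1 - c * ai * ip (Suc j))"
    by (simp add: AWm_def mult.assoc)
  also have "\<dots> = ?T * ?C * ((1 - p ^ Suc j) * (1 - a * b * p ^ j) * (1 - a * d * p ^ j) * (c * ai * ip j)
     + (1 - ip (Suc r)) * (1 - a * b * c * d * p ^ n * p ^ j) * (p * (1 - c * ai * ip (Suc j))))"
    unfolding AWc_low_step[OF n] AWc_mid_step[OF n] distrib_left[of "?T * ?C"] by (simp only: mult_ac)
  also have "p * (1 - c * ai * ip (Suc j)) = p - c * ai * ip j"
    unfolding ip_Suc[of j, symmetric] by (simp add: algebra_simps)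
  finally show ?thesis by (simp only: power_Suc mult_ac)
qed

lemma E5_combine: "(T * (B * C)) * (P * U - Q * V) = B * P * (T * C * U) - Q * C * (T * B * V)" for T :: 'a
  by (simp add: algebra_simps)

lemma AWc_E5_mid:
  assumes a: "a * ai = 1" and n: "n = Suc (j + r)"
  shows "(b - c) * ai * AWc (Suc n) a b c d p (Suc j) =
    (1 - a * b * p ^ n) * (1 - b * d * p ^ n) * AWm n a ai b (c * p) d c (Suc j)
  - (1 - c * d * p ^ n) * (1 - a * c * p ^ n) * AWm n a ai (b * p) c d b (Suc j)"
proof -
  define x where "x = p ^ j"
  define y where "y = p ^ n"
  define w where "w = ip (Suc r)"
  define \<beta> where "\<beta> = b * ai * ip j"
  define \<gamma> where "\<gamma> = c * ai * ip j"
  define T where "T = qp (ip n) p j * qp (a * b * c * d * y) p j * iv (qp p p (Suc j)) * x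
      * (qp (a * b * p ^ Suc j) p r * qp (a * c * p ^ Suc j) p r * qp (a * d * p ^ Suc j) p r)"
  have xw: "x = w * y"
  proof -
    have "y = p ^ Suc r * x" unfolding y_def x_def n by (simp add: power_add mult_ac)
    thus ?thesis using ip[of "Suc r"] unfolding w_def by (metis mult.assoc mult.commute mult_1)
  qed
  have ax: "ai * ip j * (a * x) = 1" using a ip[of j] unfolding x_def by (metis (no_types, lifting) mult.assoc mult.commute mult_1)
  have b: "b = \<beta> * (a * x)" unfolding \<beta>_def using ax by (metis mult.assoc mult.commute mult_1)
  have c: "c = \<gamma> * (a * x)" unfolding \<gamma>_def using ax by (metis mult.assoc mult.commute mult_1)
  have sw: "AWm n a ai (b * p) c d b (Suc j) = AWm n a ai c (b * p) d b (Suc j)"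
    unfolding AWm_def by (simp only: AWc_swap(1)[of n a "b * p" c d] nat.case)
  have T': "qp (ip n) p j * qp (a * c * b * d * y) p j * iv (qp p p (Suc j)) * x
      * (qp (a * c * p ^ Suc j) p r * qp (a * b * p ^ Suc j) p r * qp (a * d * p ^ Suc j) p r) = T"
    unfolding T_def by (simp only: mult_ac)
  have M1: "AWm n a ai b (c * p) d c (Suc j) = T * (1 - a * c * y) * ((1 - p * x) * (1 - a * b * x) * (1 - a * d * x) * \<gamma>
        + (1 - w) * (1 - a * b * c * d * x * y) * (p - \<gamma>))"
    unfolding AWm_mid[OF n] T_def x_def y_def w_def \<gamma>_def ..
  have M2: "AWm n a ai (b * p) c d b (Suc j) = T * (1 - a * b * y) * ((1 - p * x) * (1 - a * c * x) * (1 - a * d * x) * \<beta>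
        + (1 - w) * (1 - a * b * c * d * x * y) * (p - \<beta>))"
    unfolding sw AWm_mid[OF n] unfolding x_def[symmetric] y_def[symmetric] w_def[symmetric] \<beta>_def[symmetric] T'
    by (simp only: mult_ac)
  have K: "AWc (Suc n) a b c d p (Suc j) = T * ((1 - ip (Suc n)) * p * (1 - a * b * c * d * x * y) * ((1 - a * b * y) * (1 - a * c * y) * (1 - a * d * y)))"
    unfolding AWc_top_step[OF n] T_def x_def y_def by (simp only: mult_ac)
  have u: "(b - c) * ai = (\<beta> - \<gamma>) * x"
  proof -
    have "\<beta> * x = b * ai" "\<gamma> * x = c * ai" unfolding \<beta>_def \<gamma>_def x_def using ip[of j] by (simp_all add: mult_ac)
    thus ?thesis by (simp add: algebra_simps)
  qed
  have v: "x * ((1 - ip (Suc n)) * p) = p * x - w"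
  proof -
    have "x * ip n = w" unfolding x_def w_def n using ip_add[of j "Suc r"] by (simp add: mult.commute)
    thus ?thesis using ip_Suc[of n] by (simp add: algebra_simps)
  qed
  have "(b - c) * ai * AWc (Suc n) a b c d p (Suc j) = (\<beta> - \<gamma>) * (x * ((1 - ip (Suc n)) * p)) *
     (T * (1 - a * b * c * d * x * y) * ((1 - a * b * y) * (1 - a * c * y) * (1 - a * d * y)))"
    unfolding K u by (simp only: mult_ac)
  hence "(b - c) * ai * AWc (Suc n) a b c d p (Suc j) =
    (T * ((1 - a * b * y) * (1 - a * c * y))) * ((\<beta> - \<gamma>) * (p * x - w) * (1 - a * b * c * d * x * y) * (1 - a * d * y))"
    unfolding v by (simp only: mult_ac)
  also have "\<dots> = (1 - a * b * y) * (1 - b * d * y) * AWm n a ai b (c * p) d c (Suc j)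
     - (1 - c * d * y) * (1 - a * c * y) * AWm n a ai (b * p) c d b (Suc j)"
    unfolding poly_E5_mid[OF xw b c] M1 M2 by (rule E5_combine)
  finally show ?thesis unfolding y_def .
qed

lemma iv_1: "iv (1 :: 'a) = 1"
  by (rule iv_unique) simp

lemma AWc_0: "AWc n a b c d p 0 = qp (a * b) p n * qp (a * c) p n * qp (a * d) p n"
  by (simp add: AWc_def iv_1)

lemma AWm_0:
  "AWm n a ai b (c * p) d c 0 = qp (a * b) p n * qp (a * c) p n * qp (a * d) p n * (1 - a * c * p ^ n) * (1 - c * ai)"
proof -
  have "AWm n a ai b (c * p) d c 0 = qp (a * b) p n * (qp (a * c * p) p n * (1 - a * c)) * qp (a * d) p n * (1 - c * ai)"
    by (simp add: AWm_def AWc_0 ip_0 mult_ac)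
  also have "qp (a * c * p) p n * (1 - a * c) = qp (a * c) p n * (1 - a * c * p ^ n)"
    using qp_Suc'[of "a * c" p n] by (simp add: qp_Suc mult.commute)
  finally show ?thesis by (simp only: mult_ac)
qed

lemma AWm_swap: "AWm n a ai b c d h i = AWm n a ai c b d h i"
  unfolding AWm_def by (cases i) (simp_all only: AWc_swap(1)[of n a b c d] nat.case)

text \<open>The indices 0 and n + 1 are treated apart from the interior ones, because there only one
  of the two terms of \<open>AWm\<close> survives.\<close>

lemma AWc_E5_0:
  assumes a: "a * ai = 1"
  shows "(b - c) * ai * AWc (Suc n) a b c d p 0 =
    (1 - a * b * p ^ n) * (1 - b * d * p ^ n) * AWm n a ai b (c * p) d c 0
  - (1 - c * d * p ^ n) * (1 - a * c * p ^ n) * AWm n a ai (b * p) c d b 0"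
proof -
  define \<beta> where "\<beta> = b * ai"
  define \<gamma> where "\<gamma> = c * ai"
  define T where "T = qp (a * b) p n * qp (a * c) p n * qp (a * d) p n"
  have b: "b = \<beta> * a" unfolding \<beta>_def using a by (metis mult.assoc mult.commute mult_1)
  have c: "c = \<gamma> * a" unfolding \<gamma>_def using a by (metis mult.assoc mult.commute mult_1)
  have T': "qp (a * c) p n * qp (a * b) p n * qp (a * d) p n = T" by (simp only: T_def mult_ac)
  have "(b - c) * ai = \<beta> - \<gamma>" by (simp add: \<beta>_def \<gamma>_def algebra_simps)
  hence "(b - c) * ai * AWc (Suc n) a b c d p 0 =
     (T * ((1 - a * b * p ^ n) * (1 - a * c * p ^ n))) * ((\<beta> - \<gamma>) * (1 - a * d * p ^ n))"
    unfolding AWc_0 qp_Suc T_def by (simp only: mult_ac)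
  also have "(\<beta> - \<gamma>) * (1 - a * d * p ^ n) = (1 - b * d * p ^ n) * (1 - \<gamma>) - (1 - c * d * p ^ n) * (1 - \<beta>)"
    unfolding b c by (simp add: algebra_simps)
  also have "(T * ((1 - a * b * p ^ n) * (1 - a * c * p ^ n))) * ((1 - b * d * p ^ n) * (1 - \<gamma>) - (1 - c * d * p ^ n) * (1 - \<beta>))
     = (1 - a * b * p ^ n) * (1 - b * d * p ^ n) * AWm n a ai b (c * p) d c 0
     - (1 - c * d * p ^ n) * (1 - a * c * p ^ n) * AWm n a ai (b * p) c d b 0"
    unfolding AWm_swap[of n a ai "b * p"] AWm_0 T' unfolding T_def[symmetric] \<gamma>_def[symmetric] \<beta>_def[symmetric]
    by (rule E5_combine)
  finally show ?thesis .
qed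

lemma AWc_last:
  "AWc (Suc n) a b c d p (Suc n) = (qp (ip n) p n * qp (a * b * c * d * p ^ n) p n * iv (qp p p (Suc n)) * p ^ n)
     * ((1 - ip (Suc n)) * p * (1 - a * b * c * d * p ^ n * p ^ n))"
  unfolding AWc_ip qp_ip_Suc qp_Suc[of "a * b * c * d * p ^ (Suc n - 1)"] by (simp add: mult_ac)

lemma AWc_last_low:
  "AWc n a b (c * p) d p n = (qp (ip n) p n * qp (a * b * c * d * p ^ n) p n * iv (qp p p (Suc n)) * p ^ n) * (1 - p * p ^ n)"
proof -
  have "qp (a * b * (c * p) * d * p ^ (n - 1)) p n = qp (a * b * c * d * p ^ n) p n"
    by (cases n) (simp_all add: mult_ac)
  thus ?thesis unfolding AWc_ip iv_qp_Suc[of n] by (simp add: mult_ac)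
qed

lemma AWm_last: "AWm n a ai b c d h (Suc n) = AWc n a b c d p n * (h * ai * ip n)"
  unfolding AWm_def by (simp add: AWc_beyond)

lemma ip_Suc_p: "(1 - ip (Suc n)) * p = - ((1 - p * p ^ n) * ip n)"
proof -
  have "(1 - ip (Suc n)) * p = p - ip n" using ip_Suc[of n] by (simp add: algebra_simps)
  also have "p * p ^ n * ip n = p" using ip[of n] by (simp add: mult.assoc)
  hence "p - ip n = - ((1 - p * p ^ n) * ip n)" by (simp add: algebra_simps)
  finally show ?thesis .
qed

lemma AWc_E5_last:
  shows "(b - c) * ai * AWc (Suc n) a b c d p (Suc n) =
    (1 - a * b * p ^ n) * (1 - b * d * p ^ n) * AWm n a ai b (c * p) d c (Suc n)
  - (1 - c * d * p ^ n) * (1 - a * c * p ^ n) * AWm n a ai (b * p) c d b (Suc n)"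
proof -
  define T where "T = qp (ip n) p n * qp (a * b * c * d * p ^ n) p n * iv (qp p p (Suc n)) * p ^ n"
  have T': "qp (ip n) p n * qp (a * c * b * d * p ^ n) p n * iv (qp p p (Suc n)) * p ^ n = T"
    unfolding T_def by (simp only: mult_ac)
  define y where "y = p ^ n"
  define v where "v = (1 - p * y) * ip n * ai"
  have "(b - c) * ai * AWc (Suc n) a b c d p (Suc n) = (T * v) * ((c - b) * (1 - a * b * c * d * y * y))"
    unfolding AWc_last T_def[symmetric] ip_Suc_p v_def y_def by (simp add: algebra_simps)
  also have "(c - b) * (1 - a * b * c * d * y * y) = (1 - a * b * y) * (1 - b * d * y) * c - (1 - c * d * y) * (1 - a * c * y) * b"
    by (simp add: algebra_simps)
  also have "(T * v) * ((1 - a * b * y) * (1 - b * d * y) * c - (1 - c * d * y) * (1 - a * c * y) * b) =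
     (1 - a * b * y) * (1 - b * d * y) * (T * (1 - p * y) * (c * ai * ip n)) - (1 - c * d * y) * (1 - a * c * y) * (T * (1 - p * y) * (b * ai * ip n))"
    unfolding v_def right_diff_distrib[of "T * ((1 - p * y) * ip n * ai)"] by (simp only: mult_ac)
  finally show ?thesis
    unfolding AWm_last AWc_swap(1)[of n a "b * p"] AWc_last_low T' unfolding T_def[symmetric] y_def .
qed

lemma diff_mult_assoc: "(f * g - h * k) * x = f * (g * x) - h * (k * x)" for f :: 'a
  by (simp add: algebra_simps)

text \<open>All three polynomials keep the parameter a and can be expanded in the same basis (a e^{i
  theta}, a e^{-i theta}; p)_i, the quadratic factors being absorbed by \<open>AWm\<close>. The
  relation is then checked coefficient by coefficient.\<close>

lemma AWs_contiguous_bc: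
  assumes a: "a * ai = 1"
  shows "(b - c) * ai * AWs (Suc n) a b c d p z =
    (1 - a * b * p ^ n) * (1 - b * d * p ^ n) * (qq c z * AWs n a b (c * p) d p z)
  - (1 - c * d * p ^ n) * (1 - a * c * p ^ n) * (qq b z * AWs n a (b * p) c d p z)"
proof -
  have coeff: "(b - c) * ai * AWc (Suc n) a b c d p i =
      (1 - a * b * p ^ n) * (1 - b * d * p ^ n) * AWm n a ai b (c * p) d c i
    - (1 - c * d * p ^ n) * (1 - a * c * p ^ n) * AWm n a ai (b * p) c d b i" if "i \<le> Suc n" for i
  proof (cases i)
    case 0 thus ?thesis using AWc_E5_0[OF a] by simp
  next
    case (Suc j)
    show ?thesis
    proof (cases "j = n")
      case True thus ?thesis using AWc_E5_last Suc by simp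
    next
      case False
      hence "j < n" using that Suc by simp
      then obtain r where "n = Suc (j + r)" using less_imp_Suc_add by blast
      thus ?thesis using AWc_E5_mid[OF a] Suc by blast
    qed
  qed
  have "(b - c) * ai * AWs (Suc n) a b c d p z = (\<Sum>i\<le>Suc n. ((b - c) * ai * AWc (Suc n) a b c d p i) * qp2 a z p i)"
    unfolding AWs_def sum_distrib_left by (simp only: mult.assoc)
  also have "\<dots> = (\<Sum>i\<le>Suc n. (1 - a * b * p ^ n) * (1 - b * d * p ^ n) * (AWm n a ai b (c * p) d c i * qp2 a z p i)
    - (1 - c * d * p ^ n) * (1 - a * c * p ^ n) * (AWm n a ai (b * p) c d b i * qp2 a z p i))"
    by (intro sum.cong refl) (simp only: atMost_iff coeff diff_mult_assoc)
  also have "\<dots> = (1 - a * b * p ^ n) * (1 - b * d * p ^ n) * (qq c z * AWs n a b (c * p) d p z)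
    - (1 - c * d * p ^ n) * (1 - a * c * p ^ n) * (qq b z * AWs n a (b * p) c d p z)"
    unfolding qq_AWs[OF a] sum_distrib_left sum_subtractf ..
  finally show ?thesis .
qed

lemma E3_combine:
  fixes T :: 'a
  assumes "S2 - S1 = y * R" "(p' - v) * y = p' * y - 1"
  shows "T * ((p' - v) * S1) = (1 - p' * y) * (T * R) + T * ((p' - v) * S2)"
proof -
  have "T * ((p' - v) * S2) = T * ((p' - v) * S1) + T * (((p' - v) * y) * R)"
    using assms(1) by (simp add: algebra_simps)
  thus ?thesis unfolding assms(2) by (simp add: algebra_simps)
qed

lemma AWc_E3_mid:
  assumes a: "a * ai = 1" and n: "n = Suc (j + r)"
  shows "(1 - b * D) * AWc (Suc n) a b c (D * p) p (Suc j) =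
    (1 - p ^ Suc n) * (a * D) * (1 - a * c * p ^ n) * AWm n a ai (b * p) c (D * p) b (Suc j)
  + (1 - b * D * p ^ Suc n) * AWc (Suc n) a b c D p (Suc j)"
proof -
  define x where "x = p ^ j"
  define y where "y = p ^ n"
  define w where "w = ip (Suc r)"
  define v where "v = ip n"
  define e where "e = a * b * c * D"
  define \<beta> where "\<beta> = b * ai * ip j"
  define T where "T = qp (ip n) p j * qp (e * p * y) p j * iv (qp p p (Suc j)) * x
      * (qp (a * b * p ^ Suc j) p r * qp (a * c * p ^ Suc j) p r * qp (a * (D * p) * p ^ Suc j) p r)"
  define B C where "B = 1 - a * b * y" and "C = 1 - a * c * y"
  have xw: "x = w * y"
  proof -
    have "y = p ^ Suc r * x" unfolding y_def x_def n by (simp add: power_add mult_ac)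
    thus ?thesis using ip[of "Suc r"] unfolding w_def by (metis mult.assoc mult.commute mult_1)
  qed
  have ax: "ai * ip j * (a * x) = 1" using a ip[of j] unfolding x_def by (metis (no_types, lifting) mult.assoc mult.commute mult_1)
  have b: "b = \<beta> * (a * x)" unfolding \<beta>_def using ax by (metis mult.assoc mult.commute mult_1)
  have pv: "(1 - ip (Suc n)) * p = p - v" unfolding v_def using ip_Suc[of n] by (simp add: algebra_simps)
  have vy: "(p - v) * y = p * y - 1" unfolding v_def y_def using ip[of n] by (simp add: algebra_simps)
  have t_ga_de: "qp (ip n) p j * qp (a * b * c * (D * p) * p ^ n) p j * iv (qp p p (Suc j)) * p ^ j
      * (qp (a * b * p ^ Suc j) p r * qp (a * c * p ^ Suc j) p r * qp (a * (D * p) * p ^ Suc j) p r) = T"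
    unfolding T_def e_def x_def y_def by (simp only: mult_ac)
  have t_ga_al: "qp (ip n) p j * qp (a * c * b * (D * p) * p ^ n) p j * iv (qp p p (Suc j)) * p ^ j
      * (qp (a * c * p ^ Suc j) p r * qp (a * b * p ^ Suc j) p r * qp (a * (D * p) * p ^ Suc j) p r) = T"
    unfolding T_def e_def x_def y_def by (simp only: mult_ac)
  have K1: "AWc (Suc n) a b c (D * p) p (Suc j) = (T * (B * C)) * ((p - v) * ((1 - e * p * x * y) * (1 - a * D * p * y)))"
    unfolding AWc_top_step[OF n] t_ga_de pv unfolding B_def C_def e_def x_def y_def by (simp only: mult_ac)
  have M: "AWm n a ai (b * p) c (D * p) b (Suc j) = T * B * ((1 - p * x) * (1 - a * c * x) * (1 - a * D * p * x) * \<beta>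
        + (1 - w) * (1 - e * p * x * y) * (p - \<beta>))"
    unfolding AWm_swap[of n a ai "b * p"] AWm_mid[OF n] t_ga_al unfolding B_def e_def x_def y_def w_def \<beta>_def by (simp only: mult_ac)
  have K2: "AWc (Suc n) a b c D p (Suc j) = (T * (B * C)) * ((p - v) * ((1 - e * y) * (1 - a * D * p * x)))"
  proof -
    have y': "h * p ^ Suc j * p ^ r = h * y" for h unfolding n y_def by (simp add: power_add mult_ac)
    have d: "Suc n - 1 = n" "Suc n - Suc j = Suc r" using n by auto
    have "AWc (Suc n) a b c D p (Suc j) = ((1 - ip (Suc n)) * qp (ip n) p j) * ((1 - e * y) * qp (e * y * p) p j) * iv (qp p p (Suc j)) * (p * p ^ j)
      * ((qp (a * b * p ^ Suc j) p r * B) * (qp (a * c * p ^ Suc j) p r * C) * ((1 - a * D * p ^ Suc j) * qp (a * D * p ^ Suc j * p) p r))"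
      unfolding AWc_ip d qp_ip_Suc qp_Suc'[of "a * b * c * D * p ^ n" p j] qp_Suc[of "a * b * p ^ Suc j" p r]  qp_Suc[of "a * c * p ^ Suc j" p r]
         qp_Suc'[of "a * D * p ^ Suc j" p r] y' unfolding B_def C_def e_def y_def by (simp only: power_Suc)
    also have "\<dots> = (T * (B * C)) * (((1 - ip (Suc n)) * p) * ((1 - e * y) * (1 - a * D * p * x)))"
      unfolding T_def x_def by (simp only: mult_ac power_Suc)
    finally show ?thesis unfolding pv .
  qed
  let ?R = "(1 - p * x) * (1 - a * c * x) * (1 - a * D * p * x) * \<beta> + (1 - w) * (1 - e * p * x * y) * (p - \<beta>)"
  have "(T * (B * C)) * ((p - v) * ((1 - b * D) * (1 - e * p * x * y) * (1 - a * D * p * y))) =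
    (1 - p * y) * ((T * (B * C)) * (a * D * ?R)) + (T * (B * C)) * ((p - v) * ((1 - b * D * p * y) * (1 - e * y) * (1 - a * D * p * x)))"
    by (rule E3_combine[OF poly_E3_mid[OF xw b] vy]) (simp add: e_def)
  hence "(1 - b * D) * ((T * (B * C)) * ((p - v) * ((1 - e * p * x * y) * (1 - a * D * p * y)))) =
    (1 - p * y) * (a * D) * C * (T * B * ?R) + (1 - b * D * (p * y)) * ((T * (B * C)) * ((p - v) * ((1 - e * y) * (1 - a * D * p * x))))"
    by (simp only: mult_ac)
  thus ?thesis unfolding K1 K2 M unfolding C_def y_def power_Suc .
qed

lemma AWc_E3_0:
  assumes a: "a * ai = 1"
  shows "(1 - b * D) * AWc (Suc n) a b c (D * p) p 0 =
    (1 - p ^ Suc n) * (a * D) * (1 - a * c * p ^ n) * AWm n a ai (b * p) c (D * p) b 0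
  + (1 - b * D * p ^ Suc n) * AWc (Suc n) a b c D p 0"
proof -
  define \<beta> where "\<beta> = b * ai"
  define y where "y = p ^ n"
  define T where "T = qp (a * b) p n * qp (a * c) p n * qp (a * (D * p)) p n * ((1 - a * b * y) * (1 - a * c * y))"
  have b: "b = \<beta> * a" unfolding \<beta>_def using a by (metis mult.assoc mult.commute mult_1)
  have K1: "AWc (Suc n) a b c (D * p) p 0 = T * (1 - a * D * p * y)"
    unfolding AWc_0 qp_Suc T_def y_def by (simp only: mult_ac)
  have K2: "AWc (Suc n) a b c D p 0 = T * (1 - a * D)"
    unfolding AWc_0 qp_Suc[of "a * b"] qp_Suc[of "a * c"] qp_Suc'[of "a * D"] T_def y_def by (simp only: mult_ac)
  have M: "(1 - a * c * y) * AWm n a ai (b * p) c (D * p) b 0 = T * (1 - \<beta>)"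
    unfolding AWm_swap[of n a ai "b * p"] AWm_0 T_def y_def \<beta>_def by (simp only: mult_ac)
  have "(1 - b * D) * (1 - a * D * p * y) = (1 - p * y) * (a * D) * (1 - \<beta>) + (1 - b * D * (p * y)) * (1 - a * D)"
    unfolding b by (simp add: algebra_simps)
  hence "T * ((1 - b * D) * (1 - a * D * p * y)) = T * ((1 - p * y) * (a * D) * (1 - \<beta>)) + T * ((1 - b * D * (p * y)) * (1 - a * D))"
    by (simp only: distrib_left)
  hence "(1 - b * D) * (T * (1 - a * D * p * y)) = (1 - p * y) * (a * D) * (T * (1 - \<beta>)) + (1 - b * D * (p * y)) * (T * (1 - a * D))"
    by (simp only: mult_ac)
  thus ?thesis unfolding K1 K2 M[symmetric] unfolding y_def power_Suc by (simp only: mult.assoc)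
qed

lemma E3_last_combine:
  fixes T :: 'a
  assumes "- (P * E) = g * h * k * m - u * f"
  shows "P * (T * (- (k * v) * E)) = k * g * h * (T * (k * (m * v))) + u * (T * (- (k * v) * f))"
proof -
  have "P * (T * (- (k * v) * E)) = (T * k * v) * (- (P * E))" by (simp add: algebra_simps)
  thus ?thesis unfolding assms by (simp add: algebra_simps)
qed

lemma AWc_E3_last:
  assumes a: "a * ai = 1"
  shows "(1 - b * D) * AWc (Suc n) a b c (D * p) p (Suc n) =
    (1 - p ^ Suc n) * (a * D) * (1 - a * c * p ^ n) * AWm n a ai (b * p) c (D * p) b (Suc n)
  + (1 - b * D * p ^ Suc n) * AWc (Suc n) a b c D p (Suc n)"
proof -
  define \<beta> where "\<beta> = b * ai"
  define y where "y = p ^ n"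
  define v where "v = ip n"
  define e where "e = a * b * c * D"
  have b: "b = \<beta> * a" unfolding \<beta>_def using a by (metis mult.assoc mult.commute mult_1)
  define T where "T = qp (ip n) p n * qp (e * p * y) p n * iv (qp p p (Suc n)) * p ^ n"
  have t_ga_de: "qp (ip n) p n * qp (a * b * c * (D * p) * p ^ n) p n * iv (qp p p (Suc n)) * p ^ n = T"
    "qp (ip n) p n * qp (a * c * b * (D * p) * p ^ n) p n * iv (qp p p (Suc n)) * p ^ n = T"
    unfolding T_def e_def y_def by (simp_all only: mult_ac)
  have K1: "AWc (Suc n) a b c (D * p) p (Suc n) = T * (- ((1 - p * y) * v) * (1 - e * p * y * y))"
    unfolding AWc_last t_ga_de ip_Suc_p unfolding v_def e_def y_def by (simp only: mult_ac)
  have K2: "AWc (Suc n) a b c D p (Suc n) = T * (- ((1 - p * y) * v) * (1 - e * y))"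
  proof -
    have "AWc (Suc n) a b c D p (Suc n) = ((1 - ip (Suc n)) * qp (ip n) p n) * ((1 - e * y) * qp (e * y * p) p n) * iv (qp p p (Suc n)) * (p * p ^ n)"
      unfolding AWc_ip qp_ip_Suc qp_Suc'[of "a * b * c * D * p ^ (Suc n - 1)" p n] e_def y_def by simp
    also have "\<dots> = T * (((1 - ip (Suc n)) * p) * (1 - e * y))"
      unfolding T_def by (simp only: mult_ac)
    finally show ?thesis unfolding ip_Suc_p y_def v_def .
  qed
  have M: "AWm n a ai (b * p) c (D * p) b (Suc n) = T * ((1 - p * y) * (\<beta> * v))"
    unfolding AWm_last AWc_swap(1)[of n a "b * p"] AWc_last_low t_ga_de unfolding y_def \<beta>_def v_def by (simp only: mult_ac)
  have "- ((1 - b * D) * (1 - e * p * y * y)) = (a * D) * (1 - a * c * y) * (1 - p * y) * \<beta> - (1 - b * D * (p * y)) * (1 - e * y)"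
    unfolding e_def b by (simp add: algebra_simps)
  hence "(1 - b * D) * (T * (- ((1 - p * y) * v) * (1 - e * p * y * y))) =
    (1 - p * y) * (a * D) * (1 - a * c * y) * (T * ((1 - p * y) * (\<beta> * v))) + (1 - b * D * (p * y)) * (T * (- ((1 - p * y) * v) * (1 - e * y)))"
    by (rule E3_last_combine)
  thus ?thesis unfolding K1 K2 M unfolding y_def power_Suc .
qed

text \<open>Proved like the relation in b and c. Replacing D by D p will mean raising m = |N - k -
  j| by one, so this relation governs the cases in which a recurrence changes m while keeping n in
  one of its terms.\<close>

lemma AWs_contiguous_d:
  assumes a: "a * ai = 1"
  shows "(1 - b * D) * AWs (Suc n) a b c (D * p) p z =
    (1 - p ^ Suc n) * (a * D) * (1 - a * c * p ^ n) * (qq b z * AWs n a (b * p) c (D * p) p z)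
  + (1 - b * D * p ^ Suc n) * AWs (Suc n) a b c D p z"
proof -
  have coeff: "(1 - b * D) * AWc (Suc n) a b c (D * p) p i =
    (1 - p ^ Suc n) * (a * D) * (1 - a * c * p ^ n) * AWm n a ai (b * p) c (D * p) b i
  + (1 - b * D * p ^ Suc n) * AWc (Suc n) a b c D p i" if "i \<le> Suc n" for i
  proof (cases i)
    case 0 thus ?thesis using AWc_E3_0[OF a] by simp
  next
    case (Suc j)
    show ?thesis
    proof (cases "j = n")
      case True thus ?thesis using AWc_E3_last[OF a] Suc by simp
    next
      case False
      hence "j < n" using that Suc by simp
      then obtain r where "n = Suc (j + r)" using less_imp_Suc_add by blast
      thus ?thesis using AWc_E3_mid[OF a] Suc by blast
    qed
  qed
  have "(1 - b * D) * AWs (Suc n) a b c (D * p) p z = (\<Sum>i\<le>Suc n. ((1 - b * D) * AWc (Suc n) a b c (D * p) p i) * qp2 a z p i)"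
    unfolding AWs_def sum_distrib_left by (simp only: mult.assoc)
  also have "\<dots> = (\<Sum>i\<le>Suc n. (1 - p ^ Suc n) * (a * D) * (1 - a * c * p ^ n) * (AWm n a ai (b * p) c (D * p) b i * qp2 a z p i)
    + (1 - b * D * p ^ Suc n) * (AWc (Suc n) a b c D p i * qp2 a z p i))"
    by (intro sum.cong refl) (simp only: atMost_iff coeff distrib_right mult.assoc)
  also have "\<dots> = (1 - p ^ Suc n) * (a * D) * (1 - a * c * p ^ n) * (qq b z * AWs n a (b * p) c (D * p) p z)
    + (1 - b * D * p ^ Suc n) * AWs (Suc n) a b c D p z"
    unfolding qq_AWs[OF a] unfolding AWs_def sum_distrib_left sum.distrib ..
  finally show ?thesis .
qed

end

section \<open>Recurrences for the matrix elements\<close>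

text \<open>Up to powers of q, all coefficients in the q-commutation of powers have this form in
  lambda or mu: u is q^{-1} \<open>rat 4 2\<close> and v is q \<open>rat 0 2\<close>. A shift moves
  both indices by the same amount, so products telescope.\<close>

definition rat :: "int \<Rightarrow> int \<Rightarrow> real \<Rightarrow> mero" where
  "rat i j q = (1 - mexp q 2 i) / (1 - mexp q 2 j)"

definition sq :: "int \<Rightarrow> sl2" where "sq k = sc (\<lambda>q. of_real (q powi k))"

abbreviation Lr :: "int \<Rightarrow> int \<Rightarrow> sl2" where "Lr i j \<equiv> lm (rat i j)"
abbreviation Mr :: "int \<Rightarrow> int \<Rightarrow> sl2" where "Mr i j \<equiv> mm (rat i j)"

lemma rat_mult: "good q \<Longrightarrow> rat i j q * rat j k q = rat i k q"
  using mexp_1_nz(1)[of q 2 j] by (simp add: rat_def)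

lemma rat_id: "good q \<Longrightarrow> rat i i q = 1"
  using mexp_1_nz(1)[of q 2 i] by (simp add: rat_def)

lemma shift_rat: "mero_shift (of_int k) (rat i j q) = rat (i + 2 * k) (j + 2 * k) q"
  by (simp add: rat_def mero_shift_hom mero_shift_mexp)

lemma (in mero_hom) rat_mult: "l (rat i j) * l (rat j k) = l (rat i k)"
  unfolding mult[symmetric] by (rule cong) (rule rat_mult)

lemma (in mero_hom) rat_id: "l (rat i i) = 1"
  unfolding one[symmetric] by (rule cong) (rule rat_id)

lemma sq_add: "sq i * sq j = sq (i + j)"
proof -
  have "sq i * sq j = lm (\<lambda>q. mero_const (of_real (q powi i)) * mero_const (of_real (q powi j)))"
    unfolding A.L.mult A.L.const sq_def ..
  also have "\<dots> = lm (\<lambda>q. mero_const (of_real (q powi (i + j))))"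
    by (rule A.L.cong) (simp add: power_int_add mero_const_mult)
  finally show ?thesis by (simp add: sq_def A.L.const)
qed

lemma sq_0: "sq 0 = 1"
  by (simp add: sq_def A.L.s1)

lemma sq_commute: "x * sq k = sq k * x"
  by (simp add: sq_def sc_commute)

lemma sq_left_commute0: "x * (sq k * y) = sq k * (x * y)"
proof -
  have "x * (sq k * y) = (x * sq k) * y" by (simp only: mult.assoc)
  thus ?thesis unfolding sq_commute by (simp only: mult.assoc)
qed

lemma sq_left_commute: "gs g * (sq k * y) = sq k * (gs g * y)" "gs g ^ n * (sq k * y) = sq k * (gs g ^ n * y)"
  "lm f * (sq k * y) = sq k * (lm f * y)" "mm f * (sq k * y) = sq k * (mm f * y)"
  by (rule sq_left_commute0)+

lemma sq_sq: "sq i * (sq j * x) = sq (i + j) * x"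
  by (simp add: sq_add flip: mult.assoc)

lemma LM_mult [simp]: "Lr i j * Lr j k = Lr i k" "Mr i j * Mr j k = Mr i k" "Lr i i = 1" "Mr i i = 1"
  by (rule A.L.rat_mult A.M.rat_mult A.L.rat_id A.M.rat_id)+

lemma LM_mult' [simp]: "Lr i j * (Lr j k * x) = Lr i k * x" "Mr i j * (Mr j k * x) = Mr i k * x"
  by (simp_all flip: mult.assoc)

lemma UL_eq: "UL = sq (- 1) * Lr 4 2"
  unfolding sq_def A.L.const[symmetric] A.L.mult[symmetric]
  by (rule A.L.cong) (simp add: uf_eq rat_def mexp_const)

lemma VM_eq: "VM = sq 1 * Mr 0 2"
  unfolding sq_def A.M.const[symmetric] A.M.mult[symmetric]
  by (rule A.M.cong) (simp add: vf_eq rat_def mexp_const)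

lemma gs_LM:
  "gs g * Lr i j = Lr (i - 2 * fst (gen_deg g)) (j - 2 * fst (gen_deg g)) * gs g"
  "gs g * Mr i j = Mr (i - 2 * snd (gen_deg g)) (j - 2 * snd (gen_deg g)) * gs g"
  by (simp_all add: shift_gs shift_rat)

lemma gs_LM_power:
  "gs g ^ n * Lr i j = Lr (i - 2 * int n * fst (gen_deg g)) (j - 2 * int n * fst (gen_deg g)) * gs g ^ n"
  "gs g ^ n * Mr i j = Mr (i - 2 * int n * snd (gen_deg g)) (j - 2 * int n * snd (gen_deg g)) * gs g ^ n"
proof (induction n)
  case (Suc n)
  have e: "i - 2 * int n * a - 2 * a = i - 2 * int (Suc n) * a" for i a by (simp add: algebra_simps)
  show "gs g ^ Suc n * Lr i j = Lr (i - 2 * int (Suc n) * fst (gen_deg g)) (j - 2 * int (Suc n) * fst (gen_deg g)) * gs g ^ Suc n"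
    unfolding power_Suc mult.assoc Suc unfolding mult.assoc[symmetric] gs_LM e ..
  show "gs g ^ Suc n * Mr i j = Mr (i - 2 * int (Suc n) * snd (gen_deg g)) (j - 2 * int (Suc n) * snd (gen_deg g)) * gs g ^ Suc n"
    unfolding power_Suc mult.assoc Suc unfolding mult.assoc[symmetric] gs_LM e ..
qed simp_all

section \<open>q-commutation of powers of the generators\<close>

lemma gen_comm:
  "al * ga = sq (- 1) * (Lr 4 2 * (ga * al))" "be * de = sq (- 1) * (Lr 4 2 * (de * be))"
  "be * al = sq 1 * (Mr 0 2 * (al * be))" "de * ga = sq 1 * (Mr 0 2 * (ga * de))"
  by (rule sl2_qcomm[unfolded UL_eq VM_eq mult.assoc] sl2_qcomm[unfolded UL_eq VM_eq mult.assoc, symmetric])+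

lemma gen_comm':
  "al * be = sq (- 1) * (Mr 2 0 * (be * al))" "ga * de = sq (- 1) * (Mr 2 0 * (de * ga))"
  unfolding gen_comm by (simp_all add: sq_left_commute sq_sq sq_0)

lemma neg_commute_1: "- 1 - int m = - int m - 1"
  by simp

text \<open>Each exchange of alpha with one gamma costs q^{-1} \<open>rat 4 2\<close> in lambda.
  Carried to the front of the other gammas, these factors get successive indices and telescope. The
  power rules below follow the same pattern.\<close>

lemma al_ga_power: "al * ga ^ m = sq (- int m) * (Lr (2 * int m + 2) 2 * (ga ^ m * al))"
proof (induction m)
  case (Suc m)
  have "al * ga ^ Suc m = (al * ga ^ m) * ga" by (simp add: power_Suc2 mult.assoc del: power_Suc)
  also have "\<dots> = sq (- int m) * (Lr (2 * int m + 2) 2 * (ga ^ m * (al * ga)))" unfolding Suc by (simp add: mult.assoc)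
  also have "\<dots> = sq (- int m - 1) * (Lr (2 * int m + 2) 2 * ((ga ^ m * Lr 4 2) * (ga * al)))"
    unfolding gen_comm(1) by (simp add: mult.assoc sq_left_commute sq_sq)
  also have "\<dots> = sq (- int m - 1) * ((Lr (2 * int m + 2) 2 * Lr (2 * int m + 4) (2 * int m + 2)) * (ga ^ m * (ga * al)))"
    unfolding gs_LM_power by (simp add: mult.assoc algebra_simps)
  also have "Lr (2 * int m + 2) 2 * Lr (2 * int m + 4) (2 * int m + 2) = Lr (2 * int m + 4) 2"
    unfolding A.L.commute[of "rat (2 * int m + 2) 2"] by simp
  also have "ga ^ m * (ga * al) = ga ^ Suc m * al" by (simp add: power_Suc2 mult.assoc del: power_Suc)
  finally show ?case by (simp add: algebra_simps neg_commute_1)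
qed (simp add: sq_0)

lemma al_power_ga: "al ^ j * ga = sq (- int j) * (Lr 4 (4 - 2 * int j) * (ga * al ^ j))"
proof (induction j)
  case (Suc j)
  have "al ^ Suc j * ga = al * (al ^ j * ga)" by (simp add: mult.assoc)
  also have "\<dots> = sq (- int j) * ((al * Lr 4 (4 - 2 * int j)) * (ga * al ^ j))" unfolding Suc by (simp add: mult.assoc sq_left_commute)
  also have "\<dots> = sq (- int j) * (Lr 2 (2 - 2 * int j) * ((al * ga) * al ^ j))" unfolding gs_LM by (simp add: mult.assoc)
  also have "\<dots> = sq (- int j - 1) * ((Lr 2 (2 - 2 * int j) * Lr 4 2) * (ga * (al * al ^ j)))"
    unfolding gen_comm(1) by (simp add: mult.assoc sq_left_commute sq_sq)
  also have "Lr 2 (2 - 2 * int j) * Lr 4 2 = Lr 4 (2 - 2 * int j)"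
    unfolding A.L.commute[of "rat 2 (2 - 2 * int j)"] by simp
  finally show ?case by (simp add: algebra_simps neg_commute_1)
qed (simp add: sq_0)

lemma ga_al_ga: "ga ^ r * al ^ j * ga = sq (- int j) * (Lr (4 + 2 * int r) (4 + 2 * int r - 2 * int j) * (ga ^ Suc r * al ^ j))"
proof -
  have "ga ^ r * al ^ j * ga = sq (- int j) * ((ga ^ r * Lr 4 (4 - 2 * int j)) * (ga * al ^ j))"
    unfolding mult.assoc al_power_ga by (simp add: sq_left_commute)
  also have "\<dots> = sq (- int j) * (Lr (4 + 2 * int r) (4 + 2 * int r - 2 * int j) * (ga ^ r * (ga * al ^ j)))"
    unfolding gs_LM_power by (simp add: mult.assoc algebra_simps)
  also have "ga ^ r * (ga * al ^ j) = ga ^ Suc r * al ^ j" by (simp add: power_Suc2 mult.assoc del: power_Suc)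
  finally show ?thesis .
qed

lemma ga_de_power: "ga * de ^ m = sq (- int m) * (Mr (2 * int m) 0 * (de ^ m * ga))"
proof (induction m)
  case (Suc m)
  have "ga * de ^ Suc m = (ga * de ^ m) * de" by (simp add: power_Suc2 mult.assoc del: power_Suc)
  also have "\<dots> = sq (- int m - 1) * (Mr (2 * int m) 0 * ((de ^ m * Mr 2 0) * (de * ga)))"
    unfolding Suc by (simp add: mult.assoc gen_comm'(2) sq_left_commute sq_sq)
  also have "\<dots> = sq (- int m - 1) * ((Mr (2 * int m) 0 * Mr (2 * int m + 2) (2 * int m)) * (de ^ m * (de * ga)))"
    unfolding gs_LM_power by (simp add: mult.assoc algebra_simps)
  also have "Mr (2 * int m) 0 * Mr (2 * int m + 2) (2 * int m) = Mr (2 * int m + 2) 0"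
    unfolding A.M.commute[of "rat (2 * int m) 0"] by simp
  also have "de ^ m * (de * ga) = de ^ Suc m * ga" by (simp add: power_Suc2 mult.assoc del: power_Suc)
  finally show ?case by (simp add: algebra_simps neg_commute_1)
qed (simp add: sq_0)

lemma ga_de_be: "ga * (de ^ m * be) = sq (- int m) * (de ^ m * (Mr 0 (- 2 * int m) * (ga * be)))"
proof -
  have "ga * (de ^ m * be) = sq (- int m) * ((Mr (2 * int m) 0 * de ^ m) * (ga * be))"
    unfolding mult.assoc[symmetric, of ga] ga_de_power by (simp add: mult.assoc)
  also have "Mr (2 * int m) 0 * de ^ m = de ^ m * Mr 0 (- 2 * int m)"
    unfolding gs_LM_power by simp
  finally show ?thesis by (simp add: mult.assoc)
qed

lemma al_power_be: "al ^ m * be = sq (- int m) * (Mr 2 (2 - 2 * int m) * (be * al ^ m))"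
proof (induction m)
  case (Suc m)
  have "al ^ Suc m * be = al * (al ^ m * be)" by (simp add: mult.assoc)
  also have "\<dots> = sq (- int m) * ((al * Mr 2 (2 - 2 * int m)) * (be * al ^ m))" unfolding Suc by (simp add: mult.assoc sq_left_commute)
  also have "\<dots> = sq (- int m) * (Mr 0 (- 2 * int m) * ((al * be) * al ^ m))" unfolding gs_LM by (simp add: mult.assoc)
  also have "\<dots> = sq (- int m - 1) * ((Mr 0 (- 2 * int m) * Mr 2 0) * (be * (al * al ^ m)))"
    unfolding gen_comm'(1) by (simp add: mult.assoc sq_left_commute sq_sq)
  also have "Mr 0 (- 2 * int m) * Mr 2 0 = Mr 2 (- 2 * int m)"
    unfolding A.M.commute[of "rat 0 (- 2 * int m)"] by simp
  finally show ?case by (simp add: algebra_simps neg_commute_1)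
qed (simp add: sq_0)

lemma ga_al_be: "ga * (al ^ m * be) = sq (- int m) * (Mr 0 (- 2 * int m) * (ga * be * al ^ m))"
proof -
  have "ga * (al ^ m * be) = sq (- int m) * ((ga * Mr 2 (2 - 2 * int m)) * (be * al ^ m))"
    unfolding al_power_be by (simp add: mult.assoc sq_left_commute)
  thus ?thesis unfolding gs_LM by (simp add: mult.assoc)
qed

lemma de_ga_power: "de * ga ^ d = sq (int d) * (Mr (2 - 2 * int d) 2 * (ga ^ d * de))"
proof (induction d)
  case (Suc d)
  have "de * ga ^ Suc d = (de * ga ^ d) * ga" by (simp add: power_Suc2 mult.assoc del: power_Suc)
  also have "\<dots> = sq (int d + 1) * (Mr (2 - 2 * int d) 2 * ((ga ^ d * Mr 0 2) * (ga * de)))"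
    unfolding Suc by (simp add: mult.assoc gen_comm(4) sq_left_commute sq_sq)
  also have "\<dots> = sq (int d + 1) * ((Mr (2 - 2 * int d) 2 * Mr (- 2 * int d) (2 - 2 * int d)) * (ga ^ d * (ga * de)))"
    unfolding gs_LM_power by (simp add: mult.assoc algebra_simps)
  also have "Mr (2 - 2 * int d) 2 * Mr (- 2 * int d) (2 - 2 * int d) = Mr (- 2 * int d) 2"
    unfolding A.M.commute[of "rat (2 - 2 * int d) 2"] by simp
  also have "ga ^ d * (ga * de) = ga ^ Suc d * de" by (simp add: power_Suc2 mult.assoc del: power_Suc)
  finally show ?case by (simp add: algebra_simps neg_commute_1)
qed (simp add: sq_0)

lemma be_power_al: "be ^ d * al = sq (int d) * (Mr 0 (2 * int d) * (al * be ^ d))"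
proof (induction d)
  case (Suc d)
  have "be ^ Suc d * al = be * (be ^ d * al)" by (simp add: mult.assoc)
  also have "\<dots> = sq (int d) * ((be * Mr 0 (2 * int d)) * (al * be ^ d))" unfolding Suc by (simp add: mult.assoc sq_left_commute)
  also have "\<dots> = sq (int d) * (Mr 2 (2 * int d + 2) * ((be * al) * be ^ d))" unfolding gs_LM by (simp add: mult.assoc)
  also have "\<dots> = sq (int d + 1) * ((Mr 2 (2 * int d + 2) * Mr 0 2) * (al * (be * be ^ d)))"
    unfolding gen_comm(3) by (simp add: mult.assoc sq_left_commute sq_sq)
  also have "Mr 2 (2 * int d + 2) * Mr 0 2 = Mr 0 (2 * int d + 2)"
    unfolding A.M.commute[of "rat 2 (2 * int d + 2)"] by simp
  finally show ?case by (simp add: algebra_simps neg_commute_1)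
qed (simp add: sq_0)

section \<open>Rows of matrix elements and their two recurrences\<close>

lemma HR_mult:
  assumes "x \<in> HR c" "y \<in> HR c'" shows "x * y \<in> HR (c + c')"
proof -
  obtain r s where "x = abs_sl2 r" "y = abs_sl2 s" and rs: "\<And>q. r q \<in> free_rcomp c" "\<And>q. s q \<in> free_rcomp c'"
    using assms by (auto simp: HR_def)
  moreover have "r q * s q \<in> free_rcomp (c + c')" for q
    using rs[of q] keys_mult[of "r q" "s q"] unfolding free_rcomp_def by (force simp: rdeg_plus)
  ultimately show ?thesis by (auto simp: HR_def times_sl2.abs_eq)
qed

lemma HR_add:
  assumes "x \<in> HR c" "y \<in> HR c" shows "x + y \<in> HR c"
proof -
  obtain r s where "x = abs_sl2 r" "y = abs_sl2 s" and rs: "\<And>q. r q \<in> free_rcomp c" "\<And>q. s q \<in> free_rcomp c"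
    using assms by (auto simp: HR_def)
  moreover have "r q + s q \<in> free_rcomp c" for q
    using rs[of q] Poly_Mapping.keys_add[of "r q" "s q"] unfolding free_rcomp_def by blast
  ultimately show ?thesis by (auto simp: HR_def plus_sl2.abs_eq)
qed

lemma HR_0: "0 \<in> HR c"
  unfolding HR_def zero_sl2_def by (auto simp: free_rcomp_def intro!: exI[of _ "\<lambda>_. 0"])

text \<open>The condition that determines row k in \<open>mat_elt\<close>, for families over all
  \<open>q\<close> and without prescribing values for j > N.\<close>

definition matrix_row :: "nat \<Rightarrow> nat \<Rightarrow> (nat \<Rightarrow> sl2) \<Rightarrow> bool" where
  "matrix_row N k t \<longleftrightarrow> (\<forall>j\<le>N. t j \<in> HR (2 * int j - int N)) \<and>
     Delta (ga ^ (N - k) * al ^ k) = (\<Sum>j\<le>N. tn (t j) (ga ^ (N - j) * al ^ j))"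

lemma matrix_row_unique: "matrix_row N k t \<Longrightarrow> matrix_row N k t' \<Longrightarrow> j \<le> N \<Longrightarrow> t j = t' j"
  unfolding matrix_row_def by (rule tn_unique[of N]) auto

lemma matrix_row_cong: "matrix_row N k t \<Longrightarrow> (\<And>j. j \<le> N \<Longrightarrow> t j = t' j) \<Longrightarrow> matrix_row N k t'"
  unfolding matrix_row_def by (auto intro!: sum.cong)

lemma matrix_row_0: "matrix_row 0 0 (\<lambda>_. 1)"
  unfolding matrix_row_def using Hm_HR[OF HR_sc(4)] by (simp add: Delta_1 tn_11)

text \<open>The coefficients come from moving $\alpha$ past $\gamma^{N-j}$ and $\gamma$ past $\alpha^j$.\<close>

definition "cL N j = sq (- int (N - j)) * Mr (2 * int (N - j) + 2) 2"
definition "cR N j = sq (- int j) * Mr (4 + 2 * int (N - j)) (4 + 2 * int (N - j) - 2 * int j)"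

text \<open>A row of size N + 1 from one of size N, by multiplication with Delta(gamma) from the
  left (\<open>stepL\<close>, k unchanged) or with Delta(alpha) from the right
  (\<open>stepR\<close>, k raised by 1). A neighbour outside the old row counts as 0.\<close>

definition "stepL N t i = (case i of 0 \<Rightarrow> 0 | Suc j \<Rightarrow> cL N j * (ga * t j)) + (if i \<le> N then de * t i else 0)"
definition "stepR N t i = (case i of 0 \<Rightarrow> 0 | Suc j \<Rightarrow> t j * al) + (if i \<le> N then cR N i * (t i * be) else 0)"

text \<open>Coefficients in lambda that reordering creates in the right factor turn into
  coefficients in mu in front of the left factor; this is why \<open>cL\<close> and
  \<open>cR\<close> involve mu only.\<close>

lemma tn_sq_LM: "tn x (sq k * (Lr i j * y)) = tn (sq k * Mr i j * x) y"
  unfolding sq_def tn_sc[symmetric] tn_balance[symmetric] by (simp add: mult.assoc sc_commute)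

lemma HR_coef: "sq k \<in> HR 0" "Mr i j \<in> HR 0" "gs g \<in> HR (snd (gen_deg g))"
  unfolding sq_def by (rule Hm_HR[OF HR_sc(1)] Hm_HR[OF HR_sc(3)] Hm_HR[OF HR_sc(5)])+

lemma HR_cLR: "cL N j \<in> HR 0" "cR N j \<in> HR 0"
  unfolding cL_def cR_def using HR_mult[OF HR_coef(1) HR_coef(2)] by simp_all

lemma ga_al_HL: "j \<le> N \<Longrightarrow> ga ^ (N - j) * al ^ j \<in> HL (2 * int j - int N)"
  unfolding HL_def ga_al_abs using ga_al_free by blast

lemma sum_shift_split:
  fixes f g :: "nat \<Rightarrow> 'a::ab_group_add"
  shows "(\<Sum>j\<le>N. f (Suc j)) + (\<Sum>j\<le>N. g j) = (\<Sum>i\<le>Suc N. (case i of 0 \<Rightarrow> 0 | Suc j \<Rightarrow> f i) + (if i \<le> N then g i else 0))"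
proof -
  have "(\<Sum>i\<le>Suc N. (case i of 0 \<Rightarrow> 0 | Suc j \<Rightarrow> f i)) = (\<Sum>j\<le>N. f (Suc j))"
    unfolding sum.atMost_Suc_shift by simp
  moreover have "(\<Sum>i\<le>Suc N. (if i \<le> N then g i else 0)) = (\<Sum>j\<le>N. g j)" by simp
  ultimately show ?thesis by (simp only: sum.distrib)
qed

lemma matrix_row_left:
  assumes "matrix_row N k t" "k \<le> N"
  shows "matrix_row (Suc N) k (stepL N t)"
  unfolding matrix_row_def
proof (intro conjI allI impI)
  fix i assume i: "i \<le> Suc N"
  have HR: "t j \<in> HR (2 * int j - int N)" if "j \<le> N" for j using assms that by (simp add: matrix_row_def)
  have "(case i of 0 \<Rightarrow> 0 | Suc j \<Rightarrow> cL N j * (ga * t j)) \<in> HR (2 * int i - int (Suc N))"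
  proof (cases i)
    case (Suc j)
    have "cL N j * (ga * t j) \<in> HR (0 + (1 + (2 * int j - int N)))"
      by (intro HR_mult HR_cLR HR) (use HR_coef(3)[of Ga] i Suc in auto)
    thus ?thesis using Suc by (simp add: algebra_simps)
  qed (simp add: HR_0)
  moreover have "(if i \<le> N then de * t i else 0) \<in> HR (2 * int i - int (Suc N))"
  proof (cases "i \<le> N")
    case True
    have "de * t i \<in> HR (- 1 + (2 * int i - int N))"
      by (intro HR_mult HR) (use HR_coef(3)[of De] True in auto)
    thus ?thesis using True by (simp add: algebra_simps)
  qed (simp add: HR_0)
  ultimately show "stepL N t i \<in> HR (2 * int i - int (Suc N))"
    unfolding stepL_def by (rule HR_add)
next
  have "ga ^ (Suc N - k) * al ^ k = ga * (ga ^ (N - k) * al ^ k)" using assms by (simp add: Suc_diff_le mult.assoc)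
  hence "Delta (ga ^ (Suc N - k) * al ^ k) = Dga * (\<Sum>j\<le>N. tn (t j) (ga ^ (N - j) * al ^ j))"
    using assms by (simp add: matrix_row_def Delta_mult Delta_gs)
  also have "\<dots> = (\<Sum>j\<le>N. tn (cL N j * (ga * t j)) (ga ^ (Suc N - Suc j) * al ^ Suc j)) + (\<Sum>j\<le>N. tn (de * t j) (ga ^ (Suc N - j) * al ^ j))"
    unfolding sum_distrib_left sum.distrib[symmetric]
  proof (intro sum.cong refl)
    fix j assume "j \<in> {..N}"
    hence j: "j \<le> N" by simp
    have "al * (ga ^ (N - j) * al ^ j) = sq (- int (N - j)) * (Lr (2 * int (N - j) + 2) 2 * (ga ^ (N - j) * al ^ Suc j))"
      unfolding mult.assoc[symmetric, of al] al_ga_power by (simp add: mult.assoc)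
    hence "Dga * tn (t j) (ga ^ (N - j) * al ^ j) =
       tn (ga * t j) (sq (- int (N - j)) * (Lr (2 * int (N - j) + 2) 2 * (ga ^ (N - j) * al ^ Suc j))) + tn (de * t j) (ga * (ga ^ (N - j) * al ^ j))"
      unfolding Dga_def distrib_right tn_gs_mults by simp
    thus "Dga * tn (t j) (ga ^ (N - j) * al ^ j) =
      tn (cL N j * (ga * t j)) (ga ^ (Suc N - Suc j) * al ^ Suc j) + tn (de * t j) (ga ^ (Suc N - j) * al ^ j)"
      unfolding tn_sq_LM cL_def using j by (simp add: Suc_diff_le mult.assoc)
  qed
  also have "\<dots> = (\<Sum>i\<le>Suc N. (case i of 0 \<Rightarrow> 0 | Suc j \<Rightarrow> tn (cL N (i - 1) * (ga * t (i - 1))) (ga ^ (Suc N - i) * al ^ i))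
     + (if i \<le> N then tn (de * t i) (ga ^ (Suc N - i) * al ^ i) else 0))"
    unfolding sum_shift_split[symmetric] by simp
  also have "\<dots> = (\<Sum>i\<le>Suc N. tn (stepL N t i) (ga ^ (Suc N - i) * al ^ i))"
    by (intro sum.cong refl) (auto simp: stepL_def tn_add_left tn_0 split: nat.splits)
  finally show "Delta (ga ^ (Suc N - k) * al ^ k) = (\<Sum>i\<le>Suc N. tn (stepL N t i) (ga ^ (Suc N - i) * al ^ i))" .
qed

lemma matrix_row_right:
  assumes "matrix_row N k t" "k \<le> N"
  shows "matrix_row (Suc N) (Suc k) (stepR N t)"
  unfolding matrix_row_def
proof (intro conjI allI impI)
  fix i assume i: "i \<le> Suc N"
  have HR: "t j \<in> HR (2 * int j - int N)" if "j \<le> N" for j using assms that by (simp add: matrix_row_def)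
  have "(case i of 0 \<Rightarrow> 0 | Suc j \<Rightarrow> t j * al) \<in> HR (2 * int i - int (Suc N))"
  proof (cases i)
    case (Suc j)
    have "t j * al \<in> HR ((2 * int j - int N) + 1)"
      by (intro HR_mult HR) (use HR_coef(3)[of Al] i Suc in auto)
    thus ?thesis using Suc by (simp add: algebra_simps)
  qed (simp add: HR_0)
  moreover have "(if i \<le> N then cR N i * (t i * be) else 0) \<in> HR (2 * int i - int (Suc N))"
  proof (cases "i \<le> N")
    case True
    have "cR N i * (t i * be) \<in> HR (0 + ((2 * int i - int N) + - 1))"
      by (intro HR_mult HR HR_cLR) (use HR_coef(3)[of Be] True in auto)
    thus ?thesis using True by (simp add: algebra_simps)
  qed (simp add: HR_0)
  ultimately show "stepR N t i \<in> HR (2 * int i - int (Suc N))"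
    unfolding stepR_def by (rule HR_add)
next
  have "ga ^ (Suc N - Suc k) * al ^ Suc k = (ga ^ (N - k) * al ^ k) * al" using assms by (simp add: power_Suc2 mult.assoc del: power_Suc)
  hence "Delta (ga ^ (Suc N - Suc k) * al ^ Suc k) = (\<Sum>j\<le>N. tn (t j) (ga ^ (N - j) * al ^ j)) * Dal"
    using assms by (simp add: matrix_row_def Delta_mult[of _ al] Delta_gs)
  also have "\<dots> = (\<Sum>j\<le>N. tn (t j * al) (ga ^ (Suc N - Suc j) * al ^ Suc j)) + (\<Sum>j\<le>N. tn (cR N j * (t j * be)) (ga ^ (Suc N - j) * al ^ j))"
    unfolding sum_distrib_right sum.distrib[symmetric]
  proof (intro sum.cong refl)
    fix j assume "j \<in> {..N}"
    hence j: "j \<le> N" by simp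
    have HR: "t j \<in> HR (2 * int j - int N)" using assms j by (simp add: matrix_row_def)
    have "tn (t j) (ga ^ (N - j) * al ^ j) * Dal =
       tn (t j * al) (ga ^ (N - j) * al ^ j * al) + tn (t j * be) (sq (- int j) * (Lr (4 + 2 * int (N - j)) (4 + 2 * int (N - j) - 2 * int j) * (ga ^ Suc (N - j) * al ^ j)))"
      unfolding Dal_def distrib_left tn_mult[OF HR ga_al_HL[OF j]] ga_al_ga ..
    thus "tn (t j) (ga ^ (N - j) * al ^ j) * Dal =
      tn (t j * al) (ga ^ (Suc N - Suc j) * al ^ Suc j) + tn (cR N j * (t j * be)) (ga ^ (Suc N - j) * al ^ j)"
      unfolding tn_sq_LM cR_def using j by (simp add: Suc_diff_le power_Suc2 mult.assoc del: power_Suc)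
  qed
  also have "\<dots> = (\<Sum>i\<le>Suc N. (case i of 0 \<Rightarrow> 0 | Suc j \<Rightarrow> tn (t (i - 1) * al) (ga ^ (Suc N - i) * al ^ i))
     + (if i \<le> N then tn (cR N i * (t i * be)) (ga ^ (Suc N - i) * al ^ i) else 0))"
    unfolding sum_shift_split[symmetric] by simp
  also have "\<dots> = (\<Sum>i\<le>Suc N. tn (stepR N t i) (ga ^ (Suc N - i) * al ^ i))"
    by (intro sum.cong refl) (auto simp: stepR_def tn_add_left tn_0 split: nat.splits)
  finally show "Delta (ga ^ (Suc N - Suc k) * al ^ Suc k) = (\<Sum>i\<le>Suc N. tn (stepR N t i) (ga ^ (Suc N - i) * al ^ i))" .
qed

lemma matrix_row_HR: "matrix_row N k t \<Longrightarrow> j \<le> N \<Longrightarrow> t j \<in> HR (2 * int j - int N)"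
  by (simp add: matrix_row_def)

section \<open>The commutative subalgebra generated by $\lambda$, $\mu$ and $\gamma\beta$\<close>

text \<open>Only the part of A_00 generated by the functions and gamma beta is considered: it
  contains Xi and the coefficients that occur, and its commutativity follows from that of the
  generators by induction.\<close>

inductive_set diag_set :: "sl2 set" where
  lmI: "lm f \<in> diag_set"
| mmI: "mm f \<in> diag_set"
| gbI: "ga * be \<in> diag_set"
| addI: "x \<in> diag_set \<Longrightarrow> y \<in> diag_set \<Longrightarrow> x + y \<in> diag_set"
| uminusI: "x \<in> diag_set \<Longrightarrow> - x \<in> diag_set"
| multI: "x \<in> diag_set \<Longrightarrow> y \<in> diag_set \<Longrightarrow> x * y \<in> diag_set"

lemma LM_gb: "lm f * (ga * be) = ga * be * lm f" "mm f * (ga * be) = ga * be * mm f"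
  by (simp_all add: shift_gs mero_shift_shift flip: mult.assoc) (simp_all add: shift_gs mero_shift_shift mult.assoc)

lemma diag_set_commute_gen:
  assumes "x \<in> diag_set"
  shows "lm f * x = x * lm f" "mm f * x = x * mm f" "(ga * be) * x = x * (ga * be)"
proof -
  have left: "g * (x * y) = x * y * g" if "g * x = x * g" "g * y = y * g" for g x y :: sl2
    using that by (metis mult.assoc)
  show "lm f * x = x * lm f" using assms
    by induction (auto simp: A.L.commute[of f] A.comm LM_gb left algebra_simps(18,19) distrib_left distrib_right simp del: mult.assoc intro!: left)
  show "mm f * x = x * mm f" using assms
    by induction (auto simp: A.M.commute[of f] A.comm LM_gb left distrib_left distrib_right simp del: mult.assoc intro!: left)
  show "(ga * be) * x = x * (ga * be)" using assms
    by induction (auto simp: LM_gb left distrib_left distrib_right simp del: mult.assoc intro!: left)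
qed

lemma diag_set_commute:
  assumes "x \<in> diag_set" "y \<in> diag_set" shows "x * y = y * x"
  using assms(1)
proof induction
  case (multI a b)
  thus ?case by (metis mult.assoc)
qed (auto simp: diag_set_commute_gen[OF assms(2)] distrib_left distrib_right)

lemma diag_set_1: "1 \<in> diag_set" using diag_set.lmI[of "\<lambda>_. 1"] by (simp add: A.L.one)
lemma diag_set_0: "0 \<in> diag_set" using diag_set.lmI[of "\<lambda>_. 0"] by (simp add: A.L.zero)
lemma diag_set_diff: "x \<in> diag_set \<Longrightarrow> y \<in> diag_set \<Longrightarrow> x - y \<in> diag_set"
  using diag_set.addI[of x "- y"] diag_set.uminusI[of y] by simp

text \<open>As a type of class \<open>comm_ring_1\<close> the subalgebra admits the Askey-Wilson
  identities with Xi as variable; \<open>em\<close> embeds it into A.\<close>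

typedef diag = diag_set morphisms em Abs_diag
  using diag_set_0 by blast

setup_lifting type_definition_diag

instantiation diag :: comm_ring_1
begin
lift_definition zero_diag :: diag is 0 by (rule diag_set_0)
lift_definition one_diag :: diag is 1 by (rule diag_set_1)
lift_definition plus_diag :: "diag \<Rightarrow> diag \<Rightarrow> diag" is "(+)" by (rule diag_set.addI)
lift_definition minus_diag :: "diag \<Rightarrow> diag \<Rightarrow> diag" is "(-)" by (rule diag_set_diff)
lift_definition uminus_diag :: "diag \<Rightarrow> diag" is "uminus" by (rule diag_set.uminusI)
lift_definition times_diag :: "diag \<Rightarrow> diag \<Rightarrow> diag" is "(*)" by (rule diag_set.multI)
instance
proof
  show "a * b = b * a" for a b :: diag by transfer (rule diag_set_commute)
qed (transfer; simp add: algebra_simps)+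
end

lemma em_hom: "em (x + y) = em x + em y" "em (x * y) = em x * em y" "em (x - y) = em x - em y" "em (- x) = - em x" "em 0 = 0" "em 1 = 1"
  by (transfer; simp)+

lemma em_power: "em (x ^ n) = em x ^ n"
  by (induction n) (simp_all add: em_hom)

lift_definition lz :: "(real \<Rightarrow> mero) \<Rightarrow> diag" is lm by (rule diag_set.lmI)
lift_definition mz :: "(real \<Rightarrow> mero) \<Rightarrow> diag" is mm by (rule diag_set.mmI)
lift_definition gb :: diag is "ga * be" by (rule diag_set.gbI)

definition "sz c = lz (\<lambda>q. mero_const (c q))"

interpretation Z: mero_hom2 lz mz sz
proof unfold_locales
  show "lz f = lz g" if "\<And>q. good q \<Longrightarrow> f q = g q" for f g using that by transfer (rule A.L.cong)
  show "mz f = mz g" if "\<And>q. good q \<Longrightarrow> f q = g q" for f g using that by transfer (rule A.M.cong)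
qed (transfer; simp add: A.L.add A.L.mult A.M.add A.M.mult A.comm A.L.const A.M.const A.L.s1 sz_def mult.commute | simp add: mult.commute)+

section \<open>Powers of q in the commutative subalgebra, and their shifts\<close>

definition ql :: "int \<Rightarrow> int \<Rightarrow> int \<Rightarrow> diag" where
  "ql a b c = lz (\<lambda>q. mexp q a 0) * mz (\<lambda>q. mexp q b c)"

lemma ql_mult: "ql a b c * ql a' b' c' = ql (a + a') (b + b') (c + c')"
proof -
  have "ql a b c * ql a' b' c' = (lz (\<lambda>q. mexp q a 0) * lz (\<lambda>q. mexp q a' 0)) * (mz (\<lambda>q. mexp q b c) * mz (\<lambda>q. mexp q b' c'))"
    by (simp add: ql_def mult_ac)
  thus ?thesis by (simp add: ql_def mexp_add flip: Z.L.mult Z.M.mult)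
qed

lemma ql_mult': "ql a b c * (ql a' b' c' * x) = ql (a + a') (b + b') (c + c') * x"
  by (simp add: ql_mult flip: mult.assoc)

lemma ql_0: "ql 0 0 0 = 1"
proof -
  have "lz (\<lambda>q. mexp q 0 0) = 1" unfolding Z.L.one[symmetric] by (rule Z.L.cong) (simp add: mexp_0)
  moreover have "mz (\<lambda>q. mexp q 0 0) = 1" unfolding Z.M.one[symmetric] by (rule Z.M.cong) (simp add: mexp_0)
  ultimately show ?thesis by (simp add: ql_def)
qed

lemma ql_power: "ql a b c ^ n = ql (int n * a) (int n * b) (int n * c)"
  by (induction n) (simp_all add: ql_0 ql_mult algebra_simps)

lemma ql_inverse: "ql a b c * ql (- a) (- b) (- c) = 1"
  by (simp add: ql_mult ql_0)

lemma ql_dvd: "ql a b c dvd 1"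
  using ql_inverse[of a b c] by (metis dvd_triv_left)

lemma ql_lz: "ql a 0 c = lz (\<lambda>q. mexp q a c)"
proof -
  have "mz (\<lambda>q. mexp q 0 c) = lz (\<lambda>q. mexp q 0 c)"
  proof -
    have "mz (\<lambda>q. mexp q 0 c) = mz (\<lambda>q. mero_const (of_real (q powi c)))" "lz (\<lambda>q. mexp q 0 c) = lz (\<lambda>q. mero_const (of_real (q powi c)))"
      by (rule Z.L.cong Z.M.cong; simp add: mexp_const)+
    thus ?thesis by (simp add: Z.L.const Z.M.const)
  qed
  thus ?thesis by (simp add: ql_def mexp_add flip: Z.L.mult)
qed

lemma ql_mz: "ql 0 b c = mz (\<lambda>q. mexp q b c)"
proof -
  have "lz (\<lambda>q. mexp q 0 0) = 1" using ql_lz[of 0 0] unfolding ql_0 by simp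
  thus ?thesis unfolding ql_def by simp
qed

lemma ql_sz: "ql 0 0 c = sz (\<lambda>q. of_real (q powi c))"
  unfolding ql_lz Z.L.const[symmetric] by (rule Z.L.cong) (simp add: mexp_const)

text \<open>Inverses are taken in M, hence separately in lambda or in mu. An exponent containing
  both variables is excluded, because A provides only sums of products f(lambda) g(mu).\<close>

lemma one_minus_ql_dvd: "a = 0 \<and> (b \<noteq> 0 \<or> c \<noteq> 0) \<or> b = 0 \<and> (a \<noteq> 0 \<or> c \<noteq> 0) \<Longrightarrow> (1 - ql a b c) dvd 1"
proof (elim disjE conjE, goal_cases)
  case 1
  have "(1 - ql a b c) * mz (\<lambda>q. inverse (1 - mexp q b c)) = 1"
    unfolding 1(1) ql_mz Z.M.one[symmetric] Z.M.diff[symmetric] Z.M.mult[symmetric]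
    by (rule Z.M.cong) (use 1 mexp_1_nz(1) in simp)
  thus ?case by (metis dvd_triv_left)
next
  case 2
  have "(1 - ql a b c) * mz (\<lambda>q. inverse (1 - mexp q b c)) = 1"
    unfolding 2(1) ql_mz Z.M.one[symmetric] Z.M.diff[symmetric] Z.M.mult[symmetric]
    by (rule Z.M.cong) (use 2 mexp_1_nz(1) in simp)
  thus ?case by (metis dvd_triv_left)
next
  case 3
  have "(1 - ql a b c) * lz (\<lambda>q. inverse (1 - mexp q a c)) = 1"
    unfolding 3(1) ql_lz Z.L.one[symmetric] Z.L.diff[symmetric] Z.L.mult[symmetric]
    by (rule Z.L.cong) (use 3 mexp_1_nz(1) in simp)
  thus ?case by (metis dvd_triv_left)
next
  case 4
  have "(1 - ql a b c) * lz (\<lambda>q. inverse (1 - mexp q a c)) = 1"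
    unfolding 4(1) ql_lz Z.L.one[symmetric] Z.L.diff[symmetric] Z.L.mult[symmetric]
    by (rule Z.L.cong) (use 4 mexp_1_nz(1) in simp)
  thus ?case by (metis dvd_triv_left)
qed

lemma lz_rat: "lz (rat i j) * (1 - ql 2 0 j) = 1 - ql 2 0 i" and mz_rat: "mz (rat i j) * (1 - ql 0 2 j) = 1 - ql 0 2 i"
proof -
  have *: "rat i j q * (1 - mexp q 2 j) = 1 - mexp q 2 i" if "good q" for q
    using mexp_1_nz(1)[of q 2 j] that by (simp add: rat_def)
  show "lz (rat i j) * (1 - ql 2 0 j) = 1 - ql 2 0 i"
    unfolding ql_lz Z.L.one[symmetric] Z.L.diff[symmetric] Z.L.mult[symmetric] by (rule Z.L.cong) (rule *)
  show "mz (rat i j) * (1 - ql 0 2 j) = 1 - ql 0 2 i"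
    unfolding ql_mz Z.M.one[symmetric] Z.M.diff[symmetric] Z.M.mult[symmetric] by (rule Z.M.cong) (rule *)
qed

lemma em_sq: "em (ql 0 0 k) = sq k"
  unfolding ql_sz sz_def sq_def by transfer (simp add: A.L.const)

lemma em_lz: "em (lz f) = lm f" and em_mz: "em (mz f) = mm f" and em_gb: "em gb = ga * be"
  by (transfer; simp)+

text \<open>For a function, \<open>x'\<close> is \<open>x\<close> with lambda and mu shifted by the
  degrees of \<open>g\<close>. It is a relation because gamma beta changes by more than a shift; Xi
  will turn out to be unchanged.\<close>

definition shf :: "gen \<Rightarrow> diag \<Rightarrow> diag \<Rightarrow> bool" where
  "shf g x x' \<longleftrightarrow> em x * gs g = gs g * em x'"

lemma shf_add: "shf g x x' \<Longrightarrow> shf g y y' \<Longrightarrow> shf g (x + y) (x' + y')"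
  and shf_diff: "shf g x x' \<Longrightarrow> shf g y y' \<Longrightarrow> shf g (x - y) (x' - y')"
  and shf_1: "shf g 1 1" and shf_0: "shf g 0 0"
  by (simp_all add: shf_def em_hom algebra_simps)

lemma shf_mult: "shf g x x' \<Longrightarrow> shf g y y' \<Longrightarrow> shf g (x * y) (x' * y')"
  unfolding shf_def em_hom by (metis mult.assoc)

lemma shf_power: "shf g x x' \<Longrightarrow> shf g (x ^ n) (x' ^ n)"
  by (induction n) (simp_all add: shf_1 shf_mult)

lemma shf_sum: "(\<And>i. i \<in> A \<Longrightarrow> shf g (f i) (f' i)) \<Longrightarrow> shf g (sum f A) (sum f' A)"
  by (induction A rule: infinite_finite_induct) (simp_all add: shf_0 shf_add)

lemma shf_prod: "(\<And>i. i \<in> A \<Longrightarrow> shf g (f i) (f' i)) \<Longrightarrow> shf g (prod f A) (prod f' A)"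
  by (induction A rule: infinite_finite_induct) (simp_all add: shf_1 shf_mult)

lemma shf_iv:
  assumes "shf g x x'" "x dvd 1" "x' dvd 1"
  shows "shf g (iv x) (iv x')"
proof -
  have 1: "em (iv x) * em x = 1" "em x' * em (iv x') = 1"
    unfolding em_hom(2)[symmetric] using iv[OF assms(2)] iv[OF assms(3)] by (simp_all add: mult.commute em_hom)
  have "em (iv x) * gs g = em (iv x) * (gs g * em x') * em (iv x')" using 1 by (simp add: mult.assoc)
  also have "\<dots> = (em (iv x) * em x) * gs g * em (iv x')" using assms(1) by (simp add: shf_def mult.assoc)
  finally show ?thesis using 1 by (simp add: shf_def)
qed

lemma shf_lz: "shf g (lz f) (lz (\<lambda>q. mero_shift (of_int (fst (gen_deg g))) (f q)))"
  and shf_mz: "shf g (mz f) (mz (\<lambda>q. mero_shift (of_int (snd (gen_deg g))) (f q)))"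
  by (simp_all add: shf_def em_lz em_mz shift_gs)

lemma shf_ql0: "shf g (ql a b c) (ql a b (c + a * fst (gen_deg g) + b * snd (gen_deg g)))"
proof -
  have "shf g (ql a b c) (lz (\<lambda>q. mexp q a (a * fst (gen_deg g))) * mz (\<lambda>q. mexp q b (c + b * snd (gen_deg g))))"
    unfolding ql_def using shf_mult[OF shf_lz[of g "\<lambda>q. mexp q a 0"] shf_mz[of g "\<lambda>q. mexp q b c"]] by (simp add: mero_shift_mexp)
  also have "lz (\<lambda>q. mexp q a (a * fst (gen_deg g))) * mz (\<lambda>q. mexp q b (c + b * snd (gen_deg g))) =
      ql a b (c + a * fst (gen_deg g) + b * snd (gen_deg g))"
    unfolding ql_lz[symmetric] ql_mz[symmetric] ql_mult by (simp add: algebra_simps)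
  finally show ?thesis .
qed

lemma shf_ql: "c' = c + a * fst (gen_deg g) + b * snd (gen_deg g) \<Longrightarrow> shf g (ql a b c) (ql a b c')"
  using shf_ql0 by simp

lemma shf_qp: "shf g a a' \<Longrightarrow> shf g p p' \<Longrightarrow> shf g (qp a p n) (qp a' p' n)"
  unfolding qp_def by (intro shf_prod shf_diff shf_1 shf_mult shf_power)

lemma shf_qp2: "shf g a a' \<Longrightarrow> shf g z z' \<Longrightarrow> shf g p p' \<Longrightarrow> shf g (qp2 a z p n) (qp2 a' z' p' n)"
  unfolding qp2_def qq_def by (intro shf_prod shf_add shf_diff shf_1 shf_mult shf_power)

abbreviation pz :: diag where "pz \<equiv> ql 0 0 2"

interpretation W: aw_base pz
  by unfold_locales (simp_all only: ql_dvd ql_power one_minus_ql_dvd mult_zero_right, simp add: one_minus_ql_dvd)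

lemma pz_power: "pz ^ n = ql 0 0 (2 * int n)"
  by (simp add: ql_power mult.commute)

lemma shf_pz: "shf g pz pz"
  by (rule shf_ql) simp

lemma shf_AWs:
  assumes "shf g a a'" "shf g b b'" "shf g c c'" "shf g d d'" "shf g z z'"
  shows "shf g (AWs n a b c d pz z) (AWs n a' b' c' d' pz z')"
proof -
  have pd: "pz ^ n dvd 1" by (simp add: ql_power ql_dvd)
  show ?thesis
    unfolding AWs_def AWc_def
    by (intro shf_sum shf_mult shf_qp shf_qp2 shf_iv shf_power assms shf_pz pd W.qp_pp_unit)
qed

section \<open>Centrality of Xi\<close>

definition eX :: diag where "eX = ql (- 1) (- 1) (- 2) * (1 - ql 2 0 4) * (1 - ql 0 2 0)"
definition xi :: diag where "xi = ql 1 (- 1) 1 + ql (- 1) 1 (- 1) - eX * gb"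

text \<open>The counterpart of \<open>eX\<close> when Xi is written with beta gamma: Xi is also
  q^{lambda-mu-1} + q^{mu-lambda+1} minus \<open>eX2\<close> times beta gamma.\<close>

definition eX2 :: diag where "eX2 = ql (- 1) (- 1) (- 2) * (1 - ql 2 0 2) * (1 - ql 0 2 2)"

abbreviation "uz \<equiv> lz uf"
abbreviation "vz \<equiv> mz vf"

lemma uz_eq: "uz * (1 - ql 2 0 2) = ql 0 0 (- 1) * (1 - ql 2 0 4)"
proof -
  have "uz = ql 0 0 (- 1) * lz (rat 4 2)"
    unfolding ql_lz Z.L.mult[symmetric] by (rule Z.L.cong) (simp add: uf_eq rat_def)
  thus ?thesis using lz_rat[of 4 2] by (simp add: mult.assoc)
qed

lemma vz_eq: "vz * (1 - ql 0 2 2) = ql 0 0 1 * (1 - ql 0 2 0)"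
proof -
  have "vz = ql 0 0 1 * mz (rat 0 2)"
    unfolding ql_mz Z.M.mult[symmetric] by (rule Z.M.cong) (simp add: vf_eq rat_def)
  thus ?thesis using mz_rat[of 0 2] by (simp add: mult.assoc)
qed

lemma sz_kappa: "sz kappa = ql 0 0 1 + ql 0 0 (- 1)"
  unfolding ql_lz Z.L.add[symmetric] Z.L.const[symmetric]
  by (rule Z.L.cong) (simp add: kappa_def mexp_const power_int_minus inverse_eq_divide flip: mero_const_add)

lemma eX2_uv: "eX2 * uz * vz = eX"
proof -
  have "eX2 * uz * vz = ql (- 1) (- 1) (- 2) * (uz * (1 - ql 2 0 2)) * (vz * (1 - ql 0 2 2))"
    by (simp only: eX2_def mult_ac)
  also have "\<dots> = ql (- 1) (- 1) (- 2) * ql 0 0 (- 1) * ql 0 0 1 * (1 - ql 2 0 4) * (1 - ql 0 2 0)"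
    unfolding uz_eq vz_eq by (simp only: mult_ac)
  also have "\<dots> = eX" by (simp add: ql_mult eX_def)
  finally show ?thesis .
qed

lemma eX2_diff: "eX2 * (uz + vz - sz kappa) = ql 1 (- 1) (- 1) + ql (- 1) 1 1 - (ql 1 (- 1) 1 + ql (- 1) 1 (- 1))"
proof -
  have "eX2 * (uz + vz - sz kappa) = ql (- 1) (- 1) (- 2) * (uz * (1 - ql 2 0 2)) * (1 - ql 0 2 2)
     + ql (- 1) (- 1) (- 2) * (1 - ql 2 0 2) * (vz * (1 - ql 0 2 2)) - eX2 * sz kappa"
    by (simp add: eX2_def algebra_simps)
  also have "\<dots> = ql 1 (- 1) (- 1) + ql (- 1) 1 1 - (ql 1 (- 1) 1 + ql (- 1) 1 (- 1))"
    unfolding uz_eq vz_eq sz_kappa eX2_def by (simp add: algebra_simps ql_mult ql_mult')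
  finally show ?thesis .
qed

lemma em_be_ga: "be * ga = em (uz + vz - sz kappa + uz * vz * gb)"
  unfolding em_hom em_lz em_mz em_gb sz_def sl2_BG by (simp add: A.L.const)

text \<open>Moving beta through Xi shifts the functions and regroups beta (gamma beta) as (beta
  gamma) beta. This gives the beta gamma form of Xi, times beta; \<open>eX2_diff\<close> and
  \<open>eX2_uv\<close> identify the two forms.\<close>

lemma xi_be: "em xi * be = be * em xi"
proof -
  have s: "shf Be (ql 1 (- 1) (- 1) + ql (- 1) 1 1) (ql 1 (- 1) 1 + ql (- 1) 1 (- 1))"
    by (intro shf_add shf_ql) simp_all
  have e: "shf Be eX2 eX" unfolding eX2_def eX_def by (intro shf_mult shf_diff shf_1 shf_ql) simp_all
  have "be * em xi = be * em (ql 1 (- 1) 1 + ql (- 1) 1 (- 1)) - be * em eX * (ga * be)"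
    by (simp add: xi_def em_hom(2,3) em_gb right_diff_distrib mult.assoc)
  also have "\<dots> = em (ql 1 (- 1) (- 1) + ql (- 1) 1 1) * be - em eX2 * ((be * ga) * be)"
    unfolding s[unfolded shf_def, symmetric] e[unfolded shf_def, symmetric] by (simp only: mult.assoc)
  also have "\<dots> = em (ql 1 (- 1) (- 1) + ql (- 1) 1 1 - eX2 * (uz + vz - sz kappa + uz * vz * gb)) * be"
    unfolding em_be_ga by (simp only: em_hom(2,3) left_diff_distrib mult.assoc)
  also have "ql 1 (- 1) (- 1) + ql (- 1) 1 1 - eX2 * (uz + vz - sz kappa + uz * vz * gb) = xi"
    unfolding distrib_left eX2_diff mult.assoc[symmetric] eX2_uv xi_def by simp
  finally show ?thesis ..
qed

lemma xi_ga: "em xi * ga = ga * em xi"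
proof -
  have s: "shf Ga (ql 1 (- 1) 1 + ql (- 1) 1 (- 1)) (ql 1 (- 1) (- 1) + ql (- 1) 1 1)"
    by (intro shf_add shf_ql) simp_all
  have e: "shf Ga eX eX2" unfolding eX2_def eX_def by (intro shf_mult shf_diff shf_1 shf_ql) simp_all
  have "em xi * ga = em (ql 1 (- 1) 1 + ql (- 1) 1 (- 1)) * ga - (em eX * ga) * (be * ga)"
    by (simp add: xi_def em_hom(2,3) em_gb left_diff_distrib mult.assoc)
  also have "\<dots> = ga * em (ql 1 (- 1) (- 1) + ql (- 1) 1 1) - ga * em eX2 * (be * ga)"
    using s e by (simp only: shf_def)
  also have "\<dots> = ga * em (ql 1 (- 1) (- 1) + ql (- 1) 1 1 - eX2 * (uz + vz - sz kappa + uz * vz * gb))"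
    unfolding em_be_ga by (simp only: em_hom(2,3) right_diff_distrib mult.assoc)
  also have "ql 1 (- 1) (- 1) + ql (- 1) 1 1 - eX2 * (uz + vz - sz kappa + uz * vz * gb) = xi"
    unfolding distrib_left eX2_diff mult.assoc[symmetric] eX2_uv xi_def by simp
  finally show ?thesis .
qed

lemma gb_al: "ga * be * al = em (ql 0 0 2 * mz (rat (- 2) 0) * lz (rat 2 4)) * (al * (ga * be))"
proof -
  have ga_al: "ga * al = sq 1 * (Lr 2 4 * (al * ga))"
    unfolding gen_comm by (simp add: sq_left_commute sq_sq sq_0)
  have "ga * be * al = ga * (be * al)" by (simp add: mult.assoc)
  also have "\<dots> = sq 1 * ((ga * Mr 0 2) * (al * be))" unfolding gen_comm(3) by (simp add: mult.assoc sq_left_commute)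
  also have "\<dots> = sq 1 * (Mr (- 2) 0 * ((ga * al) * be))" unfolding gs_LM by (simp add: mult.assoc)
  also have "\<dots> = sq 2 * (Mr (- 2) 0 * (Lr 2 4 * (al * (ga * be))))" unfolding ga_al by (simp add: mult.assoc sq_left_commute sq_sq)
  finally show ?thesis by (simp add: em_hom(2) em_sq em_lz em_mz mult.assoc)
qed

lemma gb_de: "ga * be * de = em (ql 0 0 (- 2) * lz (rat 6 4) * mz (rat 2 0)) * (de * (ga * be))"
proof -
  have "ga * be * de = ga * (be * de)" by (simp add: mult.assoc)
  also have "\<dots> = sq (- 1) * ((ga * Lr 4 2) * (de * be))" unfolding gen_comm(2) by (simp add: mult.assoc sq_left_commute)
  also have "\<dots> = sq (- 1) * (Lr 6 4 * ((ga * de) * be))" unfolding gs_LM by (simp add: mult.assoc)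
  also have "\<dots> = sq (- 2) * (Lr 6 4 * (Mr 2 0 * (de * (ga * be))))" unfolding gen_comm' by (simp add: mult.assoc sq_left_commute sq_sq)
  finally show ?thesis by (simp add: em_hom(2) em_sq em_lz em_mz mult.assoc)
qed

text \<open>alpha and delta preserve lambda - mu, so the terms free of gamma beta do not change. The
  factor \<open>k\<close> that gamma beta picks up has to be compensated by the shift of
  \<open>eX\<close>, which is the second hypothesis.\<close>

lemma xi_comm_aux:
  assumes "ga * be * gs g = em k * (gs g * (ga * be))" "shf g (eX * k) eX" "fst (gen_deg g) = snd (gen_deg g)"
  shows "em xi * gs g = gs g * em xi"
proof -
  have s: "shf g (ql 1 (- 1) 1 + ql (- 1) 1 (- 1)) (ql 1 (- 1) 1 + ql (- 1) 1 (- 1))"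
    by (intro shf_add shf_ql) (simp_all add: assms)
  have "em xi * gs g = em (ql 1 (- 1) 1 + ql (- 1) 1 (- 1)) * gs g - em eX * (ga * be * gs g)"
    by (simp add: xi_def em_hom(2,3) em_gb left_diff_distrib mult.assoc)
  also have "\<dots> = gs g * em (ql 1 (- 1) 1 + ql (- 1) 1 (- 1)) - (em (eX * k) * gs g) * (ga * be)"
    unfolding assms(1) using s by (simp add: shf_def em_hom(2) mult.assoc)
  also have "\<dots> = gs g * em (ql 1 (- 1) 1 + ql (- 1) 1 (- 1)) - gs g * em eX * (ga * be)"
    using assms(2) by (simp only: shf_def)
  also have "\<dots> = gs g * em xi"
    by (simp add: xi_def em_hom(2,3) em_gb right_diff_distrib mult.assoc)
  finally show ?thesis .
qed

lemma xi_al: "em xi * al = al * em xi"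
proof (rule xi_comm_aux[OF gb_al])
  have 1: "(1 - ql 2 0 4) * lz (rat 2 4) = 1 - ql 2 0 2" "(1 - ql 0 2 0) * mz (rat (- 2) 0) = 1 - ql 0 2 (- 2)"
    using lz_rat[of 2 4] mz_rat[of "- 2" 0] by (simp_all add: mult.commute)
  have "eX * (ql 0 0 2 * mz (rat (- 2) 0) * lz (rat 2 4)) =
     (ql (- 1) (- 1) (- 2) * ql 0 0 2) * ((1 - ql 2 0 4) * lz (rat 2 4)) * ((1 - ql 0 2 0) * mz (rat (- 2) 0))"
    by (simp only: eX_def mult_ac)
  also have "\<dots> = ql (- 1) (- 1) 0 * (1 - ql 2 0 2) * (1 - ql 0 2 (- 2))" unfolding 1 ql_mult by simp
  finally have e: "eX * (ql 0 0 2 * mz (rat (- 2) 0) * lz (rat 2 4)) = ql (- 1) (- 1) 0 * (1 - ql 2 0 2) * (1 - ql 0 2 (- 2))" .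
  show "shf Al (eX * (ql 0 0 2 * mz (rat (- 2) 0) * lz (rat 2 4))) eX"
    unfolding e unfolding eX_def by (intro shf_mult shf_diff shf_1 shf_ql) simp_all
qed simp

lemma xi_de: "em xi * de = de * em xi"
proof (rule xi_comm_aux[OF gb_de])
  have 1: "(1 - ql 2 0 4) * lz (rat 6 4) = 1 - ql 2 0 6" "(1 - ql 0 2 0) * mz (rat 2 0) = 1 - ql 0 2 2"
    using lz_rat[of 6 4] mz_rat[of 2 0] by (simp_all add: mult.commute)
  have "eX * (ql 0 0 (- 2) * lz (rat 6 4) * mz (rat 2 0)) =
     (ql (- 1) (- 1) (- 2) * ql 0 0 (- 2)) * ((1 - ql 2 0 4) * lz (rat 6 4)) * ((1 - ql 0 2 0) * mz (rat 2 0))"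
    by (simp only: eX_def mult_ac)
  also have "\<dots> = ql (- 1) (- 1) (- 4) * (1 - ql 2 0 6) * (1 - ql 0 2 2)" unfolding 1 ql_mult by simp
  finally have e: "eX * (ql 0 0 (- 2) * lz (rat 6 4) * mz (rat 2 0)) = ql (- 1) (- 1) (- 4) * (1 - ql 2 0 6) * (1 - ql 0 2 2)" .
  show "shf De (eX * (ql 0 0 (- 2) * lz (rat 6 4) * mz (rat 2 0))) eX"
    unfolding e unfolding eX_def by (intro shf_mult shf_diff shf_1 shf_ql) simp_all
qed simp

text \<open>The Askey--Wilson parameters, with \<open>d\<close> and \<open>m\<close> standing for $|j-k|$ and $|N-k-j|$; \<open>aiZ\<close> is
  the inverse of \<open>aZ\<close>.\<close>

definition "aZ d = ql (- 1) 1 (1 + 2 * int d)"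
definition "aiZ d = ql 1 (- 1) (- 1 - 2 * int d)"
definition "bZ = ql 1 (- 1) 1"
definition "cZ = ql 1 1 3"
definition "dZ m = ql (- 1) (- 1) (2 * int m - 1)"
lemmas abcd_defs = aZ_def aiZ_def bZ_def cZ_def dZ_def

text \<open>\<open>WA\<close> and \<open>WB\<close> arise from \<open>Wz\<close> by moving it past $\alpha$ and $\beta$, which multiplies the
  parameter \<open>c\<close> respectively \<open>b\<close> by \<open>p\<close>.\<close>

definition "Wz n d m = (bZ * ql 0 0 (int n + int m) * aiZ d) ^ n * AWs n (aZ d) bZ cZ (dZ m) pz xi
  * iv (qp (bZ * cZ) pz n) * iv (qp (bZ * dZ m) pz n)"
definition "WA n d m = (bZ * ql 0 0 (int n + 1 + int m) * aiZ d) ^ n * AWs n (aZ d) bZ (cZ * pz) (dZ m) pz xi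
  * iv (qp (bZ * cZ * pz) pz n) * iv (qp (bZ * dZ m) pz n)"
definition "WB n d m = (bZ * ql 0 0 (int n + 2 + int m) * aiZ d) ^ n * AWs n (aZ d) (bZ * pz) cZ (dZ m) pz xi
  * iv (qp (bZ * cZ * pz) pz n) * iv (qp (bZ * dZ m * pz) pz n)"

text \<open>The scalar prefactors of P_n, where N = 2n + d + m. In the first and fourth case of the
  theorem j and N - j are n + d and n + m in some order (\<open>C1\<close>). In the other two they
  are n and n + d + m, and the quotient of shifted factorials reduces to 1/(q^2;q^2)_n
  (\<open>C2\<close>).\<close>

definition "C1 n d m = ql 0 0 (- (int (n + d) * int (n + m))) * qp pz pz (n + d + m) * iv (qp pz pz (n + d)) * iv (qp pz pz (n + m))"
definition "C2 n d m = ql 0 0 (- (int n * int (n + d + m))) * iv (qp pz pz n)"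

lemma qp_ql_dvd: "a \<noteq> 0 \<and> b = 0 \<or> a = 0 \<and> b \<noteq> 0 \<Longrightarrow> qp (ql a b c) pz n dvd 1"
  by (rule qp_unit) (auto simp: pz_power ql_mult intro!: one_minus_ql_dvd)

text \<open>Each parameter involves both lambda and mu, but every product of two of them depends on
  at most one of the variables. This is why the shifted factorials in the series and in P_n are
  invertible.\<close>

lemma abcd_mult:
  "bZ * cZ = ql 2 0 4" "bZ * dZ m = ql 0 (- 2) (2 * int m)" "aZ d * bZ = ql 0 0 (2 + 2 * int d)"
  "aZ d * cZ = ql 0 2 (4 + 2 * int d)" "cZ * dZ m = ql 0 0 (2 + 2 * int m)" "aZ d * dZ m = ql (- 2) 0 (2 * int d + 2 * int m)"
  by (simp_all add: abcd_defs ql_mult)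

lemma aiZ: "aZ d * aiZ d = 1"
  by (simp add: abcd_defs ql_mult ql_0)

lemma gs_lm: "gs (Lam f) = lm (\<lambda>_. f)" and gs_mm: "gs (Mu f) = mm (\<lambda>_. f)"
  by (transfer; simp)+

lemma shf_xi: "shf g xi xi"
proof (cases g)
  case (Lam f)
  have "em (xi * lz (\<lambda>_. f)) = em (lz (\<lambda>_. f) * xi)" by (simp only: mult.commute)
  thus ?thesis by (simp add: Lam shf_def gs_lm em_hom em_lz)
next
  case (Mu f)
  have "em (xi * mz (\<lambda>_. f)) = em (mz (\<lambda>_. f) * xi)" by (simp only: mult.commute)
  thus ?thesis by (simp add: Mu shf_def gs_mm em_hom em_mz)
qed (simp_all add: shf_def xi_al xi_be xi_ga xi_de)

text \<open>alpha raises lambda and mu by 1. The first two parameters contain only lambda - mu and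
  stay, \<open>cZ\<close> becomes \<open>cZ * pz\<close>, and \<open>dZ (Suc m)\<close> becomes
  \<open>dZ m\<close>.\<close>

lemma shf_WA: "shf Al (Wz n d (Suc m)) (WA n d m)"
proof -
  have e: "cZ * pz = ql 1 1 5" "ql 2 0 4 * pz = ql 2 0 6" by (simp_all add: abcd_defs ql_mult)
  show ?thesis
    unfolding Wz_def WA_def e abcd_mult
    by (intro shf_mult shf_power shf_AWs shf_iv shf_qp shf_pz shf_xi qp_ql_dvd)
       (auto simp: abcd_defs intro!: shf_ql)
qed

text \<open>beta raises lambda and lowers mu by 1. The last two parameters contain only lambda + mu
  and stay, \<open>bZ\<close> becomes \<open>bZ * pz\<close>, and \<open>aZ (Suc d)\<close> becomes
  \<open>aZ d\<close>.\<close>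

lemma shf_WB: "shf Be (Wz n (Suc d) m) (WB n d m)"
proof -
  have e: "bZ * pz = ql 1 (- 1) 3" "ql 2 0 4 * pz = ql 2 0 6" "ql 0 (- 2) (2 * int m) * pz = ql 0 (- 2) (2 * int m + 2)" by (simp_all add: abcd_defs ql_mult)
  have p: "bZ * ql 0 0 (int n + int m) * aiZ (Suc d) = ql 2 (- 2) (int n + int m - 2 - 2 * int d)"
    "bZ * ql 0 0 (int n + 2 + int m) * aiZ d = ql 2 (- 2) (int n + int m + 2 - 2 * int d)"
    by (simp_all add: abcd_defs ql_mult algebra_simps)
  show ?thesis
    unfolding Wz_def WB_def e abcd_mult p
    by (intro shf_mult shf_power shf_AWs shf_iv shf_qp shf_pz shf_xi qp_ql_dvd)
       (auto simp: abcd_defs intro!: shf_ql)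
qed

lemma unit_cancel: "u dvd 1 \<Longrightarrow> x * u = y * u \<Longrightarrow> x = (y :: 'a::comm_ring_1)"
  by (metis iv mult.assoc mult_1_right)

lemma iv_qp_low: "qp a p (Suc n) dvd 1 \<Longrightarrow> iv (qp (a * p) p n) = iv (qp a p (Suc n)) * (1 - a)"
  using iv[of "qp a p (Suc n)"] by (intro iv_unique) (simp only: qp_Suc' mult_ac)

lemma iv_qp_top: "qp a p (Suc n) dvd 1 \<Longrightarrow> iv (qp a p n) = iv (qp a p (Suc n)) * (1 - a * p ^ n)"
  using iv[of "qp a p (Suc n)"] by (intro iv_unique) (simp only: qp_Suc mult_ac)

text \<open>\<open>da\<close> is $\delta\alpha$ and \<open>gb\<close> is $\gamma\beta$.\<close>

definition "da = 1 + vz * gb"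

text \<open>Both sides are affine in gamma beta. Without the gamma beta term Xi is b + 1/b for b =
  \<open>bZ\<close>, where the quadratic in c = \<open>cZ\<close> has the value (1 - b c)(1 - c/b) =
  (1 - q^{2 lambda+4})(1 - q^{2 mu+2}). For the same reason the quadratic in b is a pure multiple of
  gamma beta.\<close>

lemma qq_c: "da * (1 - ql 2 0 4) * (1 - ql 0 2 2) = qq cZ xi"
proof -
  have "da * (1 - ql 2 0 4) * (1 - ql 0 2 2) = (1 - ql 2 0 4) * (1 - ql 0 2 2) + (1 - ql 2 0 4) * (vz * (1 - ql 0 2 2)) * gb"
    by (simp add: da_def algebra_simps)
  also have "\<dots> = qq cZ xi"
    unfolding vz_eq by (simp add: qq_def xi_def eX_def cZ_def algebra_simps ql_mult ql_mult')
  finally show ?thesis .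
qed

lemma qq_b: "qq bZ xi = ql 0 (- 2) (- 1) * (1 - ql 2 0 4) * (1 - ql 0 2 0) * gb"
  by (simp add: qq_def xi_def eX_def bZ_def algebra_simps ql_mult ql_mult' ql_0)

lemma one_minus_neg: "1 - ql 0 (- 2) k = - (ql 0 (- 2) k * (1 - ql 0 2 (- k)))"
  by (simp add: algebra_simps ql_mult ql_0)

lemma C1_steps:
  "C1 n d (Suc m) = C1 (Suc n) d m * ql 0 0 (int n + 1 + int m) * (1 - ql 0 0 (2 + 2 * int d + 2 * int n))"
  "C1 n (Suc d) m = C1 (Suc n) d m * ql 0 0 (int n + 1 + int d) * (1 - ql 0 0 (2 + 2 * int m + 2 * int n))"
proof -
  have i: "iv (qp pz pz k) = iv (qp pz pz (Suc k)) * (1 - ql 0 0 (2 + 2 * int k))" for k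
    unfolding W.iv_qp_Suc[of k] pz_power by (simp add: algebra_simps)
  have e: "ql 0 0 (- (int (n + d) * int (n + Suc m))) = ql 0 0 (- (int (Suc n + d) * int (Suc n + m))) * ql 0 0 (int n + 1 + int m)"
    "ql 0 0 (- (int (n + Suc d) * int (n + m))) = ql 0 0 (- (int (Suc n + d) * int (Suc n + m))) * ql 0 0 (int n + 1 + int d)"
    unfolding ql_mult by (rule arg_cong[where f = "ql 0 0"] | simp add: algebra_simps)+
  show "C1 n d (Suc m) = C1 (Suc n) d m * ql 0 0 (int n + 1 + int m) * (1 - ql 0 0 (2 + 2 * int d + 2 * int n))"
    unfolding C1_def e i[of "n + d"] by (simp add: mult_ac add_ac)
  show "C1 n (Suc d) m = C1 (Suc n) d m * ql 0 0 (int n + 1 + int d) * (1 - ql 0 0 (2 + 2 * int m + 2 * int n))"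
    unfolding C1_def e i[of "n + m"] by (simp add: mult_ac add_ac)
qed

lemma C2_steps:
  "C2 n (Suc d) (Suc m) = C2 (Suc n) d (Suc m) * ql 0 0 (int n + 2 + int d + int m) * (1 - ql 0 0 (2 + 2 * int n))"
  "C2 (Suc n) d m = C2 (Suc n) d (Suc m) * ql 0 0 (int n + 1)"
proof -
  have i: "iv (qp pz pz n) = iv (qp pz pz (Suc n)) * (1 - ql 0 0 (2 + 2 * int n))"
    unfolding W.iv_qp_Suc[of n] pz_power by (simp add: algebra_simps)
  have e: "ql 0 0 (- (int n * int (n + Suc d + Suc m))) = ql 0 0 (- (int (Suc n) * int (Suc n + d + Suc m))) * ql 0 0 (int n + 2 + int d + int m)"
    "ql 0 0 (- (int (Suc n) * int (Suc n + d + m))) = ql 0 0 (- (int (Suc n) * int (Suc n + d + Suc m))) * ql 0 0 (int n + 1)"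
    unfolding ql_mult by (rule arg_cong[where f = "ql 0 0"] | simp add: algebra_simps)+
  show "C2 n (Suc d) (Suc m) = C2 (Suc n) d (Suc m) * ql 0 0 (int n + 2 + int d + int m) * (1 - ql 0 0 (2 + 2 * int n))"
    unfolding C2_def e i by (simp add: mult_ac)
  show "C2 (Suc n) d m = C2 (Suc n) d (Suc m) * ql 0 0 (int n + 1)"
    unfolding C2_def e by (simp add: mult_ac)
qed

text \<open>The relation in b and c, read in A: \<open>qq cZ xi\<close> becomes delta alpha,
  \<open>qq bZ xi\<close> becomes gamma beta, and the series with a parameter multiplied by the base
  are \<open>WA\<close> and \<open>WB\<close>.\<close>

lemma W_contiguous_bc:
  "C1 (Suc n) d m * Wz (Suc n) d m = C1 n d (Suc m) * (da * WA n d m)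
    + C1 n (Suc d) m * (ql 0 0 (- (int n + 1 + int d + int m)) * mz (rat (2 * int n + 2 * int d + 4) 2) * mz (rat 0 (- 2 * int m)) * (gb * WB n d m))"
\<comment> \<open>The unit comes from b - c = b (1 - q^{2(mu+1)}) in the contiguous relation; all
  terms are brought to the common factor \<open>T\<close>.\<close>
proof (rule unit_cancel[of "1 - ql 0 2 2"])
  define S0 where "S0 = AWs (Suc n) (aZ d) bZ cZ (dZ m) pz xi"
  define SA where "SA = AWs n (aZ d) bZ (cZ * pz) (dZ m) pz xi"
  define SB where "SB = AWs n (aZ d) (bZ * pz) cZ (dZ m) pz xi"
  define V1 where "V1 = iv (qp (ql 2 0 4) pz (Suc n))"
  define V2 where "V2 = iv (qp (ql 0 (- 2) (2 * int m)) pz (Suc n))"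
  define B where "B = ql 2 (- 2) (int n + 1 + int m - 2 * int d)"
  define C where "C = C1 (Suc n) d m"
  define T where "T = C * B ^ n * V1 * V2 * ql 0 0 (int n + 1 + int m)"
  have p: "bZ * ql 0 0 (int (Suc n) + int m) * aiZ d = B" "bZ * ql 0 0 (int n + 1 + int m) * aiZ d = B"
    "bZ * ql 0 0 (int n + 2 + int m) * aiZ d = B * ql 0 0 1"
    by (simp_all add: abcd_defs ql_mult algebra_simps B_def)
  have sn: "ql 0 0 1 ^ n = ql 0 0 (int n)" by (simp add: ql_power)
  have W0: "Wz (Suc n) d m = B ^ Suc n * S0 * V1 * V2"
    unfolding Wz_def p abcd_mult S0_def V1_def V2_def ..
  have i1: "iv (qp (ql 2 0 4 * pz) pz n) = iv (qp (ql 2 0 4) pz (Suc n)) * (1 - ql 2 0 4)"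
    by (rule iv_qp_low[OF qp_ql_dvd]) simp
  have i2: "iv (qp (ql 0 (- 2) (2 * int m)) pz n) = iv (qp (ql 0 (- 2) (2 * int m)) pz (Suc n)) * (1 - ql 0 (- 2) (2 * int m + 2 * int n))"
    using iv_qp_top[OF qp_ql_dvd, of 0 "- 2" "2 * int m" n] by (simp add: pz_power ql_mult)
  have i3: "iv (qp (ql 0 (- 2) (2 * int m) * pz) pz n) = iv (qp (ql 0 (- 2) (2 * int m)) pz (Suc n)) * (1 - ql 0 (- 2) (2 * int m))"
    by (rule iv_qp_low[OF qp_ql_dvd]) simp
  have A: "WA n d m = B ^ n * SA * (V1 * (1 - ql 2 0 4)) * (V2 * (1 - ql 0 (- 2) (2 * int m + 2 * int n)))"
    unfolding WA_def p abcd_mult SA_def V1_def V2_def i1 i2 ..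
  have Bq: "WB n d m = B ^ n * ql 0 0 (int n) * SB * (V1 * (1 - ql 2 0 4)) * (V2 * (1 - ql 0 (- 2) (2 * int m)))"
    unfolding WB_def p abcd_mult SB_def V1_def V2_def power_mult_distrib sn i1 i3 ..
  have E5: "(bZ - cZ) * aiZ d * S0 = (1 - ql 0 0 (2 + 2 * int d + 2 * int n)) * (1 - ql 0 (- 2) (2 * int m + 2 * int n)) * (qq cZ xi * SA)
     - (1 - ql 0 0 (2 + 2 * int m + 2 * int n)) * (1 - ql 0 2 (4 + 2 * int d + 2 * int n)) * (qq bZ xi * SB)"
    unfolding S0_def SA_def SB_def W.AWs_contiguous_bc[OF aiZ] by (simp add: abcd_mult pz_power ql_mult)
  have bc: "ql 0 0 (int n + 1 + int m) * ((bZ - cZ) * aiZ d) = B * (1 - ql 0 2 2)"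
    by (simp add: abcd_defs B_def algebra_simps ql_mult)
  have "C * Wz (Suc n) d m * (1 - ql 0 2 2) = C * B ^ n * V1 * V2 * (B * (1 - ql 0 2 2)) * S0"
    unfolding W0 by (simp only: power_Suc mult_ac)
  also have "\<dots> = T * ((bZ - cZ) * aiZ d * S0)"
    unfolding bc[symmetric] T_def by (simp only: mult_ac)
  finally have L: "C * Wz (Suc n) d m * (1 - ql 0 2 2) = T * ((bZ - cZ) * aiZ d * S0)" .
  have "C1 n d (Suc m) * (da * WA n d m) * (1 - ql 0 2 2) = T * ((1 - ql 0 0 (2 + 2 * int d + 2 * int n)) * (1 - ql 0 (- 2) (2 * int m + 2 * int n)) * ((da * (1 - ql 2 0 4) * (1 - ql 0 2 2)) * SA))"
    unfolding C1_steps(1) A T_def C_def by (simp only: mult_ac)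
  hence R1: "C1 n d (Suc m) * (da * WA n d m) * (1 - ql 0 2 2) = T * ((1 - ql 0 0 (2 + 2 * int d + 2 * int n)) * (1 - ql 0 (- 2) (2 * int m + 2 * int n)) * (qq cZ xi * SA))"
    unfolding qq_c .
  have m1: "mz (rat (2 * int n + 2 * int d + 4) 2) * (1 - ql 0 2 2) = 1 - ql 0 2 (4 + 2 * int d + 2 * int n)"
    unfolding mz_rat by (simp add: algebra_simps)
  \<comment> \<open>The sign produced by rewriting 1 - q^{-2 mu + 2m} turns the difference in the
    contiguous relation into the sum that the recurrence requires.\<close>
  have m2: "mz (rat 0 (- 2 * int m)) * (1 - ql 0 (- 2) (2 * int m)) = - (ql 0 (- 2) (2 * int m) * (1 - ql 0 2 0))"
  proof -
    have "mz (rat 0 (- 2 * int m)) * (1 - ql 0 (- 2) (2 * int m)) = - (ql 0 (- 2) (2 * int m) * (mz (rat 0 (- 2 * int m)) * (1 - ql 0 2 (- 2 * int m))))"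
      unfolding one_minus_neg by simp
    thus ?thesis unfolding mz_rat .
  qed
  have s: "ql 0 0 (int n + 1 + int d) * ql 0 0 (- (int n + 1 + int d + int m)) * ql 0 0 (int n) * ql 0 (- 2) (2 * int m) = ql 0 0 (int n + 1 + int m) * ql 0 (- 2) (- 1)"
    by (simp add: ql_mult add.commute)
  let ?k = "ql 0 0 (- (int n + 1 + int d + int m)) * mz (rat (2 * int n + 2 * int d + 4) 2) * mz (rat 0 (- 2 * int m))"
  have "C1 n (Suc d) m * (?k * (gb * WB n d m)) * (1 - ql 0 2 2) =
     C * B ^ n * V1 * V2 * (1 - ql 0 0 (2 + 2 * int m + 2 * int n)) * (mz (rat (2 * int n + 2 * int d + 4) 2) * (1 - ql 0 2 2))
     * (ql 0 0 (int n + 1 + int d) * ql 0 0 (- (int n + 1 + int d + int m)) * ql 0 0 (int n))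
     * (mz (rat 0 (- 2 * int m)) * (1 - ql 0 (- 2) (2 * int m))) * ((1 - ql 2 0 4) * gb * SB)"
    unfolding C1_steps(2) Bq C_def by (simp only: mult_ac)
  also have "\<dots> = - (C * B ^ n * V1 * V2 * (1 - ql 0 0 (2 + 2 * int m + 2 * int n)) * (1 - ql 0 2 (4 + 2 * int d + 2 * int n))
     * (ql 0 0 (int n + 1 + int d) * ql 0 0 (- (int n + 1 + int d + int m)) * ql 0 0 (int n) * ql 0 (- 2) (2 * int m)) * ((1 - ql 0 2 0) * ((1 - ql 2 0 4) * gb * SB)))"
    unfolding m1 m2 unfolding mult_minus_left mult_minus_right by (simp only: mult_ac)
  also have "\<dots> = - (T * ((1 - ql 0 0 (2 + 2 * int m + 2 * int n)) * (1 - ql 0 2 (4 + 2 * int d + 2 * int n)) * (qq bZ xi * SB)))"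
    unfolding s qq_b T_def by (simp only: mult_ac)
  finally have R2: "C1 n (Suc d) m * (?k * (gb * WB n d m)) * (1 - ql 0 2 2) =
     - (T * ((1 - ql 0 0 (2 + 2 * int m + 2 * int n)) * (1 - ql 0 2 (4 + 2 * int d + 2 * int n)) * (qq bZ xi * SB)))" .
  show "C1 (Suc n) d m * Wz (Suc n) d m * (1 - ql 0 2 2) = (C1 n d (Suc m) * (da * WA n d m) + C1 n (Suc d) m * (?k * (gb * WB n d m))) * (1 - ql 0 2 2)"
    unfolding distrib_right R1 R2 C_def[symmetric] L E5 right_diff_distrib[of T] by simp
qed (rule one_minus_ql_dvd, simp)

lemma W_contiguous_d:
  "C2 (Suc n) d (Suc m) * Wz (Suc n) d (Suc m) = C2 n (Suc d) (Suc m) *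
     (ql 0 0 (- (int n + 3 + int d + 2 * int m)) * mz (rat 0 (- 2 * int m - 2)) * mz (rat (2 * int n + 2 * int d + 4) (- 2 * int m)) * (gb * WB n d (Suc m)))
    + C2 (Suc n) d m * Wz (Suc n) d m"
\<comment> \<open>The unit is the product 1 - b D with D = \<open>dZ m\<close>, the factor in front
  of the left-hand side of \<open>AWs_contiguous_d\<close>; D times the base is
  \<open>dZ (Suc m)\<close>.\<close>
proof (rule unit_cancel[of "1 - ql 0 (- 2) (2 * int m)"])
  define S0 where "S0 = AWs (Suc n) (aZ d) bZ cZ (dZ m * pz) pz xi"
  define S1 where "S1 = AWs (Suc n) (aZ d) bZ cZ (dZ m) pz xi"
  define SB where "SB = AWs n (aZ d) (bZ * pz) cZ (dZ m * pz) pz xi"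
  define V1 where "V1 = iv (qp (ql 2 0 4) pz (Suc n))"
  define V2 where "V2 = iv (qp (ql 0 (- 2) (2 * int m + 2)) pz (Suc n))"
  define B where "B = ql 2 (- 2) (int n + 2 + int m - 2 * int d)"
  define C where "C = C2 (Suc n) d (Suc m)"
  define T where "T = C * B ^ Suc n * V1 * V2"
  have dp: "dZ (Suc m) = dZ m * pz" by (simp add: dZ_def ql_mult)
  have p: "bZ * ql 0 0 (int (Suc n) + int (Suc m)) * aiZ d = B" "bZ * ql 0 0 (int n + 2 + int (Suc m)) * aiZ d = B * ql 0 0 1"
    "bZ * ql 0 0 (int (Suc n) + int m) * aiZ d = B * ql 0 0 (- 1)"
    by (simp_all add: abcd_defs ql_mult algebra_simps B_def)
  have "- int (Suc n) = - int n - 1" by simp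
  hence sn: "ql 0 0 1 ^ n = ql 0 0 (int n)" "ql 0 0 (- 1) ^ Suc n = ql 0 0 (- int n - 1)"
    unfolding ql_power by (simp_all only: mult_zero_right mult_1_right mult_minus1_right)
  have bd: "bZ * dZ (Suc m) = ql 0 (- 2) (2 * int m + 2)" by (simp add: abcd_defs ql_mult add.commute)
  have W0: "Wz (Suc n) d (Suc m) = B ^ Suc n * S0 * V1 * V2"
    unfolding Wz_def p bd abcd_mult(1) S0_def V1_def V2_def unfolding dp ..
  have i2: "iv (qp (ql 0 (- 2) (2 * int m)) pz (Suc n)) * (1 - ql 0 (- 2) (2 * int m)) = V2 * (1 - ql 0 (- 2) (2 * int m + 2 * int n + 2))"
  proof -
    have u: "qp (ql 0 (- 2) (2 * int m)) pz (Suc (Suc n)) dvd 1" by (rule qp_ql_dvd) simp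
    have "V2 = iv (qp (ql 0 (- 2) (2 * int m) * pz) pz (Suc n))" by (simp add: V2_def ql_mult)
    hence 1: "V2 = iv (qp (ql 0 (- 2) (2 * int m)) pz (Suc (Suc n))) * (1 - ql 0 (- 2) (2 * int m))"
      using iv_qp_low[OF u] by simp
    have 2: "ql 0 (- 2) (2 * int m) * pz ^ Suc n = ql 0 (- 2) (2 * int m + 2 * int n + 2)"
      unfolding pz_power ql_mult by (simp add: algebra_simps)
    show ?thesis unfolding 1 iv_qp_top[OF u] 2 by (simp only: mult_ac)
  qed
  have i1: "iv (qp (ql 2 0 4 * pz) pz n) = iv (qp (ql 2 0 4) pz (Suc n)) * (1 - ql 2 0 4)"
    by (rule iv_qp_low[OF qp_ql_dvd]) simp
  have i3: "iv (qp (ql 0 (- 2) (2 * int m + 2) * pz) pz n) = iv (qp (ql 0 (- 2) (2 * int m + 2)) pz (Suc n)) * (1 - ql 0 (- 2) (2 * int m + 2))"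
    by (rule iv_qp_low[OF qp_ql_dvd]) simp
  have W1: "Wz (Suc n) d m * (1 - ql 0 (- 2) (2 * int m)) = B ^ Suc n * ql 0 0 (- int n - 1) * S1 * V1 * (V2 * (1 - ql 0 (- 2) (2 * int m + 2 * int n + 2)))"
    unfolding Wz_def p abcd_mult S1_def V1_def power_mult_distrib sn i2[symmetric] by (simp only: mult_ac)
  have Bq: "WB n d (Suc m) = B ^ n * ql 0 0 (int n) * SB * (V1 * (1 - ql 2 0 4)) * (V2 * (1 - ql 0 (- 2) (2 * int m + 2)))"
    unfolding WB_def p bd abcd_mult(1) SB_def V1_def V2_def power_mult_distrib sn i1 i3 unfolding dp ..
  have E3: "(1 - ql 0 (- 2) (2 * int m)) * S0 = (1 - ql 0 0 (2 + 2 * int n)) * ql (- 2) 0 (2 * int d + 2 * int m) * (1 - ql 0 2 (4 + 2 * int d + 2 * int n)) * (qq bZ xi * SB)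
     + (1 - ql 0 (- 2) (2 * int m + 2 * int n + 2)) * S1"
  proof -
    have 1: "1 - pz ^ Suc n = 1 - ql 0 0 (2 + 2 * int n)" unfolding pz_power by (simp add: algebra_simps)
    have 2: "bZ * dZ m * pz ^ Suc n = ql 0 (- 2) (2 * int m + 2 * int n + 2)"
      unfolding pz_power abcd_mult ql_mult by (simp add: algebra_simps)
    have 3: "aZ d * cZ * pz ^ n = ql 0 2 (4 + 2 * int d + 2 * int n)" unfolding pz_power abcd_mult ql_mult by simp
    show ?thesis
      using W.AWs_contiguous_d[OF aiZ, of bZ "dZ m" n d cZ xi] unfolding 1 2 3 S0_def S1_def SB_def unfolding abcd_mult .
  qed
  have L: "C * Wz (Suc n) d (Suc m) * (1 - ql 0 (- 2) (2 * int m)) = T * ((1 - ql 0 (- 2) (2 * int m)) * S0)"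
    unfolding W0 T_def by (simp only: mult_ac)
  have s1: "ql 0 0 (int n + 1) * ql 0 0 (- int n - 1) = 1" by (simp add: ql_mult ql_0)
  have "C2 (Suc n) d m * (Wz (Suc n) d m * (1 - ql 0 (- 2) (2 * int m))) = T * ((1 - ql 0 (- 2) (2 * int m + 2 * int n + 2)) * S1) * (ql 0 0 (int n + 1) * ql 0 0 (- int n - 1))"
    unfolding W1 C2_steps(2)[of n d m] T_def C_def by (simp only: mult_ac)
  hence R2: "C2 (Suc n) d m * Wz (Suc n) d m * (1 - ql 0 (- 2) (2 * int m)) = T * ((1 - ql 0 (- 2) (2 * int m + 2 * int n + 2)) * S1)"
    unfolding s1 by (simp add: mult.assoc)
  let ?r1 = "mz (rat 0 (- 2 * int m - 2))" and ?r2 = "mz (rat (2 * int n + 2 * int d + 4) (- 2 * int m))"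
  have m1: "?r2 * (1 - ql 0 (- 2) (2 * int m)) = - (ql 0 (- 2) (2 * int m) * (1 - ql 0 2 (4 + 2 * int d + 2 * int n)))"
    unfolding one_minus_neg using mz_rat[of "2 * int n + 2 * int d + 4" "- 2 * int m"] by (simp add: mult_ac add_ac)
  have m2: "?r1 * (1 - ql 0 (- 2) (2 * int m + 2)) = - (ql 0 (- 2) (2 * int m + 2) * (1 - ql 0 2 0))"
  proof -
    have "?r1 * (1 - ql 0 (- 2) (2 * int m + 2)) = - (ql 0 (- 2) (2 * int m + 2) * (?r1 * (1 - ql 0 2 (- 2 * int m - 2))))"
      unfolding one_minus_neg by simp
    thus ?thesis unfolding mz_rat .
  qed
  have s: "ql 0 0 (int n + 2 + int d + int m) * ql 0 0 (- (int n + 3 + int d + 2 * int m)) * ql 0 0 (int n) * ql 0 (- 2) (2 * int m) * ql 0 (- 2) (2 * int m + 2)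
     = B * (ql (- 2) 0 (2 * int d + 2 * int m) * ql 0 (- 2) (- 1))"
    by (simp add: ql_mult B_def algebra_simps)
  let ?k = "ql 0 0 (- (int n + 3 + int d + 2 * int m)) * ?r1 * ?r2"
  have "C2 n (Suc d) (Suc m) * (?k * (gb * WB n d (Suc m))) * (1 - ql 0 (- 2) (2 * int m)) =
     C * B ^ n * V1 * V2 * (1 - ql 0 0 (2 + 2 * int n)) * (?r2 * (1 - ql 0 (- 2) (2 * int m)))
     * (ql 0 0 (int n + 2 + int d + int m) * ql 0 0 (- (int n + 3 + int d + 2 * int m)) * ql 0 0 (int n))
     * (?r1 * (1 - ql 0 (- 2) (2 * int m + 2))) * ((1 - ql 2 0 4) * gb * SB)"
    unfolding C2_steps(1) Bq C_def by (simp only: mult_ac)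
  also have "\<dots> = C * B ^ n * V1 * V2 * (1 - ql 0 0 (2 + 2 * int n)) * (1 - ql 0 2 (4 + 2 * int d + 2 * int n))
     * (ql 0 0 (int n + 2 + int d + int m) * ql 0 0 (- (int n + 3 + int d + 2 * int m)) * ql 0 0 (int n) * ql 0 (- 2) (2 * int m) * ql 0 (- 2) (2 * int m + 2))
     * ((1 - ql 0 2 0) * ((1 - ql 2 0 4) * gb * SB))"
    unfolding m1 m2 unfolding mult_minus_left mult_minus_right minus_minus by (simp only: mult_ac)
  also have "\<dots> = T * ((1 - ql 0 0 (2 + 2 * int n)) * ql (- 2) 0 (2 * int d + 2 * int m) * (1 - ql 0 2 (4 + 2 * int d + 2 * int n)) * (qq bZ xi * SB))"
    unfolding s qq_b T_def by (simp only: power_Suc mult_ac)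
  finally have R1: "C2 n (Suc d) (Suc m) * (?k * (gb * WB n d (Suc m))) * (1 - ql 0 (- 2) (2 * int m)) =
     T * ((1 - ql 0 0 (2 + 2 * int n)) * ql (- 2) 0 (2 * int d + 2 * int m) * (1 - ql 0 2 (4 + 2 * int d + 2 * int n)) * (qq bZ xi * SB))" .
  show "C2 (Suc n) d (Suc m) * Wz (Suc n) d (Suc m) * (1 - ql 0 (- 2) (2 * int m)) =
     (C2 n (Suc d) (Suc m) * (?k * (gb * WB n d (Suc m))) + C2 (Suc n) d m * Wz (Suc n) d m) * (1 - ql 0 (- 2) (2 * int m))"
    unfolding distrib_right R1 R2 C_def[symmetric] L E3 distrib_left[of T] ..
qed (rule one_minus_ql_dvd, simp)

section \<open>The closed form satisfies the recurrences\<close>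

text \<open>The four closed forms, named after the generators that accompany P_n. The coordinates
  are the index n of P_n, d = |j - k| and m = |N - k - j|, so that N = 2n + d + m.\<close>

definition "t_ga_de n d m = ga ^ d * (de ^ m * em (C1 n d m * Wz n d m))"
definition "t_ga_al n d m = ga ^ d * (em (C2 n d m * Wz n d m) * al ^ m)"
definition "t_de_be n d m = de ^ m * (em (C2 n d m * Wz n d m) * be ^ d)"
definition "t_al_be n d m = em (C1 n d m * Wz n d m) * (al ^ m * be ^ d)"

lemma shf_C: "shf g (C1 n d m) (C1 n d m)" "shf g (C2 n d m) (C2 n d m)"
  unfolding C1_def C2_def by (intro shf_mult shf_iv shf_qp shf_pz W.qp_pp_unit shf_ql; simp)+

lemma shf_WB': "shf Ga (WB n d m) (Wz n (Suc d) m)"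
proof -
  have e: "bZ * pz = ql 1 (- 1) 3" "ql 2 0 4 * pz = ql 2 0 6" "ql 0 (- 2) (2 * int m) * pz = ql 0 (- 2) (2 * int m + 2)" by (simp_all add: abcd_defs ql_mult)
  have p: "bZ * ql 0 0 (int n + int m) * aiZ (Suc d) = ql 2 (- 2) (int n + int m - 2 - 2 * int d)"
    "bZ * ql 0 0 (int n + 2 + int m) * aiZ d = ql 2 (- 2) (int n + int m + 2 - 2 * int d)"
    by (simp_all add: abcd_defs ql_mult algebra_simps)
  show ?thesis
    unfolding Wz_def WB_def e abcd_mult p
    by (intro shf_mult shf_power shf_AWs shf_iv shf_qp shf_pz shf_xi qp_ql_dvd)
       (auto simp: abcd_defs intro!: shf_ql)
qed

lemma em_da: "em da = de * al"
  unfolding da_def em_hom em_mz em_gb sl2_DA ..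

lemma WA_al: "em (C1 n d k * Wz n d (Suc m)) * al = al * em (C1 n d k * WA n d m)"
  using shf_mult[OF shf_C(1) shf_WA] unfolding shf_def .

lemma WB_be: "em (C1 n k l * Wz n (Suc d) m) * be = be * em (C1 n k l * WB n d m)"
  "em (C2 n k l * Wz n (Suc d) m) * be = be * em (C2 n k l * WB n d m)"
  using shf_mult[OF shf_C(1) shf_WB] shf_mult[OF shf_C(2) shf_WB] unfolding shf_def by blast+

lemma WB_ga: "ga * em (C1 n k l * Wz n (Suc d) m) = em (C1 n k l * WB n d m) * ga"
  "ga * em (C2 n k l * Wz n (Suc d) m) = em (C2 n k l * WB n d m) * ga"
  using shf_mult[OF shf_C(1) shf_WB'] shf_mult[OF shf_C(2) shf_WB'] unfolding shf_def by metis+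

lemma Mr_gs:
  "Mr i j * (ga ^ d * x) = ga ^ d * (Mr (i + 2 * int d) (j + 2 * int d) * x)"
  "Mr i j * (de ^ d * x) = de ^ d * (Mr (i - 2 * int d) (j - 2 * int d) * x)"
  "al ^ d * (Mr i j * x) = Mr (i - 2 * int d) (j - 2 * int d) * (al ^ d * x)"
  using gs_LM_power(2)[of Ga d "i + 2 * int d" "j + 2 * int d"] gs_LM_power(2)[of De d "i - 2 * int d" "j - 2 * int d"]
    gs_LM_power(2)[of Al d i j] by (simp_all flip: mult.assoc)

lemma em_k: "em (ql 0 0 k * (mz f * (mz g * (gb * x)))) = sq k * (mm f * (mm g * (ga * be * em x)))"
  unfolding em_hom em_sq em_mz em_gb ..

lemma em_W_contiguous_bc:
  "em (C1 (Suc n) d m * Wz (Suc n) d m) = de * al * em (C1 n d (Suc m) * WA n d m) +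
     sq (- (int n + 1 + int d + int m)) * (Mr (2 * int n + 2 * int d + 4) 2 * (Mr 0 (- 2 * int m) * (ga * be * em (C1 n (Suc d) m * WB n d m))))"
proof -
  have "C1 (Suc n) d m * Wz (Suc n) d m = da * (C1 n d (Suc m) * WA n d m) +
    ql 0 0 (- (int n + 1 + int d + int m)) * (mz (rat (2 * int n + 2 * int d + 4) 2) * (mz (rat 0 (- 2 * int m)) * (gb * (C1 n (Suc d) m * WB n d m))))"
    unfolding W_contiguous_bc by (simp only: mult_ac)
  thus ?thesis by (simp only: em_hom(1) em_k) (simp only: em_hom(2) em_da)
qed

lemma em_W_contiguous_d:
  "em (C2 (Suc n) d (Suc m) * Wz (Suc n) d (Suc m)) =
     sq (- (int n + 3 + int d + 2 * int m)) * (Mr (2 * int n + 2 * int d + 4) (- 2 * int m) * (Mr 0 (- 2 * int m - 2) * (ga * be * em (C2 n (Suc d) (Suc m) * WB n d (Suc m)))))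
     + em (C2 (Suc n) d m * Wz (Suc n) d m)"
proof -
  have "C2 (Suc n) d (Suc m) * Wz (Suc n) d (Suc m) =
    ql 0 0 (- (int n + 3 + int d + 2 * int m)) * (mz (rat (2 * int n + 2 * int d + 4) (- 2 * int m)) * (mz (rat 0 (- 2 * int m - 2)) * (gb * (C2 n (Suc d) (Suc m) * WB n d (Suc m)))))
    + C2 (Suc n) d m * Wz (Suc n) d m"
    unfolding W_contiguous_d by (simp only: mult_ac)
  thus ?thesis by (simp only: em_hom(1) em_k)
qed

lemma em_commute: "em x * em y = em y * em x"
  unfolding em_hom(2)[symmetric] mult.commute[of x] ..

lemma em_Mr: "em x * (Mr i j * y) = Mr i j * (em x * y)"
  unfolding em_mz[symmetric] mult.assoc[symmetric] em_commute[of x] ..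

lemma em_gb_commute: "em x * (ga * be * y) = ga * be * (em x * y)"
  unfolding em_gb[symmetric] mult.assoc[symmetric] em_commute[of x] ..

lemma sq_Mr_cong: "a = a' \<Longrightarrow> b = b' \<Longrightarrow> c = c' \<Longrightarrow> sq a * Mr b c = sq a' * Mr b' c'"
  by simp

lemma T_step_exponent: "- int n - 1 - int d + - int m = - (int n + 1 + int d + int m)"
  by simp

text \<open>Moved past the diagonal factor, alpha and beta meet the neighbouring delta and gamma.
  The two terms become gamma^d delta^m times delta alpha and gamma beta with the series
  \<open>WA\<close> and \<open>WB\<close>, which is the relation in b and c.\<close>

lemma t_ga_de_step:
  "t_ga_de (Suc n) d m = t_ga_de n d (Suc m) * al + cR (2 * n + d + m + 1) (n + 1 + d) * (t_ga_de n (Suc d) m * be)"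
proof -
  let ?A = "em (C1 n d (Suc m) * WA n d m)" and ?B = "em (C1 n (Suc d) m * WB n d m)"
  have a: "t_ga_de n d (Suc m) * al = ga ^ d * (de ^ m * (de * al * ?A))"
    unfolding t_ga_de_def by (simp add: mult.assoc WA_al power_Suc2 del: power_Suc)
  have c: "cR (2 * n + d + m + 1) (n + 1 + d) = sq (- int n - 1 - int d) * Mr (2 * int n + 2 * int m + 4) (2 * int m + 2 - 2 * int d)"
    unfolding cR_def by (rule sq_Mr_cong) auto
  have "t_ga_de n (Suc d) m * be = ga ^ d * (ga * (de ^ m * be) * ?B)"
    unfolding t_ga_de_def by (simp add: mult.assoc WB_be power_Suc2 del: power_Suc)
  also have "\<dots> = sq (- int m) * (ga ^ d * (de ^ m * (Mr 0 (- 2 * int m) * (ga * be * ?B))))"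
    unfolding ga_de_be by (simp add: mult.assoc sq_left_commute)
  finally have "cR (2 * n + d + m + 1) (n + 1 + d) * (t_ga_de n (Suc d) m * be) =
     sq (- (int n + 1 + int d + int m)) * (Mr (2 * int n + 2 * int m + 4) (2 * int m + 2 - 2 * int d) * (ga ^ d * (de ^ m * (Mr 0 (- 2 * int m) * (ga * be * ?B)))))"
    unfolding c by (simp only: mult.assoc sq_left_commute sq_sq T_step_exponent)
  also have "\<dots> = sq (- (int n + 1 + int d + int m)) * (ga ^ d * (de ^ m * (Mr (2 * int n + 2 * int d + 4) 2 * (Mr 0 (- 2 * int m) * (ga * be * ?B)))))"
    unfolding Mr_gs by (simp add: algebra_simps)
  finally show ?thesis
    unfolding a t_ga_de_def[of "Suc n"] em_W_contiguous_bc distrib_left sq_left_commute by simp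
qed

lemma t_al_be_step:
  "t_al_be (Suc n) d m = cL (2 * n + d + m + 1) (n + m) * (ga * t_al_be n (Suc d) m) + de * t_al_be n d (Suc m)"
proof -
  let ?A = "em (C1 n d (Suc m) * WA n d m)" and ?B = "em (C1 n (Suc d) m * WB n d m)"
  have "de * t_al_be n d (Suc m) = de * (em (C1 n d (Suc m) * Wz n d (Suc m)) * al) * (al ^ m * be ^ d)"
    unfolding t_al_be_def by (simp add: mult.assoc)
  hence a: "de * t_al_be n d (Suc m) = de * al * ?A * (al ^ m * be ^ d)"
    unfolding WA_al by (simp add: mult.assoc)
  have c: "cL (2 * n + d + m + 1) (n + m) = sq (- int n - 1 - int d) * Mr (2 * int n + 2 * int d + 4) 2"
    unfolding cL_def by (rule sq_Mr_cong) auto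
  have "ga * t_al_be n (Suc d) m = (ga * em (C1 n (Suc d) m * Wz n (Suc d) m)) * (al ^ m * be) * be ^ d"
    unfolding t_al_be_def by (simp add: mult.assoc)
  also have "\<dots> = ?B * (ga * (al ^ m * be)) * be ^ d"
    unfolding WB_ga by (simp add: mult.assoc)
  also have "\<dots> = sq (- int m) * (?B * (Mr 0 (- 2 * int m) * (ga * be * (al ^ m * be ^ d))))"
    unfolding ga_al_be mult.assoc sq_left_commute0[of ?B] ..
  also have "\<dots> = sq (- int m) * (Mr 0 (- 2 * int m) * (ga * be * ?B)) * (al ^ m * be ^ d)"
    unfolding em_Mr em_gb_commute by (simp add: mult.assoc)
  finally have "cL (2 * n + d + m + 1) (n + m) * (ga * t_al_be n (Suc d) m) =
     sq (- (int n + 1 + int d + int m)) * (Mr (2 * int n + 2 * int d + 4) 2 * (Mr 0 (- 2 * int m) * (ga * be * ?B))) * (al ^ m * be ^ d)"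
    unfolding c by (simp only: mult.assoc sq_left_commute sq_sq T_step_exponent)
  thus ?thesis
    unfolding a t_al_be_def[of "Suc n"] em_W_contiguous_bc distrib_right by simp
qed

text \<open>Here only gamma and beta meet across the diagonal factor. The other term keeps n + 1 and
  just has m lowered, which is the situation of the relation in the fourth parameter.\<close>

lemma t_de_be_step:
  "t_de_be (Suc n) d (Suc m) = cL (2 * n + d + m + 2) n * (ga * t_de_be n (Suc d) (Suc m)) + de * t_de_be (Suc n) d m"
proof -
  let ?B = "em (C2 n (Suc d) (Suc m) * WB n d (Suc m))"
  have c: "cL (2 * n + d + m + 2) n = sq (- int n - 2 - int d - int m) * Mr (2 * int n + 2 * int d + 2 * int m + 6) 2"
    unfolding cL_def by (rule sq_Mr_cong) auto
  have "ga * t_de_be n (Suc d) (Suc m) = ga * (de ^ Suc m * ((em (C2 n (Suc d) (Suc m) * Wz n (Suc d) (Suc m)) * be) * be ^ d))"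
    unfolding t_de_be_def by (simp only: mult.assoc power_Suc)
  also have "\<dots> = ga * (de ^ Suc m * be) * (?B * be ^ d)"
    unfolding WB_be by (simp only: mult.assoc)
  also have "\<dots> = sq (- int (Suc m)) * (de ^ Suc m * (Mr 0 (- 2 * int (Suc m)) * (ga * be * (?B * be ^ d))))"
    unfolding ga_de_be by (simp only: mult.assoc sq_left_commute)
  finally have "cL (2 * n + d + m + 2) n * (ga * t_de_be n (Suc d) (Suc m)) =
     sq (- int n - 2 - int d - int m + - int (Suc m)) * (de ^ Suc m * (Mr (2 * int n + 2 * int d + 2 * int m + 6 - 2 * int (Suc m)) (2 - 2 * int (Suc m)) * (Mr 0 (- 2 * int (Suc m)) * (ga * be * (?B * be ^ d)))))"
    unfolding c by (simp only: mult.assoc sq_left_commute sq_sq Mr_gs)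
  also have "- int n - 2 - int d - int m + - int (Suc m) = - (int n + 3 + int d + 2 * int m)" by simp
  also have "2 * int n + 2 * int d + 2 * int m + 6 - 2 * int (Suc m) = 2 * int n + 2 * int d + 4" by simp
  also have "2 - 2 * int (Suc m) = - 2 * int m" by simp
  also have "- 2 * int (Suc m) = - 2 * int m - 2" by simp
  finally have b: "cL (2 * n + d + m + 2) n * (ga * t_de_be n (Suc d) (Suc m)) =
     sq (- (int n + 3 + int d + 2 * int m)) * (de ^ Suc m * (Mr (2 * int n + 2 * int d + 4) (- 2 * int m) * (Mr 0 (- 2 * int m - 2) * (ga * be * (?B * be ^ d)))))" .
  show ?thesis
    unfolding b t_de_be_def[of "Suc n"] em_W_contiguous_d distrib_left distrib_right mult.assoc sq_left_commute by (simp add: mult.assoc)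
qed

lemma t_ga_al_step:
  "t_ga_al (Suc n) d (Suc m) = t_ga_al (Suc n) d m * al + cR (2 * n + d + m + 2) (n + d + m + 2) * (t_ga_al n (Suc d) (Suc m) * be)"
proof -
  let ?B = "em (C2 n (Suc d) (Suc m) * WB n d (Suc m))"
  have c: "cR (2 * n + d + m + 2) (n + d + m + 2) = sq (- int n - 2 - int d - int m) * Mr (2 * int n + 4) (- 2 * int d - 2 * int m)"
    unfolding cR_def by (rule sq_Mr_cong) auto
  have "t_ga_al n (Suc d) (Suc m) * be = ga ^ d * ((ga * em (C2 n (Suc d) (Suc m) * Wz n (Suc d) (Suc m))) * (al ^ Suc m * be))"
    unfolding t_ga_al_def power_Suc2[of ga] by (simp only: mult.assoc)
  also have "\<dots> = ga ^ d * (?B * (ga * (al ^ Suc m * be)))"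
    unfolding WB_ga by (simp only: mult.assoc)
  also have "\<dots> = sq (- int (Suc m)) * (ga ^ d * (?B * (Mr 0 (- 2 * int (Suc m)) * (ga * be * al ^ Suc m))))"
    unfolding ga_al_be sq_left_commute0[of ?B] sq_left_commute ..
  also have "\<dots> = sq (- int (Suc m)) * (ga ^ d * (Mr 0 (- 2 * int (Suc m)) * (ga * be * (?B * al ^ Suc m))))"
    unfolding em_Mr em_gb_commute ..
  finally have "cR (2 * n + d + m + 2) (n + d + m + 2) * (t_ga_al n (Suc d) (Suc m) * be) =
     sq (- int n - 2 - int d - int m + - int (Suc m)) * (ga ^ d * (Mr (2 * int n + 4 + 2 * int d) (- 2 * int d - 2 * int m + 2 * int d) * (Mr 0 (- 2 * int (Suc m)) * (ga * be * (?B * al ^ Suc m)))))"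
    unfolding c by (simp only: mult.assoc sq_left_commute sq_sq Mr_gs)
  also have "- int n - 2 - int d - int m + - int (Suc m) = - (int n + 3 + int d + 2 * int m)" by simp
  also have "2 * int n + 4 + 2 * int d = 2 * int n + 2 * int d + 4" by simp
  also have "- 2 * int d - 2 * int m + 2 * int d = - 2 * int m" by simp
  also have "- 2 * int (Suc m) = - 2 * int m - 2" by simp
  finally have b: "cR (2 * n + d + m + 2) (n + d + m + 2) * (t_ga_al n (Suc d) (Suc m) * be) =
     sq (- (int n + 3 + int d + 2 * int m)) * (ga ^ d * (Mr (2 * int n + 2 * int d + 4) (- 2 * int m) * (Mr 0 (- 2 * int m - 2) * (ga * be * (?B * al ^ Suc m)))))" .
  show ?thesis
    unfolding b t_ga_al_def[of "Suc n"] em_W_contiguous_d distrib_left distrib_right mult.assoc sq_left_commute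
    by (simp add: mult.assoc power_Suc2 del: power_Suc)
qed

lemma iv_1: "iv 1 = 1"
  by (rule iv_unique) simp

lemma Wz_0: "Wz 0 d m = 1"
  by (simp add: Wz_def AWs_def AWc_def iv_1)

lemma C2_0: "C2 0 d m = 1"
  by (simp add: C2_def iv_1 ql_0)

lemma C_overlap: "C1 n 0 m = C2 n 0 m" "C1 n d 0 = C2 n d 0"
  unfolding C1_def C2_def using iv[OF W.qp_pp_unit[of "n + m"]] iv[OF W.qp_pp_unit[of "n + d"]] by (simp_all add: mult_ac)

text \<open>On the lines k = j and k + j = N, that is for d = 0 or m = 0, two cases of the theorem
  apply; their agreement comes down to \<open>C_overlap\<close>.\<close>

lemma t_overlap: "t_ga_al n 0 m = t_al_be n 0 m" "t_ga_de n 0 m = t_de_be n 0 m" "t_ga_de n d 0 = t_ga_al n d 0" "t_de_be n d 0 = t_al_be n d 0"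
  by (simp_all add: t_ga_de_def t_ga_al_def t_de_be_def t_al_be_def C_overlap mult.assoc)

lemma t_ga_al_0: "t_ga_al 0 d (Suc m) = t_ga_al 0 d m * al"
  by (simp add: t_ga_al_def C2_0 Wz_0 em_hom mult.assoc power_Suc2 del: power_Suc)

lemma t_de_be_0: "t_de_be 0 d (Suc m) = de * t_de_be 0 d m"
  by (simp add: t_de_be_def C2_0 Wz_0 em_hom mult.assoc)

text \<open>For n = 0 the prefactor is q^{-dm} times a Gaussian binomial coefficient in base q^2.
  After clearing the denominator in mu, the terms without q^{2 mu} and the terms with it give the
  two forms of the q-Pascal rule.\<close>

lemma C1_base:
  "C1 0 (Suc d) (Suc m) = ql 0 0 (- int m - 1) * mz (rat (2 * int d + 4) (2 * int d - 2 * int m + 2)) * C1 0 d (Suc m)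
     + ql 0 0 (int d + 1) * mz (rat (- 2 * int m) (2 * int d - 2 * int m + 2)) * C1 0 (Suc d) m"
proof (rule unit_cancel[of "1 - ql 0 2 (2 * int d - 2 * int m + 2)"])
  define K where "K = ql 0 0 (- (int (Suc d) * int (Suc m))) * qp pz pz (Suc (d + m)) * iv (qp pz pz (Suc d)) * iv (qp pz pz (Suc m))"
  have i: "iv (qp pz pz k) = iv (qp pz pz (Suc k)) * (1 - ql 0 0 (2 + 2 * int k))" for k
    unfolding W.iv_qp_Suc[of k] pz_power by (simp add: algebra_simps)
  have e: "ql 0 0 (- (int d * int (Suc m))) = ql 0 0 (- (int (Suc d) * int (Suc m))) * ql 0 0 (int m + 1)"
    "ql 0 0 (- (int (Suc d) * int m)) = ql 0 0 (- (int (Suc d) * int (Suc m))) * ql 0 0 (int d + 1)"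
    unfolding ql_mult by (rule arg_cong[where f = "ql 0 0"] | simp add: algebra_simps)+
  have "C1 0 (Suc d) (Suc m) = ql 0 0 (- (int (Suc d) * int (Suc m))) * (qp pz pz (Suc (d + m)) * (1 - pz * pz ^ Suc (d + m))) * iv (qp pz pz (Suc d)) * iv (qp pz pz (Suc m))"
    unfolding C1_def by (simp only: qp_Suc add_0 add_Suc_right add_Suc)
  also have "\<dots> = K * (1 - ql 0 0 (2 * int d + 2 * int m + 4))"
    unfolding pz_power ql_mult K_def by (simp add: algebra_simps)
  finally have 1: "C1 0 (Suc d) (Suc m) = K * (1 - ql 0 0 (2 * int d + 2 * int m + 4))" .
  have 2: "C1 0 d (Suc m) = K * ql 0 0 (int m + 1) * (1 - ql 0 0 (2 + 2 * int d))"
    unfolding C1_def K_def add_0 e(1) i[of d] add_Suc_right by (simp only: mult_ac)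
  have 3: "C1 0 (Suc d) m = K * ql 0 0 (int d + 1) * (1 - ql 0 0 (2 + 2 * int m))"
    unfolding C1_def K_def add_0 e(2) i[of m] add_Suc by (simp only: mult_ac)
  let ?r1 = "mz (rat (2 * int d + 4) (2 * int d - 2 * int m + 2))" and ?r2 = "mz (rat (- 2 * int m) (2 * int d - 2 * int m + 2))"
    and ?u = "1 - ql 0 2 (2 * int d - 2 * int m + 2)"
  have "(ql 0 0 (- int m - 1) * ?r1 * C1 0 d (Suc m) + ql 0 0 (int d + 1) * ?r2 * C1 0 (Suc d) m) * ?u
    = K * ((ql 0 0 (- int m - 1) * ql 0 0 (int m + 1)) * (?r1 * ?u) * (1 - ql 0 0 (2 + 2 * int d)) + (ql 0 0 (int d + 1) * ql 0 0 (int d + 1)) * (?r2 * ?u) * (1 - ql 0 0 (2 + 2 * int m)))"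
    unfolding 2 3 distrib_left distrib_right by (simp only: mult_ac)
  also have "\<dots> = K * ((1 - ql 0 0 (2 * int d + 2 * int m + 4)) * ?u)"
    unfolding mz_rat ql_mult by (simp add: algebra_simps ql_mult ql_0)
  finally show "C1 0 (Suc d) (Suc m) * ?u = (ql 0 0 (- int m - 1) * ?r1 * C1 0 d (Suc m) + ql 0 0 (int d + 1) * ?r2 * C1 0 (Suc d) m) * ?u"
    unfolding 1 by (simp only: mult.assoc)
qed (rule one_minus_ql_dvd, simp)

lemma C1_base_em:
  "em (C1 0 (Suc d) (Suc m) * Wz 0 k l) = sq (- int m - 1) * (Mr (2 * int d + 4) (2 * int d - 2 * int m + 2) * em (C1 0 d (Suc m)))
     + sq (int d + 1) * (Mr (- 2 * int m) (2 * int d - 2 * int m + 2) * em (C1 0 (Suc d) m))"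
  unfolding C1_base Wz_0 by (simp add: em_hom em_sq em_mz mult.assoc)

lemma t_ga_de_base:
  "t_ga_de 0 (Suc d) (Suc m) = cL (d + m + 1) d * (ga * t_ga_de 0 d (Suc m)) + de * t_ga_de 0 (Suc d) m"
proof -
  have c: "cL (d + m + 1) d = sq (- int m - 1) * Mr (2 * int m + 4) 2"
    unfolding cL_def by (rule sq_Mr_cong) auto
  have "cL (d + m + 1) d * (ga * t_ga_de 0 d (Suc m)) = sq (- int m - 1) * (Mr (2 * int m + 4) 2 * (ga ^ Suc d * (de ^ Suc m * em (C1 0 d (Suc m)))))"
    unfolding t_ga_de_def c Wz_0 by (simp only: mult.assoc power_Suc mult_1_right)
  also have "\<dots> = ga ^ Suc d * (de ^ Suc m * (sq (- int m - 1) * (Mr (2 * int d + 4) (2 * int d - 2 * int m + 2) * em (C1 0 d (Suc m)))))"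
    unfolding Mr_gs sq_left_commute by (simp add: algebra_simps)
  finally have 1: "cL (d + m + 1) d * (ga * t_ga_de 0 d (Suc m)) = \<dots>" .
  have "de * t_ga_de 0 (Suc d) m = (de * ga ^ Suc d) * (de ^ m * em (C1 0 (Suc d) m))"
    unfolding t_ga_de_def Wz_0 by (simp only: mult.assoc mult_1_right)
  also have "\<dots> = sq (int (Suc d)) * (Mr (2 - 2 * int (Suc d)) 2 * (ga ^ Suc d * (de ^ Suc m * em (C1 0 (Suc d) m))))"
    unfolding de_ga_power by (simp only: mult.assoc power_Suc)
  also have "\<dots> = ga ^ Suc d * (de ^ Suc m * (sq (int d + 1) * (Mr (- 2 * int m) (2 * int d - 2 * int m + 2) * em (C1 0 (Suc d) m))))"
    unfolding Mr_gs sq_left_commute by (simp add: algebra_simps)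
  finally show ?thesis unfolding 1 t_ga_de_def[of 0 "Suc d" "Suc m"] C1_base_em distrib_left by simp
qed

lemma t_al_be_base:
  "t_al_be 0 (Suc d) (Suc m) = t_al_be 0 (Suc d) m * al + cR (d + m + 1) (Suc m) * (t_al_be 0 d (Suc m) * be)"
proof -
  have c: "cR (d + m + 1) (Suc m) = sq (- int m - 1) * Mr (2 * int d + 4) (2 * int d - 2 * int m + 2)"
    unfolding cR_def by (rule sq_Mr_cong) auto
  have 1: "cR (d + m + 1) (Suc m) * (t_al_be 0 d (Suc m) * be) = (sq (- int m - 1) * (Mr (2 * int d + 4) (2 * int d - 2 * int m + 2) * em (C1 0 d (Suc m)))) * (al ^ Suc m * be ^ Suc d)"
    unfolding t_al_be_def c Wz_0 power_Suc2[of be] by (simp only: mult.assoc mult_1_right)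
  have "t_al_be 0 (Suc d) m * al = em (C1 0 (Suc d) m) * (al ^ m * (be ^ Suc d * al))"
    unfolding t_al_be_def Wz_0 by (simp only: mult.assoc mult_1_right)
  also have "\<dots> = sq (int (Suc d)) * (em (C1 0 (Suc d) m) * (Mr (- 2 * int m) (2 * int (Suc d) - 2 * int m) * (al ^ Suc m * be ^ Suc d)))"
    unfolding be_power_al sq_left_commute sq_left_commute0[of "em _"] Mr_gs power_Suc2[of al] by (simp add: mult.assoc)
  also have "\<dots> = (sq (int d + 1) * (Mr (- 2 * int m) (2 * int d - 2 * int m + 2) * em (C1 0 (Suc d) m))) * (al ^ Suc m * be ^ Suc d)"
    unfolding em_Mr by (simp add: mult.assoc algebra_simps del: power_Suc)
  finally show ?thesis unfolding 1 t_al_be_def[of 0 "Suc d" "Suc m"] C1_base_em distrib_right by simp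
qed

definition "t_mat N k j = (if k \<le> j then if k + j \<le> N then t_ga_de k (j - k) (N - k - j) else t_ga_al (N - j) (j - k) (k + j - N)
   else if k + j \<le> N then t_de_be j (k - j) (N - k - j) else t_al_be (N - k) (k - j) (k + j - N))"

lemma t_mat:
  "N = 2 * n + d + m \<Longrightarrow> k = n \<Longrightarrow> j = n + d \<Longrightarrow> t_mat N k j = t_ga_de n d m"
  "N = 2 * n + d + m \<Longrightarrow> k = n + m \<Longrightarrow> j = n + d + m \<Longrightarrow> t_mat N k j = t_ga_al n d m"
  "N = 2 * n + d + m \<Longrightarrow> k = n + d \<Longrightarrow> j = n \<Longrightarrow> t_mat N k j = t_de_be n d m"
  "N = 2 * n + d + m \<Longrightarrow> k = n + d + m \<Longrightarrow> j = n + m \<Longrightarrow> t_mat N k j = t_al_be n d m"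
proof -
  note o = t_overlap
  show "N = 2 * n + d + m \<Longrightarrow> k = n \<Longrightarrow> j = n + d \<Longrightarrow> t_mat N k j = t_ga_de n d m"
    by (simp add: t_mat_def)
  show "N = 2 * n + d + m \<Longrightarrow> k = n + m \<Longrightarrow> j = n + d + m \<Longrightarrow> t_mat N k j = t_ga_al n d m"
    by (cases "m = 0") (auto simp: t_mat_def o)
  show "N = 2 * n + d + m \<Longrightarrow> k = n + d \<Longrightarrow> j = n \<Longrightarrow> t_mat N k j = t_de_be n d m"
    by (cases "d = 0") (auto simp: t_mat_def o)
  show "N = 2 * n + d + m \<Longrightarrow> k = n + d + m \<Longrightarrow> j = n + m \<Longrightarrow> t_mat N k j = t_al_be n d m"
    by (cases "m = 0"; cases "d = 0") (auto simp: t_mat_def o)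
qed

text \<open>The line k + j = N is assigned to the first and fourth case, so that m > 0 in the other
  two, whose recurrences lower m.\<close>

lemma region_cases:
  fixes N k j :: nat
  assumes "k \<le> N" "j \<le> N"
  obtains (1) n d m where "N = 2 * n + d + m" "k = n" "j = n + d"
    | (2) n d m where "N = 2 * n + d + m" "k = n + m" "j = n + d + m" "m > 0"
    | (3) n d m where "N = 2 * n + d + m" "k = n + d" "j = n" "m > 0"
    | (4) n d m where "N = 2 * n + d + m" "k = n + d + m" "j = n + m"
proof -
  consider "k \<le> j" "k + j \<le> N" | "k \<le> j" "k + j > N" | "k > j" "k + j < N" | "k > j" "k + j \<ge> N" by linarith
  thus thesis
  proof cases
    case 1 thus ?thesis by (intro that(1)[of k "j - k" "N - k - j"]) auto
  next
    case 2 thus ?thesis using assms by (intro that(2)[of "N - j" "j - k" "k + j - N"]) auto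
  next
    case 3 thus ?thesis by (intro that(3)[of j "k - j" "N - k - j"]) auto
  next
    case 4 thus ?thesis using assms by (intro that(4)[of "N - k" "k - j" "k + j - N"]) auto
  qed
qed

text \<open>For n > 0 the first region uses \<open>stepR\<close> and the fourth
  \<open>stepL\<close>; for n = 0 they use the opposite step, with the q-Pascal rule when d and m
  are both positive. The second region always uses \<open>stepR\<close> and the third
  \<open>stepL\<close>. With these choices the predecessors stay in the closed region.\<close>

lemma t_mat_step:
  assumes "k \<le> Suc N" "j \<le> Suc N"
  shows "k \<le> N \<and> t_mat (Suc N) k j = stepL N (t_mat N k) j \<or> k > 0 \<and> t_mat (Suc N) k j = stepR N (t_mat N (k - 1)) j"
  using assms
proof (cases rule: region_cases)
  case (1 n d m)
  show ?thesis
  proof (cases n)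
    case 0
    have "stepL N (t_mat N k) j = t_ga_de 0 d m"
    proof (cases d; cases m)
      fix d' m' assume dm: "d = Suc d'" "m = Suc m'"
      have "t_mat N k d' = t_ga_de 0 d' (Suc m')" "t_mat N k (Suc d') = t_ga_de 0 (Suc d') m'" using 1 0 dm by (auto intro!: t_mat(1))
      moreover have "N = d' + m' + 1" "j = Suc d'" using 1 0 dm by auto
      ultimately show ?thesis by (simp add: stepL_def dm t_ga_de_base)
    next
      fix d' assume dm: "d = Suc d'" "m = 0"
      have "t_mat N k d' = t_ga_de 0 d' 0" using 1 0 dm by (auto intro!: t_mat(1))
      moreover have "N = d'" "j = Suc d'" using 1 0 dm by auto
      ultimately show ?thesis by (simp add: stepL_def dm t_overlap t_ga_al_def C2_0 Wz_0 em_hom cL_def sq_0)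
    next
      fix m' assume dm: "d = 0" "m = Suc m'"
      have "t_mat N k 0 = t_ga_de 0 0 m'" using 1 0 dm by (auto intro!: t_mat(1))
      moreover have "j = 0" using 1 0 dm by auto
      ultimately show ?thesis by (simp add: stepL_def dm t_overlap t_de_be_0 del: t_overlap(1))
    qed (use 1 0 in auto)
    thus ?thesis using 1 0 t_mat(1)[OF 1] by auto
  next
    case (Suc n')
    have "t_mat N (k - 1) (n' + d) = t_ga_de n' d (Suc m)" "t_mat N (k - 1) (Suc (n' + d)) = t_ga_de n' (Suc d) m" using 1 Suc by (auto intro!: t_mat(1))
    moreover have "N = 2 * n' + d + m + 1" "j = Suc (n' + d)" using 1 Suc by auto
    ultimately have "stepR N (t_mat N (k - 1)) j = t_ga_de (Suc n') d m" by (simp add: stepR_def t_ga_de_step)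
    thus ?thesis using 1 Suc t_mat(1)[OF 1] by auto
  qed
next
  case (2 n d m)
  then obtain m' where m: "m = Suc m'" by (cases m) auto
  have "stepR N (t_mat N (k - 1)) j = t_ga_al n d m"
  proof (cases n)
    case 0
    have "t_mat N (k - 1) (d + m') = t_ga_al 0 d m'" using 2 m 0 by (auto intro!: t_mat(2))
    moreover have "N = d + m'" "j = Suc (d + m')" using 2 m 0 by auto
    ultimately show ?thesis by (simp add: stepR_def m 0 t_ga_al_0)
  next
    case (Suc n')
    have "t_mat N (k - 1) (n' + d + m' + 1) = t_ga_al (Suc n') d m'" "t_mat N (k - 1) (n' + d + m' + 2) = t_ga_al n' (Suc d) (Suc m')" using 2 m Suc by (auto intro!: t_mat(2))
    moreover have "N = 2 * n' + d + m' + 2" "j = n' + d + m' + 2" using 2 m Suc by auto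
    ultimately show ?thesis by (simp add: stepR_def t_ga_al_step m Suc)
  qed
  thus ?thesis using 2 t_mat(2)[OF 2(1-3)] by auto
next
  case (3 n d m)
  then obtain m' where m: "m = Suc m'" by (cases m) auto
  have "stepL N (t_mat N k) j = t_de_be n d m"
  proof (cases n)
    case 0
    have "t_mat N k 0 = t_de_be 0 d m'" using 3 m 0 by (auto intro!: t_mat(3))
    thus ?thesis by (simp add: stepL_def m 0 t_de_be_0 3)
  next
    case (Suc n')
    have "t_mat N k n' = t_de_be n' (Suc d) (Suc m')" "t_mat N k (Suc n') = t_de_be (Suc n') d m'" using 3 m Suc by (auto intro!: t_mat(3))
    moreover have "N = 2 * n' + d + m' + 2" "j = Suc n'" using 3 m Suc by auto
    ultimately show ?thesis by (simp add: stepL_def t_de_be_step m Suc)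
  qed
  thus ?thesis using 3 t_mat(3)[OF 3(1-3)] by auto
next
  case (4 n d m)
  show ?thesis
  proof (cases n)
    case 0
    have "stepR N (t_mat N (k - 1)) j = t_al_be 0 d m"
    proof (cases d; cases m)
      fix d' m' assume dm: "d = Suc d'" "m = Suc m'"
      have "t_mat N (k - 1) m' = t_al_be 0 (Suc d') m'" "t_mat N (k - 1) (Suc m') = t_al_be 0 d' (Suc m')" using 4 0 dm by (auto intro!: t_mat(4))
      moreover have "N = d' + m' + 1" "j = Suc m'" using 4 0 dm by auto
      ultimately show ?thesis by (simp add: stepR_def dm t_al_be_base)
    next
      fix d' assume dm: "d = Suc d'" "m = 0"
      have "t_mat N (k - 1) 0 = t_al_be 0 d' 0" using 4 0 dm by (auto intro!: t_mat(4))
      moreover have "j = 0" "N = d'" using 4 0 dm by auto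
      ultimately show ?thesis by (simp add: stepR_def dm t_overlap(4)[symmetric] t_de_be_def C2_0 Wz_0 em_hom cR_def sq_0 power_commutes)
    next
      fix m' assume dm: "d = 0" "m = Suc m'"
      have "t_mat N (k - 1) m' = t_al_be 0 0 m'" using 4 0 dm by (auto intro!: t_mat(4))
      moreover have "j = Suc m'" "N = m'" using 4 0 dm by auto
      ultimately show ?thesis by (simp add: stepR_def dm t_overlap(1)[symmetric] t_ga_al_0)
    qed (use 4 0 in auto)
    thus ?thesis using 4 0 t_mat(4)[OF 4] by auto
  next
    case (Suc n')
    have "t_mat N k (n' + m) = t_al_be n' (Suc d) m" "t_mat N k (Suc (n' + m)) = t_al_be n' d (Suc m)" using 4 Suc by (auto intro!: t_mat(4))
    moreover have "N = 2 * n' + d + m + 1" "j = Suc (n' + m)" using 4 Suc by auto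
    ultimately have "stepL N (t_mat N k) j = t_al_be (Suc n') d m" by (simp add: stepL_def t_al_be_step)
    thus ?thesis using 4 Suc t_mat(4)[OF 4] by auto
  qed
qed

lemma matrix_row_t_mat: "k \<le> N \<Longrightarrow> matrix_row N k (t_mat N k)"
proof (induction N arbitrary: k)
  case 0
  have "t_mat 0 0 0 = 1" using t_mat(3)[of 0 0 0 0 0 0] by (simp add: t_de_be_def C2_0 Wz_0 em_hom)
  thus ?case using 0 by (auto intro!: matrix_row_cong[OF matrix_row_0])
next
  case (Suc N)
  note step = t_mat_step[OF Suc.prems]
  have L: "matrix_row (Suc N) k (stepL N (t_mat N k))" if "k \<le> N" using matrix_row_left[OF Suc.IH] that by blast
  have R: "matrix_row (Suc N) k (stepR N (t_mat N (k - 1)))" if "k > 0" using matrix_row_right[OF Suc.IH, of "k - 1"] that Suc.prems by auto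
  show ?case
  proof (cases "k \<le> N")
    case True
    show ?thesis
    proof (rule matrix_row_cong[OF L[OF True]])
      fix j assume j: "j \<le> Suc N"
      \<comment> \<open>If this entry was verified through \<open>stepR\<close>, uniqueness of row k
        identifies it with the entry of \<open>stepL\<close>.\<close>
      show "stepL N (t_mat N k) j = t_mat (Suc N) k j"
        using step[OF j] matrix_row_unique[OF L R j] True by auto
    qed
  next
    case False
    \<comment> \<open>The last row, k = N + 1, is obtained from \<open>stepR\<close> alone.\<close>
    hence k: "k > 0" by simp
    show ?thesis by (rule matrix_row_cong[OF R[OF k]]) (use step False in auto)
  qed
qed

section \<open>Comparison with the definitions\<close>

definition evz :: "real \<Rightarrow> diag \<Rightarrow> free_alg set" where "evz q x = ev q (em x)"

lemma ev_power: "good q \<Longrightarrow> ev q (x ^ n) = ev q x [^]\<^bsub>SL2 q\<^esub> n"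
  by (induction n) (simp_all add: ev_hom power_Suc2 del: power_Suc)

lemma ev_gs: "good q \<Longrightarrow> ev q (gs g) = cls q (gn g)"
  by transfer simp

lemma ev_gens: "good q \<Longrightarrow> gaA q = ev q ga" "good q \<Longrightarrow> alA q = ev q al" "good q \<Longrightarrow> beA q = ev q be" "good q \<Longrightarrow> deA q = ev q de"
  by (simp_all add: ev_gs gaA_def alA_def beA_def deA_def)

lemma HR_rcomp: "good q \<Longrightarrow> x \<in> HR c \<Longrightarrow> ev q x \<in> SL2_rcomp q c"
  by (auto simp: HR_def SL2_rcomp_def ev.abs_eq)

lemma tev_sum: "good q \<Longrightarrow> tev q (\<Sum>j\<le>N. f j) = (\<Oplus>\<^bsub>SL2_tensor q\<^esub>j\<in>{..(N::nat)}. tev q (f j))"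
proof -
  assume q: "good q"
  interpret R: ring "SL2_tensor q" by (rule ring_SL2_tensor)
  show ?thesis
    by (induction N) (simp_all add: tev_hom[OF q] R.a_comm Pi_def)
qed

lemma mat_elt_eqI:
  assumes q: "good q" and t: "matrix_row N k t" and j: "j \<le> N"
  shows "mat_elt q N k j = ev q (t j)"
proof -
  interpret R: ring "SL2_tensor q" by (rule ring_SL2_tensor)
  let ?m = "\<lambda>j. gaA q [^]\<^bsub>SL2 q\<^esub> (N - j) \<otimes>\<^bsub>SL2 q\<^esub> alA q [^]\<^bsub>SL2 q\<^esub> j"
  have m: "?m j = ev q (ga ^ (N - j) * al ^ j)" for j
    using q by (simp add: ev_hom ev_power ev_gens)
  have S: "(\<Oplus>\<^bsub>SL2_tensor q\<^esub>j\<in>{..N}. tensor q (s j) (?m j)) = tev q (\<Sum>j\<le>N. tn (y j) (ga ^ (N - j) * al ^ j))"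
    if "\<And>j. j \<le> N \<Longrightarrow> y j \<in> HR (2 * int j - int N)" "\<And>j. j \<le> N \<Longrightarrow> s j = ev q (y j)" for s y
    unfolding tev_sum[OF q]
  proof (rule R.finsum_cong')
    show "(\<lambda>j. tev q (tn (y j) (ga ^ (N - j) * al ^ j))) \<in> {..N} \<rightarrow> carrier (SL2_tensor q)"
      using tev_hom(5)[OF q] by simp
    fix j assume "j \<in> {..N}"
    hence "tensor q (s j) (?m j) = tensor q (ev q (y j)) (ev q (ga ^ (N - j) * al ^ j))" unfolding m using that(2) by simp
    thus "tensor q (s j) (?m j) = tev q (tn (y j) (ga ^ (N - j) * al ^ j))"
      using tev_tn[OF that(1) ga_al_HL q] \<open>j \<in> {..N}\<close> by simp
  qed simp
  have D: "coprod q (gaA q [^]\<^bsub>SL2 q\<^esub> (N - k) \<otimes>\<^bsub>SL2 q\<^esub> alA q [^]\<^bsub>SL2 q\<^esub> k) = tev q (\<Sum>j\<le>N. tn (t j) (ga ^ (N - j) * al ^ j))"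
    using t tev_Delta[OF q, of "ga ^ (N - k) * al ^ k"] unfolding m matrix_row_def by simp
  have HR: "\<And>j. j \<le> N \<Longrightarrow> t j \<in> HR (2 * int j - int N)" using matrix_row_HR[OF t] .
  have "mat_elt q N k = (\<lambda>j\<in>{..N}. ev q (t j))"
    unfolding mat_elt_def D
  proof (rule the_equality, intro conjI)
    show "(\<lambda>j\<in>{..N}. ev q (t j)) \<in> (\<Pi>\<^sub>E j\<in>{..N}. SL2_rcomp q (2 * int j - int N))"
      using HR_rcomp[OF q HR] by auto
    show "tev q (\<Sum>j\<le>N. tn (t j) (ga ^ (N - j) * al ^ j)) = (\<Oplus>\<^bsub>SL2_tensor q\<^esub>j\<in>{..N}. tensor q ((\<lambda>j\<in>{..N}. ev q (t j)) j) (?m j))"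
      by (rule S[symmetric]) (simp_all add: HR)
  next
    fix s
    assume s: "s \<in> (\<Pi>\<^sub>E j\<in>{..N}. SL2_rcomp q (2 * int j - int N)) \<and>
       tev q (\<Sum>j\<le>N. tn (t j) (ga ^ (N - j) * al ^ j)) = (\<Oplus>\<^bsub>SL2_tensor q\<^esub>j\<in>{..N}. tensor q (s j) (?m j))"
    have "\<forall>j\<in>{..N}. \<exists>y. s j = ev q y \<and> y \<in> HR (2 * int j - int N)"
    proof
      fix j assume "j \<in> {..N}"
      hence "s j \<in> SL2_rcomp q (2 * int j - int N)" using s by (auto simp: PiE_def Pi_def)
      then obtain r where "r \<in> free_rcomp (2 * int j - int N)" "s j = cls q r" by (auto simp: SL2_rcomp_def)
      \<comment> \<open>A competing solution exists at the given \<open>q\<close> only; constant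
        representatives extend it to a family.\<close>
      hence "s j = ev q (abs_sl2 (\<lambda>_. r)) \<and> abs_sl2 (\<lambda>_. r) \<in> HR (2 * int j - int N)"
        using q by (auto simp: HR_def ev.abs_eq)
      thus "\<exists>y. s j = ev q y \<and> y \<in> HR (2 * int j - int N)" ..
    qed
    then obtain y where y: "\<And>j. j \<le> N \<Longrightarrow> s j = ev q (y j)" "\<And>j. j \<le> N \<Longrightarrow> y j \<in> HR (2 * int j - int N)"
      unfolding bchoice_iff by auto
    have eq: "tev q (\<Sum>j\<le>N. tn (y j) (ga ^ (N - j) * al ^ j)) = tev q (\<Sum>j\<le>N. tn (t j) (ga ^ (N - j) * al ^ j))"
        (is "_ = ?t")
    proof -
      have "tev q (\<Sum>j\<le>N. tn (y j) (ga ^ (N - j) * al ^ j)) = (\<Oplus>\<^bsub>SL2_tensor q\<^esub>j\<in>{..N}. tensor q (s j) (?m j))"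
        by (rule S[symmetric]) (use y in auto)
      also have "\<dots> = ?t" using s by (elim conjE) (rule sym)
      finally show ?thesis .
    qed
    show "s = (\<lambda>j\<in>{..N}. ev q (t j))"
    proof
      fix j
      show "s j = (\<lambda>j\<in>{..N}. ev q (t j)) j"
      proof (cases "j \<le> N")
        case True
        thus ?thesis using tn_unique_ev[OF y(2) HR q True eq] y(1)[OF True] by simp
      next
        case False
        thus ?thesis using s by (auto simp: PiE_def extensional_def)
      qed
    qed
  qed
  thus ?thesis using j by simp
qed

lemma evz_hom:
  assumes q: "good q"
  shows "evz q x \<oplus>\<^bsub>SL2 q\<^esub> evz q y = evz q (x + y)" "evz q x \<otimes>\<^bsub>SL2 q\<^esub> evz q y = evz q (x * y)"
    "\<one>\<^bsub>SL2 q\<^esub> = evz q 1" "evz q x [^]\<^bsub>SL2 q\<^esub> n = evz q (x ^ n)"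
    "evz q x \<ominus>\<^bsub>SL2 q\<^esub> evz q y = evz q (x - y)" "x dvd 1 \<Longrightarrow> inv\<^bsub>SL2 q\<^esub> (evz q x) = evz q (iv x)"
    "(\<Oplus>\<^bsub>SL2 q\<^esub>i\<in>{..(n::nat)}. evz q (f i)) = evz q (\<Sum>i\<le>n. f i)" "evz q x \<in> carrier (SL2 q)"
proof -
  interpret R: ring "SL2 q" by (rule ring_SL2)
  show c: "evz q x \<in> carrier (SL2 q)" for x using ev_hom(5)[OF q] by (simp add: evz_def)
  show add: "evz q x \<oplus>\<^bsub>SL2 q\<^esub> evz q y = evz q (x + y)" and mult: "evz q x \<otimes>\<^bsub>SL2 q\<^esub> evz q y = evz q (x * y)"
    and one: "\<one>\<^bsub>SL2 q\<^esub> = evz q 1" for x y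
    using q by (simp_all add: evz_def em_hom ev_hom)
  show "evz q x [^]\<^bsub>SL2 q\<^esub> n = evz q (x ^ n)"
    using q by (simp add: evz_def em_power ev_power)
  have "evz q (x - y) \<oplus>\<^bsub>SL2 q\<^esub> evz q y = evz q x" by (simp add: add)
  thus "evz q x \<ominus>\<^bsub>SL2 q\<^esub> evz q y = evz q (x - y)"
    using c R.minus_eq R.add.inv_solve_right'[of "evz q (x - y)" "evz q x" "evz q y"] by simp
  show "inv\<^bsub>SL2 q\<^esub> (evz q x) = evz q (iv x)" if "x dvd 1"
    by (rule R.inv_char) (use iv[OF that] c in \<open>simp_all add: mult one mult.commute\<close>)
  show "(\<Oplus>\<^bsub>SL2 q\<^esub>i\<in>{..n}. evz q (f i)) = evz q (\<Sum>i\<le>n. f i)"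
    by (induction n) (simp_all add: c add Pi_def add.commute)
qed

lemma qpoch_evz: "good q \<Longrightarrow> qpoch (SL2 q) (evz q a) (evz q p) n = evz q (qp a p n)"
  by (induction n) (simp_all add: evz_hom qp_Suc)

text \<open>\<open>qpoch2\<close> is written in cos theta and \<open>qp2\<close> in 2 cos theta,
  whence \<open>x + x\<close>.\<close>

lemma qpoch2_evz: "good q \<Longrightarrow> qpoch2 (SL2 q) (evz q a) (evz q x) (evz q p) n = evz q (qp2 a (x + x) p n)"
  by (induction n) (simp_all add: evz_hom qp2_Suc Let_def qq_def algebra_simps)

lemma dvd_1_mult: "x dvd 1 \<Longrightarrow> y dvd 1 \<Longrightarrow> x * y dvd (1 :: 'a::comm_ring_1)"
  using mult_dvd_mono[of x 1 y 1] by simp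

lemma dvd_1_power: "x dvd 1 \<Longrightarrow> x ^ n dvd (1 :: 'a::comm_ring_1)"
  by (induction n) (simp_all add: dvd_1_mult)

text \<open>Splitting (h;p)_n into (h;p)_k and (h p^k;p)_(n-k) cancels the denominators of the
  series against its prefactor.\<close>

lemma AWc_eq:
  fixes a :: "'a::comm_ring_1"
  assumes "k \<le> n" "\<And>k. qp p p k dvd 1" "\<And>k. qp (a * b) p k dvd 1" "\<And>k. qp (a * c) p k dvd 1" "\<And>k. qp (a * d) p k dvd 1"
  shows "qp (a * b) p n * qp (a * c) p n * qp (a * d) p n *
     (qp (iv (p ^ n)) p k * qp (a * b * c * d * p ^ (n - 1)) p k * z
        * iv (qp p p k * qp (a * b) p k * qp (a * c) p k * qp (a * d) p k) * p ^ k) = AWc n a b c d p k * z"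
proof -
  obtain r where n: "n = k + r" using assms(1) le_iff_add by blast
  have i: "iv (qp p p k * qp (a * b) p k * qp (a * c) p k * qp (a * d) p k) =
     iv (qp p p k) * iv (qp (a * b) p k) * iv (qp (a * c) p k) * iv (qp (a * d) p k)"
    by (simp add: iv_mult dvd_1_mult assms)
  have s: "qp h p n = qp h p k * qp (h * p ^ k) p (n - k)" for h
    unfolding n qp_add by simp
  let ?T = "qp (iv (p ^ n)) p k * qp (a * b * c * d * p ^ (n - 1)) p k * iv (qp p p k) * p ^ k
    * (qp (a * b * p ^ k) p (n - k) * qp (a * c * p ^ k) p (n - k) * qp (a * d * p ^ k) p (n - k)) * z"
  have "qp (a * b) p n * qp (a * c) p n * qp (a * d) p n *
     (qp (iv (p ^ n)) p k * qp (a * b * c * d * p ^ (n - 1)) p k * z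
        * iv (qp p p k * qp (a * b) p k * qp (a * c) p k * qp (a * d) p k) * p ^ k) =
    (qp (a * b) p k * iv (qp (a * b) p k)) * (qp (a * c) p k * iv (qp (a * c) p k)) * (qp (a * d) p k * iv (qp (a * d) p k)) * ?T"
    unfolding i s[of "a * b"] s[of "a * c"] s[of "a * d"] by (simp only: mult_ac)
  also have "\<dots> = ?T" using iv[OF assms(3)] iv[OF assms(4)] iv[OF assms(5)] by simp
  finally show ?thesis unfolding AWc_def .
qed

lemma askey_wilson_evz:
  assumes q: "good q" and u: "a dvd 1" "p dvd 1" "\<And>k. qp p p k dvd 1" "\<And>k. qp (a * b) p k dvd 1" "\<And>k. qp (a * c) p k dvd 1" "\<And>k. qp (a * d) p k dvd 1"
  shows "askey_wilson (SL2 q) n (evz q x) (evz q a) (evz q b) (evz q c) (evz q d) (evz q p) = evz q (iv (a ^ n) * AWs n a b c d p (x + x))"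
proof -
  interpret R: ring "SL2 q" by (rule ring_SL2)
  define f where "f k = qp (iv (p ^ n)) p k * qp (a * b * c * d * p ^ (n - 1)) p k * qp2 a (x + x) p k
        * iv (qp p p k * qp (a * b) p k * qp (a * c) p k * qp (a * d) p k) * p ^ k" for k
  \<comment> \<open>For n = 0 the integer exponent is -1, whereas \<open>n - 1\<close> is 0 on the
    naturals. Only k = 0 occurs then, and the shifted factorial is 1 in both readings.\<close>
  have "qpoch (SL2 q) (evz q (a * b * c * d) \<otimes>\<^bsub>SL2 q\<^esub> evz q p [^]\<^bsub>SL2 q\<^esub> (int n - 1)) (evz q p) k
     = evz q (qp (a * b * c * d * p ^ (n - 1)) p k)" if "k \<le> n" for k
  proof (cases n)
    case 0
    thus ?thesis using that by (simp add: evz_hom[OF q])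
  next
    case (Suc n')
    have "evz q p [^]\<^bsub>SL2 q\<^esub> (int n - 1) = evz q p [^]\<^bsub>SL2 q\<^esub> n'"
      by (simp add: Suc int_pow_int)
    thus ?thesis by (simp add: evz_hom[OF q] qpoch_evz[OF q] Suc)
  qed
  hence F: "qpoch (SL2 q) (inv\<^bsub>SL2 q\<^esub> (evz q p [^]\<^bsub>SL2 q\<^esub> n)) (evz q p) k
          \<otimes>\<^bsub>SL2 q\<^esub> qpoch (SL2 q) (evz q a \<otimes>\<^bsub>SL2 q\<^esub> evz q b \<otimes>\<^bsub>SL2 q\<^esub> evz q c \<otimes>\<^bsub>SL2 q\<^esub> evz q d \<otimes>\<^bsub>SL2 q\<^esub> evz q p [^]\<^bsub>SL2 q\<^esub> (int n - 1)) (evz q p) k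
          \<otimes>\<^bsub>SL2 q\<^esub> qpoch2 (SL2 q) (evz q a) (evz q x) (evz q p) k
          \<otimes>\<^bsub>SL2 q\<^esub> inv\<^bsub>SL2 q\<^esub> (qpoch (SL2 q) (evz q p) (evz q p) k \<otimes>\<^bsub>SL2 q\<^esub> qpoch (SL2 q) (evz q a \<otimes>\<^bsub>SL2 q\<^esub> evz q b) (evz q p) k
                \<otimes>\<^bsub>SL2 q\<^esub> qpoch (SL2 q) (evz q a \<otimes>\<^bsub>SL2 q\<^esub> evz q c) (evz q p) k \<otimes>\<^bsub>SL2 q\<^esub> qpoch (SL2 q) (evz q a \<otimes>\<^bsub>SL2 q\<^esub> evz q d) (evz q p) k)
          \<otimes>\<^bsub>SL2 q\<^esub> evz q p [^]\<^bsub>SL2 q\<^esub> k = evz q (f k)" if "k \<in> {..n}" for k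
    using that unfolding f_def by (simp add: evz_hom[OF q] qpoch_evz[OF q] qpoch2_evz[OF q] u dvd_1_mult dvd_1_power)
  have "askey_wilson (SL2 q) n (evz q x) (evz q a) (evz q b) (evz q c) (evz q d) (evz q p) =
     evz q (qp (a * b) p n * qp (a * c) p n * qp (a * d) p n * iv (a ^ n) * (\<Sum>k\<le>n. f k))"
    unfolding askey_wilson_def
    by (subst R.finsum_cong'[OF refl _ F]) (simp_all add: evz_hom[OF q] qpoch_evz[OF q] dvd_1_power u)
  also have "qp (a * b) p n * qp (a * c) p n * qp (a * d) p n * iv (a ^ n) * (\<Sum>k\<le>n. f k) =
     iv (a ^ n) * (\<Sum>k\<le>n. qp (a * b) p n * qp (a * c) p n * qp (a * d) p n * f k)"
    unfolding sum_distrib_left[symmetric] by (simp only: mult_ac)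
  also have "(\<Sum>k\<le>n. qp (a * b) p n * qp (a * c) p n * qp (a * d) p n * f k) = AWs n a b c d p (x + x)"
    unfolding AWs_def f_def by (intro sum.cong refl AWc_eq u) simp
  finally show ?thesis .
qed

lemma qlm_evz: "good q \<Longrightarrow> qlm q a b c = evz q (ql a b c)"
proof -
  assume q: "good q"
  have "mexp q a 0 = abs_mero (\<lambda>l. qpow q (of_int a * l))" "mexp q b c = abs_mero (\<lambda>l. qpow q (of_int b * l + of_int c))"
    using abs_mero_qpow[of q a 0] abs_mero_qpow[of q b c] by simp_all
  moreover have "ev q (lm f * mm g) = cls q (lam (f q) * mu (g q))" for f g using q by transfer simp
  ultimately show ?thesis unfolding qlm_def evz_def ql_def em_hom em_lz em_mz by simp
qed

lemma Xi_evz: "good q \<Longrightarrow> Xi q = evz q xi"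
proof -
  assume q: "good q"
  interpret R: ring "SL2 q" by (rule ring_SL2)
  have "evz q x \<otimes>\<^bsub>SL2 q\<^esub> gaA q \<otimes>\<^bsub>SL2 q\<^esub> beA q = evz q (x * gb)" for x
    using q by (simp add: evz_def ev_gens em_hom em_gb mult.assoc flip: ev_hom(2))
  thus ?thesis unfolding Xi_def qlm_evz[OF q] by (simp add: evz_hom[OF q] xi_def eX_def)
qed

lemma half_xi_evz: "good q \<Longrightarrow> cls q (scal (1 / 2)) \<otimes>\<^bsub>SL2 q\<^esub> Xi q = evz q (sz (\<lambda>_. 1 / 2) * xi)"
proof -
  assume q: "good q"
  have "ev q (sc (\<lambda>_. 1 / 2)) = cls q (scal (1 / 2))" using q by transfer simp
  moreover have "em (sz (\<lambda>_. 1 / 2)) = sc (\<lambda>_. 1 / 2)" unfolding sz_def em_lz A.L.const ..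
  ultimately have "cls q (scal (1 / 2)) = evz q (sz (\<lambda>_. 1 / 2))" by (simp add: evz_def)
  thus ?thesis by (simp add: Xi_evz[OF q] evz_hom[OF q])
qed

lemma half_xi: "sz (\<lambda>_. 1 / 2) * xi + sz (\<lambda>_. 1 / 2) * xi = xi"
proof -
  have "sz (\<lambda>_. 1 / 2) + sz (\<lambda>_. 1 / 2) = 1"
    unfolding sz_def Z.L.add[symmetric] mero_const_add[symmetric] by (simp add: Z.L.one mero_const_1)
  hence "(sz (\<lambda>_. 1 / 2) + sz (\<lambda>_. 1 / 2)) * xi = xi" by simp
  thus ?thesis unfolding distrib_right .
qed

text \<open>P_n is a scalar times \<open>Wz\<close>: the factor a^(-n) in the normalisation of the
  Askey-Wilson polynomial is the power of \<open>aiZ d\<close> inside \<open>Wz\<close>.\<close>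

lemma Pn_evz:
  assumes q: "good q" and m: "\<bar>int N - int k - int j\<bar> = int m" and d: "\<bar>int j - int k\<bar> = int d"
  shows "Pn q N k j n = evz q (ql 0 0 (int j * (int j - int N)) * qp pz pz (N - n) * iv (qp pz pz j) * iv (qp pz pz (N - j)) * Wz n d m)"
proof -
  note u = W.qp_pp_unit qp_ql_dvd
  have i: "iv (qp pz pz j * qp pz pz (N - j) * qp (ql 2 0 4) pz n * qp (ql 0 (- 2) (2 * int m)) pz n) =
     iv (qp pz pz j) * iv (qp pz pz (N - j)) * iv (qp (ql 2 0 4) pz n) * iv (qp (ql 0 (- 2) (2 * int m)) pz n)"
    by (simp add: iv_mult dvd_1_mult u)
  have ab: "qp (ql (- 1) 1 (1 + 2 * int d) * ql 1 (- 1) 1) pz k dvd 1" for k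
    unfolding ql_mult by (rule qp_unit) (simp add: pz_power ql_mult one_minus_ql_dvd)
  have acd: "qp (ql (- 1) 1 (1 + 2 * int d) * ql 1 1 3) pz k dvd 1"
     "qp (ql (- 1) 1 (1 + 2 * int d) * ql (- 1) (- 1) (- 1 + 2 * int m)) pz k dvd 1" for k
    unfolding ql_mult by (rule qp_ql_dvd; simp)+
  have aw: "askey_wilson (SL2 q) n (evz q (sz (\<lambda>_. 1 / 2) * xi)) (evz q (ql (- 1) 1 (1 + 2 * int d))) (evz q (ql 1 (- 1) 1)) (evz q (ql 1 1 3))
     (evz q (ql (- 1) (- 1) (- 1 + 2 * int m))) (evz q pz) = evz q (iv (aZ d ^ n) * AWs n (aZ d) bZ cZ (dZ m) pz xi)"
    by (subst askey_wilson_evz[OF q ql_dvd ql_dvd W.qp_pp_unit ab acd]) (simp add: half_xi abcd_defs add.commute)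
  have a: "iv (aZ d ^ n) = aiZ d ^ n"
    by (rule iv_unique) (simp add: aiZ flip: power_mult_distrib)
  have b: "(bZ * ql 0 0 (int n + int m) * aiZ d) ^ n = ql (int n) (- int n) (int n * (1 + int n + int m)) * aiZ d ^ n"
    unfolding power_mult_distrib[of _ "aiZ d"] by (simp add: bZ_def ql_mult ql_power algebra_simps)
  have e: "ql (int n) (- int n) (int n * (1 + int n + int m) + int j * (int j - int N)) =
     ql (int n) (- int n) (int n * (1 + int n + int m)) * ql 0 0 (int j * (int j - int N))"
    by (simp add: ql_mult)
  have "Pn q N k j n = evz q (ql (int n) (- int n) (int n * (1 + int n + int m) + int j * (int j - int N)) * qp pz pz (N - n)
     * (iv (qp pz pz j) * iv (qp pz pz (N - j)) * iv (qp (ql 2 0 4) pz n) * iv (qp (ql 0 (- 2) (2 * int m)) pz n))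
     * (aiZ d ^ n * AWs n (aZ d) bZ cZ (dZ m) pz xi))"
    unfolding Pn_def Let_def m d half_xi_evz[OF q] qlm_evz[OF q] aw qpoch_evz[OF q] evz_hom(2)[OF q]
    by (subst evz_hom(6)[OF q]) (simp_all add: i dvd_1_mult u evz_hom(2)[OF q] a)
  also have "ql (int n) (- int n) (int n * (1 + int n + int m) + int j * (int j - int N)) * qp pz pz (N - n)
     * (iv (qp pz pz j) * iv (qp pz pz (N - j)) * iv (qp (ql 2 0 4) pz n) * iv (qp (ql 0 (- 2) (2 * int m)) pz n))
     * (aiZ d ^ n * AWs n (aZ d) bZ cZ (dZ m) pz xi) =
     ql 0 0 (int j * (int j - int N)) * qp pz pz (N - n) * iv (qp pz pz j) * iv (qp pz pz (N - j)) * Wz n d m"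
    unfolding Wz_def abcd_mult b e by (simp only: mult_ac)
  finally show ?thesis .
qed

lemma Pn_C1:
  assumes q: "good q" and N: "N = 2 * n + d + m" and kj: "k = n \<and> j = n + d \<or> k = n + d + m \<and> j = n + m"
  shows "Pn q N k j n = evz q (C1 n d m * Wz n d m)"
proof -
  have "\<bar>int N - int k - int j\<bar> = int m" "\<bar>int j - int k\<bar> = int d" using N kj by auto
  moreover have "int j * (int j - int N) = - (int (n + d) * int (n + m))" "N - n = n + d + m"
    using N kj by (auto simp: algebra_simps)
  moreover have "iv (qp pz pz j) * iv (qp pz pz (N - j)) = iv (qp pz pz (n + d)) * iv (qp pz pz (n + m))"
    using N kj by (auto simp: algebra_simps)
  ultimately show ?thesis by (simp add: Pn_evz[OF q] C1_def mult.assoc)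
qed

lemma Pn_C2:
  assumes q: "good q" and N: "N = 2 * n + d + m" and kj: "k = n + m \<and> j = n + d + m \<or> k = n + d \<and> j = n"
  shows "Pn q N k j n = evz q (C2 n d m * Wz n d m)"
proof -
  have "\<bar>int N - int k - int j\<bar> = int m" "\<bar>int j - int k\<bar> = int d" using N kj by auto
  moreover have "int j * (int j - int N) = - (int n * int (n + d + m))"
    using N kj by (auto simp: algebra_simps)
  moreover have "qp pz pz (N - n) * iv (qp pz pz j) * iv (qp pz pz (N - j)) = iv (qp pz pz n)"
  proof -
    have u: "qp pz pz (n + d + m) * iv (qp pz pz (n + d + m)) = 1" by (rule iv[OF W.qp_pp_unit])
    have "N - n = n + d + m" using N by simp
    moreover have "iv (qp pz pz j) * iv (qp pz pz (N - j)) = iv (qp pz pz (n + d + m)) * iv (qp pz pz n)"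
      using N kj by (auto simp: mult.commute add_ac)
    ultimately show ?thesis using u by (simp add: mult.assoc) (simp add: mult.assoc[symmetric])
  qed
  ultimately show ?thesis by (simp add: Pn_evz[OF q] C2_def) (simp add: mult.assoc)
qed

text \<open>The generators of the commutative subalgebra all have bidegree (0,0); this provides the
  claim that P_n lies in A_00.\<close>

lemma em_Hm: "em x \<in> Hm 0 0"
proof -
  have "x \<in> Hm 0 0" if "x \<in> diag_set" for x
    using that
  proof (induction rule: diag_set.induct)
    case gbI show ?case by (rule Hm_mult[OF HR_sc(5) HR_sc(5)]) auto
  next
    case (uminusI x)
    have "- x = lm (\<lambda>_. - 1) * x" by (simp add: A.L.uminus A.L.one)
    thus ?case using Hm_mult[OF HR_sc(2) uminusI(2)] by simp
  qed (auto intro: HR_sc Hm_add Hm_mult)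
  thus ?thesis using em by blast
qed

lemma evz_comp: "good q \<Longrightarrow> evz q x \<in> SL2_comp q 0 0"
  using em_Hm[of x] by (auto simp: evz_def Hm_def SL2_comp_def ev.abs_eq)

lemma ev_t:
  assumes "good q"
  shows "ev q (t_ga_de n d m) = gaA q [^]\<^bsub>SL2 q\<^esub> d \<otimes>\<^bsub>SL2 q\<^esub> deA q [^]\<^bsub>SL2 q\<^esub> m \<otimes>\<^bsub>SL2 q\<^esub> evz q (C1 n d m * Wz n d m)"
    "ev q (t_ga_al n d m) = gaA q [^]\<^bsub>SL2 q\<^esub> d \<otimes>\<^bsub>SL2 q\<^esub> evz q (C2 n d m * Wz n d m) \<otimes>\<^bsub>SL2 q\<^esub> alA q [^]\<^bsub>SL2 q\<^esub> m"
    "ev q (t_de_be n d m) = deA q [^]\<^bsub>SL2 q\<^esub> m \<otimes>\<^bsub>SL2 q\<^esub> evz q (C2 n d m * Wz n d m) \<otimes>\<^bsub>SL2 q\<^esub> beA q [^]\<^bsub>SL2 q\<^esub> d"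
    "ev q (t_al_be n d m) = evz q (C1 n d m * Wz n d m) \<otimes>\<^bsub>SL2 q\<^esub> alA q [^]\<^bsub>SL2 q\<^esub> m \<otimes>\<^bsub>SL2 q\<^esub> beA q [^]\<^bsub>SL2 q\<^esub> d"
  unfolding t_ga_de_def t_ga_al_def t_de_be_def t_al_be_def evz_def ev_gens[OF assms]
  unfolding ev_power[OF assms, symmetric] ev_hom(2)[OF assms, symmetric] mult.assoc by (rule refl)+

theorem theorem3p5:
  fixes q :: real and N k j :: nat
  assumes "0 < q" and "q < 1" and "k \<le> N" and "j \<le> N"
  shows
    "(k \<le> j \<and> k + j \<le> N \<longrightarrow>
        Pn q N k j k \<in> SL2_comp q 0 0 \<and>
        mat_elt q N k j =
          gaA q [^]\<^bsub>SL2 q\<^esub> (j - k) \<otimes>\<^bsub>SL2 q\<^esub> deA q [^]\<^bsub>SL2 q\<^esub> (N - k - j) \<otimes>\<^bsub>SL2 q\<^esub> Pn q N k j k) \<and>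
     (k \<le> j \<and> N \<le> k + j \<longrightarrow>
        Pn q N k j (N - j) \<in> SL2_comp q 0 0 \<and>
        mat_elt q N k j =
          gaA q [^]\<^bsub>SL2 q\<^esub> (j - k) \<otimes>\<^bsub>SL2 q\<^esub> Pn q N k j (N - j) \<otimes>\<^bsub>SL2 q\<^esub> alA q [^]\<^bsub>SL2 q\<^esub> (k + j - N)) \<and>
     (j \<le> k \<and> k + j \<le> N \<longrightarrow>
        Pn q N k j j \<in> SL2_comp q 0 0 \<and>
        mat_elt q N k j =
          deA q [^]\<^bsub>SL2 q\<^esub> (N - k - j) \<otimes>\<^bsub>SL2 q\<^esub> Pn q N k j j \<otimes>\<^bsub>SL2 q\<^esub> beA q [^]\<^bsub>SL2 q\<^esub> (k - j)) \<and>
     (j \<le> k \<and> N \<le> k + j \<longrightarrow>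
        Pn q N k j (N - k) \<in> SL2_comp q 0 0 \<and>
        mat_elt q N k j =
          Pn q N k j (N - k) \<otimes>\<^bsub>SL2 q\<^esub> alA q [^]\<^bsub>SL2 q\<^esub> (k + j - N) \<otimes>\<^bsub>SL2 q\<^esub> beA q [^]\<^bsub>SL2 q\<^esub> (k - j))"
proof (intro conjI[of "_ \<longrightarrow> _"] impI)
  have q: "good q" using assms by simp
  have M: "mat_elt q N k j = ev q (t_mat N k j)" by (rule mat_elt_eqI[OF q matrix_row_t_mat]) (use assms in auto)
  {
    assume c: "k \<le> j \<and> k + j \<le> N"
    have "t_mat N k j = t_ga_de k (j - k) (N - k - j)" using c by (intro t_mat(1)) auto
    moreover have "Pn q N k j k = evz q (C1 k (j - k) (N - k - j) * Wz k (j - k) (N - k - j))" using c by (intro Pn_C1[OF q]) auto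
    ultimately show "Pn q N k j k \<in> SL2_comp q 0 0 \<and> mat_elt q N k j =
          gaA q [^]\<^bsub>SL2 q\<^esub> (j - k) \<otimes>\<^bsub>SL2 q\<^esub> deA q [^]\<^bsub>SL2 q\<^esub> (N - k - j) \<otimes>\<^bsub>SL2 q\<^esub> Pn q N k j k"
      unfolding M by (simp add: ev_t[OF q] evz_comp[OF q])
  next
    assume c: "k \<le> j \<and> N \<le> k + j"
    have "t_mat N k j = t_ga_al (N - j) (j - k) (k + j - N)" using c assms by (intro t_mat(2)) auto
    moreover have "Pn q N k j (N - j) = evz q (C2 (N - j) (j - k) (k + j - N) * Wz (N - j) (j - k) (k + j - N))" using c assms by (intro Pn_C2[OF q]) auto
    ultimately show "Pn q N k j (N - j) \<in> SL2_comp q 0 0 \<and> mat_elt q N k j =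
          gaA q [^]\<^bsub>SL2 q\<^esub> (j - k) \<otimes>\<^bsub>SL2 q\<^esub> Pn q N k j (N - j) \<otimes>\<^bsub>SL2 q\<^esub> alA q [^]\<^bsub>SL2 q\<^esub> (k + j - N)"
      unfolding M by (simp add: ev_t[OF q] evz_comp[OF q])
  next
    assume c: "j \<le> k \<and> k + j \<le> N"
    have "t_mat N k j = t_de_be j (k - j) (N - k - j)" using c by (intro t_mat(3)) auto
    moreover have "Pn q N k j j = evz q (C2 j (k - j) (N - k - j) * Wz j (k - j) (N - k - j))" using c by (intro Pn_C2[OF q]) auto
    ultimately show "Pn q N k j j \<in> SL2_comp q 0 0 \<and> mat_elt q N k j =
          deA q [^]\<^bsub>SL2 q\<^esub> (N - k - j) \<otimes>\<^bsub>SL2 q\<^esub> Pn q N k j j \<otimes>\<^bsub>SL2 q\<^esub> beA q [^]\<^bsub>SL2 q\<^esub> (k - j)"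
      unfolding M by (simp add: ev_t[OF q] evz_comp[OF q])
  next
    assume c: "j \<le> k \<and> N \<le> k + j"
    have "t_mat N k j = t_al_be (N - k) (k - j) (k + j - N)" using c assms by (intro t_mat(4)) auto
    moreover have "Pn q N k j (N - k) = evz q (C1 (N - k) (k - j) (k + j - N) * Wz (N - k) (k - j) (k + j - N))" using c assms by (intro Pn_C1[OF q]) auto
    ultimately show "Pn q N k j (N - k) \<in> SL2_comp q 0 0 \<and> mat_elt q N k j =
          Pn q N k j (N - k) \<otimes>\<^bsub>SL2 q\<^esub> alA q [^]\<^bsub>SL2 q\<^esub> (k + j - N) \<otimes>\<^bsub>SL2 q\<^esub> beA q [^]\<^bsub>SL2 q\<^esub> (k - j)"
      unfolding M by (simp add: ev_t[OF q] evz_comp[OF q])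
  }
qed

end
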